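(* Suppose $\Lambda$ is a finitely aligned $k$-graph. Then $C^*(\Lambda)$ is simple if and only if $\Lambda$ is aperiodic and cofinal.
   Context: Conventions. $\mathbb{N}$ contains $0$, $k\ge 1$ is an integer, $\mathbb{N}^k$ is ordered coordinatewise, $e_i$ is its $i$th generator, and $m\vee n$, $m\wedge n$ denote the coordinatewise maximum and minimum. A $k$-graph $(\Lambda,d)$ is a countable small category $\Lambda$ (identified with its set of morphisms, called paths) with a functor $d:\Lambda\to\mathbb{N}^k$ satisfying the factorisation property: whenever $d(\lambda)=m+n$ there exist unique $\mu,\nu\in\Lambda$ with $d(\mu)=m$, $d(\nu)=n$ and $\lambda=\mu\nu$. Write $\Lambda^n=\{\lambda\in\Lambda: d(\lambda)=n\}$. Objects are identified with their identity morphisms, which form $\Lambda^0$ (the vertices). $r(\lambda),s(\lambda)\in\Lambda^0$ are the unique vertices with $\lambda=r(\lambda)\lambda=\lambda s(\lambda)$; the product $\mu\nu$ is defined exactly when $s(\mu)=r(\nu)$. For $m\le n\le d(\lambda)$, $\lambda(m,n)$ is the unique path in $\Lambda^{n-m}$ with $\lambda=\lambda'\lambda(m,n)\lambda''$, $d(\lambda')=m$, $d(\lambda'')=d(\lambda)-n$. For $v,w\in\Lambda^0$ and $X\subseteq\Lambda$: $vX=\{\lambda\in X:r(\lambda)=v\}$, $Xv=\{\lambda\in X:s(\lambda)=v\}$, $v\Lambda w=v\Lambda\cap\Lambda w$. For $\mu,\nu\in\Lambda$, $\operatorname{MCE}(\mu,\nu)=\{\lambda\in\Lambda: d(\lambda)=d(\mu)\vee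 d(\nu),\ \lambda(0,d(\mu))=\mu,\ \lambda(0,d(\nu))=\nu\}$. $\Lambda$ is finitely aligned if $\operatorname{MCE}(\mu,\nu)$ is finite for all $\mu,\nu\in\Lambda$. A set $E\subseteq v\Lambda$ is exhaustive if for every $\mu\in v\Lambda$ there is $\lambda\in E$ with $\operatorname{MCE}(\mu,\lambda)\neq\emptyset$; $v\operatorname{FE}(\Lambda)$ is the set of finite exhaustive subsets of $v\Lambda$. A Cuntz-Krieger $\Lambda$-family is a set $\{t_\lambda:\lambda\in\Lambda\}$ of partial isometries in a $C^*$-algebra such that: (CK1) $\{t_v:v\in\Lambda^0\}$ are mutually orthogonal projections; (CK2) $t_\mu t_\nu=t_{\mu\nu}$ whenever $s(\mu)=r(\nu)$; (CK3) $t_\mu^*t_\nu=\sum_{\mu\alpha=\nu\beta\in\operatorname{MCE}(\mu,\nu)}t_\alpha t_\beta^*$ for all $\mu,\nu\in\Lambda$; (CK4) $\prod_{\lambda\in E}(t_v-t_\lambda t_\lambda^* )=0$ for all $v\in\Lambda^0$ and $E\in v\operatorname{FE}(\Lambda)$. $C^*(\Lambda)$ is the universal $C^*$-algebra generated by a Cuntz-Krieger $\Lambda$-family $\{s_\lambda:\lambda\in\Lambda\}$. $\Lambda$ is aperiodic if for every pair of distinct $\alpha,\beta\in\Lambda$ with $s(\alpha)=s(\beta)$ there exists $\tau\in s(\alpha)\Lambda$ such that $\operatorname{MCE}(\alpha\tau,\beta\tau)=\emptyset$. $\Lambda$ is cofinal if for all $v,w\in\Lambda^0$ there exists $E\in w\operatorname{FE}(\Lambda)$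 such that $v\Lambda s(\alpha)\neq\emptyset$ for every $\alpha\in E$. Ideals are closed and two-sided; a $C^*$-algebra $A$ is simple if its only ideals are $\{0\}$ and $A$. *)

theory Defs
  imports
    "HOL-Analysis.Abstract_Metric_Spaces"
    "HOL-Algebra.Module"
    "HOL-Library.Function_Algebras"
    "HOL-Library.Countable_Set"
begin

section \<open>Higher-rank graphs\<close>

text \<open>
  The index type \<open>'k\<close> plays the role of the set of the \<open>k\<close> generators, so that \<open>'k \<Rightarrow> nat\<close> is
  \<open>\<nat>\<^sup>k\<close> with its coordinatewise order, sums and differences; \<open>sup\<close> is the coordinatewise maximum.
  A category is given by its morphisms only, an object being identified with its identity
  morphism.  \<open>cmp \<Lambda> \<mu> \<nu>\<close> is the product \<open>\<mu>\<nu>\<close>; it is meaningful only if \<open>src \<Lambda> \<mu> = ran \<Lambda> \<nu>\<close>.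
\<close>

record ('p, 'k) kgraph =
  paths :: "'p set"
  cmp :: "'p \<Rightarrow> 'p \<Rightarrow> 'p"
  ran :: "'p \<Rightarrow> 'p"
  src :: "'p \<Rightarrow> 'p"
  deg :: "'p \<Rightarrow> 'k \<Rightarrow> nat"

locale small_category =
  fixes \<Lambda> :: "('p, 'k) kgraph"
  assumes ran_closed: "\<eta> \<in> paths \<Lambda> \<Longrightarrow> ran \<Lambda> \<eta> \<in> paths \<Lambda>"
    and src_closed: "\<eta> \<in> paths \<Lambda> \<Longrightarrow> src \<Lambda> \<eta> \<in> paths \<Lambda>"
    and ran_ran: "\<eta> \<in> paths \<Lambda> \<Longrightarrow> ran \<Lambda> (ran \<Lambda> \<eta>) = ran \<Lambda> \<eta>"
    and src_ran: "\<eta> \<in> paths \<Lambda> \<Longrightarrow> src \<Lambda> (ran \<Lambda> \<eta>) = ran \<Lambda> \<eta>"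
    and ran_src: "\<eta> \<in> paths \<Lambda> \<Longrightarrow> ran \<Lambda> (src \<Lambda> \<eta>) = src \<Lambda> \<eta>"
    and src_src: "\<eta> \<in> paths \<Lambda> \<Longrightarrow> src \<Lambda> (src \<Lambda> \<eta>) = src \<Lambda> \<eta>"
    and cmp_ran_left: "\<eta> \<in> paths \<Lambda> \<Longrightarrow> cmp \<Lambda> (ran \<Lambda> \<eta>) \<eta> = \<eta>"
    and cmp_src_right: "\<eta> \<in> paths \<Lambda> \<Longrightarrow> cmp \<Lambda> \<eta> (src \<Lambda> \<eta>) = \<eta>"
    and cmp_closed:
      "\<lbrakk>\<mu> \<in> paths \<Lambda>; \<nu> \<in> paths \<Lambda>; src \<Lambda> \<mu> = ran \<Lambda> \<nu>\<rbrakk> \<Longrightarrow> cmp \<Lambda> \<mu> \<nu> \<in> paths \<Lambda>"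
    and ran_cmp:
      "\<lbrakk>\<mu> \<in> paths \<Lambda>; \<nu> \<in> paths \<Lambda>; src \<Lambda> \<mu> = ran \<Lambda> \<nu>\<rbrakk> \<Longrightarrow> ran \<Lambda> (cmp \<Lambda> \<mu> \<nu>) = ran \<Lambda> \<mu>"
    and src_cmp:
      "\<lbrakk>\<mu> \<in> paths \<Lambda>; \<nu> \<in> paths \<Lambda>; src \<Lambda> \<mu> = ran \<Lambda> \<nu>\<rbrakk> \<Longrightarrow> src \<Lambda> (cmp \<Lambda> \<mu> \<nu>) = src \<Lambda> \<nu>"
    and cmp_assoc:
      "\<lbrakk>\<eta> \<in> paths \<Lambda>; \<mu> \<in> paths \<Lambda>; \<nu> \<in> paths \<Lambda>; src \<Lambda> \<eta> = ran \<Lambda> \<mu>; src \<Lambda> \<mu> = ran \<Lambda> \<nu>\<rbrakk>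
        \<Longrightarrow> cmp \<Lambda> (cmp \<Lambda> \<eta> \<mu>) \<nu> = cmp \<Lambda> \<eta> (cmp \<Lambda> \<mu> \<nu>)"

locale k_graph = small_category \<Lambda>
  for \<Lambda> :: "('p, 'k::finite) kgraph" +
  assumes countable_paths: "countable (paths \<Lambda>)"
    and deg_ran: "\<eta> \<in> paths \<Lambda> \<Longrightarrow> deg \<Lambda> (ran \<Lambda> \<eta>) = 0"
    and deg_src: "\<eta> \<in> paths \<Lambda> \<Longrightarrow> deg \<Lambda> (src \<Lambda> \<eta>) = 0"
    and deg_cmp:
      "\<lbrakk>\<mu> \<in> paths \<Lambda>; \<nu> \<in> paths \<Lambda>; src \<Lambda> \<mu> = ran \<Lambda> \<nu>\<rbrakk>
        \<Longrightarrow> deg \<Lambda> (cmp \<Lambda> \<mu> \<nu>) = deg \<Lambda> \<mu> + deg \<Lambda> \<nu>"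
    and factorisation:
      "\<lbrakk>\<eta> \<in> paths \<Lambda>; deg \<Lambda> \<eta> = m + n\<rbrakk>
        \<Longrightarrow> \<exists>!(\<mu>, \<nu>). \<mu> \<in> paths \<Lambda> \<and> \<nu> \<in> paths \<Lambda> \<and> deg \<Lambda> \<mu> = m \<and> deg \<Lambda> \<nu> = n
              \<and> src \<Lambda> \<mu> = ran \<Lambda> \<nu> \<and> \<eta> = cmp \<Lambda> \<mu> \<nu>"

definition vertices :: "('p, 'k) kgraph \<Rightarrow> 'p set" where
  "vertices \<Lambda> = {v \<in> paths \<Lambda>. deg \<Lambda> v = 0}"

text \<open>The elements of degree zero are precisely the identity morphisms.\<close>

lemma (in k_graph) vertex_ran:
  assumes "v \<in> vertices \<Lambda>"
  shows "ran \<Lambda> v = v" and "src \<Lambda> v = v"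
proof -
  have v: "v \<in> paths \<Lambda>" and d: "deg \<Lambda> v = 0 + 0"
    using assms by (auto simp: vertices_def)
  let ?P = "\<lambda>\<mu> \<nu>. \<mu> \<in> paths \<Lambda> \<and> \<nu> \<in> paths \<Lambda> \<and> deg \<Lambda> \<mu> = 0 \<and> deg \<Lambda> \<nu> = 0
              \<and> src \<Lambda> \<mu> = ran \<Lambda> \<nu> \<and> v = cmp \<Lambda> \<mu> \<nu>"
  have "\<exists>!(\<mu>, \<nu>). ?P \<mu> \<nu>"
    by (rule factorisation[OF v d])
  moreover have "?P (ran \<Lambda> v) v" "?P v (src \<Lambda> v)"
    using v d by (auto simp: ran_closed src_closed deg_ran deg_src src_ran ran_src
        cmp_ran_left cmp_src_right)
  ultimately have "(ran \<Lambda> v, v) = (v, src \<Lambda> v)"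
    by blast
  then show "ran \<Lambda> v = v" and "src \<Lambda> v = v"
    by auto
qed

lemma (in k_graph) vertices_eq_identities: "vertices \<Lambda> = ran \<Lambda> ` paths \<Lambda>"
proof
  show "vertices \<Lambda> \<subseteq> ran \<Lambda> ` paths \<Lambda>"
    using vertex_ran(1) by (force simp: vertices_def)
  show "ran \<Lambda> ` paths \<Lambda> \<subseteq> vertices \<Lambda>"
    by (auto simp: vertices_def ran_closed deg_ran)
qed

text \<open>The path \<open>\<eta>(m, n)\<close>, for \<open>m \<le> n \<le> d(\<eta>)\<close>.\<close>

definition segment :: "('p, 'k) kgraph \<Rightarrow> 'p \<Rightarrow> ('k \<Rightarrow> nat) \<Rightarrow> ('k \<Rightarrow> nat) \<Rightarrow> 'p" where
  "segment \<Lambda> \<eta> m n =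
     (THE \<mu>. \<mu> \<in> paths \<Lambda> \<and> deg \<Lambda> \<mu> = n - m \<and>
        (\<exists>\<eta>'\<in>paths \<Lambda>. \<exists>\<eta>''\<in>paths \<Lambda>.
           src \<Lambda> \<eta>' = ran \<Lambda> \<mu> \<and> src \<Lambda> \<mu> = ran \<Lambda> \<eta>'' \<and>
           \<eta> = cmp \<Lambda> \<eta>' (cmp \<Lambda> \<mu> \<eta>'') \<and>
           deg \<Lambda> \<eta>' = m \<and> deg \<Lambda> \<eta>'' = deg \<Lambda> \<eta> - n))"

definition MCE :: "('p, 'k) kgraph \<Rightarrow> 'p \<Rightarrow> 'p \<Rightarrow> 'p set" where
  "MCE \<Lambda> \<mu> \<nu> =
     {\<eta> \<in> paths \<Lambda>. deg \<Lambda> \<eta> = sup (deg \<Lambda> \<mu>) (deg \<Lambda> \<nu>)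
        \<and> segment \<Lambda> \<eta> 0 (deg \<Lambda> \<mu>) = \<mu> \<and> segment \<Lambda> \<eta> 0 (deg \<Lambda> \<nu>) = \<nu>}"

definition finitely_aligned :: "('p, 'k) kgraph \<Rightarrow> bool" where
  "finitely_aligned \<Lambda> \<longleftrightarrow> (\<forall>\<mu>\<in>paths \<Lambda>. \<forall>\<nu>\<in>paths \<Lambda>. finite (MCE \<Lambda> \<mu> \<nu>))"

definition paths_to :: "('p, 'k) kgraph \<Rightarrow> 'p \<Rightarrow> 'p set" where
  "paths_to \<Lambda> v = {\<eta> \<in> paths \<Lambda>. ran \<Lambda> \<eta> = v}"

definition exhaustive :: "('p, 'k) kgraph \<Rightarrow> 'p \<Rightarrow> 'p set \<Rightarrow> bool" where
  "exhaustive \<Lambda> v E \<longleftrightarrow>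
     E \<subseteq> paths_to \<Lambda> v \<and> (\<forall>\<mu>\<in>paths_to \<Lambda> v. \<exists>\<eta>\<in>E. MCE \<Lambda> \<mu> \<eta> \<noteq> {})"

definition FE :: "('p, 'k) kgraph \<Rightarrow> 'p \<Rightarrow> 'p set set" where
  "FE \<Lambda> v = {E. finite E \<and> exhaustive \<Lambda> v E}"

definition kgraph_aperiodic :: "('p, 'k) kgraph \<Rightarrow> bool" where
  "kgraph_aperiodic \<Lambda> \<longleftrightarrow>
     (\<forall>\<alpha>\<in>paths \<Lambda>. \<forall>\<beta>\<in>paths \<Lambda>. \<alpha> \<noteq> \<beta> \<and> src \<Lambda> \<alpha> = src \<Lambda> \<beta> \<longrightarrow>
        (\<exists>\<tau>\<in>paths_to \<Lambda> (src \<Lambda> \<alpha>). MCE \<Lambda> (cmp \<Lambda> \<alpha> \<tau>) (cmp \<Lambda> \<beta> \<tau>) = {}))"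

definition kgraph_cofinal :: "('p, 'k) kgraph \<Rightarrow> bool" where
  "kgraph_cofinal \<Lambda> \<longleftrightarrow>
     (\<forall>v\<in>vertices \<Lambda>. \<forall>w\<in>vertices \<Lambda>. \<exists>E\<in>FE \<Lambda> w. \<forall>\<alpha>\<in>E.
        {\<eta> \<in> paths_to \<Lambda> v. src \<Lambda> \<eta> = src \<Lambda> \<alpha>} \<noteq> {})"


section \<open>C*-algebras\<close>

definition complex_ring :: "complex ring" where
  "complex_ring = \<lparr>carrier = UNIV, mult = (*), one = 1, zero = 0, add = (+)\<rparr>"

lemma cring_complex_ring: "cring complex_ring"
proof (rule cringI)
  show "abelian_group complex_ring"
  proof (rule abelian_groupI)
    fix x assume "x \<in> carrier complex_ring"
    have "- x + x = 0" by simp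
    then show "\<exists>y\<in>carrier complex_ring. y \<oplus>\<^bsub>complex_ring\<^esub> x = \<zero>\<^bsub>complex_ring\<^esub>"
      unfolding complex_ring_def by (simp only: ring.simps partial_object.simps) blast
  qed (auto simp: complex_ring_def)
  show "Group.comm_monoid complex_ring"
    by unfold_locales (auto simp: complex_ring_def)
qed (auto simp: complex_ring_def algebra_simps)

text \<open>
  C*-algebras are not assumed to be unital: the field \<open>one\<close>, which is inherited from the ring
  records, is never referred to.
\<close>

record 'a cstar = "(complex, 'a) module" +
  invol :: "'a \<Rightarrow> 'a" (\<open>adj\<index> _\<close> [81] 80)
  cnorm :: "'a \<Rightarrow> real" (\<open>nrm\<index> _\<close> [81] 80)

locale normed_star_algebra = module complex_ring A
  for A :: "'a cstar" (structure) +
  assumes mult_closed: "\<lbrakk>x \<in> carrier A; y \<in> carrier A\<rbrakk> \<Longrightarrow> x \<otimes> y \<in> carrier A"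
    and mult_assoc:
      "\<lbrakk>x \<in> carrier A; y \<in> carrier A; z \<in> carrier A\<rbrakk> \<Longrightarrow> (x \<otimes> y) \<otimes> z = x \<otimes> (y \<otimes> z)"
    and mult_l_distr:
      "\<lbrakk>x \<in> carrier A; y \<in> carrier A; z \<in> carrier A\<rbrakk>
        \<Longrightarrow> (x \<oplus> y) \<otimes> z = (x \<otimes> z) \<oplus> (y \<otimes> z)"
    and mult_r_distr:
      "\<lbrakk>x \<in> carrier A; y \<in> carrier A; z \<in> carrier A\<rbrakk>
        \<Longrightarrow> x \<otimes> (y \<oplus> z) = (x \<otimes> y) \<oplus> (x \<otimes> z)"
    and smult_mult_left:
      "\<lbrakk>x \<in> carrier A; y \<in> carrier A\<rbrakk> \<Longrightarrow> (c \<odot> x) \<otimes> y = c \<odot> (x \<otimes> y)"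
    and smult_mult_right:
      "\<lbrakk>x \<in> carrier A; y \<in> carrier A\<rbrakk> \<Longrightarrow> x \<otimes> (c \<odot> y) = c \<odot> (x \<otimes> y)"
    and adj_closed: "x \<in> carrier A \<Longrightarrow> adj x \<in> carrier A"
    and adj_adj: "x \<in> carrier A \<Longrightarrow> adj (adj x) = x"
    and adj_add: "\<lbrakk>x \<in> carrier A; y \<in> carrier A\<rbrakk> \<Longrightarrow> adj (x \<oplus> y) = adj x \<oplus> adj y"
    and adj_smult: "x \<in> carrier A \<Longrightarrow> adj (c \<odot> x) = cnj c \<odot> adj x"
    and adj_mult: "\<lbrakk>x \<in> carrier A; y \<in> carrier A\<rbrakk> \<Longrightarrow> adj (x \<otimes> y) = adj y \<otimes> adj x"
    and nrm_nonneg: "x \<in> carrier A \<Longrightarrow> nrm x \<ge> 0"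
    and nrm_eq_0_iff: "x \<in> carrier A \<Longrightarrow> nrm x = 0 \<longleftrightarrow> x = \<zero>"
    and nrm_smult: "x \<in> carrier A \<Longrightarrow> nrm (c \<odot> x) = cmod c * nrm x"
    and nrm_add: "\<lbrakk>x \<in> carrier A; y \<in> carrier A\<rbrakk> \<Longrightarrow> nrm (x \<oplus> y) \<le> nrm x + nrm y"
    and nrm_mult: "\<lbrakk>x \<in> carrier A; y \<in> carrier A\<rbrakk> \<Longrightarrow> nrm (x \<otimes> y) \<le> nrm x * nrm y"

text \<open>
  The library's metric spaces require a distance that is nonnegative and symmetric on the
  whole type, hence the default value outside the carrier.
\<close>

definition cdist :: "'a cstar \<Rightarrow> 'a \<Rightarrow> 'a \<Rightarrow> real" where
  "cdist A x y = (if x \<in> carrier A \<and> y \<in> carrier A then nrm\<^bsub>A\<^esub> (x \<ominus>\<^bsub>A\<^esub> y) else 0)"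

lemma (in normed_star_algebra) Metric_space_cdist: "Metric_space (carrier A) (cdist A)"
proof
  have minus_one: "\<ominus> x = (- 1) \<odot> x" if x: "x \<in> carrier A" for x
  proof (rule minus_equality)
    have "(- 1) \<odot> x \<oplus> x = (- 1) \<odot> x \<oplus> 1 \<odot> x"
      using smult_one[OF x] by (simp add: complex_ring_def)
    also have "\<dots> = (- 1 + 1) \<odot> x"
      using smult_l_distr[of "- 1" 1 x] x by (simp add: complex_ring_def)
    also have "\<dots> = \<zero>"
      using smult_l_null[OF x] by (simp add: complex_ring_def)
    finally show "(- 1) \<odot> x \<oplus> x = \<zero>" .
    show "(- 1) \<odot> x \<in> carrier A"
      using x by (simp add: complex_ring_def smult_closed)
  qed (use x in auto)
  have nrm_minus: "nrm (\<ominus> x) = nrm x" if "x \<in> carrier A" for x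
    using that by (simp add: minus_one nrm_smult)
  fix x y z
  show "0 \<le> cdist A x y"
    by (simp add: cdist_def nrm_nonneg)
  show "cdist A x y = cdist A y x"
  proof (cases "x \<in> carrier A \<and> y \<in> carrier A")
    case True
    then have "\<ominus> (y \<ominus> x) = x \<ominus> y"
      by (simp add: a_minus_def minus_add a_comm)
    with True show ?thesis
      using nrm_minus[of "y \<ominus> x"] by (simp add: cdist_def)
  qed (auto simp: cdist_def)
  assume x: "x \<in> carrier A" and y: "y \<in> carrier A"
  show "cdist A x y = 0 \<longleftrightarrow> x = y"
  proof -
    have "x = (x \<ominus> y) \<oplus> y"
      using x y by (simp add: a_minus_def a_assoc l_neg)
    then have "x \<ominus> y = \<zero> \<longleftrightarrow> x = y"
      using x y by (metis M.l_zero M.minus_closed M.r_neg a_minus_def)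
    with x y show ?thesis
      by (simp add: cdist_def nrm_eq_0_iff)
  qed
  assume z: "z \<in> carrier A"
  have "x \<ominus> z = (x \<ominus> y) \<oplus> (y \<ominus> z)"
    using x y z by (simp add: a_minus_def a_assoc r_neg1)
  then show "cdist A x z \<le> cdist A x y + cdist A y z"
    using x y z nrm_add[of "x \<ominus> y" "y \<ominus> z"] by (simp add: cdist_def)
qed

locale cstar_algebra = normed_star_algebra A
  for A :: "'a cstar" (structure) +
  assumes cstar_identity: "x \<in> carrier A \<Longrightarrow> nrm (adj x \<otimes> x) = (nrm x)\<^sup>2"
    and complete: "Metric_space.mcomplete (carrier A) (cdist A)"

definition norm_closed :: "'a cstar \<Rightarrow> 'a set \<Rightarrow> bool" where
  "norm_closed A S \<longleftrightarrow> closedin (Metric_space.mtopology (carrier A) (cdist A)) S"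

definition cstar_subalgebra :: "'a cstar \<Rightarrow> 'a set \<Rightarrow> bool" where
  "cstar_subalgebra A S \<longleftrightarrow>
     submodule S complex_ring A \<and> norm_closed A S \<and>
     (\<forall>x\<in>S. \<forall>y\<in>S. x \<otimes>\<^bsub>A\<^esub> y \<in> S) \<and> (\<forall>x\<in>S. adj\<^bsub>A\<^esub> x \<in> S)"

definition cstar_ideal :: "'a cstar \<Rightarrow> 'a set \<Rightarrow> bool" where
  "cstar_ideal A I \<longleftrightarrow>
     submodule I complex_ring A \<and> norm_closed A I \<and>
     (\<forall>a\<in>carrier A. \<forall>x\<in>I. a \<otimes>\<^bsub>A\<^esub> x \<in> I \<and> x \<otimes>\<^bsub>A\<^esub> a \<in> I)"

text \<open>With this definition the zero algebra is simple.\<close>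

definition cstar_simple :: "'a cstar \<Rightarrow> bool" where
  "cstar_simple A \<longleftrightarrow> (\<forall>I. cstar_ideal A I \<longrightarrow> I = {\<zero>\<^bsub>A\<^esub>} \<or> I = carrier A)"

definition star_hom :: "'a cstar \<Rightarrow> 'b cstar \<Rightarrow> ('a \<Rightarrow> 'b) \<Rightarrow> bool" where
  "star_hom A B \<phi> \<longleftrightarrow>
     \<phi> \<in> carrier A \<rightarrow> carrier B \<and>
     (\<forall>x\<in>carrier A. \<forall>y\<in>carrier A. \<phi> (x \<oplus>\<^bsub>A\<^esub> y) = \<phi> x \<oplus>\<^bsub>B\<^esub> \<phi> y) \<and>
     (\<forall>c. \<forall>x\<in>carrier A. \<phi> (c \<odot>\<^bsub>A\<^esub> x) = c \<odot>\<^bsub>B\<^esub> \<phi> x) \<and>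
     (\<forall>x\<in>carrier A. \<forall>y\<in>carrier A. \<phi> (x \<otimes>\<^bsub>A\<^esub> y) = \<phi> x \<otimes>\<^bsub>B\<^esub> \<phi> y) \<and>
     (\<forall>x\<in>carrier A. \<phi> (adj\<^bsub>A\<^esub> x) = adj\<^bsub>B\<^esub> (\<phi> x))"


section \<open>The C*-algebra of a higher-rank graph\<close>

text \<open>
  In \<open>CK4\<close> the product runs over all enumerations of \<open>E\<close> (the factors commute by \<open>CK3\<close>).  It
  starts from \<open>t v\<close>, which is a unit for all the factors; as an exhaustive set is never empty,
  this does not change its value.
\<close>

locale ck_family = cstar_algebra B
  for \<Lambda> :: "('p, 'k) kgraph" and B :: "'b cstar" (structure) and t :: "'p \<Rightarrow> 'b" +
  assumes in_carrier: "\<eta> \<in> paths \<Lambda> \<Longrightarrow> t \<eta> \<in> carrier B"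
    and partial_isometry: "\<eta> \<in> paths \<Lambda> \<Longrightarrow> t \<eta> \<otimes> adj (t \<eta>) \<otimes> t \<eta> = t \<eta>"
    and CK1_projection: "v \<in> vertices \<Lambda> \<Longrightarrow> adj (t v) = t v \<and> t v \<otimes> t v = t v"
    and CK1_orthogonal:
      "\<lbrakk>v \<in> vertices \<Lambda>; w \<in> vertices \<Lambda>; v \<noteq> w\<rbrakk> \<Longrightarrow> t v \<otimes> t w = \<zero>"
    and CK2:
      "\<lbrakk>\<mu> \<in> paths \<Lambda>; \<nu> \<in> paths \<Lambda>; src \<Lambda> \<mu> = ran \<Lambda> \<nu>\<rbrakk> \<Longrightarrow> t \<mu> \<otimes> t \<nu> = t (cmp \<Lambda> \<mu> \<nu>)"
    and CK3:
      "\<lbrakk>\<mu> \<in> paths \<Lambda>; \<nu> \<in> paths \<Lambda>\<rbrakk> \<Longrightarrow>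
        adj (t \<mu>) \<otimes> t \<nu> =
          finsum B (\<lambda>(\<alpha>, \<beta>). t \<alpha> \<otimes> adj (t \<beta>))
            {(\<alpha>, \<beta>). \<alpha> \<in> paths_to \<Lambda> (src \<Lambda> \<mu>) \<and> \<beta> \<in> paths_to \<Lambda> (src \<Lambda> \<nu>) \<and>
               cmp \<Lambda> \<mu> \<alpha> = cmp \<Lambda> \<nu> \<beta> \<and> cmp \<Lambda> \<mu> \<alpha> \<in> MCE \<Lambda> \<mu> \<nu>}"
    and CK4:
      "\<lbrakk>v \<in> vertices \<Lambda>; set \<eta>s \<in> FE \<Lambda> v; distinct \<eta>s\<rbrakk> \<Longrightarrow>
        foldr (\<lambda>\<eta> x. (t v \<ominus> t \<eta> \<otimes> adj (t \<eta>)) \<otimes> x) \<eta>s (t v) = \<zero>"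

text \<open>
  \<open>graph_cstar \<Lambda> A s\<close>: the pair \<open>(A, s)\<close> is a C*-algebra of \<open>\<Lambda>\<close>, i.e. \<open>A\<close> is generated by the
  Cuntz-Krieger family \<open>s\<close>, and \<open>s\<close> is universal among all Cuntz-Krieger families.  This
  determines \<open>(A, s)\<close> up to isomorphism.

  HOL cannot quantify over all types in \<open>universal\<close>, so the target algebras have carriers in
  the fixed type \<open>nat \<Rightarrow> complex\<close>.  This is no restriction: as \<open>\<Lambda>\<close> is countable, any family
  generates a separable subalgebra of its target algebra; such a subalgebra has at most
  continuum many elements, so it has an isomorphic copy with carrier in \<open>nat \<Rightarrow> complex\<close>.
\<close>

locale graph_cstar = ck_family \<Lambda> A s
  for \<Lambda> :: "('p, 'k) kgraph" and A :: "'a cstar" (structure) and s :: "'p \<Rightarrow> 'a" +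
  assumes generated: "\<lbrakk>cstar_subalgebra A S; s ` paths \<Lambda> \<subseteq> S\<rbrakk> \<Longrightarrow> S = carrier A"
    and universal:
      "ck_family \<Lambda> (B :: (nat \<Rightarrow> complex) cstar) t \<Longrightarrow>
        \<exists>\<phi>. star_hom A B \<phi> \<and> (\<forall>\<eta>\<in>paths \<Lambda>. \<phi> (s \<eta>) = t \<eta>)"

end

theory Submission
  imports Defs "HOL-Analysis.Urysohn" "HOL-Analysis.Bounded_Linear_Function" "HOL-Analysis.Infinite_Sum"
begin

text \<open>
  Aperiodic and cofinal implies simple.  Let \<open>I\<close> be an ideal.  If \<open>I\<close> contains some \<open>s v\<close>, then
  cofinality and \<open>CK4\<close> put every \<open>s w\<close> into \<open>I\<close>.  Otherwise \<open>I\<close> is zero, because the norm of each \<open>x\<close> in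
  the span of the \<open>s \<mu> (s \<nu>)\<^sup>*\<close> is at most its distance \<open>D\<close> from \<open>I\<close>.  The elements of degree zero of
  the span lie in finite-dimensional algebras with explicit matrix units, on which the norm can be
  read off after compressing by a projection; aperiodicity provides a projection that in addition
  kills the finitely many terms of nonzero degree.  Instead of averaging over the gauge action, the
  C*-identity is iterated: \<open>h\<^sup>n\<close> has only polynomially many homogeneous components, so the estimate
  for each of them gives \<open>nrm h ^ n \<le> p n * D ^ n\<close> with a polynomial \<open>p\<close> for self-adjoint \<open>h\<close>, hence
  \<open>nrm h \<le> D\<close>.

  Simple implies aperiodic and cofinal.  Boundary paths are encoded as tight filters of paths.  The
  orbit of a boundary path carries a Cuntz-Krieger family on \<open>\<ell>\<^sup>2\<close>, whence a homomorphism on the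
  graph algebra.  If \<open>v\<close> and \<open>w\<close> violate cofinality, then there is a boundary path starting at \<open>w\<close>
  whose orbit avoids \<open>v\<close>, and its homomorphism kills \<open>s v\<close> but not \<open>s w\<close>.  If \<open>\<alpha>\<close> and \<open>\<beta>\<close> violate
  aperiodicity, then the homomorphism identifies \<open>s \<alpha>\<close> and \<open>s \<beta>\<close>, while its twist by a character of
  \<open>\<int>\<^sup>k\<close> shows that they differ.
\<close>

section \<open>Paths and their prefixes\<close>

text \<open>The obstacle is that paths of different degrees overlap, so the
  \<open>sp \<mu> \<nu>\<close> of degree zero are not matrix units. Subtracting the nontrivial
  continuations of \<nu> inside a finite set closed under the product repairs this. The corrected
  unit is zero by \<open>CK4\<close> if those continuations are exhaustive; otherwise some path
  misses all of them, and its extensions are where coefficients are read off and where aperiodicity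
  is applied. Neither quotient algebras nor spectral theory enter: the relation \<open>near\<close>
  stands for the quotient norm. Reading off coefficients costs a constant that depends on the finite
  set, but (h q)^n = h^n q for h in the core and the compressing projection q, so the constant
  disappears when powers are taken, just like the polynomial factor. In the converse direction all
  representations live in one concrete algebra \<open>BL\<close>, whose elements are coded as
  matrices because the universal property speaks of carriers in
  \<open>nat \<Rightarrow> complex\<close> only. Both homomorphisms of the aperiodic case come from
  the same orbit and the same partial bijections; they differ only by phases.\<close>

context k_graph
begin

abbreviation paths where "paths \<equiv> kgraph.paths \<Lambda>"
abbreviation src where "src \<equiv> kgraph.src \<Lambda>"
abbreviation ran where "ran \<equiv> kgraph.ran \<Lambda>"
abbreviation deg where "deg \<equiv> kgraph.deg \<Lambda>"
abbreviation cmp where "cmp \<equiv> kgraph.cmp \<Lambda>"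
abbreviation vertices where "vertices \<equiv> Defs.vertices \<Lambda>"
abbreviation paths_to where "paths_to \<equiv> Defs.paths_to \<Lambda>"
abbreviation FE where "FE \<equiv> Defs.FE \<Lambda>"
abbreviation MCE where "MCE \<equiv> Defs.MCE \<Lambda>"

text \<open>Initial segments are described by factorisations instead of \<open>segment\<close>.
  After the one translation in \<open>MCE_iff\<close>, common extensions are upper bounds in an
  order in which a path has exactly one initial segment of each degree up to its own.\<close>

definition pre :: "'p \<Rightarrow> 'p \<Rightarrow> bool" (infix \<open>\<preceq>\<close> 50) where
  "\<mu> \<preceq> \<eta> \<longleftrightarrow> \<mu> \<in> paths \<and> (\<exists>\<nu>\<in>paths. src \<mu> = ran \<nu> \<and> \<eta> = cmp \<mu> \<nu>)"

text \<open>Any common extension counts, not only a minimal one; this makes the relation hereditary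
  in both arguments, and \<open>MCE_empty_iff\<close> identifies its negation with an empty
  \<open>MCE\<close>.\<close>

definition meets :: "'p \<Rightarrow> 'p \<Rightarrow> bool" where
  "meets \<mu> \<nu> \<longleftrightarrow> (\<exists>\<eta>. \<mu> \<preceq> \<eta> \<and> \<nu> \<preceq> \<eta>)"

text \<open>Equal degrees of the left factors force equal degrees of the right ones, so both pairs
  factorise one path with the same pair of degrees.\<close>

lemma cmp_cancel:
  assumes p: "\<mu> \<in> paths" "\<nu> \<in> paths" "\<mu>' \<in> paths" "\<nu>' \<in> paths"
    and c: "src \<mu> = ran \<nu>" "src \<mu>' = ran \<nu>'" and d: "deg \<mu> = deg \<mu>'"
    and eq: "cmp \<mu> \<nu> = cmp \<mu>' \<nu>'"
  shows "\<mu> = \<mu>'" and "\<nu> = \<nu>'"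
proof -
  have d1: "deg (cmp \<mu> \<nu>) = deg \<mu> + deg \<nu>"
    and d2: "deg (cmp \<mu>' \<nu>') = deg \<mu>' + deg \<nu>'"
    using p c by (auto intro: deg_cmp)
  then have d': "deg \<nu>' = deg \<nu>"
    using eq d by simp
  have q: "cmp \<mu> \<nu> \<in> paths"
    using p c by (auto intro: cmp_closed)
  let ?P = "\<lambda>\<alpha> \<beta>. \<alpha> \<in> paths \<and> \<beta> \<in> paths \<and> deg \<alpha> = deg \<mu> \<and> deg \<beta> = deg \<nu>
              \<and> src \<alpha> = ran \<beta> \<and> cmp \<mu> \<nu> = cmp \<alpha> \<beta>"
  have "\<exists>!(\<alpha>, \<beta>). ?P \<alpha> \<beta>"
    by (rule factorisation[OF q d1])
  moreover have "?P \<mu> \<nu>" "?P \<mu>' \<nu>'"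
    using p c d d' eq by auto
  ultimately have "(\<mu>, \<nu>) = (\<mu>', \<nu>')"
    by blast
  then show "\<mu> = \<mu>'" and "\<nu> = \<nu>'"
    by auto
qed

lemma cmp_left_cancel:
  assumes "\<mu> \<in> paths" "\<nu> \<in> paths" "\<nu>' \<in> paths"
    and "src \<mu> = ran \<nu>" "src \<mu> = ran \<nu>'" "cmp \<mu> \<nu> = cmp \<mu> \<nu>'"
  shows "\<nu> = \<nu>'"
  using cmp_cancel(2)[of \<mu> \<nu> \<mu> \<nu>'] assms by auto

lemma src_vertex: "\<eta> \<in> paths \<Longrightarrow> src \<eta> \<in> vertices"
  and ran_vertex: "\<eta> \<in> paths \<Longrightarrow> ran \<eta> \<in> vertices"
  and vertex_path: "v \<in> vertices \<Longrightarrow> v \<in> paths"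
  and vertex_deg: "v \<in> vertices \<Longrightarrow> deg v = 0"
  by (auto simp: vertices_def src_closed ran_closed deg_src deg_ran)

lemma paths_to_iff: "\<eta> \<in> paths_to v \<longleftrightarrow> \<eta> \<in> paths \<and> ran \<eta> = v"
  by (auto simp: paths_to_def)

lemma deg_0_src:
  assumes "\<eta> \<in> paths" "deg \<eta> = 0" shows "src \<eta> = \<eta>" "ran \<eta> = \<eta>"
  using assms vertex_ran[of \<eta>] by (auto simp: vertices_def)

lemma factor:
  assumes "\<eta> \<in> paths" "m \<le> deg \<eta>"
  obtains \<mu> \<nu> where "\<mu> \<in> paths" "\<nu> \<in> paths" "deg \<mu> = m" "deg \<nu> = deg \<eta> - m"
    "src \<mu> = ran \<nu>" "\<eta> = cmp \<mu> \<nu>"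
proof -
  have "deg \<eta> = m + (deg \<eta> - m)"
    using assms(2) by (auto simp: le_fun_def fun_eq_iff)
  from factorisation[OF assms(1) this] that show ?thesis
    by blast
qed

lemma preI: "\<lbrakk>\<mu> \<in> paths; \<nu> \<in> paths; src \<mu> = ran \<nu>\<rbrakk> \<Longrightarrow> \<mu> \<preceq> cmp \<mu> \<nu>"
  by (auto simp: pre_def)

lemma preE:
  assumes "\<mu> \<preceq> \<eta>"
  obtains \<nu> where "\<mu> \<in> paths" "\<nu> \<in> paths" "src \<mu> = ran \<nu>" "\<eta> = cmp \<mu> \<nu>"
  using assms by (auto simp: pre_def)

lemma pre_paths: "\<mu> \<preceq> \<eta> \<Longrightarrow> \<mu> \<in> paths" "\<mu> \<preceq> \<eta> \<Longrightarrow> \<eta> \<in> paths"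
  by (auto simp: pre_def cmp_closed)

lemma pre_ran: "\<mu> \<preceq> \<eta> \<Longrightarrow> ran \<mu> = ran \<eta>"
  by (auto simp: pre_def ran_cmp)

lemma pre_deg: "\<mu> \<preceq> \<eta> \<Longrightarrow> deg \<mu> \<le> deg \<eta>"
  by (auto simp: pre_def deg_cmp le_fun_def)

lemma pre_refl: "\<mu> \<in> paths \<Longrightarrow> \<mu> \<preceq> \<mu>"
  using preI[of \<mu> "src \<mu>"] by (simp add: src_closed ran_src cmp_src_right)

lemma ran_pre: "\<mu> \<in> paths \<Longrightarrow> ran \<mu> \<preceq> \<mu>"
  using preI[of "ran \<mu>" \<mu>] by (simp add: ran_closed src_ran cmp_ran_left)

lemma pre_trans:
  assumes "\<mu> \<preceq> \<nu>" "\<nu> \<preceq> \<eta>" shows "\<mu> \<preceq> \<eta>"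
proof -
  obtain \<alpha> where a: "\<mu> \<in> paths" "\<alpha> \<in> paths" "src \<mu> = ran \<alpha>" "\<nu> = cmp \<mu> \<alpha>"
    using assms(1) by (rule preE)
  obtain \<beta> where b: "\<nu> \<in> paths" "\<beta> \<in> paths" "src \<nu> = ran \<beta>" "\<eta> = cmp \<nu> \<beta>"
    using assms(2) by (rule preE)
  have s: "src \<alpha> = ran \<beta>"
    using a b by (simp add: src_cmp)
  have "\<eta> = cmp \<mu> (cmp \<alpha> \<beta>)"
    using a b s by (simp add: cmp_assoc)
  then show ?thesis
    using preI[of \<mu> "cmp \<alpha> \<beta>"] a b s by (simp add: cmp_closed ran_cmp)
qed

lemma pre_unique: "\<lbrakk>\<mu> \<preceq> \<eta>; \<mu>' \<preceq> \<eta>; deg \<mu> = deg \<mu>'\<rbrakk> \<Longrightarrow> \<mu> = \<mu>'"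
  by (elim preE) (metis cmp_cancel(1))

lemma pre_of_deg:
  assumes "\<eta> \<in> paths" "m \<le> deg \<eta>"
  obtains \<mu> where "\<mu> \<preceq> \<eta>" "deg \<mu> = m"
  using factor[OF assms] preI by metis

text \<open>The initial segment of \<nu> of degree \<open>deg \<mu>\<close> is also one of \<eta>,
  hence equal to \<mu>.\<close>

lemma pre_comparable:
  assumes "\<mu> \<preceq> \<eta>" "\<nu> \<preceq> \<eta>" "deg \<mu> \<le> deg \<nu>"
  shows "\<mu> \<preceq> \<nu>"
proof -
  obtain \<mu>' where m: "\<mu>' \<preceq> \<nu>" "deg \<mu>' = deg \<mu>"
    using pre_of_deg assms pre_paths by metis
  then have "\<mu>' = \<mu>"
    using pre_unique pre_trans assms by metis
  then show ?thesis using m by simp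
qed

lemma pre_cmp_left:
  assumes "\<mu> \<in> paths" "src \<mu> = ran \<nu>" "\<nu> \<preceq> \<nu>'"
  shows "cmp \<mu> \<nu> \<preceq> cmp \<mu> \<nu>'"
  using assms(3)
proof (rule preE)
  fix \<beta> assume b: "\<nu> \<in> paths" "\<beta> \<in> paths" "src \<nu> = ran \<beta>" "\<nu>' = cmp \<nu> \<beta>"
  then show ?thesis
    using preI[of "cmp \<mu> \<nu>" \<beta>] assms by (simp add: cmp_closed src_cmp cmp_assoc)
qed

lemma pre_cmp_cancel:
  assumes "\<mu> \<in> paths" "\<nu> \<in> paths" "\<nu>' \<in> paths" "src \<mu> = ran \<nu>" "src \<mu> = ran \<nu>'"
    and "cmp \<mu> \<nu> \<preceq> cmp \<mu> \<nu>'"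
  shows "\<nu> \<preceq> \<nu>'"
  using assms(6)
proof (rule preE)
  fix \<beta> assume b: "\<beta> \<in> paths" "src (cmp \<mu> \<nu>) = ran \<beta>"
    "cmp \<mu> \<nu>' = cmp (cmp \<mu> \<nu>) \<beta>"
  then have s: "src \<nu> = ran \<beta>"
    using assms by (simp add: src_cmp)
  then have "cmp \<mu> \<nu>' = cmp \<mu> (cmp \<nu> \<beta>)"
    using assms b by (simp add: cmp_assoc)
  then have "\<nu>' = cmp \<nu> \<beta>"
    by (rule cmp_left_cancel[rotated -1]) (use assms b s in \<open>auto simp: cmp_closed ran_cmp\<close>)
  then show ?thesis
    using preI[of \<nu> \<beta>] assms b s by simp
qed

lemma segment_0:
  assumes \<eta>: "\<eta> \<in> paths" and n: "n \<le> deg \<eta>"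
  shows "segment \<Lambda> \<eta> 0 n = \<mu> \<longleftrightarrow> \<mu> \<preceq> \<eta> \<and> deg \<mu> = n"
proof -
  let ?P = "\<lambda>\<mu>. \<mu> \<in> paths \<and> deg \<mu> = n - 0 \<and>
        (\<exists>\<eta>'\<in>paths. \<exists>\<eta>''\<in>paths.
           src \<eta>' = ran \<mu> \<and> src \<mu> = ran \<eta>'' \<and>
           \<eta> = cmp \<eta>' (cmp \<mu> \<eta>'') \<and>
           deg \<eta>' = 0 \<and> deg \<eta>'' = deg \<eta> - n)"
  have P: "?P \<mu> \<longleftrightarrow> \<mu> \<preceq> \<eta> \<and> deg \<mu> = n" for \<mu>
  proof
    assume "?P \<mu>"
    then obtain \<eta>' \<eta>'' where h: "\<mu> \<in> paths" "deg \<mu> = n" "\<eta>' \<in> paths" "\<eta>'' \<in> paths"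
      "src \<eta>' = ran \<mu>" "src \<mu> = ran \<eta>''" "\<eta> = cmp \<eta>' (cmp \<mu> \<eta>'')" "deg \<eta>' = 0"
      by auto
    then have "\<eta>' = ran (cmp \<mu> \<eta>'')"
      using deg_0_src[of \<eta>'] by (simp add: ran_cmp)
    then have "\<eta> = cmp \<mu> \<eta>''"
      using h by (simp add: cmp_ran_left cmp_closed)
    then show "\<mu> \<preceq> \<eta> \<and> deg \<mu> = n"
      using h preI by simp
  next
    assume a: "\<mu> \<preceq> \<eta> \<and> deg \<mu> = n"
    then obtain \<nu> where h: "\<mu> \<in> paths" "\<nu> \<in> paths" "src \<mu> = ran \<nu>" "\<eta> = cmp \<mu> \<nu>"
      by (auto elim: preE)
    then have "cmp (ran \<mu>) (cmp \<mu> \<nu>) = \<eta>"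
      by (metis cmp_ran_left cmp_closed ran_cmp)
    moreover have "deg \<nu> = deg \<eta> - n"
      using h a by (simp add: deg_cmp)
    moreover have "n - 0 = n" by (simp add: fun_eq_iff)
    moreover have "src (ran \<mu>) = ran \<mu>" "deg (ran \<mu>) = 0" "ran \<mu> \<in> paths"
      using h by (auto simp: ran_closed src_ran deg_ran)
    ultimately show "?P \<mu>"
      using h a by metis
  qed
  obtain \<mu>0 where m0: "\<mu>0 \<preceq> \<eta>" "deg \<mu>0 = n"
    using pre_of_deg[OF \<eta> n] by auto
  have "segment \<Lambda> \<eta> 0 n = (THE \<mu>. \<mu> \<preceq> \<eta> \<and> deg \<mu> = n)"
    unfolding segment_def P ..
  also have "\<dots> = \<mu>0"
    using m0 pre_unique by (intro the_equality) auto
  finally show ?thesis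
    using m0 pre_unique by auto
qed

lemma MCE_iff:
  assumes "\<mu> \<in> paths" "\<nu> \<in> paths"
  shows "\<kappa> \<in> MCE \<mu> \<nu> \<longleftrightarrow> \<mu> \<preceq> \<kappa> \<and> \<nu> \<preceq> \<kappa> \<and> deg \<kappa> = sup (deg \<mu>) (deg \<nu>)"
  unfolding MCE_def using segment_0 pre_paths by (auto simp: segment_0)

lemma MCE_paths: "\<kappa> \<in> MCE \<mu> \<nu> \<Longrightarrow> \<kappa> \<in> paths"
  by (simp add: MCE_def)

lemma MCE_commute: "MCE \<mu> \<nu> = MCE \<nu> \<mu>"
  by (auto simp: MCE_def sup_commute)

text \<open>The candidate is the initial segment of \<eta> whose degree is the join of the two
  degrees; by comparability it extends both \<mu> and \<nu>.\<close>

lemma MCE_below: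
  assumes "\<mu> \<preceq> \<eta>" "\<nu> \<preceq> \<eta>"
  obtains \<kappa> where "\<kappa> \<in> MCE \<mu> \<nu>" "\<kappa> \<preceq> \<eta>"
proof -
  have "sup (deg \<mu>) (deg \<nu>) \<le> deg \<eta>"
    using assms pre_deg by simp
  then obtain \<kappa> where "\<kappa> \<preceq> \<eta>" "deg \<kappa> = sup (deg \<mu>) (deg \<nu>)"
    using pre_of_deg assms pre_paths by metis
  moreover from this have "\<mu> \<preceq> \<kappa>" "\<nu> \<preceq> \<kappa>"
    using pre_comparable assms by (metis sup_ge1, metis sup_ge2 pre_comparable assms(2))
  ultimately show ?thesis
    using that MCE_iff assms pre_paths by metis
qed

lemma MCE_empty_iff:
  "\<lbrakk>\<mu> \<in> paths; \<nu> \<in> paths\<rbrakk> \<Longrightarrow> MCE \<mu> \<nu> = {} \<longleftrightarrow> \<not> meets \<mu> \<nu>"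
  using MCE_iff MCE_below unfolding meets_def by (metis all_not_in_conv)

lemma meets_sym: "meets \<mu> \<nu> \<Longrightarrow> meets \<nu> \<mu>"
  by (auto simp: meets_def)

lemma meets_mono: "\<lbrakk>meets \<mu> \<nu>; \<mu>' \<preceq> \<mu>; \<nu>' \<preceq> \<nu>\<rbrakk> \<Longrightarrow> meets \<mu>' \<nu>'"
  unfolding meets_def using pre_trans by blast

lemma pre_meets: "\<mu> \<preceq> \<nu> \<Longrightarrow> meets \<mu> \<nu>"
  unfolding meets_def using pre_refl pre_paths by blast

lemma meets_paths: "meets \<mu> \<nu> \<Longrightarrow> \<mu> \<in> paths" "meets \<mu> \<nu> \<Longrightarrow> \<nu> \<in> paths"
  unfolding meets_def using pre_paths by blast+

lemma meets_same_deg: "\<lbrakk>meets \<mu> \<nu>; deg \<mu> = deg \<nu>\<rbrakk> \<Longrightarrow> \<mu> = \<nu>"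
  unfolding meets_def using pre_unique by blast

lemma meets_cmp:
  assumes "\<mu> \<in> paths" "\<alpha> \<in> paths" "\<beta> \<in> paths" "src \<mu> = ran \<alpha>" "src \<mu> = ran \<beta>"
  shows "meets (cmp \<mu> \<alpha>) (cmp \<mu> \<beta>) \<longleftrightarrow> meets \<alpha> \<beta>"
proof
  assume "meets (cmp \<mu> \<alpha>) (cmp \<mu> \<beta>)"
  then obtain \<eta> where \<eta>: "cmp \<mu> \<alpha> \<preceq> \<eta>" "cmp \<mu> \<beta> \<preceq> \<eta>"
    by (auto simp: meets_def)
  have "\<mu> \<preceq> \<eta>"
    using \<eta> pre_trans preI assms by metis
  then obtain \<nu> where n: "\<nu> \<in> paths" "src \<mu> = ran \<nu>" "\<eta> = cmp \<mu> \<nu>"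
    by (auto elim: preE)
  then have "\<alpha> \<preceq> \<nu>" "\<beta> \<preceq> \<nu>"
    using \<eta> pre_cmp_cancel assms by metis+
  then show "meets \<alpha> \<beta>"
    by (auto simp: meets_def)
next
  assume "meets \<alpha> \<beta>"
  then show "meets (cmp \<mu> \<alpha>) (cmp \<mu> \<beta>)"
    using pre_cmp_left assms unfolding meets_def by metis
qed

section \<open>Finite exhaustive sets\<close>

lemma exhaustive_iff:
  assumes "E \<subseteq> paths_to v"
  shows "exhaustive \<Lambda> v E \<longleftrightarrow> (\<forall>\<mu>\<in>paths_to v. \<exists>\<eta>\<in>E. meets \<mu> \<eta>)"
proof -
  have "MCE \<mu> \<eta> \<noteq> {} \<longleftrightarrow> meets \<mu> \<eta>" if "\<mu> \<in> paths_to v" "\<eta> \<in> E" for \<mu> \<eta>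
    using MCE_empty_iff that assms by (auto simp: paths_to_iff subset_iff)
  then show ?thesis
    unfolding exhaustive_def using assms by blast
qed

lemma FE_iff:
  "E \<in> FE v \<longleftrightarrow> finite E \<and> E \<subseteq> paths_to v \<and> (\<forall>\<mu>\<in>paths_to v. \<exists>\<eta>\<in>E. meets \<mu> \<eta>)"
  by (cases "E \<subseteq> paths_to v") (auto simp: FE_def exhaustive_iff, auto simp: exhaustive_def)

text \<open>An initial segment is determined by its degree, and the degrees lie in a finite
  box.\<close>

lemma finite_pre: "finite {\<mu>. \<mu> \<preceq> \<eta>}"
proof -
  have "inj_on deg {\<mu>. \<mu> \<preceq> \<eta>}"
    using pre_unique by (auto intro: inj_onI)
  moreover have "deg ` {\<mu>. \<mu> \<preceq> \<eta>} \<subseteq> Pi\<^sub>E UNIV (\<lambda>i. {..deg \<eta> i})"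
    using pre_deg by (auto simp: PiE_def le_fun_def)
  then have "finite (deg ` {\<mu>. \<mu> \<preceq> \<eta>})"
    by (rule finite_subset) (auto intro: finite_PiE)
  ultimately show ?thesis
    using finite_imageD by blast
qed

text \<open>A tail is determined by the path that precedes it, of which there are finitely many;
  \<open>f\<close> chooses such a path for each tail.\<close>

lemma finite_tails: "finite {\<kappa> \<in> paths. \<exists>\<mu>\<in>paths. src \<mu> = ran \<kappa> \<and> cmp \<mu> \<kappa> = \<eta>}" (is "finite ?T")
proof -
  define f where "f \<kappa> = (SOME \<mu>. \<mu> \<in> paths \<and> src \<mu> = ran \<kappa> \<and> cmp \<mu> \<kappa> = \<eta>)" for \<kappa>
  have f: "f \<kappa> \<in> paths \<and> src (f \<kappa>) = ran \<kappa> \<and> cmp (f \<kappa>) \<kappa> = \<eta>" if "\<kappa> \<in> ?T" for \<kappa>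
  proof -
    obtain \<mu> where "\<mu> \<in> paths \<and> src \<mu> = ran \<kappa> \<and> cmp \<mu> \<kappa> = \<eta>"
      using \<open>\<kappa> \<in> ?T\<close> by (simp only: mem_Collect_eq) (elim conjE bexE, simp)
    then show ?thesis
      unfolding f_def by (rule someI)
  qed
  have "inj_on f ?T"
  proof (rule inj_onI)
    fix \<kappa> \<kappa>' assume a: "\<kappa> \<in> ?T" "\<kappa>' \<in> ?T" "f \<kappa> = f \<kappa>'"
    have "\<kappa> \<in> paths" "\<kappa>' \<in> paths" using a by simp_all
    then show "\<kappa> = \<kappa>'"
      using f[OF a(1)] f[OF a(2)] a(3) cmp_left_cancel[of "f \<kappa>" \<kappa> \<kappa>'] by metis
  qed
  moreover have "f ` ?T \<subseteq> {\<mu>. \<mu> \<preceq> \<eta>}"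
  proof
    fix \<mu> assume "\<mu> \<in> f ` ?T"
    then obtain \<kappa> where k: "\<kappa> \<in> ?T" "\<mu> = f \<kappa>" by blast
    moreover have "\<kappa> \<in> paths" using k by simp
    ultimately show "\<mu> \<in> {\<mu>. \<mu> \<preceq> \<eta>}"
      using f[OF k(1)] preI[of \<mu> \<kappa>] by simp
  qed
  then have "finite (f ` ?T)"
    using finite_pre finite_subset by blast
  ultimately show ?thesis
    using finite_imageD by blast
qed

text \<open>The restriction of E along \<kappa>: the paths by which \<kappa> has to be prolonged to
  reach a minimal common extension with a member of E. It moves exhaustive sets from
  \<open>ran \<kappa>\<close> to \<open>src \<kappa>\<close>.\<close>

definition Ext :: "'p \<Rightarrow> 'p set \<Rightarrow> 'p set" where
  "Ext \<kappa> E = {\<beta> \<in> paths. src \<kappa> = ran \<beta> \<and> (\<exists>\<eta>\<in>E. cmp \<kappa> \<beta> \<in> MCE \<kappa> \<eta>)}"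

lemma finite_Ext:
  assumes fa: "finitely_aligned \<Lambda>" and E: "finite E" "E \<subseteq> paths" and \<kappa>: "\<kappa> \<in> paths"
  shows "finite (Ext \<kappa> E)"
proof (rule finite_imageD)
  have "cmp \<kappa> ` Ext \<kappa> E \<subseteq> (\<Union>\<eta>\<in>E. MCE \<kappa> \<eta>)"
    by (auto simp: Ext_def)
  moreover have "finite (\<Union>\<eta>\<in>E. MCE \<kappa> \<eta>)"
    using fa E \<kappa> unfolding finitely_aligned_def by auto
  ultimately show "finite (cmp \<kappa> ` Ext \<kappa> E)"
    using finite_subset by blast
  show "inj_on (cmp \<kappa>) (Ext \<kappa> E)"
    using \<kappa> cmp_left_cancel by (auto intro!: inj_onI simp: Ext_def)
qed

text \<open>A common extension of \<open>cmp \<kappa> \<gamma>\<close> and \<eta> extends \<kappa>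
  as well, so it lies above some member of \<open>MCE \<kappa> \<eta>\<close>; the part of that
  member after \<kappa> is the required \<beta>.\<close>

lemma Ext_meets:
  assumes \<kappa>: "\<kappa> \<in> paths" and \<gamma>: "\<gamma> \<in> paths_to (src \<kappa>)" and \<eta>: "\<eta> \<in> E" "meets (cmp \<kappa> \<gamma>) \<eta>"
  shows "\<exists>\<beta>\<in>Ext \<kappa> E. meets \<gamma> \<beta>"
proof -
  have g: "\<gamma> \<in> paths" "src \<kappa> = ran \<gamma>"
    using \<gamma> by (auto simp: paths_to_iff)
  obtain \<omega> where w: "cmp \<kappa> \<gamma> \<preceq> \<omega>" "\<eta> \<preceq> \<omega>"
    using \<eta> by (auto simp: meets_def)
  have kw: "\<kappa> \<preceq> \<omega>"
    using w(1) g \<kappa> preI pre_trans by metis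
  obtain \<mu> where m: "\<mu> \<in> MCE \<kappa> \<eta>" "\<mu> \<preceq> \<omega>"
    using MCE_below[OF kw w(2)] by auto
  have "\<kappa> \<preceq> \<mu>"
    using m(1) MCE_iff \<kappa> w pre_paths by metis
  then obtain \<beta> where b: "\<beta> \<in> paths" "src \<kappa> = ran \<beta>" "\<mu> = cmp \<kappa> \<beta>"
    by (auto elim: preE)
  have "meets (cmp \<kappa> \<gamma>) (cmp \<kappa> \<beta>)"
    using w(1) m(2) b by (auto simp: meets_def)
  then have "meets \<gamma> \<beta>"
    using meets_cmp \<kappa> g b by simp
  moreover have "\<beta> \<in> Ext \<kappa> E"
    using b m \<eta> by (auto simp: Ext_def)
  ultimately show ?thesis by blast
qed

lemma Ext_FE:
  assumes fa: "finitely_aligned \<Lambda>" and E: "E \<in> FE (ran \<kappa>)" and \<kappa>: "\<kappa> \<in> paths"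
  shows "Ext \<kappa> E \<in> FE (src \<kappa>)"
  unfolding FE_iff
proof (intro conjI ballI)
  show "finite (Ext \<kappa> E)"
    using finite_Ext[OF fa] E \<kappa> by (auto simp: FE_iff paths_to_iff subset_iff)
  show "Ext \<kappa> E \<subseteq> paths_to (src \<kappa>)"
    by (auto simp: Ext_def paths_to_iff)
  fix \<gamma> assume g: "\<gamma> \<in> paths_to (src \<kappa>)"
  then have "cmp \<kappa> \<gamma> \<in> paths_to (ran \<kappa>)"
    using \<kappa> by (auto simp: paths_to_iff cmp_closed ran_cmp)
  then obtain \<eta> where "\<eta> \<in> E" "meets (cmp \<kappa> \<gamma>) \<eta>"
    using E by (auto simp: FE_iff)
  then show "\<exists>\<beta>\<in>Ext \<kappa> E. meets \<gamma> \<beta>"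
    using Ext_meets[OF \<kappa> g] by blast
qed

text \<open>A path \<mu> meets some \<tau> in E, and what a common extension adds to \<tau> meets a
  member of \<open>F \<tau>\<close>. Such refinements are the reason why failure of cofinality at a
  vertex propagates along paths.\<close>

lemma FE_cmp:
  assumes E: "E \<in> FE u" and F: "\<And>\<tau>. \<tau> \<in> E \<Longrightarrow> F \<tau> \<in> FE (src \<tau>)"
  shows "(\<Union>\<tau>\<in>E. cmp \<tau> ` F \<tau>) \<in> FE u"
  unfolding FE_iff
proof (intro conjI ballI)
  show "finite (\<Union>\<tau>\<in>E. cmp \<tau> ` F \<tau>)"
    using E F by (auto simp: FE_iff)
  have E': "\<tau> \<in> paths \<and> ran \<tau> = u" if "\<tau> \<in> E" for \<tau>
    using that E by (auto simp: FE_iff paths_to_iff)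
  have F': "\<rho> \<in> paths \<and> ran \<rho> = src \<tau>" if "\<tau> \<in> E" "\<rho> \<in> F \<tau>" for \<tau> \<rho>
    using that F[OF that(1)] by (auto simp: FE_iff paths_to_iff)
  show "(\<Union>\<tau>\<in>E. cmp \<tau> ` F \<tau>) \<subseteq> paths_to u"
    using E' F' by (fastforce simp: paths_to_iff cmp_closed ran_cmp)
  fix \<mu> assume "\<mu> \<in> paths_to u"
  then obtain \<tau> where t: "\<tau> \<in> E" "meets \<mu> \<tau>"
    using E by (auto simp: FE_iff)
  then obtain \<omega> where w: "\<mu> \<preceq> \<omega>" "\<tau> \<preceq> \<omega>"
    by (auto simp: meets_def)
  obtain \<gamma> where g: "\<tau> \<in> paths" "\<gamma> \<in> paths" "src \<tau> = ran \<gamma>" "\<omega> = cmp \<tau> \<gamma>"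
    using w(2) by (rule preE)
  then have "\<gamma> \<in> paths_to (src \<tau>)"
    by (simp add: paths_to_iff)
  then obtain \<rho> where r: "\<rho> \<in> F \<tau>" "meets \<gamma> \<rho>"
    using F[OF t(1)] unfolding FE_iff by blast
  have "meets \<omega> (cmp \<tau> \<rho>)"
    using meets_cmp[of \<tau> \<gamma> \<rho>] g r F'[OF t(1) r(1)] by simp
  then have "meets \<mu> (cmp \<tau> \<rho>)"
    using w(1) meets_mono pre_refl meets_paths by metis
  then show "\<exists>\<eta>\<in>\<Union>\<tau>\<in>E. cmp \<tau> ` F \<tau>. meets \<mu> \<eta>"
    using t r by blast
qed

text \<open>Finitely many conditions that persist under extension and can always be met by extending
  are met one after the other. Separation properties of a path are obtained in this form.\<close>

lemma dense_extension:
  assumes "finite \<P>" and \<tau>: "\<tau> \<in> paths"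
    and up: "\<And>P \<sigma> \<sigma>'. \<lbrakk>P \<in> \<P>; \<sigma> \<preceq> \<sigma>'; P \<sigma>\<rbrakk> \<Longrightarrow> P \<sigma>'"
    and dense: "\<And>P \<sigma>. \<lbrakk>P \<in> \<P>; \<tau> \<preceq> \<sigma>\<rbrakk> \<Longrightarrow> \<exists>\<sigma>'. \<sigma> \<preceq> \<sigma>' \<and> P \<sigma>'"
  shows "\<exists>\<sigma>. \<tau> \<preceq> \<sigma> \<and> (\<forall>P\<in>\<P>. P \<sigma>)"
  using assms(1) up dense
proof (induction \<P> rule: finite_induct)
  case empty
  then show ?case using \<tau> pre_refl by blast
next
  case (insert P \<P>)
  have "\<exists>\<sigma>. \<tau> \<preceq> \<sigma> \<and> (\<forall>P\<in>\<P>. P \<sigma>)"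
  proof (rule insert.IH)
    show "P' \<sigma>'" if "P' \<in> \<P>" "\<sigma> \<preceq> \<sigma>'" "P' \<sigma>" for P' \<sigma> \<sigma>'
      using insert.prems(1)[of P' \<sigma> \<sigma>'] that by simp
    show "\<exists>\<sigma>'. \<sigma> \<preceq> \<sigma>' \<and> P' \<sigma>'" if "P' \<in> \<P>" "\<tau> \<preceq> \<sigma>" for P' \<sigma>
      using insert.prems(2)[of P' \<sigma>] that by simp
  qed
  then obtain \<sigma> where s: "\<tau> \<preceq> \<sigma>" "\<forall>P\<in>\<P>. P \<sigma>" by blast
  obtain \<sigma>' where s': "\<sigma> \<preceq> \<sigma>'" "P \<sigma>'"
    using insert.prems(2)[of P \<sigma>] s by auto
  have "Q \<sigma>'" if "Q \<in> insert P \<P>" for Q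
    using s s' that insert.prems(1)[of Q \<sigma> \<sigma>'] by auto
  then show ?case
    using s s' pre_trans by blast
qed

text \<open>Both coordinates are tails of minimal common extensions. Finiteness makes the
  \<open>finsum\<close> in \<open>CK3\<close> a genuine sum.\<close>

lemma finite_CK3_index:
  assumes fa: "finitely_aligned \<Lambda>" and p: "\<mu> \<in> paths" "\<nu> \<in> paths"
  shows "finite {(\<alpha>, \<beta>). \<alpha> \<in> paths_to (src \<mu>) \<and> \<beta> \<in> paths_to (src \<nu>) \<and>
               cmp \<mu> \<alpha> = cmp \<nu> \<beta> \<and> cmp \<mu> \<alpha> \<in> MCE \<mu> \<nu>}" (is "finite ?S")
proof (rule finite_subset)
  show "?S \<subseteq> Ext \<mu> {\<nu>} \<times> Ext \<nu> {\<mu>}"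
  proof
    fix x assume "x \<in> ?S"
    moreover obtain \<alpha> \<beta> where xe: "x = (\<alpha>, \<beta>)" by (cases x)
    ultimately have "(\<alpha>, \<beta>) \<in> ?S" by (simp only:)
    then have x: "\<alpha> \<in> paths" "ran \<alpha> = src \<mu>" "\<beta> \<in> paths" "ran \<beta> = src \<nu>"
      "cmp \<mu> \<alpha> = cmp \<nu> \<beta>" "cmp \<mu> \<alpha> \<in> MCE \<mu> \<nu>"
      unfolding mem_Collect_eq prod.case paths_to_iff by - (elim conjE, assumption)+
    show "x \<in> Ext \<mu> {\<nu>} \<times> Ext \<nu> {\<mu>}"
      using x(1-4) x(6) x(6)[unfolded x(5)] unfolding xe Ext_def by (simp add: MCE_commute)
  qed
  show "finite (Ext \<mu> {\<nu>} \<times> Ext \<nu> {\<mu>})"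
    using finite_Ext[OF fa] p by (intro finite_cartesian_product) auto
qed

subsection \<open>Finite sets closed under the product of the core\<close>

text \<open>By \<open>CK3\<close>, \<open>sp \<eta> \<mu>\<close> times
  \<open>sp \<sigma> \<tau>\<close> yields paths \<open>cmp \<eta> \<alpha>\<close> with
  \<open>cmp \<mu> \<alpha>\<close> in \<open>MCE \<mu> \<sigma>\<close>. Closure under this
  operation makes the span of the generators of degree zero over F an algebra.\<close>

definition core_closed :: "'p set \<Rightarrow> bool" where
  "core_closed F \<longleftrightarrow> F \<subseteq> paths \<and>
     (\<forall>\<eta>\<in>F. \<forall>\<mu>\<in>F. \<forall>\<sigma>\<in>F. \<forall>\<alpha>\<in>paths.
        deg \<eta> = deg \<mu> \<and> src \<eta> = src \<mu> \<and> src \<mu> = ran \<alpha> \<and> cmp \<mu> \<alpha> \<in> MCE \<mu> \<sigma>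
        \<longrightarrow> cmp \<eta> \<alpha> \<in> F)"

definition tot :: "'p \<Rightarrow> nat" where
  "tot \<eta> = (\<Sum>i\<in>UNIV. deg \<eta> i)"

lemma tot_cmp: "\<lbrakk>\<mu> \<in> paths; \<nu> \<in> paths; src \<mu> = ran \<nu>\<rbrakk> \<Longrightarrow> tot (cmp \<mu> \<nu>) = tot \<mu> + tot \<nu>"
  by (simp add: tot_def deg_cmp sum.distrib)

lemma tot_0_iff: "tot \<eta> = 0 \<longleftrightarrow> deg \<eta> = 0"
  by (auto simp: tot_def fun_eq_iff)

lemma cmp_deg_0:
  assumes "\<mu> \<in> paths" "\<alpha> \<in> paths" "src \<mu> = ran \<alpha>" "deg \<alpha> = 0"
  shows "cmp \<mu> \<alpha> = \<mu>"
  using assms deg_0_src[of \<alpha>] by (metis cmp_src_right)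

text \<open>
  A core-closed set containing \<open>E\<close> is built up by total degree \<open>j\<close>: by the factorisation property,
  a new element of total degree \<open>j\<close> is a product of an old one and of a tail of a minimal common
  extension of old ones, and there are only finitely many such tails.
\<close>

definition core_closed_below :: "nat \<Rightarrow> 'p set \<Rightarrow> bool" where
  "core_closed_below j H \<longleftrightarrow>
     (\<forall>\<eta> \<mu> \<sigma> \<alpha>. \<eta> \<in> H \<longrightarrow> \<mu> \<in> H \<longrightarrow> \<sigma> \<in> H \<longrightarrow> \<alpha> \<in> paths \<longrightarrow> deg \<eta> = deg \<mu> \<longrightarrow> src \<eta> = src \<mu> \<longrightarrow>
        src \<mu> = ran \<alpha> \<longrightarrow> cmp \<mu> \<alpha> \<in> MCE \<mu> \<sigma> \<longrightarrow> tot (cmp \<mu> \<alpha>) < j \<longrightarrow> cmp \<eta> \<alpha> \<in> H)"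

lemma core_closed_step:
  assumes fa: "finitely_aligned \<Lambda>" and E: "finite E" "E \<subseteq> paths"
  shows "\<exists>H. finite H \<and> H \<subseteq> paths \<and> {\<eta> \<in> E. tot \<eta> < j} \<subseteq> H \<and> (\<forall>\<eta>\<in>H. tot \<eta> < j) \<and>
     core_closed_below j H"
proof (induction j)
  case 0
  then show ?case by (intro exI[of _ "{}"]) (auto simp: core_closed_below_def)
next
  case (Suc j)
  then obtain H where H: "finite H" "H \<subseteq> paths" "{\<eta> \<in> E. tot \<eta> < j} \<subseteq> H" "\<And>\<eta>. \<eta> \<in> H \<Longrightarrow> tot \<eta> < j"
    and Hb: "core_closed_below j H"
    by auto
  have Hc: "cmp \<eta> \<alpha> \<in> H"
    if "\<eta> \<in> H" "\<mu> \<in> H" "\<sigma> \<in> H" "\<alpha> \<in> paths" "deg \<eta> = deg \<mu>" "src \<eta> = src \<mu>"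
      "src \<mu> = ran \<alpha>" "cmp \<mu> \<alpha> \<in> MCE \<mu> \<sigma>" "tot (cmp \<mu> \<alpha>) < j" for \<eta> \<mu> \<sigma> \<alpha>
    using Hb that unfolding core_closed_below_def by blast
  \<comment> \<open>\<open>S\<close> holds the paths of total degree j that are forced directly:
    members of E and minimal common extensions of old paths. \<open>R\<close> collects all their
    tails, and \<open>G\<close> prolongs old paths by such tails.\<close>
  define S where "S = {\<eta> \<in> E. tot \<eta> = j} \<union> {\<kappa> \<in> \<Union>\<mu>\<in>H. \<Union>\<sigma>\<in>H. MCE \<mu> \<sigma>. tot \<kappa> = j}"
  define R where "R = (\<Union>\<eta>\<in>S. {\<kappa> \<in> paths. \<exists>\<mu>\<in>paths. src \<mu> = ran \<kappa> \<and> cmp \<mu> \<kappa> = \<eta>})"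
  define G where "G = {\<kappa>. \<exists>g\<in>H. \<exists>\<alpha>\<in>R. src g = ran \<alpha> \<and> \<kappa> = cmp g \<alpha> \<and> tot \<kappa> = j}"
  have "finite (\<Union>\<mu>\<in>H. \<Union>\<sigma>\<in>H. MCE \<mu> \<sigma>)"
    using fa H(1,2) unfolding finitely_aligned_def by blast
  then have "finite {\<kappa> \<in> \<Union>\<mu>\<in>H. \<Union>\<sigma>\<in>H. MCE \<mu> \<sigma>. tot \<kappa> = j}"
    by (rule rev_finite_subset) blast
  then have fS: "finite S"
    unfolding S_def using E by simp
  have S: "S \<subseteq> paths" "\<And>\<eta>. \<eta> \<in> S \<Longrightarrow> tot \<eta> = j"
    using E(2) MCE_paths unfolding S_def by blast+
  have fR: "finite R"
    unfolding R_def using fS finite_tails by auto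
  have R: "R \<subseteq> paths"
    by (auto simp: R_def)
  have "G \<subseteq> (\<lambda>(g, \<alpha>). cmp g \<alpha>) ` (H \<times> R)"
    unfolding G_def by blast
  then have fG: "finite G"
    using H(1) fR by (meson finite_SigmaI finite_imageI finite_subset)
  have G: "G \<subseteq> paths" "\<And>\<eta>. \<eta> \<in> G \<Longrightarrow> tot \<eta> = j"
    unfolding G_def using H(2) R cmp_closed by blast+
  have SI: "\<kappa> \<in> S" if "\<kappa> \<in> MCE \<mu> \<sigma>" "\<mu> \<in> H" "\<sigma> \<in> H" "tot \<kappa> = j" for \<kappa> \<mu> \<sigma>
    using that unfolding S_def by blast
  have RI: "\<alpha> \<in> R" if "\<alpha> \<in> paths" "\<mu> \<in> paths" "src \<mu> = ran \<alpha>" "cmp \<mu> \<alpha> \<in> S" for \<mu> \<alpha>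
    using that unfolding R_def by blast
  have RT: "\<beta> \<in> R" if r: "\<rho> \<in> R" and b: "\<beta> \<in> paths" "\<beta>' \<in> paths" "src \<beta>' = ran \<beta>" "\<rho> = cmp \<beta>' \<beta>" for \<rho> \<beta> \<beta>'
  proof -
    obtain \<mu> where m: "\<mu> \<in> paths" "src \<mu> = ran \<rho>" "cmp \<mu> \<rho> \<in> S"
      using r unfolding R_def by blast
    then have "cmp (cmp \<mu> \<beta>') \<beta> \<in> S" "src (cmp \<mu> \<beta>') = ran \<beta>" "cmp \<mu> \<beta>' \<in> paths"
      using b by (auto simp: cmp_assoc ran_cmp src_cmp cmp_closed)
    then show ?thesis using RI b by blast
  qed
  have GI: "cmp g \<alpha> \<in> G" if "g \<in> H" "\<alpha> \<in> R" "src g = ran \<alpha>" "tot (cmp g \<alpha>) = j" for g \<alpha>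
    using that unfolding G_def by blast
  define H' where "H' = H \<union> S \<union> G"
  have H': "H \<subseteq> H'" "S \<subseteq> H'" "G \<subseteq> H'" "H' \<subseteq> paths"
    using H(2) S(1) G(1) by (simp_all add: H'_def le_supI1)
  have new: "\<eta> \<in> H" if "\<eta> \<in> H'" "tot \<eta> < j" for \<eta>
  proof (rule ccontr)
    assume "\<eta> \<notin> H"
    then have "\<eta> \<in> S \<or> \<eta> \<in> G" using that(1) unfolding H'_def by simp
    then show False using S(2)[of \<eta>] G(2)[of \<eta>] that(2) by (elim disjE) simp_all
  qed
  have cl: "cmp \<eta> \<alpha> \<in> H'"
    if a: "\<eta> \<in> H'" "\<mu> \<in> H'" "\<sigma> \<in> H'" "\<alpha> \<in> paths" "deg \<eta> = deg \<mu>" "src \<eta> = src \<mu>"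
        "src \<mu> = ran \<alpha>" "cmp \<mu> \<alpha> \<in> MCE \<mu> \<sigma>" "tot (cmp \<mu> \<alpha>) < Suc j" for \<eta> \<mu> \<sigma> \<alpha>
  proof -
    have p: "\<eta> \<in> paths" "\<mu> \<in> paths" "\<sigma> \<in> paths"
      using a(1-3) H'(4) by blast+
    have te: "tot \<eta> = tot \<mu>"
      using a(5) by (simp add: tot_def)
    have tm: "tot (cmp \<mu> \<alpha>) = tot \<mu> + tot \<alpha>"
      using a(4,7) p by (simp add: tot_cmp)
    have M: "\<mu> \<preceq> cmp \<mu> \<alpha>" "\<sigma> \<preceq> cmp \<mu> \<alpha>"
      using a(8) MCE_iff p by auto
    show ?thesis
    proof (cases "deg \<alpha> = 0")
      case True
      then have "cmp \<eta> \<alpha> = \<eta>"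
        using cmp_deg_0 a(4,6,7) p by simp
      then show ?thesis using a(1) by simp
    next
      case False
      then have "tot \<alpha> > 0" using tot_0_iff by auto
      then have "tot \<mu> < j" "tot \<eta> < j"
        using tm a(9) te by linarith+
      then have mH: "\<mu> \<in> H" "\<eta> \<in> H"
        using new a(1,2) by blast+
      have ts: "tot \<sigma> \<le> tot (cmp \<mu> \<alpha>)"
        using pre_deg[OF M(2)] by (auto simp: tot_def le_fun_def intro!: sum_mono)
      have tn: "tot (cmp \<eta> \<alpha>) = tot (cmp \<mu> \<alpha>)"
        using tm te a(4,6,7) p by (simp add: tot_cmp)
      show ?thesis
      proof (cases "tot (cmp \<mu> \<alpha>) < j")
        case True
        then have "\<sigma> \<in> H" using ts new a(3) by simp
        then show ?thesis
          using Hc[OF mH(2,1) _ a(4-8) True] H'(1) by blast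
      next
        case False
        then have tj: "tot (cmp \<mu> \<alpha>) = j"
          using a(9) by simp
        have RG: "cmp \<eta> \<alpha> \<in> H'" if "\<alpha> \<in> R"
          using subsetD[OF H'(3) GI[of \<eta> \<alpha>]] that mH a(6,7) tn tj by simp
        have RS: "cmp \<eta> \<alpha> \<in> H'" if "cmp \<mu> \<alpha> \<in> S"
          using RG RI[OF a(4) p(2) a(7) that] by blast
        show ?thesis
        proof (cases "tot \<sigma> < j")
          case True
          then have "\<sigma> \<in> H" using new a(3) by blast
          then show ?thesis using RS SI[OF a(8) mH(1) _ tj] by blast
        next
          case False
          have ss: "\<sigma> \<in> S \<union> G" using False a(3) H(4)[of \<sigma>] unfolding H'_def by blast
          \<comment> \<open>An initial segment with the full total degree is the whole path, so
            \<sigma> equals \<open>cmp \<mu> \<alpha>\<close>.\<close>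
          have "tot \<sigma> = tot (cmp \<mu> \<alpha>)"
            using ts False tj by simp
          moreover obtain \<zeta> where z: "\<zeta> \<in> paths" "src \<sigma> = ran \<zeta>" "cmp \<mu> \<alpha> = cmp \<sigma> \<zeta>"
            using M(2) by (rule preE)
          ultimately have "tot \<zeta> = 0"
            using tot_cmp[of \<sigma> \<zeta>] p by simp
          then have se: "\<sigma> = cmp \<mu> \<alpha>"
            using z cmp_deg_0 p tot_0_iff by metis
          show ?thesis
          proof (cases "\<sigma> \<in> S")
            case True
            then show ?thesis using RS se by simp
          next
            case False
            \<comment> \<open>If \<sigma> prolongs an old path g, compare \<mu> with g. Either their
              minimal common extension \<kappa> is \<sigma> itself, which then lies in
              \<open>S\<close>, or the swap is already available for \<kappa> and the remaining
              \<beta> is a tail in \<open>R\<close>.\<close>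
            then obtain g \<rho> where g: "g \<in> H" "\<rho> \<in> R" "src g = ran \<rho>" "\<sigma> = cmp g \<rho>"
              using ss unfolding G_def by blast
            have gp: "g \<in> paths" "\<rho> \<in> paths"
              using g H(2) R by blast+
            have gs: "g \<preceq> \<sigma>" using g gp preI by simp
            have ms: "\<mu> \<preceq> \<sigma>" using se M by simp
            obtain \<kappa> where k: "\<kappa> \<in> MCE \<mu> g" "\<kappa> \<preceq> \<sigma>"
              using MCE_below[OF ms gs] by auto
            have k': "\<mu> \<preceq> \<kappa>" "g \<preceq> \<kappa>"
              using k(1) MCE_iff[OF p(2) gp(1)] by blast+
            have "tot \<kappa> \<le> j"
              using pre_deg[OF k(2)] se tj by (auto simp: tot_def le_fun_def intro!: sum_mono)
            then consider "tot \<kappa> = j" | "tot \<kappa> < j" by linarith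
            then show ?thesis
            proof cases
              case 1
              obtain \<zeta> where z: "\<kappa> \<in> paths" "\<zeta> \<in> paths" "src \<kappa> = ran \<zeta>" "\<sigma> = cmp \<kappa> \<zeta>"
                using k(2) by (blast elim: preE)
              then have "tot \<zeta> = 0"
                using 1 tj se tot_cmp[of \<kappa> \<zeta>] by simp
              then have "\<kappa> = \<sigma>"
                using z cmp_deg_0 tot_0_iff by metis
              then have "\<sigma> \<in> S"
                using SI[OF k(1) mH(1) g(1)] 1 by simp
              then show ?thesis using False by simp
            next
              case 2
              obtain \<alpha>1 where a1: "\<alpha>1 \<in> paths" "src \<mu> = ran \<alpha>1" "\<kappa> = cmp \<mu> \<alpha>1"
                using k'(1) by (blast elim: preE)
              obtain \<rho>1 where r1: "\<rho>1 \<in> paths" "src g = ran \<rho>1" "\<kappa> = cmp g \<rho>1"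
                using k'(2) by (blast elim: preE)
              obtain \<beta> where b: "\<beta> \<in> paths" "src \<kappa> = ran \<beta>" "\<sigma> = cmp \<kappa> \<beta>"
                using k(2) by (blast elim: preE)
              have s1: "src \<alpha>1 = ran \<beta>" "src \<rho>1 = ran \<beta>"
                using src_cmp[OF p(2) a1(1,2)] src_cmp[OF gp(1) r1(1,2)] a1(3) r1(3) b(2) by simp_all
              have "cmp g \<rho> = cmp g (cmp \<rho>1 \<beta>)"
                using g(4) b(3) r1(3) cmp_assoc[OF gp(1) r1(1) b(1) r1(2) s1(2)] by simp
              then have "\<rho> = cmp \<rho>1 \<beta>"
                by (rule cmp_left_cancel[rotated -1]) (use g gp r1 b s1 in \<open>auto simp: cmp_closed ran_cmp\<close>)
              then have bR: "\<beta> \<in> R"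
                using RT[OF g(2)] b r1 s1 by blast
              have "cmp \<mu> \<alpha> = cmp \<mu> (cmp \<alpha>1 \<beta>)"
                using se b(3) a1(3) cmp_assoc[OF p(2) a1(1) b(1) a1(2) s1(1)] by simp
              then have al: "\<alpha> = cmp \<alpha>1 \<beta>"
                by (rule cmp_left_cancel[rotated -1]) (use a(4,7) p a1 b s1 in \<open>auto simp: cmp_closed ran_cmp\<close>)
              have hH: "cmp \<eta> \<alpha>1 \<in> H"
                using Hc[OF mH(2,1) g(1) a1(1) a(5,6) a1(2)] a1(3) k(1) 2 by simp
              have eq: "cmp \<eta> \<alpha> = cmp (cmp \<eta> \<alpha>1) \<beta>"
                using al a(6) a1 b s1 p by (simp add: cmp_assoc)
              have "src (cmp \<eta> \<alpha>1) = ran \<beta>"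
                using a(6) a1 s1 p by (simp add: src_cmp)
              then show ?thesis
                using subsetD[OF H'(3) GI[OF hH bR]] eq tn tj by simp
            qed
          qed
        qed
      qed
    qed
  qed
  have "core_closed_below (Suc j) H'"
    unfolding core_closed_below_def
    by (intro allI impI) (rule cl)
  moreover have "{\<eta> \<in> E. tot \<eta> < Suc j} \<subseteq> H'"
  proof
    fix \<eta> assume "\<eta> \<in> {\<eta> \<in> E. tot \<eta> < Suc j}"
    then have "\<eta> \<in> E" "tot \<eta> < j \<or> tot \<eta> = j" by auto
    then show "\<eta> \<in> H'" using H(3) unfolding H'_def S_def by blast
  qed
  moreover have "tot \<eta> < Suc j" if "\<eta> \<in> H'" for \<eta>
    using that H(4)[of \<eta>] S(2)[of \<eta>] G(2)[of \<eta>] unfolding H'_def by (elim UnE) simp_all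
  moreover have "finite H'"
    using H(1) fS fG by (simp add: H'_def)
  ultimately show ?case
    using H'(4) by blast
qed

text \<open>A swap preserves degrees, and a minimal common extension has the join of the degrees, so
  the box of degrees at most N is stable. Inside the box every total degree is less than j, where
  closure below j amounts to unconditional closure.\<close>

lemma core_closed_exists:
  assumes fa: "finitely_aligned \<Lambda>" and E: "finite E" "E \<subseteq> paths"
  obtains F where "finite F" "E \<subseteq> F" "core_closed F"
proof -
  define N where "N = (\<lambda>i. \<Sum>\<eta>\<in>E. deg \<eta> i)"
  have N: "deg \<eta> \<le> N" if "\<eta> \<in> E" for \<eta>
    unfolding N_def le_fun_def using E that by (auto intro: member_le_sum)
  define j where "j = Suc (\<Sum>i\<in>UNIV. N i)"
  have j: "tot \<eta> < j" if "deg \<eta> \<le> N" for \<eta>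
    using that by (auto simp: tot_def j_def le_fun_def less_Suc_eq_le intro!: sum_mono)
  from core_closed_step[OF fa E, of j] obtain H
    where H: "finite H" "H \<subseteq> paths" "{\<eta> \<in> E. tot \<eta> < j} \<subseteq> H"
    and Hb: "core_closed_below j H"
    by auto
  have Hc: "cmp \<eta> \<alpha> \<in> H"
    if "\<eta> \<in> H" "\<mu> \<in> H" "\<sigma> \<in> H" "\<alpha> \<in> paths" "deg \<eta> = deg \<mu>" "src \<eta> = src \<mu>"
      "src \<mu> = ran \<alpha>" "cmp \<mu> \<alpha> \<in> MCE \<mu> \<sigma>" "tot (cmp \<mu> \<alpha>) < j" for \<eta> \<mu> \<sigma> \<alpha>
    using Hb that unfolding core_closed_below_def by blast
  let ?F = "{\<eta> \<in> H. deg \<eta> \<le> N}"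
  have "core_closed ?F"
    unfolding core_closed_def
  proof (intro conjI ballI impI)
    show "?F \<subseteq> paths" using H by auto
    fix \<eta> \<mu> \<sigma> \<alpha>
    assume a: "\<eta> \<in> ?F" "\<mu> \<in> ?F" "\<sigma> \<in> ?F" "\<alpha> \<in> paths" "deg \<eta> = deg \<mu> \<and> src \<eta> = src \<mu> \<and> src \<mu> = ran \<alpha> \<and> cmp \<mu> \<alpha> \<in> MCE \<mu> \<sigma>"
    then have p: "\<eta> \<in> paths" "\<mu> \<in> paths" "\<sigma> \<in> paths"
      using H by auto
    have "deg (cmp \<mu> \<alpha>) = sup (deg \<mu>) (deg \<sigma>)"
      using a MCE_iff p by auto
    then have d: "deg (cmp \<mu> \<alpha>) \<le> N"
      using a by simp
    moreover have "deg (cmp \<eta> \<alpha>) = deg (cmp \<mu> \<alpha>)"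
      using a p by (simp add: deg_cmp)
    moreover have "cmp \<eta> \<alpha> \<in> H"
      using Hc[of \<eta> \<mu> \<sigma> \<alpha>] a j[OF d] by blast
    ultimately show "cmp \<eta> \<alpha> \<in> ?F"
      by simp
  qed
  moreover have "E \<subseteq> ?F"
    using H N j by auto
  ultimately show ?thesis
    using that[of ?F] H(1) by simp
qed

end

section \<open>Normed star algebras given by carriers\<close>

text \<open>For 0 < b < a the quotient (a / b) ^ 2 ^ j outgrows every polynomial in 2 ^ j. The
  exponents are powers of two because they arise from repeated squaring.\<close>

lemma power_comparison:
  fixes a b C :: real
  assumes "a \<ge> 0" "b \<ge> 0" and le: "\<And>j. a ^ 2 ^ j \<le> C * (2 ^ j) ^ k * b ^ 2 ^ j"
  shows "a \<le> b"
proof (rule ccontr)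
  assume "\<not> a \<le> b"
  then have ab: "b < a" by simp
  show False
  proof (cases "b = 0")
    case True
    then show False using le[of 0] ab assms(1) by simp
  next
    case False
    with assms have b: "b > 0" by simp
    define q where "q = a / b"
    have q: "q > 1" using ab b by (simp add: q_def)
    have "q ^ 2 ^ j \<le> C * (2 ^ j) ^ k" for j
      using le[of j] b by (simp add: q_def power_divide field_simps)
    then have bound: "1 \<le> C * (real (2 ^ j) ^ k / q ^ 2 ^ j)" for j
      using q by (simp add: field_simps)
    \<comment> \<open>With L = ln q this is the decay of x ^ k / exp x at x = L n, up to the factor
      L ^ k.\<close>
    have "(\<lambda>n. real n ^ k / q ^ n) \<longlonglongrightarrow> 0"
    proof -
      define L where "L = ln q"
      have L: "L > 0" using q by (simp add: L_def)
      have "filterlim (\<lambda>n. L * real n) at_top sequentially"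
        by (rule filterlim_tendsto_pos_mult_at_top[OF tendsto_const L filterlim_real_sequentially])
      then have "(\<lambda>n. (L * real n) ^ k / exp (L * real n)) \<longlonglongrightarrow> 0"
        by (rule filterlim_compose[OF tendsto_power_div_exp_0])
      then have "(\<lambda>n. (L * real n) ^ k / exp (L * real n) / L ^ k) \<longlonglongrightarrow> 0 / L ^ k"
        by (intro tendsto_divide tendsto_const) (use L in auto)
      moreover have "exp (L * real n) = q ^ n" for n
        using q exp_of_nat_mult[of n L] by (simp add: L_def mult.commute)
      ultimately show ?thesis using L by (simp add: power_mult_distrib)
    qed
    moreover have "filterlim (\<lambda>j. 2 ^ j :: nat) sequentially sequentially"
      by (rule filterlim_subseq) (auto intro: strict_monoI)
    ultimately have "(\<lambda>j. C * (real (2 ^ j) ^ k / q ^ 2 ^ j)) \<longlonglongrightarrow> C * 0"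
      by (intro tendsto_mult tendsto_const) (rule filterlim_compose)
    then have "1 \<le> C * 0"
      by (rule tendsto_lowerbound) (use bound in auto)
    then show False by simp
  qed
qed

context normed_star_algebra
begin

lemma smult_in_carrier [simp, intro]: "x \<in> carrier A \<Longrightarrow> c \<odot> x \<in> carrier A"
  by (simp add: smult_closed complex_ring_def)

declare mult_closed [simp, intro] adj_closed [simp, intro]

lemma smult_add_left: "x \<in> carrier A \<Longrightarrow> (a + b) \<odot> x = a \<odot> x \<oplus> b \<odot> x"
  using smult_l_distr[of a b x] by (simp add: complex_ring_def)

lemma smult_add_right: "\<lbrakk>x \<in> carrier A; y \<in> carrier A\<rbrakk> \<Longrightarrow> c \<odot> (x \<oplus> y) = c \<odot> x \<oplus> c \<odot> y"
  using smult_r_distr[of c x y] by (simp add: complex_ring_def)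

lemma smult_smult: "x \<in> carrier A \<Longrightarrow> a \<odot> (b \<odot> x) = (a * b) \<odot> x"
  using smult_assoc1[of a b x] by (simp add: complex_ring_def)

lemma smult_1 [simp]: "x \<in> carrier A \<Longrightarrow> 1 \<odot> x = x"
  using smult_one[of x] by (simp add: complex_ring_def)

lemma smult_0 [simp]: "x \<in> carrier A \<Longrightarrow> 0 \<odot> x = \<zero>"
  using smult_l_null[of x] by (simp add: complex_ring_def)

lemma smult_zero [simp]: "c \<odot> \<zero> = \<zero>"
  using smult_r_null[of c] by (simp add: complex_ring_def)

lemma minus_conv_smult: "x \<in> carrier A \<Longrightarrow> \<ominus> x = (- 1) \<odot> x"
  using smult_l_minus[of 1 x] smult_add_left[of x 1 "- 1"]
  by (metis M.add.inv_comm M.minus_equality add.right_inverse smult_0 smult_1 smult_in_carrier)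

lemma mult_zero_left [simp]: "x \<in> carrier A \<Longrightarrow> \<zero> \<otimes> x = \<zero>"
  using smult_mult_left[of \<zero> x 0] by simp

lemma mult_zero_right [simp]: "x \<in> carrier A \<Longrightarrow> x \<otimes> \<zero> = \<zero>"
  using smult_mult_right[of x \<zero> 0] by simp

lemma adj_zero [simp]: "adj \<zero> = \<zero>"
  using adj_smult[of \<zero> 0] by simp

lemma nrm_zero [simp]: "nrm \<zero> = 0"
  by (simp add: nrm_eq_0_iff)

lemma minus_in_carrier: "\<lbrakk>x \<in> carrier A; y \<in> carrier A\<rbrakk> \<Longrightarrow> x \<ominus> y \<in> carrier A"
  by (rule M.minus_closed)

lemma mult_minus_right: "\<lbrakk>x \<in> carrier A; y \<in> carrier A; z \<in> carrier A\<rbrakk> \<Longrightarrow> x \<otimes> (y \<ominus> z) = x \<otimes> y \<ominus> x \<otimes> z"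
  by (simp add: a_minus_def minus_conv_smult mult_r_distr smult_mult_right)

lemma mult_minus_left: "\<lbrakk>x \<in> carrier A; y \<in> carrier A; z \<in> carrier A\<rbrakk> \<Longrightarrow> (y \<ominus> z) \<otimes> x = y \<otimes> x \<ominus> z \<otimes> x"
  by (simp add: a_minus_def minus_conv_smult mult_l_distr smult_mult_left)

lemma smult_minus: "\<lbrakk>x \<in> carrier A; y \<in> carrier A\<rbrakk> \<Longrightarrow> c \<odot> (x \<ominus> y) = c \<odot> x \<ominus> c \<odot> y"
  by (simp add: a_minus_def minus_conv_smult smult_add_right smult_smult)

lemma adj_minus: "\<lbrakk>x \<in> carrier A; y \<in> carrier A\<rbrakk> \<Longrightarrow> adj (x \<ominus> y) = adj x \<ominus> adj y"
  by (simp add: a_minus_def minus_conv_smult adj_add adj_smult)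

lemma minus_add_cancel: "\<lbrakk>x \<in> carrier A; y \<in> carrier A\<rbrakk> \<Longrightarrow> (x \<ominus> y) \<oplus> y = x"
  by (simp add: a_minus_def M.a_assoc M.l_neg)

lemma add_minus_cancel: "\<lbrakk>x \<in> carrier A; y \<in> carrier A\<rbrakk> \<Longrightarrow> (x \<oplus> y) \<ominus> y = x"
  by (simp add: a_minus_def M.a_assoc M.r_neg)

lemma minus_self [simp]: "x \<in> carrier A \<Longrightarrow> x \<ominus> x = \<zero>"
  by (simp add: a_minus_def M.r_neg)

lemma minus_zero_right [simp]: "x \<in> carrier A \<Longrightarrow> x \<ominus> \<zero> = x"
  by (simp add: minus_conv_smult a_minus_def)

lemma minus_eq_zero_iff: "\<lbrakk>x \<in> carrier A; y \<in> carrier A\<rbrakk> \<Longrightarrow> x \<ominus> y = \<zero> \<longleftrightarrow> x = y"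
  using minus_add_cancel[of x y] by auto

lemma minus_minus_cancel: "\<lbrakk>x \<in> carrier A; y \<in> carrier A\<rbrakk> \<Longrightarrow> x \<ominus> (x \<ominus> y) = y"
  by (simp add: a_minus_def M.minus_add M.r_neg1 M.r_neg2 M.a_assoc[symmetric] M.r_neg)

lemma minus_add_eq: "\<lbrakk>x \<in> carrier A; y \<in> carrier A; z \<in> carrier A\<rbrakk> \<Longrightarrow> x \<ominus> (y \<oplus> z) = x \<ominus> y \<ominus> z"
  by (simp add: a_minus_def M.minus_add M.a_assoc)

lemma minus_minus_eq: "\<lbrakk>x \<in> carrier A; y \<in> carrier A; z \<in> carrier A\<rbrakk> \<Longrightarrow> x \<ominus> (y \<ominus> z) = (x \<ominus> y) \<oplus> z"
  by (simp add: a_minus_def M.minus_add M.a_assoc)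

lemma nrm_uminus: "x \<in> carrier A \<Longrightarrow> nrm (\<ominus> x) = nrm x"
  by (simp add: minus_conv_smult nrm_smult)

lemma nrm_minus_commute: "\<lbrakk>x \<in> carrier A; y \<in> carrier A\<rbrakk> \<Longrightarrow> nrm (x \<ominus> y) = nrm (y \<ominus> x)"
proof -
  assume "x \<in> carrier A" "y \<in> carrier A"
  moreover from this have "\<ominus> (x \<ominus> y) = y \<ominus> x"
    by (simp add: a_minus_def M.minus_add M.a_comm)
  ultimately show ?thesis
    using nrm_uminus[of "x \<ominus> y"] by simp
qed

lemma nrm_le_add_minus: "\<lbrakk>x \<in> carrier A; y \<in> carrier A\<rbrakk> \<Longrightarrow> nrm x \<le> nrm y + nrm (x \<ominus> y)"
  using nrm_add[of "x \<ominus> y" y] minus_add_cancel[of x y] by simp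

lemma nrm_triangle_minus:
  "\<lbrakk>x \<in> carrier A; y \<in> carrier A; z \<in> carrier A\<rbrakk> \<Longrightarrow> nrm (x \<ominus> z) \<le> nrm (x \<ominus> y) + nrm (y \<ominus> z)"
proof -
  assume a: "x \<in> carrier A" "y \<in> carrier A" "z \<in> carrier A"
  then have "x \<ominus> z = (x \<ominus> y) \<oplus> (y \<ominus> z)"
    by (simp add: a_minus_def M.a_assoc M.r_neg1)
  then show ?thesis
    using nrm_add[of "x \<ominus> y" "y \<ominus> z"] a by simp
qed

lemma finsum_mult_left:
  assumes "finite S" "f \<in> S \<rightarrow> carrier A" "z \<in> carrier A"
  shows "z \<otimes> finsum A f S = finsum A (\<lambda>i. z \<otimes> f i) S"
  using assms by (induction S rule: finite_induct) (auto simp: mult_r_distr Pi_def)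

lemma finsum_mult_right:
  assumes "finite S" "f \<in> S \<rightarrow> carrier A" "z \<in> carrier A"
  shows "finsum A f S \<otimes> z = finsum A (\<lambda>i. f i \<otimes> z) S"
  using assms by (induction S rule: finite_induct) (auto simp: mult_l_distr Pi_def)

lemma finsum_adj:
  assumes "finite S" "f \<in> S \<rightarrow> carrier A"
  shows "adj (finsum A f S) = finsum A (\<lambda>i. adj (f i)) S"
  using assms by (induction S rule: finite_induct) (auto simp: adj_add Pi_def)

lemma nrm_finsum:
  assumes "finite S" "f \<in> S \<rightarrow> carrier A"
  shows "nrm (finsum A f S) \<le> (\<Sum>i\<in>S. nrm (f i))"
  using assms
proof (induction S rule: finite_induct)
  case (insert i S)
  then have f: "f i \<in> carrier A" "f \<in> S \<rightarrow> carrier A" by auto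
  have "nrm (finsum A f (insert i S)) \<le> nrm (f i) + nrm (finsum A f S)"
    using insert f nrm_add[of "f i" "finsum A f S"] by simp
  then show ?case
    using insert.IH[OF f(2)] insert.hyps by simp
qed simp

lemma finsum_single:
  assumes "finite S" "i \<in> S" "f i \<in> carrier A" "\<And>j. \<lbrakk>j \<in> S; j \<noteq> i\<rbrakk> \<Longrightarrow> f j = \<zero>"
  shows "finsum A f S = f i"
proof -
  have "finsum A f S = finsum A (\<lambda>j. if i = j then f j else \<zero>) S"
    using assms by (intro M.finsum_cong') (auto simp: Pi_def)
  also have "\<dots> = f i"
    using M.add.finprod_singleton[of i S "\<lambda>_. f i"] assms
    by (simp add: if_distrib Pi_def cong: if_cong)
  finally show ?thesis .
qed

lemma finsum_in:
  assumes "finite S" "\<And>i. i \<in> S \<Longrightarrow> f i \<in> V" "V \<subseteq> carrier A" "\<zero> \<in> V" "\<And>x y. \<lbrakk>x \<in> V; y \<in> V\<rbrakk> \<Longrightarrow> x \<oplus> y \<in> V"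
  shows "finsum A f S \<in> V"
  using assms(1,2)
proof (induction S rule: finite_induct)
  case (insert i S)
  then have "f \<in> S \<rightarrow> carrier A" "f i \<in> carrier A" using assms by auto
  then show ?case using insert assms by simp
qed (simp add: assms)

text \<open>One scalar multiple of a generator is added at a time, so every induction treats a
  single generator and no finite families have to be indexed.\<close>

inductive_set lspan :: "'a set \<Rightarrow> 'a set" for X where
  zero: "\<zero> \<in> lspan X"
| add: "\<lbrakk>x \<in> lspan X; g \<in> X\<rbrakk> \<Longrightarrow> c \<odot> g \<oplus> x \<in> lspan X"

lemma lspan_carrier:
  assumes "X \<subseteq> carrier A" "x \<in> lspan X" shows "x \<in> carrier A"
  using assms(2) by induction (use assms(1) in auto)

lemma lspan_base: "\<lbrakk>X \<subseteq> carrier A; g \<in> X\<rbrakk> \<Longrightarrow> g \<in> lspan X"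
  using lspan.add[OF lspan.zero, of g X 1] by auto

lemma lspan_add:
  assumes X: "X \<subseteq> carrier A" and "x \<in> lspan X" "y \<in> lspan X"
  shows "x \<oplus> y \<in> lspan X"
  using assms(2)
proof induction
  case zero
  then show ?case using assms lspan_carrier by simp
next
  case (add x g c)
  have "c \<odot> g \<oplus> x \<oplus> y = c \<odot> g \<oplus> (x \<oplus> y)"
    using add X assms(3) lspan_carrier[OF X] by (auto simp: M.a_assoc)
  then show ?case
    using add lspan.add by metis
qed

lemma lspan_smult:
  assumes X: "X \<subseteq> carrier A" and "x \<in> lspan X"
  shows "c \<odot> x \<in> lspan X"
  using assms(2)
proof induction
  case zero
  then show ?case by (simp add: lspan.zero)
next
  case (add x g d)
  have "c \<odot> (d \<odot> g \<oplus> x) = (c * d) \<odot> g \<oplus> c \<odot> x"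
    using add X lspan_carrier[OF X] by (auto simp: smult_add_right smult_smult)
  then show ?case
    using add lspan.add by metis
qed

lemma lspan_minus:
  assumes X: "X \<subseteq> carrier A" and "x \<in> lspan X" "y \<in> lspan X"
  shows "x \<ominus> y \<in> lspan X"
  unfolding a_minus_def
  using lspan_add[OF X assms(2) lspan_smult[OF X assms(3), of "- 1"]] lspan_carrier[OF X assms(3)]
  by (simp add: minus_conv_smult)

lemma lspan_map:
  assumes X: "X \<subseteq> carrier A" and Y: "Y \<subseteq> carrier A"
    and f: "\<And>g. g \<in> X \<Longrightarrow> f g \<in> lspan Y" "f \<zero> = \<zero>"
    and f_add: "\<And>x y. \<lbrakk>x \<in> carrier A; y \<in> carrier A\<rbrakk> \<Longrightarrow> f (x \<oplus> y) = f x \<oplus> f y"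
    and f_smult: "\<And>c x. x \<in> carrier A \<Longrightarrow> f (c \<odot> x) = d c \<odot> f x"
    and x: "x \<in> lspan X"
  shows "f x \<in> lspan Y"
  using x
proof induction
  case zero
  then show ?case by (simp add: f lspan.zero)
next
  case (add x g c)
  have "f (c \<odot> g \<oplus> x) = d c \<odot> f g \<oplus> f x"
    using add X lspan_carrier[OF X] by (auto simp: f_add f_smult)
  then show ?case
    using add f(1) lspan_add[OF Y] lspan_smult[OF Y] by simp
qed

lemma lspan_lspan:
  assumes "X \<subseteq> carrier A" "Y \<subseteq> carrier A" "X \<subseteq> lspan Y" "x \<in> lspan X"
  shows "x \<in> lspan Y"
  using lspan_map[of X Y "\<lambda>x. x" "\<lambda>c. c"] assms by auto

lemma lspan_mono:
  assumes "X \<subseteq> Y" "x \<in> lspan X" shows "x \<in> lspan Y"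
  using assms(2) by induction (use assms(1) in \<open>auto intro: lspan.intros\<close>)

text \<open>Bilinearity is used one argument at a time: \<open>lspan_map\<close> is applied to right
  multiplication by y and, for each generator g, to left multiplication by g.\<close>

lemma lspan_mult:
  assumes X: "X \<subseteq> carrier A" and Y: "Y \<subseteq> carrier A" and Z: "Z \<subseteq> carrier A"
    and XY: "\<And>g h. \<lbrakk>g \<in> X; h \<in> Y\<rbrakk> \<Longrightarrow> g \<otimes> h \<in> lspan Z"
    and x: "x \<in> lspan X" and y: "y \<in> lspan Y"
  shows "x \<otimes> y \<in> lspan Z"
proof (rule lspan_map[OF X Z _ _ _ _ x, where d = "\<lambda>c. c"])
  have yc: "y \<in> carrier A" using lspan_carrier[OF Y y] .
  show "\<zero> \<otimes> y = \<zero>" using yc by simp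
  show "\<And>u v. \<lbrakk>u \<in> carrier A; v \<in> carrier A\<rbrakk> \<Longrightarrow> (u \<oplus> v) \<otimes> y = u \<otimes> y \<oplus> v \<otimes> y"
    using yc by (simp add: mult_l_distr)
  show "\<And>c u. u \<in> carrier A \<Longrightarrow> (c \<odot> u) \<otimes> y = c \<odot> (u \<otimes> y)"
    using yc by (simp add: smult_mult_left)
  fix g assume g: "g \<in> X"
  show "g \<otimes> y \<in> lspan Z"
  proof (rule lspan_map[OF Y Z _ _ _ _ y, where d = "\<lambda>c. c" and f = "\<lambda>u. g \<otimes> u"])
    have gc: "g \<in> carrier A" using g X by auto
    show "g \<otimes> \<zero> = \<zero>" using gc by simp
    show "\<And>u v. \<lbrakk>u \<in> carrier A; v \<in> carrier A\<rbrakk> \<Longrightarrow> g \<otimes> (u \<oplus> v) = g \<otimes> u \<oplus> g \<otimes> v"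
      using gc by (simp add: mult_r_distr)
    show "\<And>c u. u \<in> carrier A \<Longrightarrow> g \<otimes> (c \<odot> u) = c \<odot> (g \<otimes> u)"
      using gc by (simp add: smult_mult_right)
  qed (use XY g in auto)
qed

lemma lspan_adj:
  assumes X: "X \<subseteq> carrier A" and Y: "Y \<subseteq> carrier A" and XY: "\<And>g. g \<in> X \<Longrightarrow> adj g \<in> lspan Y" and x: "x \<in> lspan X"
  shows "adj x \<in> lspan Y"
  by (rule lspan_map[OF X Y _ _ _ _ x, where d = cnj]) (auto simp: XY adj_add adj_smult)

lemma lspan_finite:
  assumes "x \<in> lspan X"
  shows "\<exists>Y. finite Y \<and> Y \<subseteq> X \<and> x \<in> lspan Y"
  using assms
proof induction
  case zero
  then show ?case by (intro exI[of _ "{}"]) (auto intro: lspan.zero)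
next
  case (add x g c)
  then obtain Y where Y: "finite Y" "Y \<subseteq> X" "x \<in> lspan Y" by blast
  have "c \<odot> g \<oplus> x \<in> lspan (insert g Y)"
    using lspan_mono[OF _ Y(3), of "insert g Y"] by (auto intro: lspan.add)
  then show ?case
    using Y add by (intro exI[of _ "insert g Y"]) auto
qed

lemma lspan_finsum:
  assumes P: "finite P" and f: "f \<in> P \<rightarrow> carrier A" and x: "x \<in> lspan (f ` P)"
  shows "\<exists>d. x = finsum A (\<lambda>p. d p \<odot> f p) P"
  using x
proof induction
  case zero
  have "finsum A (\<lambda>p. 0 \<odot> f p) P = finsum A (\<lambda>p. \<zero>) P"
    using f by (intro M.finsum_cong') (auto simp: Pi_def)
  then show ?case by (intro exI[of _ "\<lambda>_. 0"]) simp
next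
  case (add x g c)
  then obtain d q where d: "x = finsum A (\<lambda>p. d p \<odot> f p) P" and q: "q \<in> P" "g = f q" by auto
  have "finsum A (\<lambda>p. (if p = q then c else 0) \<odot> f p) P = c \<odot> g"
    using finsum_single[OF P q(1), of "\<lambda>p. (if p = q then c else 0) \<odot> f p"] f q by (auto simp: Pi_def)
  then have "c \<odot> g \<oplus> x = finsum A (\<lambda>p. (if p = q then c else 0) \<odot> f p) P \<oplus> finsum A (\<lambda>p. d p \<odot> f p) P"
    using d by simp
  also have "\<dots> = finsum A (\<lambda>p. (if p = q then c else 0) \<odot> f p \<oplus> d p \<odot> f p) P"
    using f by (intro M.finsum_addf[symmetric]) (auto simp: Pi_def)
  also have "\<dots> = finsum A (\<lambda>p. ((if p = q then c else 0) + d p) \<odot> f p) P"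
    using f by (intro M.finsum_cong') (auto simp: Pi_def smult_add_left)
  finally show ?case by (intro exI)
qed

text \<open>This is x to the power 2 ^ j. For self-adjoint x the C*-identity evaluates its norm
  exactly as a power of the norm of x.\<close>

primrec isq :: "nat \<Rightarrow> 'a \<Rightarrow> 'a" where
  "isq 0 x = x"
| "isq (Suc j) x = isq j x \<otimes> isq j x"

lemma isq_carrier [simp]: "x \<in> carrier A \<Longrightarrow> isq j x \<in> carrier A"
  by (induction j) auto

section \<open>Norm closures\<close>

lemma norm_closed_iff:
  "norm_closed A S \<longleftrightarrow> S \<subseteq> carrier A \<and> (\<forall>x\<in>carrier A. (\<forall>e>0. \<exists>y\<in>S. nrm (x \<ominus> y) < e) \<longrightarrow> x \<in> S)"
proof -
  interpret Metric_space "carrier A" "cdist A" by (rule Metric_space_cdist)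
  have "norm_closed A S \<longleftrightarrow> S \<subseteq> carrier A \<and> (\<forall>x. x \<in> carrier A - S \<longrightarrow> (\<exists>r>0. disjnt S (mball x r)))"
    unfolding norm_closed_def by (rule closedin_metric)
  also have "\<dots> \<longleftrightarrow> S \<subseteq> carrier A \<and> (\<forall>x\<in>carrier A. (\<forall>e>0. \<exists>y\<in>S. nrm (x \<ominus> y) < e) \<longrightarrow> x \<in> S)"
  proof (intro conj_cong refl)
    assume S: "S \<subseteq> carrier A"
    have "disjnt S (mball x r) \<longleftrightarrow> \<not> (\<exists>y\<in>S. nrm (x \<ominus> y) < r)" if "x \<in> carrier A" for x r
      using S that by (auto simp: disjnt_iff in_mball cdist_def)
    then show "(\<forall>x. x \<in> carrier A - S \<longrightarrow> (\<exists>r>0. disjnt S (mball x r))) \<longleftrightarrow>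
        (\<forall>x\<in>carrier A. (\<forall>e>0. \<exists>y\<in>S. nrm (x \<ominus> y) < e) \<longrightarrow> x \<in> S)"
      by (metis DiffD1 DiffD2 DiffI)
  qed
  finally show ?thesis .
qed

definition nclosure :: "'a set \<Rightarrow> 'a set" where
  "nclosure S = {x \<in> carrier A. \<forall>e>0. \<exists>y\<in>S. nrm (x \<ominus> y) < e}"

lemma nclosureE:
  assumes "x \<in> nclosure S" "e > 0"
  obtains y where "y \<in> S" "nrm (x \<ominus> y) < e"
  using assms unfolding nclosure_def by blast

lemma nclosure_subset: "S \<subseteq> carrier A \<Longrightarrow> S \<subseteq> nclosure S"
  by (force simp: nclosure_def)

lemma norm_closed_nclosure:
  assumes S: "S \<subseteq> carrier A" shows "norm_closed A (nclosure S)"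
  unfolding norm_closed_iff
proof (intro conjI ballI impI)
  show "nclosure S \<subseteq> carrier A" by (auto simp: nclosure_def)
  fix x assume x: "x \<in> carrier A" and a: "\<forall>e>0. \<exists>y\<in>nclosure S. nrm (x \<ominus> y) < e"
  show "x \<in> nclosure S"
    unfolding nclosure_def
  proof (intro CollectI conjI allI impI x)
    fix e :: real assume e: "e > 0"
    obtain y where y: "y \<in> nclosure S" "nrm (x \<ominus> y) < e / 2"
      using a e by (meson half_gt_zero)
    obtain z where z: "z \<in> S" "nrm (y \<ominus> z) < e / 2"
      using nclosureE[OF y(1), of "e / 2"] e by auto
    have "nrm (x \<ominus> z) \<le> nrm (x \<ominus> y) + nrm (y \<ominus> z)"
      using x y z S by (intro nrm_triangle_minus) (auto simp: nclosure_def)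
    then show "\<exists>y\<in>S. nrm (x \<ominus> y) < e"
      using y z by (intro bexI[of _ z]) auto
  qed
qed

text \<open>The Lipschitz estimate is asked for between x and the points of S, as multiplication by
  a fixed element and the adjoint provide it.\<close>

lemma nclosure_map:
  assumes "x \<in> nclosure S" "S \<subseteq> carrier A" "f x \<in> carrier A"
    and "\<And>y. y \<in> S \<Longrightarrow> f y \<in> T" "\<And>y. y \<in> S \<Longrightarrow> nrm (f x \<ominus> f y) \<le> K * nrm (x \<ominus> y)"
  shows "f x \<in> nclosure T"
  unfolding nclosure_def
proof (intro CollectI conjI allI impI)
  fix e :: real assume "e > 0"
  \<comment> \<open>The summand 1 keeps the divisor positive when K is zero.\<close>
  then have "e / (\<bar>K\<bar> + 1) > 0" by (simp add: add_nonneg_pos)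
  then obtain y where y: "y \<in> S" "nrm (x \<ominus> y) < e / (\<bar>K\<bar> + 1)"
    using assms(1) unfolding nclosure_def by blast
  have n: "nrm (x \<ominus> y) \<ge> 0"
    using assms y by (intro nrm_nonneg) (auto simp: nclosure_def)
  have "nrm (f x \<ominus> f y) \<le> K * nrm (x \<ominus> y)" using assms y by simp
  also have "\<dots> \<le> (\<bar>K\<bar> + 1) * nrm (x \<ominus> y)" using n by (intro mult_right_mono) auto
  also have "\<dots> < e" using y by (simp add: field_simps add_nonneg_pos)
  finally show "\<exists>z\<in>T. nrm (f x \<ominus> z) < e"
    using assms(4) y by blast
qed (use assms in auto)

lemma nclosure_add:
  assumes S: "S \<subseteq> carrier A" "\<And>x y. \<lbrakk>x \<in> S; y \<in> S\<rbrakk> \<Longrightarrow> x \<oplus> y \<in> S" and xy: "x \<in> nclosure S" "y \<in> nclosure S"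
  shows "x \<oplus> y \<in> nclosure S"
  unfolding nclosure_def
proof (intro CollectI conjI allI impI)
  have c: "x \<in> carrier A" "y \<in> carrier A" using xy by (auto simp: nclosure_def)
  then show "x \<oplus> y \<in> carrier A" by simp
  fix e :: real assume "e > 0"
  then have e: "e / 2 > 0" by simp
  obtain x' where "x' \<in> S" "nrm (x \<ominus> x') < e / 2"
    using nclosureE[OF xy(1) e] .
  moreover obtain y' where "y' \<in> S" "nrm (y \<ominus> y') < e / 2"
    using nclosureE[OF xy(2) e] .
  ultimately have p: "x' \<in> S" "nrm (x \<ominus> x') < e / 2" "y' \<in> S" "nrm (y \<ominus> y') < e / 2"
    by auto
  have c': "x' \<in> carrier A" "y' \<in> carrier A" using p S by auto
  have "(x \<oplus> y) \<ominus> (x' \<oplus> y') = (x \<ominus> x') \<oplus> (y \<ominus> y')"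
    using c c' by (simp add: a_minus_def M.minus_add M.a_ac)
  then have "nrm ((x \<oplus> y) \<ominus> (x' \<oplus> y')) \<le> nrm (x \<ominus> x') + nrm (y \<ominus> y')"
    using nrm_add[of "x \<ominus> x'" "y \<ominus> y'"] c c' by simp
  then show "\<exists>z\<in>S. nrm (x \<oplus> y \<ominus> z) < e"
    using p S(2) by (intro bexI[of _ "x' \<oplus> y'"]) auto
qed

lemma nclosure_submodule:
  assumes S: "S \<subseteq> carrier A" "\<zero> \<in> S" "\<And>x y. \<lbrakk>x \<in> S; y \<in> S\<rbrakk> \<Longrightarrow> x \<oplus> y \<in> S" "\<And>c x. x \<in> S \<Longrightarrow> c \<odot> x \<in> S"
  shows "submodule (nclosure S) complex_ring A"
proof (rule submoduleI)
  have sm: "c \<odot> x \<in> nclosure S" if x: "x \<in> nclosure S" for c x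
  proof (rule nclosure_map[OF x S(1), where K = "cmod c"])
    have xc: "x \<in> carrier A" using x by (auto simp: nclosure_def)
    then show "c \<odot> x \<in> carrier A" by simp
    fix y assume "y \<in> S"
    with xc S show "c \<odot> y \<in> S" "nrm (c \<odot> x \<ominus> c \<odot> y) \<le> cmod c * nrm (x \<ominus> y)"
      by (auto simp: smult_minus[symmetric] nrm_smult subset_iff)
  qed
  show "nclosure S \<subseteq> carrier A" by (auto simp: nclosure_def)
  show "\<zero> \<in> nclosure S" using nclosure_subset S by auto
  show "\<ominus> x \<in> nclosure S" if "x \<in> nclosure S" for x
    using sm[OF that, of "- 1"] that by (simp add: minus_conv_smult nclosure_def)
  show "x \<oplus> y \<in> nclosure S" if "x \<in> nclosure S" "y \<in> nclosure S" for x y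
    using nclosure_add S that by blast
  show "c \<odot> x \<in> nclosure S" if "c \<in> carrier complex_ring" "x \<in> nclosure S" for c x
    using sm that by blast
qed

section \<open>Closed ideals and the distance from them\<close>

lemma cstar_idealD:
  assumes "cstar_ideal A I"
  shows "I \<subseteq> carrier A" "\<zero> \<in> I" "\<And>x y. \<lbrakk>x \<in> I; y \<in> I\<rbrakk> \<Longrightarrow> x \<oplus> y \<in> I" "\<And>x y. \<lbrakk>x \<in> I; y \<in> I\<rbrakk> \<Longrightarrow> x \<ominus> y \<in> I"
    "\<And>c x. x \<in> I \<Longrightarrow> c \<odot> x \<in> I" "\<And>a x. \<lbrakk>a \<in> carrier A; x \<in> I\<rbrakk> \<Longrightarrow> a \<otimes> x \<in> I" "\<And>a x. \<lbrakk>a \<in> carrier A; x \<in> I\<rbrakk> \<Longrightarrow> x \<otimes> a \<in> I"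
    "norm_closed A I"
proof -
  have sub: "submodule I complex_ring A" using assms by (simp add: cstar_ideal_def)
  note E = submoduleE[OF sub]
  show "I \<subseteq> carrier A" "\<And>x y. \<lbrakk>x \<in> I; y \<in> I\<rbrakk> \<Longrightarrow> x \<oplus> y \<in> I" by (rule E(1), rule E(5))
  show sm: "\<And>c x. x \<in> I \<Longrightarrow> c \<odot> x \<in> I" using E(4) by (simp add: complex_ring_def)
  show "\<And>x y. \<lbrakk>x \<in> I; y \<in> I\<rbrakk> \<Longrightarrow> x \<ominus> y \<in> I" unfolding a_minus_def using E(3,5) by auto
  obtain x where "x \<in> I" using E(2) by auto
  then show "\<zero> \<in> I" using sm[of x 0] E(1) by auto
qed (use assms in \<open>auto simp: cstar_ideal_def\<close>)

text \<open>A witness within distance D replaces a bound on the quotient norm modulo I, so that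
  estimates in the quotient are carried out without forming it.\<close>

definition near :: "'a set \<Rightarrow> 'a \<Rightarrow> real \<Rightarrow> bool" where
  "near I x D \<longleftrightarrow> (\<exists>y\<in>I. nrm (x \<ominus> y) \<le> D)"

lemma near_nonneg: "\<lbrakk>cstar_ideal A I; x \<in> carrier A; near I x D\<rbrakk> \<Longrightarrow> 0 \<le> D"
  unfolding near_def using cstar_idealD(1) nrm_nonneg minus_in_carrier by (meson order_trans subsetD)

text \<open>The product of the two differences equals \<open>x \<otimes> x'\<close> minus an element
  of I, as in the proof that a quotient norm is submultiplicative.\<close>

lemma near_mult:
  assumes I: "cstar_ideal A I" and x: "x \<in> carrier A" "x' \<in> carrier A" and n: "near I x D" "near I x' D'"
  shows "near I (x \<otimes> x') (D * D')"
proof -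
  obtain y y' where y: "y \<in> I" "nrm (x \<ominus> y) \<le> D" "y' \<in> I" "nrm (x' \<ominus> y') \<le> D'"
    using n by (auto simp: near_def)
  have c: "y \<in> carrier A" "y' \<in> carrier A" using y cstar_idealD(1)[OF I] by auto
  have "(x \<ominus> y) \<otimes> (x' \<ominus> y') = (x \<otimes> x' \<ominus> x \<otimes> y') \<ominus> y \<otimes> (x' \<ominus> y')"
    using x c by (simp add: mult_minus_left mult_minus_right[of x])
  also have "\<dots> = x \<otimes> x' \<ominus> (x \<otimes> y' \<oplus> y \<otimes> (x' \<ominus> y'))"
    using x c by (simp add: minus_add_eq)
  finally have "nrm (x \<otimes> x' \<ominus> (x \<otimes> y' \<oplus> y \<otimes> (x' \<ominus> y'))) \<le> nrm (x \<ominus> y) * nrm (x' \<ominus> y')"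
    using nrm_mult[of "x \<ominus> y" "x' \<ominus> y'"] x c by simp
  also have "\<dots> \<le> D * D'"
    using y x c nrm_nonneg[of "x \<ominus> y"] nrm_nonneg[of "x' \<ominus> y'"] by (intro mult_mono) auto
  finally show ?thesis
    unfolding near_def using x c y cstar_idealD[OF I] by (intro bexI[of _ "x \<otimes> y' \<oplus> y \<otimes> (x' \<ominus> y')"]) auto
qed

lemma near_self: "\<lbrakk>cstar_ideal A I; x \<in> carrier A\<rbrakk> \<Longrightarrow> near I x (nrm x)"
  unfolding near_def using cstar_idealD(2) by (intro bexI[of _ \<zero>]) auto

lemma near_le: "\<lbrakk>near I x D; D \<le> D'\<rbrakk> \<Longrightarrow> near I x D'"
  unfolding near_def by force

lemma near_mult_left:
  "\<lbrakk>cstar_ideal A I; x \<in> carrier A; z \<in> carrier A; near I x D\<rbrakk> \<Longrightarrow> near I (z \<otimes> x) (nrm z * D)"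
  by (intro near_mult near_self)

lemma near_compress:
  assumes I: "cstar_ideal A I" and x: "x \<in> carrier A" and p: "p \<in> carrier A" "nrm p \<le> 1" "q \<in> carrier A" "nrm q \<le> 1"
    and n: "near I x D"
  shows "near I (p \<otimes> x \<otimes> q) D"
proof -
  have D: "D \<ge> 0" using near_nonneg[OF I x n] .
  have "near I (p \<otimes> x) (1 * D)"
    by (rule near_mult[OF I p(1) x near_le[OF near_self[OF I p(1)] p(2)] n])
  then have "near I (p \<otimes> x \<otimes> q) ((1 * D) * 1)"
    using near_mult[OF I _ p(3) _ near_le[OF near_self[OF I p(3)] p(4)]] x p by simp
  then show ?thesis by simp
qed

lemma near_isq:
  assumes I: "cstar_ideal A I" and x: "x \<in> carrier A" and n: "near I x D"
  shows "near I (isq j x) (D ^ 2 ^ j)"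
proof (induction j)
  case (Suc j)
  have "near I (isq j x \<otimes> isq j x) (D ^ 2 ^ j * D ^ 2 ^ j)"
    using Suc x by (intro near_mult[OF I]) auto
  then show ?case by (simp add: power_add[symmetric] mult_2)
qed (use n in simp)

text \<open>I is closed, so x has a positive distance \<delta> from it; dividing a witness for
  \<open>c \<odot> x\<close> by c gives one for x. For c = 0 the claim is just
  \<open>0 \<le> D\<close>.\<close>

lemma near_scalar:
  assumes I: "cstar_ideal A I" and x: "x \<in> carrier A" "x \<notin> I"
  obtains \<delta> where "\<delta> > 0" "\<And>c D. near I (c \<odot> x) D \<Longrightarrow> cmod c * \<delta> \<le> D"
proof -
  obtain \<delta> where d: "\<delta> > 0" "\<And>y. y \<in> I \<Longrightarrow> \<delta> \<le> nrm (x \<ominus> y)"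
    using cstar_idealD(8)[OF I] x unfolding norm_closed_iff by (meson not_le)
  have "cmod c * \<delta> \<le> D" if n: "near I (c \<odot> x) D" for c D
  proof (cases "c = 0")
    case True
    then show ?thesis using near_nonneg[OF I _ n] x by simp
  next
    case False
    obtain y where y: "y \<in> I" "nrm (c \<odot> x \<ominus> y) \<le> D" using n by (auto simp: near_def)
    have yc: "y \<in> carrier A" using y cstar_idealD(1)[OF I] by auto
    have "c \<odot> x \<ominus> y = c \<odot> (x \<ominus> (1 / c) \<odot> y)"
      using False x yc by (simp add: smult_minus smult_smult)
    then have "nrm (c \<odot> x \<ominus> y) = cmod c * nrm (x \<ominus> (1 / c) \<odot> y)"
      using x yc by (simp add: nrm_smult)
    moreover have "\<delta> \<le> nrm (x \<ominus> (1 / c) \<odot> y)"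
      using d(2) cstar_idealD(5)[OF I y(1)] by blast
    ultimately show ?thesis
      using y(2) mult_left_mono[of \<delta> "nrm (x \<ominus> (1 / c) \<odot> y)" "cmod c"] by simp
  qed
  then show ?thesis using that d by blast
qed

end

context cstar_algebra
begin

lemma nrm_isq:
  assumes "x \<in> carrier A" "adj x = x"
  shows "nrm (isq j x) = (nrm x) ^ 2 ^ j" and "adj (isq j x) = isq j x"
proof (induction j)
  case (Suc j)
  { case 1 show ?case using Suc cstar_identity[of "isq j x"] assms(1) by (simp flip: power_mult add: mult.commute) }
  { case 2 show ?case using Suc assms(1) by (simp add: adj_mult) }
qed (use assms in auto)

lemma nrm_projection:
  assumes p: "p \<in> carrier A" "adj p = p" "p \<otimes> p = p"
  shows "nrm p \<le> 1"
proof -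
  have "(nrm p)\<^sup>2 = nrm p" using cstar_identity[of p] p by simp
  then show ?thesis by (auto simp: power2_eq_square)
qed

lemma finsum_projection:
  assumes S: "finite S" and p: "\<And>i. i \<in> S \<Longrightarrow> p i \<in> carrier A \<and> adj (p i) = p i \<and> p i \<otimes> p i = p i"
    and orth: "\<And>i j. \<lbrakk>i \<in> S; j \<in> S; i \<noteq> j\<rbrakk> \<Longrightarrow> p i \<otimes> p j = \<zero>"
  shows "adj (finsum A p S) = finsum A p S" "finsum A p S \<otimes> finsum A p S = finsum A p S"
proof -
  have pc: "p \<in> S \<rightarrow> carrier A" using p by auto
  have "adj (finsum A p S) = finsum A (\<lambda>i. adj (p i)) S" using finsum_adj[OF S pc] .
  also have "\<dots> = finsum A p S" using p by (intro M.finsum_cong') auto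
  finally show "adj (finsum A p S) = finsum A p S" .
  have "finsum A p S \<otimes> p i = p i" if i: "i \<in> S" for i
  proof -
    have "finsum A p S \<otimes> p i = finsum A (\<lambda>j. p j \<otimes> p i) S" using finsum_mult_right[OF S pc] p i by auto
    also have "\<dots> = p i \<otimes> p i" using i p orth by (intro finsum_single[OF S]) auto
    finally show ?thesis using p i by simp
  qed
  moreover have "finsum A p S \<otimes> finsum A p S = finsum A (\<lambda>i. finsum A p S \<otimes> p i) S"
    using finsum_mult_left[OF S pc] pc by simp
  ultimately show "finsum A p S \<otimes> finsum A p S = finsum A p S"
    using pc by (simp cong: M.finsum_cong' add: Pi_def)
qed

end

section \<open>Cuntz-Krieger families\<close>

locale kgraph_ck_family = k_graph \<Lambda> + ck_family \<Lambda> A t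
  for \<Lambda> :: "('p, 'k::finite) kgraph" and A :: "'a cstar" (structure) and t :: "'p \<Rightarrow> 'a" +
  assumes fa: "finitely_aligned \<Lambda>"
begin

lemma t_carrier [simp, intro]: "\<eta> \<in> paths \<Longrightarrow> t \<eta> \<in> carrier A"
  by (rule in_carrier)

definition sp :: "'p \<Rightarrow> 'p \<Rightarrow> 'a" where
  "sp \<mu> \<nu> = t \<mu> \<otimes> adj (t \<nu>)"

lemma sp_carrier [simp, intro]: "\<lbrakk>\<mu> \<in> paths; \<nu> \<in> paths\<rbrakk> \<Longrightarrow> sp \<mu> \<nu> \<in> carrier A"
  by (simp add: sp_def)

lemma adj_sp: "\<lbrakk>\<mu> \<in> paths; \<nu> \<in> paths\<rbrakk> \<Longrightarrow> adj (sp \<mu> \<nu>) = sp \<nu> \<mu>"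
  by (simp add: sp_def adj_mult adj_adj)

lemma t_mult_src: "\<mu> \<in> paths \<Longrightarrow> t \<mu> \<otimes> t (src \<mu>) = t \<mu>"
  using CK2[of \<mu> "src \<mu>"] by (simp add: src_closed ran_src cmp_src_right)

lemma ran_mult_t: "\<mu> \<in> paths \<Longrightarrow> t (ran \<mu>) \<otimes> t \<mu> = t \<mu>"
  using CK2[of "ran \<mu>" \<mu>] by (simp add: ran_closed src_ran cmp_ran_left)

lemma t_vertex:
  assumes "v \<in> vertices" shows "adj (t v) = t v" "t v \<otimes> t v = t v"
  using CK1_projection[OF assms] by auto

text \<open>A minimal common extension of \<mu> with itself adds a path of degree zero, so the sum
  in \<open>CK3\<close> has the single term at \<open>src \<mu>\<close>.\<close>

lemma adj_t_mult_t_self: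
  assumes "\<mu> \<in> paths" shows "adj (t \<mu>) \<otimes> t \<mu> = t (src \<mu>)"
proof -
  let ?u = "src \<mu>"
  have u: "?u \<in> vertices" "?u \<in> paths" "ran ?u = ?u" using assms by (auto simp: src_vertex src_closed ran_src)
  have "{(\<alpha>, \<beta>). \<alpha> \<in> paths_to ?u \<and> \<beta> \<in> paths_to ?u \<and> cmp \<mu> \<alpha> = cmp \<mu> \<beta> \<and> cmp \<mu> \<alpha> \<in> MCE \<mu> \<mu>}
      = {(?u, ?u)}" (is "?S = _")
  proof (intro equalityI subsetI)
    fix x assume "x \<in> ?S"
    moreover obtain \<alpha> \<beta> where xe: "x = (\<alpha>, \<beta>)" by (cases x)
    ultimately have "(\<alpha>, \<beta>) \<in> ?S" by (simp only:)
    then have x: "\<alpha> \<in> paths" "ran \<alpha> = ?u" "\<beta> \<in> paths" "ran \<beta> = ?u"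
      "cmp \<mu> \<alpha> = cmp \<mu> \<beta>" "cmp \<mu> \<alpha> \<in> MCE \<mu> \<mu>"
      unfolding mem_Collect_eq prod.case paths_to_iff by - (elim conjE, assumption)+
    have "\<beta> = \<alpha>" using cmp_left_cancel[OF assms x(3,1) x(4,2)[symmetric] x(5)[symmetric]] .
    moreover have "deg \<alpha> = 0"
      using x(6) MCE_iff[OF assms assms] deg_cmp[of \<mu> \<alpha>] x assms by simp
    then have "\<alpha> = ?u" using deg_0_src[of \<alpha>] x by simp
    ultimately show "x \<in> {(?u, ?u)}" using xe by simp
  next
    fix x assume "x \<in> {(?u, ?u)}"
    then show "x \<in> ?S"
      using u assms MCE_iff[OF assms assms, of \<mu>] by (simp add: paths_to_iff cmp_src_right pre_refl)
  qed
  then show ?thesis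
    using CK3[OF assms assms] u t_vertex[OF u(1)] by simp
qed

lemma adj_t_mult_t_0:
  assumes "\<mu> \<in> paths" "\<nu> \<in> paths" "\<not> meets \<mu> \<nu>" shows "adj (t \<mu>) \<otimes> t \<nu> = \<zero>"
proof -
  have "MCE \<mu> \<nu> = {}" using assms MCE_empty_iff by blast
  then show ?thesis using CK3[OF assms(1,2)] by simp
qed

lemma adj_t_mult_t_cmp:
  assumes "\<mu> \<in> paths" "\<kappa> \<in> paths" "src \<mu> = ran \<kappa>" shows "adj (t \<mu>) \<otimes> t (cmp \<mu> \<kappa>) = t \<kappa>"
proof -
  have "adj (t \<mu>) \<otimes> t (cmp \<mu> \<kappa>) = (adj (t \<mu>) \<otimes> t \<mu>) \<otimes> t \<kappa>"
    using assms by (simp add: CK2[symmetric] mult_assoc)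
  then show ?thesis using assms adj_t_mult_t_self ran_mult_t by simp
qed

lemma sp_mult_t_cmp:
  assumes "\<mu> \<in> paths" "\<nu> \<in> paths" "src \<mu> = src \<nu>" "\<kappa> \<in> paths" "src \<nu> = ran \<kappa>"
  shows "sp \<mu> \<nu> \<otimes> t (cmp \<nu> \<kappa>) = t (cmp \<mu> \<kappa>)"
  unfolding sp_def using assms adj_t_mult_t_cmp[of \<nu> \<kappa>] CK2[of \<mu> \<kappa>] by (simp add: mult_assoc cmp_closed)

lemma sp_mult_t_0:
  assumes "\<mu> \<in> paths" "\<nu> \<in> paths" "\<eta> \<in> paths" "\<not> meets \<nu> \<eta>"
  shows "sp \<mu> \<nu> \<otimes> t \<eta> = \<zero>"
  unfolding sp_def using assms adj_t_mult_t_0[of \<nu> \<eta>] by (simp add: mult_assoc)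

text \<open>\<open>CK3\<close> expands the middle factor
  \<open>adj (t \<nu>) \<otimes> t \<sigma>\<close>. The target span is left arbitrary because the
  same expansion serves range projections, the core and the grading.\<close>

lemma sp_mult_sp:
  assumes p: "\<mu> \<in> paths" "\<nu> \<in> paths" "\<sigma> \<in> paths" "\<tau> \<in> paths"
    and s: "src \<mu> = src \<nu>" "src \<sigma> = src \<tau>"
    and X: "X \<subseteq> carrier A"
    and XI: "\<And>\<alpha> \<beta>. \<lbrakk>\<alpha> \<in> paths; \<beta> \<in> paths; src \<nu> = ran \<alpha>; src \<sigma> = ran \<beta>;
      cmp \<nu> \<alpha> = cmp \<sigma> \<beta>; cmp \<nu> \<alpha> \<in> MCE \<nu> \<sigma>\<rbrakk> \<Longrightarrow> sp (cmp \<mu> \<alpha>) (cmp \<tau> \<beta>) \<in> lspan X"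
  shows "sp \<mu> \<nu> \<otimes> sp \<sigma> \<tau> \<in> lspan X"
proof -
  let ?S = "{(\<alpha>, \<beta>). \<alpha> \<in> paths_to (src \<nu>) \<and> \<beta> \<in> paths_to (src \<sigma>) \<and>
               cmp \<nu> \<alpha> = cmp \<sigma> \<beta> \<and> cmp \<nu> \<alpha> \<in> MCE \<nu> \<sigma>}"
  let ?f = "\<lambda>(\<alpha>, \<beta>). t \<alpha> \<otimes> adj (t \<beta>)"
  have fin: "finite ?S" by (rule finite_CK3_index[OF fa p(2,3)])
  have fc: "?f \<in> ?S \<rightarrow> carrier A" by (auto simp: paths_to_iff)
  have "sp \<mu> \<nu> \<otimes> sp \<sigma> \<tau> = t \<mu> \<otimes> ((adj (t \<nu>) \<otimes> t \<sigma>) \<otimes> adj (t \<tau>))"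
    using p by (simp add: sp_def mult_assoc)
  also have "adj (t \<nu>) \<otimes> t \<sigma> = finsum A ?f ?S"
    by (rule CK3[OF p(2,3)])
  also have "t \<mu> \<otimes> (finsum A ?f ?S \<otimes> adj (t \<tau>)) = finsum A (\<lambda>i. t \<mu> \<otimes> (?f i \<otimes> adj (t \<tau>))) ?S"
  proof -
    have "finsum A ?f ?S \<otimes> adj (t \<tau>) = finsum A (\<lambda>i. ?f i \<otimes> adj (t \<tau>)) ?S"
      using p by (intro finsum_mult_right[OF fin fc]) auto
    moreover have "(\<lambda>i. ?f i \<otimes> adj (t \<tau>)) \<in> ?S \<rightarrow> carrier A"
      using p by (auto simp: paths_to_iff)
    ultimately show ?thesis
      using p finsum_mult_left[OF fin, of "\<lambda>i. ?f i \<otimes> adj (t \<tau>)" "t \<mu>"] by simp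
  qed
  also have "\<dots> \<in> lspan X"
  proof (rule finsum_in[OF fin])
    fix i assume "i \<in> ?S"
    moreover obtain \<alpha> \<beta> where ie: "i = (\<alpha>, \<beta>)" by (cases i)
    ultimately have "(\<alpha>, \<beta>) \<in> ?S" by (simp only:)
    then have i: "\<alpha> \<in> paths" "ran \<alpha> = src \<nu>" "\<beta> \<in> paths" "ran \<beta> = src \<sigma>"
      "cmp \<nu> \<alpha> = cmp \<sigma> \<beta>" "cmp \<nu> \<alpha> \<in> MCE \<nu> \<sigma>"
      unfolding mem_Collect_eq prod.case paths_to_iff by - (elim conjE, assumption)+
    have "t \<mu> \<otimes> (?f i \<otimes> adj (t \<tau>)) = (t \<mu> \<otimes> t \<alpha>) \<otimes> adj (t \<tau> \<otimes> t \<beta>)"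
      using i(1,3) ie p by (simp add: mult_assoc adj_mult)
    also have "\<dots> = sp (cmp \<mu> \<alpha>) (cmp \<tau> \<beta>)"
      using i(1-4) p s CK2[of \<mu> \<alpha>] CK2[of \<tau> \<beta>] by (simp add: sp_def)
    finally show "t \<mu> \<otimes> (?f i \<otimes> adj (t \<tau>)) \<in> lspan X"
      using XI[OF i(1,3) i(2,4)[symmetric] i(5,6)] by simp
  qed (use X lspan_carrier lspan_add lspan.zero in auto)
  finally show ?thesis .
qed

subsection \<open>Products of complements of range projections\<close>

text \<open>Written with the same fold as \<open>CK4\<close>, which therefore says literally that
  this product vanishes on distinct enumerations of finite exhaustive sets.\<close>

definition gap :: "'p \<Rightarrow> 'p list \<Rightarrow> 'a" where
  "gap u \<eta>s = foldr (\<lambda>\<eta> x. (t u \<ominus> t \<eta> \<otimes> adj (t \<eta>)) \<otimes> x) \<eta>s (t u)"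

lemma gap_simps [simp]:
  "gap u [] = t u" "gap u (\<eta> # \<eta>s) = (t u \<ominus> sp \<eta> \<eta>) \<otimes> gap u \<eta>s"
  by (simp_all add: gap_def sp_def)

lemma gap_carrier [simp]: "\<lbrakk>u \<in> paths; set \<eta>s \<subseteq> paths\<rbrakk> \<Longrightarrow> gap u \<eta>s \<in> carrier A"
  by (induction \<eta>s) auto

lemma gap_FE: "\<lbrakk>u \<in> vertices; set \<eta>s \<in> FE u; distinct \<eta>s\<rbrakk> \<Longrightarrow> gap u \<eta>s = \<zero>"
  unfolding gap_def by (rule CK4)

lemma sp_mult_t_pre:
  assumes "\<eta> \<preceq> \<sigma>" shows "sp \<eta> \<eta> \<otimes> t \<sigma> = t \<sigma>"
  using assms by (elim preE) (simp add: sp_mult_t_cmp)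

text \<open>Each factor annihilates \<open>t \<sigma>\<close> if \<sigma> extends \<eta>, and fixes
  it if the two paths have no common extension; the hypothesis \<open>dec\<close> excludes partial
  overlap.\<close>

lemma gap_mult_t:
  assumes u: "u \<in> vertices" and \<sigma>: "\<sigma> \<in> paths_to u" and \<eta>s: "set \<eta>s \<subseteq> paths"
    and dec: "\<And>\<eta>. \<eta> \<in> set \<eta>s \<Longrightarrow> \<eta> \<preceq> \<sigma> \<or> \<not> meets \<eta> \<sigma>"
  shows "gap u \<eta>s \<otimes> t \<sigma> = (if \<exists>\<eta>\<in>set \<eta>s. \<eta> \<preceq> \<sigma> then \<zero> else t \<sigma>)"
  using \<eta>s dec
proof (induction \<eta>s)
  case Nil
  then show ?case using ran_mult_t[of \<sigma>] \<sigma> by (simp add: paths_to_iff)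
next
  case (Cons \<eta> \<eta>s)
  have p: "u \<in> paths" "\<sigma> \<in> paths" "\<eta> \<in> paths" "t u \<otimes> t \<sigma> = t \<sigma>"
    using u \<sigma> Cons.prems ran_mult_t[of \<sigma>] by (auto simp: paths_to_iff vertex_path)
  have IH: "gap u \<eta>s \<otimes> t \<sigma> = (if \<exists>\<eta>\<in>set \<eta>s. \<eta> \<preceq> \<sigma> then \<zero> else t \<sigma>)"
    using Cons.IH Cons.prems by auto
  have "gap u (\<eta> # \<eta>s) \<otimes> t \<sigma> = (t u \<ominus> sp \<eta> \<eta>) \<otimes> (gap u \<eta>s \<otimes> t \<sigma>)"
    using p Cons.prems by (simp add: mult_assoc)
  moreover have "(t u \<ominus> sp \<eta> \<eta>) \<otimes> t \<sigma> = (if \<eta> \<preceq> \<sigma> then \<zero> else t \<sigma>)"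
    using p Cons.prems(2)[of \<eta>] sp_mult_t_pre[of \<eta> \<sigma>] sp_mult_t_0[of \<eta> \<eta> \<sigma>]
    by (auto simp: mult_minus_left)
  ultimately show ?case
    using IH p by auto
qed

text \<open>Expanding the product leaves range projections of paths in T, because a product of two
  of them is a sum over minimal common extensions.\<close>

lemma gap_span:
  assumes u: "u \<in> vertices" and T: "T \<subseteq> paths_to u"
    and Tc: "\<And>\<rho> \<rho>' \<kappa>. \<lbrakk>\<rho> \<in> T; \<rho>' \<in> T; \<kappa> \<in> MCE \<rho> \<rho>'\<rbrakk> \<Longrightarrow> \<kappa> \<in> T"
    and \<eta>s: "set \<eta>s \<subseteq> T"
  shows "t u \<ominus> gap u \<eta>s \<in> lspan ((\<lambda>\<rho>. sp \<rho> \<rho>) ` T)"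
  using \<eta>s
proof (induction \<eta>s)
  case Nil
  then show ?case using u by (simp add: vertex_path lspan.zero)
next
  case (Cons \<eta> \<eta>s)
  let ?X = "(\<lambda>\<rho>. sp \<rho> \<rho>) ` T"
  have TP: "T \<subseteq> paths" using T by (auto simp: paths_to_iff)
  then have X: "?X \<subseteq> carrier A" by auto
  have u': "u \<in> paths" using u vertex_path by simp
  have e: "\<eta> \<in> T" "\<eta> \<in> paths" "set \<eta>s \<subseteq> paths" "ran \<eta> = u" using Cons.prems T TP by (auto simp: paths_to_iff)
  let ?g = "gap u \<eta>s"
  have g: "?g \<in> carrier A" using e u' by simp
  have IH: "t u \<ominus> ?g \<in> lspan ?X" using Cons by simp
  have ug: "t u \<otimes> ?g = ?g"
  proof (cases \<eta>s)
    case Nil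
    then show ?thesis using t_vertex[OF u] by simp
  next
    case (Cons \<eta>' \<eta>s')
    then have e': "\<eta>' \<in> paths" "ran \<eta>' = u" "set \<eta>s' \<subseteq> paths"
      using e \<open>set (\<eta> # \<eta>s) \<subseteq> T\<close> T by (auto simp: paths_to_iff)
    have "t u \<otimes> sp \<eta>' \<eta>' = sp \<eta>' \<eta>'"
      using e' u' ran_mult_t[of \<eta>'] by (simp add: sp_def mult_assoc[symmetric])
    then show ?thesis
      using Cons e' u' t_vertex[OF u] by (simp add: mult_assoc[symmetric] mult_minus_right)
  qed
  have eu: "sp \<eta> \<eta> \<otimes> t u = sp \<eta> \<eta>"
    using arg_cong[OF ran_mult_t[OF e(2)], of "\<lambda>x. adj x"] e u' t_vertex[OF u] by (simp add: sp_def mult_assoc adj_mult)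
  have span_e: "sp \<eta> \<eta> \<otimes> x \<in> lspan ?X" if "x \<in> lspan ?X" for x
  proof (rule lspan_mult[of "{sp \<eta> \<eta>}" ?X ?X])
    fix g h assume "g \<in> {sp \<eta> \<eta>}" "h \<in> ?X"
    then obtain \<rho> where r: "\<rho> \<in> T" "g = sp \<eta> \<eta>" "h = sp \<rho> \<rho>" by auto
    show "g \<otimes> h \<in> lspan ?X"
      unfolding r(2,3)
    proof (rule sp_mult_sp)
      fix \<alpha> \<beta> assume a: "cmp \<eta> \<alpha> = cmp \<rho> \<beta>" "cmp \<eta> \<alpha> \<in> MCE \<eta> \<rho>"
      then show "sp (cmp \<eta> \<alpha>) (cmp \<rho> \<beta>) \<in> lspan ?X"
        using Tc[OF e(1) r(1) a(2)] by (intro lspan_base[OF X]) auto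
    qed (use e r TP X in auto)
  qed (use X e that lspan_base[of "{sp \<eta> \<eta>}"] in auto)
  \<comment> \<open>The induction hypothesis speaks of \<open>t u \<ominus> ?g\<close> and not of
    \<open>?g\<close>, hence this detour through the difference.\<close>
  have "sp \<eta> \<eta> \<otimes> ?g = sp \<eta> \<eta> \<ominus> sp \<eta> \<eta> \<otimes> (t u \<ominus> ?g)"
    using e g u' eu by (simp add: mult_minus_right minus_minus_cancel)
  moreover have "sp \<eta> \<eta> \<in> lspan ?X" using lspan_base[OF X] e by auto
  ultimately have "sp \<eta> \<eta> \<otimes> ?g \<in> lspan ?X"
    using span_e[OF IH] lspan_minus[OF X] by simp
  moreover have "t u \<ominus> gap u (\<eta> # \<eta>s) = (t u \<ominus> ?g) \<oplus> sp \<eta> \<eta> \<otimes> ?g"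
    using e g u' ug by (simp add: mult_minus_left minus_minus_eq)
  ultimately show ?case
    using IH lspan_add[OF X] by simp
qed

end

subsection \<open>Blocks of the core\<close>

context k_graph
begin

text \<open>Paths of equal degree and source can replace each other in the core; they index the rows
  and columns of one matrix block.\<close>

definition block :: "'p set \<Rightarrow> 'p \<Rightarrow> 'p set" where
  "block F \<nu> = {\<eta> \<in> F. deg \<eta> = deg \<nu> \<and> src \<eta> = src \<nu>}"

text \<open>The nontrivial continuations of \<nu> within F. Their range projections are what
  distinguishes \<open>sp \<mu> \<nu>\<close> from a matrix unit.\<close>

definition tails :: "'p set \<Rightarrow> 'p \<Rightarrow> 'p set" where
  "tails F \<nu> = {\<rho> \<in> paths. src \<nu> = ran \<rho> \<and> deg \<rho> \<noteq> 0 \<and> cmp \<nu> \<rho> \<in> F}"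

lemma core_closedD:
  assumes "core_closed F" "\<eta> \<in> F" "\<mu> \<in> F" "\<sigma> \<in> F" "\<alpha> \<in> paths"
    "deg \<eta> = deg \<mu>" "src \<eta> = src \<mu>" "src \<mu> = ran \<alpha>" "cmp \<mu> \<alpha> \<in> MCE \<mu> \<sigma>"
  shows "cmp \<eta> \<alpha> \<in> F"
  using assms unfolding core_closed_def by blast

lemma core_closed_MCE:
  assumes F: "core_closed F" "\<mu> \<in> F" "\<sigma> \<in> F" and \<kappa>: "\<kappa> \<in> MCE \<mu> \<sigma>"
  shows "\<kappa> \<in> F"
proof -
  have p: "\<mu> \<in> paths" "\<sigma> \<in> paths" using F by (auto simp: core_closed_def)
  obtain \<alpha> where a: "\<alpha> \<in> paths" "src \<mu> = ran \<alpha>" "\<kappa> = cmp \<mu> \<alpha>"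
    using \<kappa> MCE_iff[OF p] by (blast elim: preE)
  show ?thesis using core_closedD[OF F(1,2,2,3) a(1) _ _ a(2)] \<kappa> a(3) by simp
qed

text \<open>Since \<open>cmp \<mu> \<alpha>\<close> lies in
  \<open>MCE \<mu> (cmp \<mu> \<alpha>)\<close>, this is the closure condition with
  \<open>cmp \<mu> \<alpha>\<close> in place of \<sigma>.\<close>

lemma core_closed_swap:
  assumes F: "core_closed F" "\<eta> \<in> F" "\<mu> \<in> F" "cmp \<mu> \<alpha> \<in> F" and a: "\<alpha> \<in> paths"
    "deg \<eta> = deg \<mu>" "src \<eta> = src \<mu>" "src \<mu> = ran \<alpha>"
  shows "cmp \<eta> \<alpha> \<in> F"
proof -
  have p: "\<mu> \<in> paths" "cmp \<mu> \<alpha> \<in> paths" using F by (auto simp: core_closed_def)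
  have "\<mu> \<preceq> cmp \<mu> \<alpha>" using preI p a by simp
  then have "cmp \<mu> \<alpha> \<in> MCE \<mu> (cmp \<mu> \<alpha>)"
    using MCE_iff[OF p] pre_refl[OF p(2)] pre_deg by (simp add: sup_absorb2)
  then show ?thesis using core_closedD[OF F a] by blast
qed

text \<open>By swapping, continuations are shared by a whole block; hence the \<open>gap\<close> in
  a matrix unit depends on the block only.\<close>

lemma tails_cong:
  assumes "core_closed F" "\<nu> \<in> F" "\<mu> \<in> block F \<nu>"
  shows "tails F \<mu> = tails F \<nu>" "block F \<mu> = block F \<nu>"
proof -
  have b: "\<mu> \<in> F" "deg \<mu> = deg \<nu>" "src \<mu> = src \<nu>" using assms by (auto simp: block_def)
  show "block F \<mu> = block F \<nu>" using b by (simp add: block_def)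
  show "tails F \<mu> = tails F \<nu>"
  proof (intro equalityI subsetI)
    fix \<rho> assume "\<rho> \<in> tails F \<mu>"
    then show "\<rho> \<in> tails F \<nu>"
      using core_closed_swap[OF assms(1,2) b(1), of \<rho>] b by (simp add: tails_def)
  next
    fix \<rho> assume "\<rho> \<in> tails F \<nu>"
    then show "\<rho> \<in> tails F \<mu>"
      using core_closed_swap[OF assms(1) b(1) assms(2), of \<rho>] b by (simp add: tails_def)
  qed
qed

lemma finite_tails_block:
  assumes F: "finite F" "core_closed F" and \<nu>: "\<nu> \<in> F" shows "finite (tails F \<nu>)"
proof (rule finite_imageD)
  have p: "\<nu> \<in> paths" using assms by (auto simp: core_closed_def)
  show "finite (cmp \<nu> ` tails F \<nu>)"
    by (rule finite_subset[OF _ F(1)]) (auto simp: tails_def)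
  show "inj_on (cmp \<nu>) (tails F \<nu>)"
  proof (rule inj_onI)
    fix x y assume a: "x \<in> tails F \<nu>" "y \<in> tails F \<nu>" "cmp \<nu> x = cmp \<nu> y"
    then have "x \<in> paths" "y \<in> paths" "src \<nu> = ran x" "src \<nu> = ran y"
      by (simp_all add: tails_def)
    then show "x = y" using cmp_left_cancel[OF p] a(3) by simp
  qed
qed

text \<open>Prefixing \<nu> carries minimal common extensions to minimal common extensions. This is
  the closure of the tails that \<open>gap_span\<close> asks for.\<close>

lemma tails_MCE:
  assumes F: "core_closed F" "\<nu> \<in> F" and r: "\<rho> \<in> tails F \<nu>" "\<rho>' \<in> tails F \<nu>" "\<kappa> \<in> MCE \<rho> \<rho>'"
  shows "\<kappa> \<in> tails F \<nu>"
proof -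
  have n: "\<nu> \<in> paths" using F by (auto simp: core_closed_def)
  have p: "\<rho> \<in> paths" "src \<nu> = ran \<rho>" "deg \<rho> \<noteq> 0" "cmp \<nu> \<rho> \<in> F"
    and p': "\<rho>' \<in> paths" "src \<nu> = ran \<rho>'" "cmp \<nu> \<rho>' \<in> F"
    using r by (simp_all add: tails_def)
  have k: "\<rho> \<preceq> \<kappa>" "\<rho>' \<preceq> \<kappa>" "deg \<kappa> = sup (deg \<rho>) (deg \<rho>')" "\<kappa> \<in> paths"
    using r(3) MCE_iff[OF p(1) p'(1)] MCE_paths by blast+
  have rk: "src \<nu> = ran \<kappa>" using pre_ran[OF k(1)] p by simp
  have "cmp \<nu> \<rho> \<preceq> cmp \<nu> \<kappa>" "cmp \<nu> \<rho>' \<preceq> cmp \<nu> \<kappa>"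
    using pre_cmp_left[OF n] p p' k by auto
  moreover have "deg (cmp \<nu> \<kappa>) = sup (deg (cmp \<nu> \<rho>)) (deg (cmp \<nu> \<rho>'))"
    using n p p' k rk by (simp add: deg_cmp fun_eq_iff sup_max nat_add_max_right)
  ultimately have "cmp \<nu> \<kappa> \<in> MCE (cmp \<nu> \<rho>) (cmp \<nu> \<rho>')"
    using MCE_iff cmp_closed n p p' by simp
  then have "cmp \<nu> \<kappa> \<in> F" using core_closed_MCE[OF F(1) p(4) p'(3)] by blast
  moreover have "deg \<kappa> \<noteq> 0"
    using pre_deg[OF k(1)] p(3) by (metis le_fun_def le_zero_eq zero_fun_apply ext)
  ultimately show ?thesis using k rk by (simp add: tails_def)
qed

text \<open>
  The vectors \<open>t (cmp \<eta> \<tau>)\<close> with \<open>\<eta>\<close> in the block of \<open>\<nu>\<close> will carry a matrix representation of the core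
  over \<open>F\<close>.
\<close>

definition separating :: "'p set \<Rightarrow> 'p \<Rightarrow> 'p \<Rightarrow> bool" where
  "separating F \<nu> \<tau> \<longleftrightarrow> \<tau> \<in> paths \<and> ran \<tau> = src \<nu> \<and>
     (\<forall>\<rho>\<in>tails F \<nu>. \<not> meets \<rho> \<tau>) \<and>
     (\<forall>\<eta>\<in>block F \<nu>. \<forall>\<mu>\<in>F. \<mu> \<preceq> cmp \<eta> \<tau> \<or> \<not> meets \<mu> (cmp \<eta> \<tau>)) \<and>
     (\<forall>\<eta>\<in>F. \<forall>\<eta>'\<in>F. \<forall>\<mu>\<in>paths. \<forall>\<mu>'\<in>paths. \<forall>\<kappa>\<in>paths. \<forall>\<kappa>'\<in>paths.
        src \<mu> = ran \<kappa> \<longrightarrow> src \<mu>' = ran \<kappa>' \<longrightarrow> cmp \<mu> \<kappa> = \<eta> \<longrightarrow> cmp \<mu>' \<kappa>' = \<eta>' \<longrightarrow>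
        src \<eta> = src \<nu> \<longrightarrow> src \<eta>' = src \<nu> \<longrightarrow> \<kappa> \<noteq> \<kappa>' \<longrightarrow> \<not> meets (cmp \<kappa> \<tau>) (cmp \<kappa>' \<tau>))"

text \<open>Since the tails are not exhaustive, some \<tau>0 meets none of them. The other demands
  are met by extending it: a path of F is decided by passing to a common extension if there is one,
  and two different tails are driven apart by aperiodicity. These demands are finite in number and
  persist under further extension.\<close>

lemma separating_exists:
  assumes ap: "kgraph_aperiodic \<Lambda>" and F: "finite F" "core_closed F" and \<nu>: "\<nu> \<in> F"
    and ne: "tails F \<nu> \<notin> FE (src \<nu>)"
  obtains \<tau> where "separating F \<nu> \<tau>"
proof -
  let ?u = "src \<nu>"
  have FP: "F \<subseteq> paths" using F by (auto simp: core_closed_def)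
  have "tails F \<nu> \<subseteq> paths_to ?u" by (auto simp: tails_def paths_to_iff)
  then obtain \<tau>0 where "\<tau>0 \<in> paths_to ?u" "\<forall>\<rho>\<in>tails F \<nu>. \<not> meets \<tau>0 \<rho>"
    using ne finite_tails_block[OF F \<nu>] unfolding FE_iff by blast
  then have t0: "\<tau>0 \<in> paths" "ran \<tau>0 = ?u" "\<And>\<rho>. \<rho> \<in> tails F \<nu> \<Longrightarrow> \<not> meets \<tau>0 \<rho>"
    by (simp_all add: paths_to_iff)
  \<comment> \<open>\<open>K\<close> contains every final part of a path of F that ends at
    \<open>?u\<close>; two different members have to become disjoint after \<tau> is
    appended.\<close>
  define K where "K = {\<kappa> \<in> \<Union>\<eta>\<in>F. {\<kappa> \<in> paths. \<exists>\<mu>\<in>paths. src \<mu> = ran \<kappa> \<and> cmp \<mu> \<kappa> = \<eta>}. src \<kappa> = ?u}"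
  have fK: "finite K"
    unfolding K_def by (rule finite_subset[OF Collect_restrict finite_UN_I[OF F(1) finite_tails]])
  have KP: "K \<subseteq> paths" "\<And>\<kappa>. \<kappa> \<in> K \<Longrightarrow> src \<kappa> = ?u" by (simp_all add: K_def subset_iff)
  define P1 where "P1 = (\<lambda>(\<eta>, \<mu>) \<sigma>. ran \<sigma> = ?u \<and> (\<mu> \<preceq> cmp \<eta> \<sigma> \<or> \<not> meets \<mu> (cmp \<eta> \<sigma>)))"
  define P2 where "P2 = (\<lambda>(\<kappa>, \<kappa>') \<sigma>. ran \<sigma> = ?u \<and> \<not> meets (cmp \<kappa> \<sigma>) (cmp \<kappa>' \<sigma>))"
  define PP where "PP = P1 ` (block F \<nu> \<times> F) \<union> P2 ` {(\<kappa>, \<kappa>') \<in> K \<times> K. \<kappa> \<noteq> \<kappa>'}"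
  have "finite (block F \<nu>)" using F by (simp add: block_def)
  moreover have "finite {(\<kappa>, \<kappa>') \<in> K \<times> K. \<kappa> \<noteq> \<kappa>'}"
    by (rule finite_subset[of _ "K \<times> K"]) (use fK in auto)
  ultimately have fP: "finite PP" unfolding PP_def using F(1) by simp
  have "\<exists>\<sigma>. \<tau>0 \<preceq> \<sigma> \<and> (\<forall>P\<in>PP. P \<sigma>)"
  proof (rule dense_extension[OF fP t0(1)])
    fix P \<sigma> \<sigma>' assume a: "P \<in> PP" "\<sigma> \<preceq> \<sigma>'" "P \<sigma>"
    have r: "ran \<sigma>' = ran \<sigma>" using pre_ran[OF a(2)] by simp
    have ext: "cmp \<kappa> \<sigma> \<preceq> cmp \<kappa> \<sigma>'" if "\<kappa> \<in> paths" "src \<kappa> = ?u" "ran \<sigma> = ?u" for \<kappa>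
      using pre_cmp_left[OF that(1) _ a(2)] that by simp
    from a(1) consider \<eta> \<mu> where "P = P1 (\<eta>, \<mu>)" "\<eta> \<in> block F \<nu>" "\<mu> \<in> F"
      | \<kappa> \<kappa>' where "P = P2 (\<kappa>, \<kappa>')" "\<kappa> \<in> K" "\<kappa>' \<in> K"
      unfolding PP_def by auto
    then show "P \<sigma>'"
    proof cases
      case 1
      then have e: "\<eta> \<in> paths" "src \<eta> = ?u" using FP by (auto simp: block_def)
      have s: "ran \<sigma> = ?u" "\<mu> \<preceq> cmp \<eta> \<sigma> \<or> \<not> meets \<mu> (cmp \<eta> \<sigma>)" using a(3) 1 by (auto simp: P1_def)
      note x = ext[OF e s(1)]
      have "\<mu> \<preceq> cmp \<eta> \<sigma>' \<or> \<not> meets \<mu> (cmp \<eta> \<sigma>')"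
        using s(2) x pre_trans meets_mono[OF _ pre_refl x] FP 1(3) by blast
      then show ?thesis using 1 r s by (simp add: P1_def)
    next
      case 2
      have s: "ran \<sigma> = ?u" "\<not> meets (cmp \<kappa> \<sigma>) (cmp \<kappa>' \<sigma>)" using a(3) 2 by (auto simp: P2_def)
      have "\<not> meets (cmp \<kappa> \<sigma>') (cmp \<kappa>' \<sigma>')"
        using s(2) meets_mono ext[OF _ _ s(1)] KP 2 by blast
      then show ?thesis using 2 r s by (simp add: P2_def)
    qed
  next
    fix P \<sigma> assume a: "P \<in> PP" "\<tau>0 \<preceq> \<sigma>"
    have s: "ran \<sigma> = ?u" "\<sigma> \<in> paths" using pre_ran[OF a(2)] t0 pre_paths[OF a(2)] by auto
    from a(1) consider \<eta> \<mu> where "P = P1 (\<eta>, \<mu>)" "\<eta> \<in> block F \<nu>" "\<mu> \<in> F"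
      | \<kappa> \<kappa>' where "P = P2 (\<kappa>, \<kappa>')" "\<kappa> \<in> K" "\<kappa>' \<in> K" "\<kappa> \<noteq> \<kappa>'"
      unfolding PP_def by auto
    then show "\<exists>\<sigma>'. \<sigma> \<preceq> \<sigma>' \<and> P \<sigma>'"
    proof cases
      case 1
      then have e: "\<eta> \<in> paths" "src \<eta> = ran \<sigma>" using FP s by (auto simp: block_def)
      show ?thesis
      proof (cases "meets \<mu> (cmp \<eta> \<sigma>)")
        case True
        then obtain \<omega> where w: "\<mu> \<preceq> \<omega>" "cmp \<eta> \<sigma> \<preceq> \<omega>" by (auto simp: meets_def)
        obtain \<beta> where b: "\<beta> \<in> paths" "src (cmp \<eta> \<sigma>) = ran \<beta>" "\<omega> = cmp (cmp \<eta> \<sigma>) \<beta>"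
          using w(2) by (blast elim: preE)
        have sb: "src \<sigma> = ran \<beta>" using b e s src_cmp by simp
        have "\<mu> \<preceq> cmp \<eta> (cmp \<sigma> \<beta>)" using w(1) b(1,3) e s sb by (simp add: cmp_assoc)
        moreover have "\<sigma> \<preceq> cmp \<sigma> \<beta>" using preI s b sb by simp
        moreover have "ran (cmp \<sigma> \<beta>) = ?u" using s b sb ran_cmp by simp
        ultimately show ?thesis using 1(1) unfolding P1_def by (intro exI[of _ "cmp \<sigma> \<beta>"]) simp
      next
        case False
        then show ?thesis using 1(1) s pre_refl[OF s(2)] unfolding P1_def by (intro exI[of _ \<sigma>]) simp
      qed
    next
      case 2
      have k: "\<kappa> \<in> paths" "\<kappa>' \<in> paths" "src \<kappa> = ran \<sigma>" "src \<kappa>' = ran \<sigma>" using KP 2 s by auto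
      let ?a = "cmp \<kappa> \<sigma>" and ?b = "cmp \<kappa>' \<sigma>"
      \<comment> \<open>Aperiodicity speaks of different paths with a common source. Cancelling
        \<sigma> on the right is legitimate, since equality would force equal degrees of \<kappa>
        and \<kappa>'.\<close>
      have "?a \<noteq> ?b"
      proof
        assume eq: "?a = ?b"
        then have "deg \<kappa> + deg \<sigma> = deg \<kappa>' + deg \<sigma>" using k s deg_cmp by metis
        then show False using cmp_cancel(1)[OF k(1) s(2) k(2) s(2) k(3,4) _ eq] 2(4) by simp
      qed
      moreover have "?a \<in> paths" "?b \<in> paths" "src ?a = src \<sigma>" "src ?b = src \<sigma>"
        using k s by (simp_all add: cmp_closed src_cmp)
      ultimately obtain \<tau> where t: "\<tau> \<in> paths_to (src \<sigma>)" "MCE (cmp ?a \<tau>) (cmp ?b \<tau>) = {}"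
        using ap unfolding kgraph_aperiodic_def by metis
      then have t': "\<tau> \<in> paths" "src \<sigma> = ran \<tau>" by (auto simp: paths_to_iff)
      have "cmp ?a \<tau> = cmp \<kappa> (cmp \<sigma> \<tau>)" "cmp ?b \<tau> = cmp \<kappa>' (cmp \<sigma> \<tau>)"
        using k s t' by (simp_all add: cmp_assoc)
      moreover have "cmp \<kappa> (cmp \<sigma> \<tau>) \<in> paths" "cmp \<kappa>' (cmp \<sigma> \<tau>) \<in> paths" "ran (cmp \<sigma> \<tau>) = ?u"
        using k s t' by (simp_all add: cmp_closed ran_cmp)
      ultimately have "P (cmp \<sigma> \<tau>)"
        using 2(1) t(2) MCE_empty_iff unfolding P2_def by simp
      moreover have "\<sigma> \<preceq> cmp \<sigma> \<tau>" using preI s t' by simp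
      ultimately show ?thesis by blast
    qed
  qed
  then obtain \<tau> where t: "\<tau>0 \<preceq> \<tau>" "\<And>P. P \<in> PP \<Longrightarrow> P \<tau>" by blast
  have tp: "\<tau> \<in> paths" "ran \<tau> = ?u" using pre_paths[OF t(1)] pre_ran[OF t(1)] t0 by auto
  have "separating F \<nu> \<tau>"
    unfolding separating_def
  proof (intro conjI ballI impI tp)
    fix \<rho> assume r: "\<rho> \<in> tails F \<nu>"
    show "\<not> meets \<rho> \<tau>"
      using t0(3)[OF r] meets_mono[OF _ pre_refl t(1)] meets_sym meets_paths by blast
  next
    fix \<eta> \<mu> assume "\<eta> \<in> block F \<nu>" "\<mu> \<in> F"
    then have "P1 (\<eta>, \<mu>) \<tau>" using t(2)[of "P1 (\<eta>, \<mu>)"] unfolding PP_def by blast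
    then show "\<mu> \<preceq> cmp \<eta> \<tau> \<or> \<not> meets \<mu> (cmp \<eta> \<tau>)" by (simp add: P1_def)
  next
    fix \<eta> \<eta>' \<mu> \<mu>' \<kappa> \<kappa>'
    assume a: "\<eta> \<in> F" "\<eta>' \<in> F" "\<mu> \<in> paths" "\<mu>' \<in> paths" "\<kappa> \<in> paths" "\<kappa>' \<in> paths"
      "src \<mu> = ran \<kappa>" "src \<mu>' = ran \<kappa>'" "cmp \<mu> \<kappa> = \<eta>" "cmp \<mu>' \<kappa>' = \<eta>'"
      "src \<eta> = ?u" "src \<eta>' = ?u" "\<kappa> \<noteq> \<kappa>'"
    have "src \<kappa> = ?u" "src \<kappa>' = ?u"
      using src_cmp[OF a(3,5,7)] src_cmp[OF a(4,6,8)] a(9-12) by simp_all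
    then have "\<kappa> \<in> K" "\<kappa>' \<in> K"
      unfolding K_def using a(1-10) by blast+
    then have "P2 (\<kappa>, \<kappa>') \<in> PP" using a(13) unfolding PP_def by blast
    then have "P2 (\<kappa>, \<kappa>') \<tau>" by (rule t(2))
    then show "\<not> meets (cmp \<kappa> \<tau>) (cmp \<kappa>' \<tau>)" by (simp add: P2_def)
  qed
  then show ?thesis by (rule that)
qed

text \<open>If \<mu> is an initial segment of \<open>cmp \<eta> \<tau>\<close>, then \<eta> and
  \<mu> have a minimal common extension \<open>cmp \<eta> \<alpha>\<close> in F with \<alpha> below
  \<tau>. A nontrivial \<alpha> would be a tail met by \<tau>, so \<alpha> is trivial and \<mu>
  already lies below \<eta>.\<close>

lemma separating_decides:
  assumes F: "core_closed F" "\<nu> \<in> F" and s: "separating F \<nu> \<tau>" and e: "\<eta> \<in> block F \<nu>" and m: "\<mu> \<in> F"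
  shows "\<mu> \<preceq> \<eta> \<or> \<not> meets \<mu> (cmp \<eta> \<tau>)"
proof (rule ccontr)
  assume c: "\<not> ?thesis"
  have FP: "F \<subseteq> paths" using F by (simp add: core_closed_def)
  have e': "\<eta> \<in> F" "\<eta> \<in> paths" "deg \<eta> = deg \<nu>" "src \<eta> = src \<nu>" using e FP by (auto simp: block_def)
  have t: "\<tau> \<in> paths" "ran \<tau> = src \<nu>" "\<And>\<rho>. \<rho> \<in> tails F \<nu> \<Longrightarrow> \<not> meets \<rho> \<tau>"
    using s by (simp_all add: separating_def)
  have "\<mu> \<preceq> cmp \<eta> \<tau>" using s c e m unfolding separating_def by blast
  moreover have "\<eta> \<preceq> cmp \<eta> \<tau>" using preI e' t by simp
  ultimately obtain \<kappa> where k: "\<kappa> \<in> MCE \<eta> \<mu>" "\<kappa> \<preceq> cmp \<eta> \<tau>" using MCE_below by blast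
  have k': "\<eta> \<preceq> \<kappa>" "\<mu> \<preceq> \<kappa>" using k(1) MCE_iff e'(2) m FP by auto
  obtain \<alpha> where a: "\<alpha> \<in> paths" "src \<eta> = ran \<alpha>" "\<kappa> = cmp \<eta> \<alpha>"
    using k'(1) by (blast elim: preE)
  have "\<alpha> \<preceq> \<tau>"
    using pre_cmp_cancel[OF e'(2) a(1) t(1) a(2)] e' t k(2) a(3) by simp
  then have mt: "meets \<alpha> \<tau>" by (rule pre_meets)
  show False
  proof (cases "deg \<alpha> = 0")
    case True
    then have "\<kappa> = \<eta>" using cmp_deg_0 a e' by simp
    then show False using k' c by simp
  next
    case False
    have "cmp \<eta> \<alpha> \<in> F" using core_closed_MCE[OF F(1) e'(1) m k(1)] a by simp
    then have "\<alpha> \<in> tails F \<eta>" using a False by (simp add: tails_def)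
    then have "\<alpha> \<in> tails F \<nu>" using tails_cong(1)[OF F e] by simp
    then show False using t(3) mt by blast
  qed
qed

definition pairs :: "'p set \<Rightarrow> ('p \<times> 'p) set" where
  "pairs F = {(\<mu>, \<nu>). \<mu> \<in> F \<and> \<nu> \<in> F \<and> deg \<mu> = deg \<nu> \<and> src \<mu> = src \<nu>}"

end

context kgraph_ck_family
begin

text \<open>\<open>CK4\<close> multiplies along a list. The choice depends on the set of tails only
  and so agrees throughout a block of a \<open>core_closed\<close> set.\<close>

definition tails_list :: "'p set \<Rightarrow> 'p \<Rightarrow> 'p list" where
  "tails_list F \<nu> = (SOME \<eta>s. set \<eta>s = tails F \<nu> \<and> distinct \<eta>s)"

lemma tails_list:
  assumes "finite F" "core_closed F" "\<nu> \<in> F"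
  shows "set (tails_list F \<nu>) = tails F \<nu>" "distinct (tails_list F \<nu>)"
proof -
  have "\<exists>\<eta>s. set \<eta>s = tails F \<nu> \<and> distinct \<eta>s"
    using finite_distinct_list[OF finite_tails_block[OF assms]] .
  then have "set (tails_list F \<nu>) = tails F \<nu> \<and> distinct (tails_list F \<nu>)"
    unfolding tails_list_def by (rule someI_ex)
  then show "set (tails_list F \<nu>) = tails F \<nu>" "distinct (tails_list F \<nu>)" by auto
qed

text \<open>The matrix units of the core over \<open>F\<close>; those at an exhaustive set of tails vanish.\<close>

definition munit :: "'p set \<Rightarrow> 'p \<times> 'p \<Rightarrow> 'a" where
  "munit F = (\<lambda>(\<mu>, \<nu>). t \<mu> \<otimes> (gap (src \<nu>) (tails_list F \<nu>) \<otimes> adj (t \<nu>)))"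

definition core :: "'p set \<Rightarrow> 'a set" where
  "core F = lspan ((\<lambda>(\<mu>, \<nu>). sp \<mu> \<nu>) ` pairs F)"

context
  fixes F :: "'p set"
  assumes fF: "finite F" and cF: "core_closed F"
begin

lemma FP: "\<eta> \<in> F \<Longrightarrow> \<eta> \<in> paths"
  using cF by (auto simp: core_closed_def)

lemma gap_tails_carrier: "\<nu> \<in> F \<Longrightarrow> gap (src \<nu>) (tails_list F \<nu>) \<in> carrier A"
  using FP tails_list[OF fF cF, of \<nu>] by (auto simp: tails_def src_closed intro!: gap_carrier)

lemma munit_carrier: "p \<in> pairs F \<Longrightarrow> munit F p \<in> carrier A"
  using FP gap_tails_carrier by (auto simp: munit_def pairs_def)

lemma core_gens_carrier: "(\<lambda>(\<mu>, \<nu>). sp \<mu> \<nu>) ` pairs F \<subseteq> carrier A"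
  using FP by (auto simp: pairs_def)

lemma core_carrier: "x \<in> core F \<Longrightarrow> x \<in> carrier A"
  unfolding core_def by (rule lspan_carrier[OF core_gens_carrier])

text \<open>The closure condition is used twice: for the left paths with \<mu>, \<nu>, \<sigma>, and
  for the right paths with \<tau>, \<sigma>, \<nu>.\<close>

lemma core_mult: "\<lbrakk>x \<in> core F; y \<in> core F\<rbrakk> \<Longrightarrow> x \<otimes> y \<in> core F"
  unfolding core_def
proof (rule lspan_mult[OF core_gens_carrier core_gens_carrier core_gens_carrier])
  let ?X = "(\<lambda>(\<mu>, \<nu>). sp \<mu> \<nu>) ` pairs F"
  fix g h assume "g \<in> ?X" "h \<in> ?X"
  then obtain \<mu> \<nu> \<sigma> \<tau> where g: "(\<mu>, \<nu>) \<in> pairs F" "g = sp \<mu> \<nu>" and h: "(\<sigma>, \<tau>) \<in> pairs F" "h = sp \<sigma> \<tau>"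
    by auto
  have p: "\<mu> \<in> F" "\<nu> \<in> F" "\<sigma> \<in> F" "\<tau> \<in> F" "deg \<mu> = deg \<nu>" "src \<mu> = src \<nu>" "deg \<sigma> = deg \<tau>" "src \<sigma> = src \<tau>"
    using g h by (simp_all add: pairs_def)
  show "g \<otimes> h \<in> lspan ?X"
    unfolding g(2) h(2)
  proof (rule sp_mult_sp)
    fix \<alpha> \<beta> assume a: "\<alpha> \<in> paths" "\<beta> \<in> paths" "src \<nu> = ran \<alpha>" "src \<sigma> = ran \<beta>"
      "cmp \<nu> \<alpha> = cmp \<sigma> \<beta>" "cmp \<nu> \<alpha> \<in> MCE \<nu> \<sigma>"
    have "cmp \<mu> \<alpha> \<in> F" using core_closedD[OF cF p(1,2,3) a(1) p(5,6) a(3,6)] .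
    moreover have "cmp \<tau> \<beta> \<in> F"
      using core_closedD[OF cF p(4,3,2) a(2) p(7)[symmetric] p(8)[symmetric] a(4)] a(5,6) by (simp add: MCE_commute)
    moreover have "deg (cmp \<mu> \<alpha>) = deg (cmp \<tau> \<beta>)"
      using arg_cong[OF a(5), of "deg"] p a(1-4) FP by (simp add: deg_cmp)
    moreover have "src (cmp \<mu> \<alpha>) = src (cmp \<tau> \<beta>)"
      using arg_cong[OF a(5), of "src"] p a(1-4) FP by (simp add: src_cmp)
    ultimately have "(cmp \<mu> \<alpha>, cmp \<tau> \<beta>) \<in> pairs F" by (simp add: pairs_def)
    then show "sp (cmp \<mu> \<alpha>) (cmp \<tau> \<beta>) \<in> lspan ?X"
      by (intro lspan_base[OF core_gens_carrier]) force
  qed (use p FP core_gens_carrier in auto)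
qed

lemma core_adj: "x \<in> core F \<Longrightarrow> adj x \<in> core F"
  unfolding core_def
proof (rule lspan_adj[OF core_gens_carrier core_gens_carrier])
  let ?X = "(\<lambda>(\<mu>, \<nu>). sp \<mu> \<nu>) ` pairs F"
  fix g assume "g \<in> ?X"
  then obtain \<mu> \<nu> where g: "(\<mu>, \<nu>) \<in> pairs F" "g = sp \<mu> \<nu>" by auto
  then have "(\<nu>, \<mu>) \<in> pairs F" "adj g = sp \<nu> \<mu>" using FP by (auto simp: pairs_def adj_sp)
  then show "adj g \<in> lspan ?X" by (intro lspan_base[OF core_gens_carrier]) force
qed

text \<open>\<open>munit F (\<mu>, \<nu>)\<close> differs from \<open>sp \<mu> \<nu>\<close> by terms of higher degree.\<close>

lemma sp_in_span_munit:
  assumes "(\<mu>, \<nu>) \<in> pairs F" shows "sp \<mu> \<nu> \<in> lspan (munit F ` pairs F)"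
proof -
  let ?M = "munit F ` pairs F"
  have Mc: "?M \<subseteq> carrier A" using munit_carrier by auto
  define N where "N = Max (tot ` F)"
  have N: "tot \<eta> \<le> N" if "\<eta> \<in> F" for \<eta> using that fF by (simp add: N_def)
  \<comment> \<open>Downward induction on the total degree of \<nu>: the correction terms have
    strictly longer paths, and N bounds the total degrees in F.\<close>
  show ?thesis
    using assms
  proof (induction "N - tot \<nu>" arbitrary: \<mu> \<nu> rule: less_induct)
    case less
    have p: "\<mu> \<in> F" "\<nu> \<in> F" "\<mu> \<in> paths" "\<nu> \<in> paths" "deg \<mu> = deg \<nu>" "src \<mu> = src \<nu>"
      using less.prems FP by (auto simp: pairs_def)
    let ?u = "src \<nu>" and ?g = "gap (src \<nu>) (tails_list F \<nu>)"
    let ?P = "(\<lambda>\<rho>. sp \<rho> \<rho>) ` tails F \<nu>"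
    have u: "?u \<in> vertices" "?u \<in> paths" using p src_vertex src_closed by auto
    have g: "?g \<in> carrier A" using gap_tails_carrier p by simp
    have T: "tails F \<nu> \<subseteq> paths_to ?u" by (auto simp: tails_def paths_to_iff)
    then have Pc: "?P \<subseteq> carrier A" by (auto simp: paths_to_iff)
    have d: "t ?u \<ominus> ?g \<in> lspan ?P"
      using gap_span[OF u(1) T] tails_MCE[OF cF p(2)] tails_list(1)[OF fF cF p(2)] by blast
    \<comment> \<open>These are the correction terms: between \<open>t \<mu>\<close> and
      \<open>adj (t \<nu>)\<close> the range projection of a tail \<rho> becomes
      \<open>sp (cmp \<mu> \<rho>) (cmp \<nu> \<rho>)\<close>.\<close>
    have "t \<mu> \<otimes> ((t ?u \<ominus> ?g) \<otimes> adj (t \<nu>)) \<in> lspan ?M"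
    proof (rule lspan_map[OF Pc Mc _ _ _ _ d, where f = "\<lambda>x. t \<mu> \<otimes> (x \<otimes> adj (t \<nu>))" and d = "\<lambda>c. c"])
      fix x assume "x \<in> ?P"
      then obtain \<rho> where r: "\<rho> \<in> tails F \<nu>" "x = sp \<rho> \<rho>" by auto
      then have r': "\<rho> \<in> paths" "src \<nu> = ran \<rho>" "deg \<rho> \<noteq> 0" "cmp \<nu> \<rho> \<in> F" by (simp_all add: tails_def)
      have "t \<mu> \<otimes> (x \<otimes> adj (t \<nu>)) = (t \<mu> \<otimes> t \<rho>) \<otimes> adj (t \<nu> \<otimes> t \<rho>)"
        using r r' p by (simp add: sp_def mult_assoc adj_mult)
      also have "\<dots> = sp (cmp \<mu> \<rho>) (cmp \<nu> \<rho>)"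
        using CK2[of \<mu> \<rho>] CK2[of \<nu> \<rho>] p r' by (simp add: sp_def)
      also have "\<dots> \<in> lspan ?M"
      proof (rule less.hyps)
        have "tot \<rho> > 0" using r'(3) tot_0_iff by blast
        then have "tot \<nu> < tot (cmp \<nu> \<rho>)" using tot_cmp[of \<nu> \<rho>] p r' by simp
        then show "N - tot (cmp \<nu> \<rho>) < N - tot \<nu>" using N[OF r'(4)] by simp
        have "cmp \<mu> \<rho> \<in> F" using core_closed_swap[OF cF p(1,2) r'(4,1) p(5,6) r'(2)] .
        then show "(cmp \<mu> \<rho>, cmp \<nu> \<rho>) \<in> pairs F"
          using r' p by (simp add: pairs_def deg_cmp src_cmp)
      qed
      finally show "t \<mu> \<otimes> (x \<otimes> adj (t \<nu>)) \<in> lspan ?M" .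
    qed (use p in \<open>auto simp: mult_l_distr mult_r_distr smult_mult_left smult_mult_right\<close>)
    moreover have "t \<mu> \<otimes> ((t ?u \<ominus> ?g) \<otimes> adj (t \<nu>)) = sp \<mu> \<nu> \<ominus> munit F (\<mu>, \<nu>)"
      using p u g t_mult_src[of \<mu>]
      by (simp add: mult_minus_left mult_minus_right sp_def munit_def mult_assoc[symmetric])
    ultimately have "sp \<mu> \<nu> \<ominus> munit F (\<mu>, \<nu>) \<in> lspan ?M" by simp
    moreover have "munit F (\<mu>, \<nu>) \<in> lspan ?M" using lspan_base[OF Mc] less.prems by blast
    ultimately have "(sp \<mu> \<nu> \<ominus> munit F (\<mu>, \<nu>)) \<oplus> munit F (\<mu>, \<nu>) \<in> lspan ?M"
      by (rule lspan_add[OF Mc])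
    then show ?case using minus_add_cancel[of "sp \<mu> \<nu>" "munit F (\<mu>, \<nu>)"] munit_carrier[OF less.prems] p by simp
  qed
qed

lemma core_munit:
  assumes "x \<in> core F"
  shows "\<exists>d. x = finsum A (\<lambda>p. d p \<odot> munit F p) (pairs F)"
proof (rule lspan_finsum)
  have "pairs F \<subseteq> F \<times> F" by (auto simp: pairs_def)
  then show "finite (pairs F)" using fF finite_subset by blast
  show "munit F \<in> pairs F \<rightarrow> carrier A" using munit_carrier by auto
  show "x \<in> lspan (munit F ` pairs F)"
    using assms sp_in_span_munit munit_carrier core_gens_carrier unfolding core_def
    by (intro lspan_lspan[of "(\<lambda>(\<mu>, \<nu>). sp \<mu> \<nu>) ` pairs F" "munit F ` pairs F"]) auto
qed

section \<open>Compression of the core by the projection of one block\<close>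

context
  fixes \<nu> \<tau> :: 'p
  assumes \<nu>: "\<nu> \<in> F" and sep: "separating F \<nu> \<tau>"
begin

lemma sep_\<tau>: "\<tau> \<in> paths" "ran \<tau> = src \<nu>"
  using sep by (simp_all add: separating_def)

lemma sep_tails: "\<rho> \<in> tails F \<nu> \<Longrightarrow> \<not> meets \<rho> \<tau>"
  using sep by (simp add: separating_def)

lemma sep_tails_disjoint:
  assumes "\<eta> \<in> F" "\<eta>' \<in> F" "\<mu> \<in> paths" "\<mu>' \<in> paths" "\<kappa> \<in> paths" "\<kappa>' \<in> paths"
    "src \<mu> = ran \<kappa>" "src \<mu>' = ran \<kappa>'" "\<eta> = cmp \<mu> \<kappa>" "\<eta>' = cmp \<mu>' \<kappa>'"
    "src \<eta> = src \<nu>" "src \<eta>' = src \<nu>" "\<kappa> \<noteq> \<kappa>'"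
  shows "\<not> meets (cmp \<kappa> \<tau>) (cmp \<kappa>' \<tau>)"
proof -
  have "\<forall>\<eta>\<in>F. \<forall>\<eta>'\<in>F. \<forall>\<mu>\<in>paths. \<forall>\<mu>'\<in>paths. \<forall>\<kappa>\<in>paths. \<forall>\<kappa>'\<in>paths.
        src \<mu> = ran \<kappa> \<longrightarrow> src \<mu>' = ran \<kappa>' \<longrightarrow> cmp \<mu> \<kappa> = \<eta> \<longrightarrow> cmp \<mu>' \<kappa>' = \<eta>' \<longrightarrow>
        src \<eta> = src \<nu> \<longrightarrow> src \<eta>' = src \<nu> \<longrightarrow> \<kappa> \<noteq> \<kappa>' \<longrightarrow> \<not> meets (cmp \<kappa> \<tau>) (cmp \<kappa>' \<tau>)"
    using sep unfolding separating_def by (elim conjE)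
  from this[rule_format, OF assms(1-8) assms(9,10)[symmetric] assms(11-13)] show ?thesis .
qed

lemma blockD: "\<eta> \<in> block F \<nu> \<Longrightarrow> \<eta> \<in> F \<and> \<eta> \<in> paths \<and> deg \<eta> = deg \<nu> \<and> src \<eta> = src \<nu>"
  using FP by (auto simp: block_def)

definition vec :: "'p \<Rightarrow> 'a" where "vec \<eta> = t (cmp \<eta> \<tau>)"

lemma vec_path: "\<eta> \<in> block F \<nu> \<Longrightarrow> cmp \<eta> \<tau> \<in> paths"
  using blockD[of \<eta>] sep_\<tau> by (intro cmp_closed) auto

lemma vec_carrier: "\<eta> \<in> block F \<nu> \<Longrightarrow> vec \<eta> \<in> carrier A"
  using vec_path by (simp add: vec_def)

text \<open>Both paths have the same degree, so they have a common extension only if they are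
  equal.\<close>

lemma vec_orth:
  assumes "\<eta> \<in> block F \<nu>" "\<eta>' \<in> block F \<nu>"
  shows "adj (vec \<eta>) \<otimes> vec \<eta>' = (if \<eta> = \<eta>' then t (src \<tau>) else \<zero>)"
proof (cases "\<eta> = \<eta>'")
  case True
  then show ?thesis
    using adj_t_mult_t_self[OF vec_path[OF assms(1)]] blockD[OF assms(1)] sep_\<tau> by (simp add: vec_def src_cmp)
next
  case False
  have "deg (cmp \<eta> \<tau>) = deg (cmp \<eta>' \<tau>)"
    using blockD[OF assms(1)] blockD[OF assms(2)] sep_\<tau> by (simp add: deg_cmp)
  moreover have "cmp \<eta> \<tau> \<noteq> cmp \<eta>' \<tau>"
    using cmp_cancel(1)[of \<eta> \<tau> \<eta>' \<tau>] blockD[OF assms(1)] blockD[OF assms(2)] sep_\<tau> False by auto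
  ultimately have "\<not> meets (cmp \<eta> \<tau>) (cmp \<eta>' \<tau>)" using meets_same_deg by blast
  then show ?thesis using adj_t_mult_t_0 vec_path assms False by (simp add: vec_def)
qed

text \<open>By \<open>separating_decides\<close> the path \<mu> is either an initial segment of
  \<eta> or disjoint from \<open>cmp \<eta> \<tau>\<close>; partial overlap does not occur.\<close>

lemma adj_t_mult_vec:
  assumes e: "\<eta> \<in> block F \<nu>" and m: "\<mu> \<in> F"
  shows "\<lbrakk>\<kappa> \<in> paths; src \<mu> = ran \<kappa>; \<eta> = cmp \<mu> \<kappa>\<rbrakk> \<Longrightarrow> adj (t \<mu>) \<otimes> vec \<eta> = t (cmp \<kappa> \<tau>)"
    and "\<not> \<mu> \<preceq> \<eta> \<Longrightarrow> adj (t \<mu>) \<otimes> vec \<eta> = \<zero>"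
proof -
  note e' = blockD[OF e] and m' = FP[OF m]
  { assume k: "\<kappa> \<in> paths" "src \<mu> = ran \<kappa>" "\<eta> = cmp \<mu> \<kappa>"
    have sk: "src \<kappa> = ran \<tau>" using e' k src_cmp[OF m' k(1,2)] sep_\<tau> by simp
    then have "cmp \<eta> \<tau> = cmp \<mu> (cmp \<kappa> \<tau>)" using k m' sep_\<tau> cmp_assoc by simp
    then show "adj (t \<mu>) \<otimes> vec \<eta> = t (cmp \<kappa> \<tau>)"
      using adj_t_mult_t_cmp[OF m', of "cmp \<kappa> \<tau>"] k sk sep_\<tau> by (simp add: vec_def cmp_closed ran_cmp) }
  assume "\<not> \<mu> \<preceq> \<eta>"
  then have "\<not> meets \<mu> (cmp \<eta> \<tau>)" using separating_decides[OF cF \<nu> sep e m] by blast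
  then show "adj (t \<mu>) \<otimes> vec \<eta> = \<zero>" using adj_t_mult_t_0[OF m'] vec_path[OF e] by (simp add: vec_def)
qed

text \<open>If \<rho> starts \<eta>, swapping it for \<sigma> stays inside the block; if not, the
  product vanishes. Thus the vectors span a space invariant under the core.\<close>

lemma sp_mult_vec:
  assumes e: "\<eta> \<in> block F \<nu>" and p: "(\<sigma>, \<rho>) \<in> pairs F"
  shows "sp \<sigma> \<rho> \<otimes> vec \<eta> \<in> insert \<zero> (vec ` block F \<nu>)"
proof (cases "\<rho> \<preceq> \<eta>")
  case True
  have p': "\<sigma> \<in> F" "\<rho> \<in> F" "\<sigma> \<in> paths" "\<rho> \<in> paths" "deg \<sigma> = deg \<rho>" "src \<sigma> = src \<rho>"
    using p FP by (auto simp: pairs_def)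
  obtain \<kappa> where k: "\<kappa> \<in> paths" "src \<rho> = ran \<kappa>" "\<eta> = cmp \<rho> \<kappa>"
    using True by (blast elim: preE)
  have sk: "src \<kappa> = ran \<tau>" using blockD[OF e] k src_cmp[OF p'(4) k(1,2)] sep_\<tau> by simp
  have "cmp \<sigma> \<kappa> \<in> F"
    using core_closed_swap[OF cF p'(1,2) _ k(1) p'(5,6) k(2)] blockD[OF e] k by simp
  then have b: "cmp \<sigma> \<kappa> \<in> block F \<nu>"
    using blockD[OF e] k p' by (simp add: block_def deg_cmp src_cmp)
  have "sp \<sigma> \<rho> \<otimes> vec \<eta> = t \<sigma> \<otimes> t (cmp \<kappa> \<tau>)"
    using adj_t_mult_vec(1)[OF e p'(2) k] p' vec_carrier[OF e] by (simp add: sp_def mult_assoc)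
  also have "\<dots> = vec (cmp \<sigma> \<kappa>)"
    using CK2[of \<sigma> "cmp \<kappa> \<tau>"] p' k sk sep_\<tau> by (simp add: vec_def cmp_closed ran_cmp cmp_assoc)
  finally show ?thesis using b by blast
next
  case False
  then have "sp \<sigma> \<rho> \<otimes> vec \<eta> = \<zero>"
    using adj_t_mult_vec(2)[OF e, of \<rho>] p FP vec_carrier[OF e] by (auto simp: pairs_def sp_def mult_assoc)
  then show ?thesis by simp
qed

text \<open>If \<nu>' does not start \<eta>, its adjoint kills the vector. If it starts \<eta>
  properly, the remainder is a tail of \<nu>', whose factor in the \<open>gap\<close> kills what is
  left. If the two are equal, \<tau> misses all tails and the \<open>gap\<close> fixes
  \<open>t \<tau>\<close>.\<close>

lemma munit_mult_vec:
  assumes e: "\<eta> \<in> block F \<nu>" and p: "(\<mu>', \<nu>') \<in> pairs F"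
  shows "munit F (\<mu>', \<nu>') \<otimes> vec \<eta> = (if \<nu>' = \<eta> then vec \<mu>' else \<zero>)"
proof -
  note e' = blockD[OF e]
  have p': "\<mu>' \<in> F" "\<nu>' \<in> F" "\<mu>' \<in> paths" "\<nu>' \<in> paths" "deg \<mu>' = deg \<nu>'" "src \<mu>' = src \<nu>'"
    using p FP by (auto simp: pairs_def)
  let ?g = "gap (src \<nu>') (tails_list F \<nu>')"
  have g: "?g \<in> carrier A" using gap_tails_carrier p' by simp
  have T: "set (tails_list F \<nu>') = tails F \<nu>'" using tails_list[OF fF cF p'(2)] by simp
  have mv: "munit F (\<mu>', \<nu>') \<otimes> vec \<eta> = t \<mu>' \<otimes> (?g \<otimes> (adj (t \<nu>') \<otimes> vec \<eta>))"
    using p' g vec_carrier[OF e] by (simp add: munit_def mult_assoc)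
  show ?thesis
  proof (cases "\<nu>' \<preceq> \<eta>")
    case False
    then have "\<nu>' \<noteq> \<eta>" using pre_refl p' by blast
    then show ?thesis using mv adj_t_mult_vec(2)[OF e p'(2) False] p' g by simp
  next
    case True
    obtain \<kappa> where k: "\<kappa> \<in> paths" "src \<nu>' = ran \<kappa>" "\<eta> = cmp \<nu>' \<kappa>"
      using True by (blast elim: preE)
    have sk: "src \<kappa> = ran \<tau>" using e' k src_cmp[OF p'(4) k(1,2)] sep_\<tau> by simp
    have kt: "cmp \<kappa> \<tau> \<in> paths" "ran (cmp \<kappa> \<tau>) = src \<nu>'" using k sk sep_\<tau> by (auto simp: cmp_closed ran_cmp)
    have et: "cmp \<eta> \<tau> = cmp \<nu>' (cmp \<kappa> \<tau>)" using k sk sep_\<tau> p' by (simp add: cmp_assoc)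
    have dec: "\<rho> \<preceq> cmp \<kappa> \<tau> \<or> \<not> meets \<rho> (cmp \<kappa> \<tau>)" if r: "\<rho> \<in> tails F \<nu>'" for \<rho>
    proof -
      have r': "\<rho> \<in> paths" "src \<nu>' = ran \<rho>" "cmp \<nu>' \<rho> \<in> F" using r by (simp_all add: tails_def)
      have "cmp \<nu>' \<rho> \<preceq> cmp \<eta> \<tau> \<or> \<not> meets (cmp \<nu>' \<rho>) (cmp \<eta> \<tau>)"
        using sep e r'(3) unfolding separating_def by blast
      then show ?thesis
        unfolding et using pre_cmp_cancel[OF p'(4) r'(1) kt(1) r'(2)] meets_cmp[OF p'(4) r'(1) kt(1) r'(2)] kt(2) by auto
    qed
    have gt: "?g \<otimes> t (cmp \<kappa> \<tau>) = (if \<exists>\<rho>\<in>tails F \<nu>'. \<rho> \<preceq> cmp \<kappa> \<tau> then \<zero> else t (cmp \<kappa> \<tau>))"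
      using gap_mult_t[of "src \<nu>'" "cmp \<kappa> \<tau>" "tails_list F \<nu>'"] T dec kt p' src_vertex
      by (auto simp: paths_to_iff tails_def)
    have av: "adj (t \<nu>') \<otimes> vec \<eta> = t (cmp \<kappa> \<tau>)" using adj_t_mult_vec(1)[OF e p'(2) k] .
    show ?thesis
    proof (cases "deg \<kappa> = 0")
      case True
      then have eq: "\<eta> = \<nu>'" "\<kappa> = src \<nu>'" using k p' cmp_deg_0 deg_0_src[OF k(1)] by simp_all
      then have "cmp \<kappa> \<tau> = \<tau>" using cmp_ran_left[OF sep_\<tau>(1)] sk deg_0_src[OF k(1) True] by simp
      moreover have "\<not> \<rho> \<preceq> \<tau>" if "\<rho> \<in> tails F \<nu>'" for \<rho>
        using that sep_tails[of \<rho>] tails_cong(1)[OF cF \<nu> e] eq(1) pre_meets[of \<rho> \<tau>] by auto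
      ultimately have "?g \<otimes> t (cmp \<kappa> \<tau>) = t \<tau>" using gt by auto
      moreover have "t \<mu>' \<otimes> t \<tau> = vec \<mu>'"
        using CK2[of \<mu>' \<tau>] p' sep_\<tau> e' eq(1) by (simp add: vec_def)
      ultimately show ?thesis using mv av eq(1) by simp
    next
      case False
      then have "\<kappa> \<in> tails F \<nu>'" using k e' by (simp add: tails_def)
      moreover have "\<kappa> \<preceq> cmp \<kappa> \<tau>" using preI k sk sep_\<tau> by simp
      ultimately have "?g \<otimes> t (cmp \<kappa> \<tau>) = \<zero>" using gt by auto
      moreover have "\<nu>' \<noteq> \<eta>"
      proof
        assume "\<nu>' = \<eta>"
        then have "deg \<nu>' = deg \<nu>' + deg \<kappa>" using deg_cmp[OF p'(4) k(1,2)] k(3) by simp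
        then show False using False by simp
      qed
      ultimately show ?thesis using mv av p' by simp
    qed
  qed
qed

definition compr :: 'a where "compr = finsum A (\<lambda>\<eta>. vec \<eta> \<otimes> adj (vec \<eta>)) (block F \<nu>)"

lemma finite_block: "finite (block F \<nu>)"
  using fF by (simp add: block_def)

lemma vv_carrier: "(\<lambda>\<eta>. vec \<eta> \<otimes> adj (vec \<eta>)) \<in> block F \<nu> \<rightarrow> carrier A"
  using vec_carrier by auto

lemma compr_carrier: "compr \<in> carrier A"
  unfolding compr_def using vv_carrier by (rule M.finsum_closed)

lemma vec_mult_vertex:
  assumes e: "\<eta> \<in> block F \<nu>" shows "vec \<eta> \<otimes> t (src \<tau>) = vec \<eta>"
  using t_mult_src[OF vec_path[OF e]] blockD[OF e] sep_\<tau> by (simp add: vec_def src_cmp)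

lemma compr_vec:
  assumes e: "\<eta> \<in> block F \<nu>" shows "compr \<otimes> vec \<eta> = vec \<eta>"
proof -
  have "compr \<otimes> vec \<eta> = finsum A (\<lambda>\<eta>'. vec \<eta>' \<otimes> adj (vec \<eta>') \<otimes> vec \<eta>) (block F \<nu>)"
    unfolding compr_def using finsum_mult_right[OF finite_block vv_carrier vec_carrier[OF e]] .
  also have "\<dots> = vec \<eta> \<otimes> adj (vec \<eta>) \<otimes> vec \<eta>"
    using e vec_carrier vec_orth sep_\<tau> src_closed
    by (intro finsum_single[OF finite_block e]) (auto simp: mult_assoc)
  also have "\<dots> = vec \<eta>"
    using vec_orth[OF e e] vec_carrier[OF e] vec_mult_vertex[OF e] by (simp add: mult_assoc)
  finally show ?thesis .
qed

lemma compr_proj: "adj compr = compr" "compr \<otimes> compr = compr" "nrm compr \<le> 1"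
proof -
  have 1: "vec \<eta> \<otimes> adj (vec \<eta>) \<in> carrier A \<and> adj (vec \<eta> \<otimes> adj (vec \<eta>)) = vec \<eta> \<otimes> adj (vec \<eta>) \<and>
      (vec \<eta> \<otimes> adj (vec \<eta>)) \<otimes> (vec \<eta> \<otimes> adj (vec \<eta>)) = vec \<eta> \<otimes> adj (vec \<eta>)" if e: "\<eta> \<in> block F \<nu>" for \<eta>
  proof (intro conjI)
    show "vec \<eta> \<otimes> adj (vec \<eta>) \<in> carrier A" "adj (vec \<eta> \<otimes> adj (vec \<eta>)) = vec \<eta> \<otimes> adj (vec \<eta>)"
      using vec_carrier[OF e] by (simp_all add: adj_mult adj_adj)
    have "(vec \<eta> \<otimes> adj (vec \<eta>)) \<otimes> (vec \<eta> \<otimes> adj (vec \<eta>)) = vec \<eta> \<otimes> ((adj (vec \<eta>) \<otimes> vec \<eta>) \<otimes> adj (vec \<eta>))"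
      using vec_carrier[OF e] by (simp add: mult_assoc)
    also have "\<dots> = (vec \<eta> \<otimes> t (src \<tau>)) \<otimes> adj (vec \<eta>)"
      using vec_orth[OF e e] vec_carrier[OF e] sep_\<tau> by (simp add: mult_assoc src_closed)
    finally show "(vec \<eta> \<otimes> adj (vec \<eta>)) \<otimes> (vec \<eta> \<otimes> adj (vec \<eta>)) = vec \<eta> \<otimes> adj (vec \<eta>)"
      using vec_mult_vertex[OF e] by simp
  qed
  have 2: "(vec \<eta> \<otimes> adj (vec \<eta>)) \<otimes> (vec \<eta>' \<otimes> adj (vec \<eta>')) = \<zero>"
    if e: "\<eta> \<in> block F \<nu>" "\<eta>' \<in> block F \<nu>" "\<eta> \<noteq> \<eta>'" for \<eta> \<eta>'
  proof -
    have "(vec \<eta> \<otimes> adj (vec \<eta>)) \<otimes> (vec \<eta>' \<otimes> adj (vec \<eta>')) = vec \<eta> \<otimes> ((adj (vec \<eta>) \<otimes> vec \<eta>') \<otimes> adj (vec \<eta>'))"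
      using vec_carrier e by (simp add: mult_assoc)
    then show ?thesis using vec_orth[OF e(1,2)] e vec_carrier by simp
  qed
  show a: "adj compr = compr"
    unfolding compr_def by (rule finsum_projection(1)[OF finite_block 1 2])
  show m: "compr \<otimes> compr = compr"
    unfolding compr_def by (rule finsum_projection(2)[OF finite_block 1 2])
  show "nrm compr \<le> 1" by (rule nrm_projection[OF compr_carrier a m])
qed

text \<open>The range of \<open>compr\<close> is generated by the vectors, and every generator of
  the core maps a vector to a vector or to zero.\<close>

lemma compr_core:
  assumes "x \<in> core F" shows "compr \<otimes> (x \<otimes> compr) = x \<otimes> compr"
  using assms unfolding core_def
proof induction
  case zero
  then show ?case using compr_carrier by simp
next
  case (add x g c)
  have xc: "x \<in> carrier A" using lspan_carrier[OF core_gens_carrier add(1)] .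
  obtain \<sigma> \<rho> where g: "(\<sigma>, \<rho>) \<in> pairs F" "g = sp \<sigma> \<rho>" using add by auto
  have gc: "g \<in> carrier A" using g FP by (auto simp: pairs_def)
  have gv: "compr \<otimes> (g \<otimes> vec \<eta>) = g \<otimes> vec \<eta>" if "\<eta> \<in> block F \<nu>" for \<eta>
    using sp_mult_vec[OF that g(1)] compr_vec compr_carrier g(2) by auto
  have gQ: "g \<otimes> compr = finsum A (\<lambda>\<eta>. g \<otimes> (vec \<eta> \<otimes> adj (vec \<eta>))) (block F \<nu>)"
    unfolding compr_def using finsum_mult_left[OF finite_block vv_carrier gc] .
  have "compr \<otimes> (g \<otimes> compr) = compr \<otimes> finsum A (\<lambda>\<eta>. g \<otimes> (vec \<eta> \<otimes> adj (vec \<eta>))) (block F \<nu>)"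
    using gQ by simp
  also have "\<dots> = finsum A (\<lambda>\<eta>. compr \<otimes> (g \<otimes> (vec \<eta> \<otimes> adj (vec \<eta>)))) (block F \<nu>)"
    using gc vec_carrier by (intro finsum_mult_left[OF finite_block _ compr_carrier]) auto
  also have "\<dots> = finsum A (\<lambda>\<eta>. g \<otimes> (vec \<eta> \<otimes> adj (vec \<eta>))) (block F \<nu>)"
  proof (rule M.finsum_cong')
    fix \<eta> assume e: "\<eta> \<in> block F \<nu>"
    have "compr \<otimes> (g \<otimes> (vec \<eta> \<otimes> adj (vec \<eta>))) = (compr \<otimes> (g \<otimes> vec \<eta>)) \<otimes> adj (vec \<eta>)"
      using gc compr_carrier vec_carrier[OF e] by (simp add: mult_assoc)
    then show "compr \<otimes> (g \<otimes> (vec \<eta> \<otimes> adj (vec \<eta>))) = g \<otimes> (vec \<eta> \<otimes> adj (vec \<eta>))"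
      using gv[OF e] gc vec_carrier[OF e] by (simp add: mult_assoc)
  qed (use gc vec_carrier in auto)
  finally have "compr \<otimes> (g \<otimes> compr) = g \<otimes> compr" using gQ by simp
  moreover have "(c \<odot> g \<oplus> x) \<otimes> compr = c \<odot> (g \<otimes> compr) \<oplus> x \<otimes> compr"
    using xc gc compr_carrier by (simp add: mult_l_distr smult_mult_left)
  moreover have "compr \<otimes> (c \<odot> (g \<otimes> compr) \<oplus> x \<otimes> compr) = c \<odot> (compr \<otimes> (g \<otimes> compr)) \<oplus> compr \<otimes> (x \<otimes> compr)"
    using xc gc compr_carrier by (simp add: mult_r_distr smult_mult_right)
  ultimately show ?case
    using add.IH by (simp only:)
qed

text \<open>An entry between two vectors is zero or reduces to \<open>adj (t (cmp \<kappa> \<tau>))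
  \<otimes> t (cmp \<kappa>' \<tau>)\<close>. All paths of the block have the same degree while
  \<mu> and \<mu>' do not, so \<kappa> and \<kappa>' differ and \<tau> separates them.\<close>

lemma compr_off_diagonal:
  assumes m: "\<mu> \<in> F" "\<mu>' \<in> F" "src \<mu> = src \<mu>'" "deg \<mu> \<noteq> deg \<mu>'"
  shows "compr \<otimes> (sp \<mu> \<mu>' \<otimes> compr) = \<zero>"
proof -
  have mp: "\<mu> \<in> paths" "\<mu>' \<in> paths" using m FP by auto
  have z: "adj (vec \<eta>) \<otimes> (sp \<mu> \<mu>' \<otimes> vec \<eta>') = \<zero>" if e: "\<eta> \<in> block F \<nu>" "\<eta>' \<in> block F \<nu>" for \<eta> \<eta>'
  proof -
    note c = vec_carrier[OF e(1)] vec_carrier[OF e(2)]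
    have eq: "adj (vec \<eta>) \<otimes> (sp \<mu> \<mu>' \<otimes> vec \<eta>') = adj (adj (t \<mu>) \<otimes> vec \<eta>) \<otimes> (adj (t \<mu>') \<otimes> vec \<eta>')"
      using c mp by (simp add: sp_def mult_assoc adj_mult adj_adj)
    show ?thesis
    proof (cases "\<mu> \<preceq> \<eta> \<and> \<mu>' \<preceq> \<eta>'")
      case False
      then have "adj (t \<mu>) \<otimes> vec \<eta> = \<zero> \<or> adj (t \<mu>') \<otimes> vec \<eta>' = \<zero>"
        using adj_t_mult_vec(2) e m by blast
      then show ?thesis using eq c mp by auto
    next
      case True
      obtain \<kappa> where k: "\<kappa> \<in> paths" "src \<mu> = ran \<kappa>" "\<eta> = cmp \<mu> \<kappa>"
        using True by (blast elim: preE)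
      obtain \<kappa>' where k': "\<kappa>' \<in> paths" "src \<mu>' = ran \<kappa>'" "\<eta>' = cmp \<mu>' \<kappa>'"
        using True by (blast elim: preE)
      note e' = blockD[OF e(1)] blockD[OF e(2)]
      have "deg \<mu> + deg \<kappa> = deg \<mu>' + deg \<kappa>'"
        using deg_cmp[OF mp(1) k(1,2)] deg_cmp[OF mp(2) k'(1,2)] e' k(3) k'(3) by simp
      then have ne: "\<kappa> \<noteq> \<kappa>'" using m(4) by auto
      have nm: "\<not> meets (cmp \<kappa> \<tau>) (cmp \<kappa>' \<tau>)"
        using sep_tails_disjoint[of \<eta> \<eta>' \<mu> \<mu>' \<kappa> \<kappa>'] e' mp k k' ne by simp
      have "src \<kappa> = ran \<tau>" "src \<kappa>' = ran \<tau>"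
        using src_cmp[OF mp(1) k(1,2)] src_cmp[OF mp(2) k'(1,2)] k(3) k'(3) e' sep_\<tau> by simp_all
      then have "cmp \<kappa> \<tau> \<in> paths" "cmp \<kappa>' \<tau> \<in> paths" using k k' sep_\<tau> by (auto simp: cmp_closed)
      then have "adj (t (cmp \<kappa> \<tau>)) \<otimes> t (cmp \<kappa>' \<tau>) = \<zero>" using adj_t_mult_t_0 nm by blast
      then show ?thesis
        using eq adj_t_mult_vec(1)[OF e(1) m(1) k] adj_t_mult_vec(1)[OF e(2) m(2) k'] by simp
    qed
  qed
  have Qz: "compr \<otimes> (sp \<mu> \<mu>' \<otimes> vec \<eta>') = \<zero>" if e: "\<eta>' \<in> block F \<nu>" for \<eta>'
  proof -
    have c: "sp \<mu> \<mu>' \<otimes> vec \<eta>' \<in> carrier A" using vec_carrier[OF e] mp by simp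
    have "compr \<otimes> (sp \<mu> \<mu>' \<otimes> vec \<eta>') = finsum A (\<lambda>\<eta>. vec \<eta> \<otimes> adj (vec \<eta>) \<otimes> (sp \<mu> \<mu>' \<otimes> vec \<eta>')) (block F \<nu>)"
      unfolding compr_def using finsum_mult_right[OF finite_block vv_carrier c] .
    also have "\<dots> = finsum A (\<lambda>\<eta>. \<zero>) (block F \<nu>)"
    proof (rule M.finsum_cong')
      fix \<eta> assume e1: "\<eta> \<in> block F \<nu>"
      have "vec \<eta> \<otimes> adj (vec \<eta>) \<otimes> (sp \<mu> \<mu>' \<otimes> vec \<eta>') = vec \<eta> \<otimes> (adj (vec \<eta>) \<otimes> (sp \<mu> \<mu>' \<otimes> vec \<eta>'))"
        using c vec_carrier[OF e1] by (simp add: mult_assoc)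
      then show "vec \<eta> \<otimes> adj (vec \<eta>) \<otimes> (sp \<mu> \<mu>' \<otimes> vec \<eta>') = \<zero>"
        using z[OF e1 e] vec_carrier[OF e1] by simp
    qed auto
    finally show ?thesis by simp
  qed
  have s: "sp \<mu> \<mu>' \<in> carrier A" using mp by simp
  have "compr \<otimes> (sp \<mu> \<mu>' \<otimes> compr) = compr \<otimes> finsum A (\<lambda>\<eta>. sp \<mu> \<mu>' \<otimes> (vec \<eta> \<otimes> adj (vec \<eta>))) (block F \<nu>)"
    using finsum_mult_left[OF finite_block vv_carrier s] by (simp add: compr_def)
  also have "\<dots> = finsum A (\<lambda>\<eta>. compr \<otimes> (sp \<mu> \<mu>' \<otimes> (vec \<eta> \<otimes> adj (vec \<eta>)))) (block F \<nu>)"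
    using s vec_carrier by (intro finsum_mult_left[OF finite_block _ compr_carrier]) auto
  also have "\<dots> = finsum A (\<lambda>\<eta>. \<zero>) (block F \<nu>)"
  proof (rule M.finsum_cong')
    fix \<eta> assume e: "\<eta> \<in> block F \<nu>"
    have "compr \<otimes> (sp \<mu> \<mu>' \<otimes> (vec \<eta> \<otimes> adj (vec \<eta>))) = (compr \<otimes> (sp \<mu> \<mu>' \<otimes> vec \<eta>)) \<otimes> adj (vec \<eta>)"
      using s compr_carrier vec_carrier[OF e] by (simp add: mult_assoc)
    then show "compr \<otimes> (sp \<mu> \<mu>' \<otimes> (vec \<eta> \<otimes> adj (vec \<eta>))) = \<zero>"
      using Qz[OF e] vec_carrier[OF e] by simp
  qed auto
  finally show ?thesis by simp
qed

text \<open>On the vectors the elements \<open>munit F p\<close> act as genuine matrix units, so an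
  entry of x isolates one coefficient, times the projection at \<open>src \<tau>\<close>. Units of
  other blocks contribute nothing.\<close>

lemma coefficient:
  assumes d: "x = finsum A (\<lambda>p. d p \<odot> munit F p) (pairs F)" and e: "\<eta> \<in> block F \<nu>" "\<eta>' \<in> block F \<nu>"
  shows "adj (vec \<eta>) \<otimes> (x \<otimes> vec \<eta>') = d (\<eta>, \<eta>') \<odot> t (src \<tau>)"
proof -
  have "pairs F \<subseteq> F \<times> F" by (auto simp: pairs_def)
  then have fin: "finite (pairs F)" using fF finite_subset by blast
  have p: "(\<eta>, \<eta>') \<in> pairs F" using blockD[OF e(1)] blockD[OF e(2)] by (simp add: pairs_def)
  have mc: "(\<lambda>p. d p \<odot> munit F p) \<in> pairs F \<rightarrow> carrier A" using munit_carrier by auto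
  have c: "vec \<eta> \<in> carrier A" "vec \<eta>' \<in> carrier A" using vec_carrier e by auto
  have tv: "t (src \<tau>) \<in> carrier A" using sep_\<tau> src_closed by simp
  have "x \<otimes> vec \<eta>' = finsum A (\<lambda>p. d p \<odot> munit F p \<otimes> vec \<eta>') (pairs F)"
    unfolding d using finsum_mult_right[OF fin mc c(2)] .
  also have "adj (vec \<eta>) \<otimes> \<dots> = finsum A (\<lambda>p. adj (vec \<eta>) \<otimes> (d p \<odot> munit F p \<otimes> vec \<eta>')) (pairs F)"
    using mc c by (intro finsum_mult_left[OF fin]) (auto simp: munit_carrier)
  also have "\<dots> = adj (vec \<eta>) \<otimes> (d (\<eta>, \<eta>') \<odot> munit F (\<eta>, \<eta>') \<otimes> vec \<eta>')"
  proof (rule finsum_single[OF fin p])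
    show "adj (vec \<eta>) \<otimes> (d (\<eta>, \<eta>') \<odot> munit F (\<eta>, \<eta>') \<otimes> vec \<eta>') \<in> carrier A"
      using munit_carrier[OF p] c by simp
    fix q assume q: "q \<in> pairs F" "q \<noteq> (\<eta>, \<eta>')"
    obtain \<mu>' \<nu>' where q': "q = (\<mu>', \<nu>')" by (cases q)
    have "munit F q \<otimes> vec \<eta>' = (if \<nu>' = \<eta>' then vec \<mu>' else \<zero>)"
      using munit_mult_vec[OF e(2)] q q' by simp
    moreover have "adj (vec \<eta>) \<otimes> vec \<mu>' = \<zero>" if "\<nu>' = \<eta>'"
    proof -
      have "\<mu>' \<in> block F \<nu>" using q(1) q' that blockD[OF e(2)] by (simp add: pairs_def block_def)
      then show ?thesis using vec_orth[OF e(1)] q(2) q' that by auto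
    qed
    moreover have "adj (vec \<eta>) \<otimes> (d q \<odot> munit F q \<otimes> vec \<eta>') = d q \<odot> (adj (vec \<eta>) \<otimes> (munit F q \<otimes> vec \<eta>'))"
      using munit_carrier[OF q(1)] c by (simp add: smult_mult_left smult_mult_right)
    ultimately show "adj (vec \<eta>) \<otimes> (d q \<odot> munit F q \<otimes> vec \<eta>') = \<zero>" using c by auto
  qed
  also have "\<dots> = d (\<eta>, \<eta>') \<odot> (adj (vec \<eta>) \<otimes> (munit F (\<eta>, \<eta>') \<otimes> vec \<eta>'))"
    using munit_carrier[OF p] c by (simp add: smult_mult_left smult_mult_right)
  also have "\<dots> = d (\<eta>, \<eta>') \<odot> t (src \<tau>)"
    using munit_mult_vec[OF e(2) p] vec_orth[OF e(1,1)] by simp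
  finally show ?thesis .
qed

end

end

end

context cstar_algebra
begin

lemma nrm_adj:
  assumes "x \<in> carrier A" shows "nrm (adj x) = nrm x"
proof -
  have le: "nrm y \<le> nrm (adj y)" if y: "y \<in> carrier A" for y
  proof (cases "nrm y = 0")
    case True
    then show ?thesis using nrm_nonneg[of "adj y"] y by simp
  next
    case False
    then have "nrm y > 0" using nrm_nonneg[OF y] by simp
    moreover have "nrm y * nrm y \<le> nrm (adj y) * nrm y"
      using cstar_identity[OF y] nrm_mult[of "adj y" y] y by (simp add: power2_eq_square)
    ultimately show ?thesis by simp
  qed
  show ?thesis using le[OF assms] le[of "adj x"] assms by (simp add: adj_adj)
qed

text \<open>
  Both uniqueness steps below bound \<open>nrm h\<close> for self-adjoint \<open>h\<close> only up to a factor that grows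
  subexponentially along \<open>isq j h\<close>; the C*-identity then removes the factor.
\<close>

lemma nrm_le_by_isq:
  assumes h: "h \<in> carrier A" "adj h = h" and D: "D \<ge> 0"
    and le: "\<And>j. nrm (isq j h) \<le> C * (2 ^ j) ^ k * D ^ 2 ^ j"
  shows "nrm h \<le> D"
  by (rule power_comparison[of "nrm h" D C k]) (use le nrm_isq(1)[OF h] nrm_nonneg[OF h(1)] D in auto)

text \<open>Multiplication is Lipschitz in each factor separately, so one factor is approximated at
  a time; the closure of the closure that results is the closure.\<close>

lemma nclosure_mult:
  assumes S: "S \<subseteq> carrier A" "\<And>x y. \<lbrakk>x \<in> S; y \<in> S\<rbrakk> \<Longrightarrow> x \<otimes> y \<in> S" and xy: "x \<in> nclosure S" "y \<in> nclosure S"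
  shows "x \<otimes> y \<in> nclosure S"
proof -
  have c: "x \<in> carrier A" "y \<in> carrier A" using xy by (auto simp: nclosure_def)
  have NC: "nclosure S \<subseteq> carrier A" by (auto simp: nclosure_def)
  have step: "x \<otimes> z \<in> nclosure S" if z: "z \<in> S" for z
  proof (rule nclosure_map[OF xy(1) S(1), where f = "\<lambda>x. x \<otimes> z" and K = "nrm z"])
    have zc: "z \<in> carrier A" using z S by auto
    then show "x \<otimes> z \<in> carrier A" using c by simp
    fix y assume y: "y \<in> S"
    then show "y \<otimes> z \<in> S" using S z by simp
    have yc: "y \<in> carrier A" using y S by auto
    show "nrm (x \<otimes> z \<ominus> y \<otimes> z) \<le> nrm z * nrm (x \<ominus> y)"
      using nrm_mult[of "x \<ominus> y" z] c yc zc by (simp add: mult_minus_left mult.commute)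
  qed
  have "x \<otimes> y \<in> nclosure (nclosure S)"
  proof (rule nclosure_map[OF xy(2) S(1), where f = "\<lambda>y. x \<otimes> y" and K = "nrm x"])
    show "x \<otimes> y \<in> carrier A" using c by simp
    fix z assume z: "z \<in> S"
    show "x \<otimes> z \<in> nclosure S" using step z .
    have zc: "z \<in> carrier A" using z S by auto
    show "nrm (x \<otimes> y \<ominus> x \<otimes> z) \<le> nrm x * nrm (y \<ominus> z)"
      using nrm_mult[of x "y \<ominus> z"] c zc by (simp add: mult_minus_right)
  qed
  moreover have "nclosure (nclosure S) \<subseteq> nclosure S"
    using norm_closed_nclosure[OF S(1)] unfolding norm_closed_iff by (auto simp: nclosure_def)
  ultimately show ?thesis by blast
qed

lemma nclosure_adj:
  assumes S: "S \<subseteq> carrier A" "\<And>x. x \<in> S \<Longrightarrow> adj x \<in> S" and x: "x \<in> nclosure S"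
  shows "adj x \<in> nclosure S"
proof (rule nclosure_map[OF x S(1), where f = "\<lambda>x. adj x" and K = 1])
  have c: "x \<in> carrier A" using x by (auto simp: nclosure_def)
  then show "adj x \<in> carrier A" by simp
  fix y assume y: "y \<in> S"
  then show "adj y \<in> S" using S by simp
  show "nrm (adj x \<ominus> adj y) \<le> 1 * nrm (x \<ominus> y)"
    using nrm_adj[of "x \<ominus> y"] c y S by (auto simp: adj_minus subset_iff)
qed

end

context kgraph_ck_family
begin

subsection \<open>The grading by differences of degrees\<close>

definition ddeg :: "'p \<Rightarrow> 'p \<Rightarrow> 'k \<Rightarrow> int" where
  "ddeg \<mu> \<nu> = (\<lambda>i. int (deg \<mu> i) - int (deg \<nu> i))"

definition gens :: "('k \<Rightarrow> int) set \<Rightarrow> 'a set" where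
  "gens S = {x. \<exists>\<mu>\<in>paths. \<exists>\<nu>\<in>paths. src \<mu> = src \<nu> \<and> ddeg \<mu> \<nu> \<in> S \<and> x = sp \<mu> \<nu>}"

text \<open>Indexed by sets of degrees, so that homogeneous elements, remainders such as
  \<open>graded (- {m})\<close> and the whole span \<open>graded UNIV\<close> are instances of one
  notion.\<close>

definition graded :: "('k \<Rightarrow> int) set \<Rightarrow> 'a set" where
  "graded S = lspan (gens S)"

lemma gens_carrier: "gens S \<subseteq> carrier A"
  by (auto simp: gens_def)

lemma graded_carrier: "x \<in> graded S \<Longrightarrow> x \<in> carrier A"
  unfolding graded_def by (rule lspan_carrier[OF gens_carrier])

lemma graded_add: "\<lbrakk>x \<in> graded S; y \<in> graded S\<rbrakk> \<Longrightarrow> x \<oplus> y \<in> graded S"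
  unfolding graded_def by (rule lspan_add[OF gens_carrier])

lemma graded_mono: "\<lbrakk>x \<in> graded S; S \<subseteq> T\<rbrakk> \<Longrightarrow> x \<in> graded T"
  unfolding graded_def by (rule lspan_mono[of "gens S"]) (auto simp: gens_def)

text \<open>In every term of the expanded product
  \<open>deg \<nu> + deg \<alpha> = deg \<sigma> + deg \<beta>\<close>, which makes
  \<open>ddeg\<close> additive.\<close>

lemma graded_mult:
  assumes ST: "\<And>m n. \<lbrakk>m \<in> S; n \<in> T\<rbrakk> \<Longrightarrow> m + n \<in> U" and "x \<in> graded S" "y \<in> graded T"
  shows "x \<otimes> y \<in> graded U"
  using assms(2,3) unfolding graded_def
proof (rule lspan_mult[OF gens_carrier gens_carrier gens_carrier, rotated])
  fix g h assume "g \<in> gens S" "h \<in> gens T"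
  then obtain \<mu> \<nu> \<sigma> \<tau> where p: "\<mu> \<in> paths" "\<nu> \<in> paths" "\<sigma> \<in> paths" "\<tau> \<in> paths"
    "src \<mu> = src \<nu>" "src \<sigma> = src \<tau>" "ddeg \<mu> \<nu> \<in> S" "ddeg \<sigma> \<tau> \<in> T" and gh: "g = sp \<mu> \<nu>" "h = sp \<sigma> \<tau>"
    unfolding gens_def by auto
  show "g \<otimes> h \<in> lspan (gens U)"
    unfolding gh
  proof (rule sp_mult_sp[OF p(1-6) gens_carrier])
    fix \<alpha> \<beta> assume a: "\<alpha> \<in> paths" "\<beta> \<in> paths" "src \<nu> = ran \<alpha>" "src \<sigma> = ran \<beta>"
      "cmp \<nu> \<alpha> = cmp \<sigma> \<beta>"
    have d: "deg \<nu> + deg \<alpha> = deg \<sigma> + deg \<beta>" "src \<alpha> = src \<beta>"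
      using arg_cong[OF a(5), of "deg"] arg_cong[OF a(5), of "src"] p a(1-4) by (simp_all add: deg_cmp src_cmp)
    have c: "cmp \<mu> \<alpha> \<in> paths" "cmp \<tau> \<beta> \<in> paths" "src (cmp \<mu> \<alpha>) = src (cmp \<tau> \<beta>)"
      "deg (cmp \<mu> \<alpha>) = deg \<mu> + deg \<alpha>" "deg (cmp \<tau> \<beta>) = deg \<tau> + deg \<beta>"
      using p a(1-4) d by (simp_all add: cmp_closed src_cmp deg_cmp)
    have "ddeg (cmp \<mu> \<alpha>) (cmp \<tau> \<beta>) = ddeg \<mu> \<nu> + ddeg \<sigma> \<tau>"
    proof
      fix i
      have "deg \<nu> i + deg \<alpha> i = deg \<sigma> i + deg \<beta> i" using fun_cong[OF d(1), of i] by simp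
      then show "ddeg (cmp \<mu> \<alpha>) (cmp \<tau> \<beta>) i = (ddeg \<mu> \<nu> + ddeg \<sigma> \<tau>) i"
        using c by (simp add: ddeg_def)
    qed
    then have "ddeg (cmp \<mu> \<alpha>) (cmp \<tau> \<beta>) \<in> U" using ST p by simp
    then have "sp (cmp \<mu> \<alpha>) (cmp \<tau> \<beta>) \<in> gens U" using c(1-3) unfolding gens_def by blast
    then show "sp (cmp \<mu> \<alpha>) (cmp \<tau> \<beta>) \<in> lspan (gens U)" by (rule lspan_base[OF gens_carrier])
  qed
qed

lemma graded_adj:
  assumes "x \<in> graded S" "\<And>n. n \<in> S \<Longrightarrow> - n \<in> T" shows "adj x \<in> graded T"
  unfolding graded_def
proof (rule lspan_adj[OF gens_carrier gens_carrier])
  show "x \<in> lspan (gens S)" using assms by (simp add: graded_def)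
  fix g assume "g \<in> gens S"
  then obtain \<mu> \<nu> where p: "\<mu> \<in> paths" "\<nu> \<in> paths" "src \<mu> = src \<nu>" "ddeg \<mu> \<nu> \<in> S" "g = sp \<mu> \<nu>"
    unfolding gens_def by auto
  have "ddeg \<nu> \<mu> = - ddeg \<mu> \<nu>" by (auto simp: ddeg_def)
  then have "ddeg \<nu> \<mu> \<in> T" using p assms(2) by simp
  then have "adj g \<in> gens T" using p(1-3,5) unfolding gens_def by (intro CollectI bexI[of _ \<nu>] bexI[of _ \<mu>]) (simp_all add: adj_sp)
  then show "adj g \<in> lspan (gens T)" by (rule lspan_base[OF gens_carrier])
qed

lemma finite_paths_of_gens:
  assumes "finite Y" "Y \<subseteq> gens S"
  shows "\<exists>E. finite E \<and> E \<subseteq> paths \<and> (\<forall>x\<in>Y. \<exists>\<mu>\<in>E. \<exists>\<nu>\<in>E. src \<mu> = src \<nu> \<and> ddeg \<mu> \<nu> \<in> S \<and> x = sp \<mu> \<nu>)"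
  using assms
proof (induction Y rule: finite_induct)
  case empty
  then show ?case by (intro exI[of _ "{}"]) simp
next
  case (insert x Y)
  then obtain E where E: "finite E" "E \<subseteq> paths" "\<forall>x\<in>Y. \<exists>\<mu>\<in>E. \<exists>\<nu>\<in>E. src \<mu> = src \<nu> \<and> ddeg \<mu> \<nu> \<in> S \<and> x = sp \<mu> \<nu>"
    by auto
  obtain \<mu> \<nu> where p: "\<mu> \<in> paths" "\<nu> \<in> paths" "src \<mu> = src \<nu> \<and> ddeg \<mu> \<nu> \<in> S \<and> x = sp \<mu> \<nu>"
    using insert.prems unfolding gens_def by auto
  show ?case
  proof (intro exI[of _ "insert \<mu> (insert \<nu> E)"] conjI ballI)
    fix y assume "y \<in> insert x Y"
    then consider "y = x" | "y \<in> Y" by blast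
    then show "\<exists>\<mu>'\<in>insert \<mu> (insert \<nu> E). \<exists>\<nu>'\<in>insert \<mu> (insert \<nu> E). src \<mu>' = src \<nu>' \<and> ddeg \<mu>' \<nu>' \<in> S \<and> y = sp \<mu>' \<nu>'"
    proof cases
      case 1
      then show ?thesis using p(3) by (intro bexI[of _ \<mu>] bexI[of _ \<nu>]) auto
    next
      case 2
      then show ?thesis using E(3) by (meson insertCI)
    qed
  qed (use E p in auto)
qed

lemma graded_insert:
  assumes "x \<in> graded (insert m S)"
  shows "\<exists>a\<in>graded {m}. \<exists>b\<in>graded S. x = a \<oplus> b"
  using assms unfolding graded_def
proof induction
  case zero
  show ?case by (intro bexI[of _ \<zero>]) (auto intro: lspan.zero)
next
  case (add x g c)
  then obtain a b where ab: "a \<in> lspan (gens {m})" "b \<in> lspan (gens S)" "x = a \<oplus> b" by auto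
  have cc: "a \<in> carrier A" "b \<in> carrier A" "g \<in> carrier A"
    using lspan_carrier[OF gens_carrier] ab add(2) gens_carrier by auto
  have "g \<in> gens {m} \<or> g \<in> gens S" using add(2) unfolding gens_def by blast
  then show ?case
  proof
    assume "g \<in> gens {m}"
    then have "c \<odot> g \<oplus> a \<in> lspan (gens {m})" using ab lspan.add by blast
    moreover have "c \<odot> g \<oplus> x = (c \<odot> g \<oplus> a) \<oplus> b" using cc ab by (simp add: M.a_assoc)
    ultimately show ?thesis using ab by blast
  next
    assume "g \<in> gens S"
    then have "c \<odot> g \<oplus> b \<in> lspan (gens S)" using ab lspan.add by blast
    moreover have "c \<odot> g \<oplus> x = a \<oplus> (c \<odot> g \<oplus> b)" using cc ab by (simp add: M.a_lcomm)
    ultimately show ?thesis using ab by blast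
  qed
qed

definition box :: "nat \<Rightarrow> ('k \<Rightarrow> int) set" where
  "box R = {f. \<forall>i. \<bar>f i\<bar> \<le> int R}"

lemma box_eq: "box R = Pi\<^sub>E UNIV (\<lambda>_. {- int R..int R})"
  by (auto simp: box_def PiE_def Pi_def abs_le_iff) (metis minus_le_iff)+

lemma finite_box: "finite (box R)"
  unfolding box_eq by (intro finite_PiE) auto

lemma card_box: "card (box R) = (2 * R + 1) ^ CARD('k)"
proof -
  have "card {- int R..int R} = 2 * R + 1" by simp
  then show ?thesis unfolding box_eq by (subst card_PiE) auto
qed

lemma graded_box:
  assumes "x \<in> graded UNIV" shows "\<exists>R. x \<in> graded (box R)"
  using assms unfolding graded_def
proof induction
  case zero
  show ?case by (intro exI lspan.zero)
next
  case (add x g c)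
  then obtain R where R: "x \<in> lspan (gens (box R))" by blast
  obtain \<mu> \<nu> where g: "\<mu> \<in> paths" "\<nu> \<in> paths" "src \<mu> = src \<nu>" "g = sp \<mu> \<nu>"
    using add unfolding gens_def by blast
  define R' where "R' = R + tot \<mu> + tot \<nu>"
  have le: "deg \<eta> i \<le> tot \<eta>" for \<eta> i unfolding tot_def by (rule member_le_sum) auto
  have "ddeg \<mu> \<nu> \<in> box R'"
    unfolding box_def
  proof (intro CollectI allI)
    fix i show "\<bar>ddeg \<mu> \<nu> i\<bar> \<le> int R'" using le[of \<mu> i] le[of \<nu> i] by (simp add: ddeg_def R'_def)
  qed
  then have "g \<in> gens (box R')" using g unfolding gens_def by blast
  moreover have "box R \<subseteq> box R'"
  proof
    fix f assume "f \<in> box R"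
    then have "\<bar>f i\<bar> \<le> int R" for i by (simp add: box_def)
    then have "\<bar>f i\<bar> \<le> int R'" for i using order_trans[of "\<bar>f i\<bar>" "int R" "int R'"] by (simp add: R'_def)
    then show "f \<in> box R'" by (simp add: box_def)
  qed
  then have "x \<in> lspan (gens (box R'))" using graded_mono[of x "box R" "box R'"] R unfolding graded_def by blast
  ultimately show ?case using lspan.add by blast
qed

subsection \<open>The norm on the span of the generators\<close>

lemma nrm_t: "\<eta> \<in> paths \<Longrightarrow> nrm (t \<eta>) \<le> 1"
proof -
  assume e: "\<eta> \<in> paths"
  have "(nrm (t \<eta>))\<^sup>2 = nrm (t (src \<eta>))"
    using cstar_identity[of "t \<eta>"] adj_t_mult_t_self[OF e] e by simp
  also have "\<dots> \<le> 1"
    using nrm_projection t_vertex[OF src_vertex[OF e]] e src_closed by simp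
  finally show ?thesis by (simp add: power_le_one_iff abs_square_le_1)
qed

section \<open>Distance from an ideal that contains no vertex projection\<close>

context
  fixes I :: "'a set"
  assumes I: "cstar_ideal A I" and tI: "\<And>v. v \<in> vertices \<Longrightarrow> t v \<notin> I" and ap: "kgraph_aperiodic \<Lambda>"
begin

definition offdiag :: "'p set \<Rightarrow> 'a set" where
  "offdiag F = {x. \<exists>\<mu>\<in>F. \<exists>\<nu>\<in>F. src \<mu> = src \<nu> \<and> deg \<mu> \<noteq> deg \<nu> \<and> x = sp \<mu> \<nu>}"

text \<open>Collects what the estimate on the core uses of one block. The constant is 1 / \<delta>,
  where \<delta> separates the projection at \<open>src \<tau>\<close> from I: it is a multiple of
  this projection that remains of x when one coefficient is isolated.\<close>

lemma block_compression:
  assumes F: "finite F" "core_closed F" and \<nu>: "\<nu> \<in> F" "tails F \<nu> \<notin> FE (src \<nu>)"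
  shows "\<exists>q C. q \<in> carrier A \<and> nrm q \<le> 1 \<and> C \<ge> 0 \<and> (\<forall>x\<in>core F. q \<otimes> (x \<otimes> q) = x \<otimes> q) \<and>
     (\<forall>x\<in>offdiag F. q \<otimes> (x \<otimes> q) = \<zero>) \<and>
     (\<forall>d D \<eta>. \<eta> \<in> block F \<nu> \<longrightarrow> near I (finsum A (\<lambda>p. d p \<odot> munit F p) (pairs F) \<otimes> q) D \<longrightarrow> cmod (d (\<eta>, \<nu>)) \<le> C * D)"
proof -
  obtain \<tau> where s: "separating F \<nu> \<tau>" using separating_exists[OF ap F \<nu>] .
  let ?q = "compr F \<nu> \<tau>" and ?v = "src \<tau>"
  note c = F \<nu>(1) s
  have v: "?v \<in> vertices" "?v \<in> paths" using sep_\<tau>[OF c] src_vertex src_closed by auto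
  obtain \<delta> where d: "\<delta> > 0" "\<And>c D. near I (c \<odot> t ?v) D \<Longrightarrow> cmod c * \<delta> \<le> D"
    using near_scalar[OF I _ tI[OF v(1)]] v by blast
  have mb: "munit F p \<in> carrier A" if "p \<in> pairs F" for p using munit_carrier[OF F that] .
  show ?thesis
  proof (intro exI[of _ ?q] exI[of _ "1 / \<delta>"] conjI ballI allI impI)
    show "?q \<in> carrier A" using compr_carrier[OF c] .
    show "nrm ?q \<le> 1" using compr_proj(3)[OF c] .
    show "0 \<le> 1 / \<delta>" using d by simp
    show "?q \<otimes> (x \<otimes> ?q) = x \<otimes> ?q" if "x \<in> core F" for x using compr_core[OF c that] .
    show "?q \<otimes> (x \<otimes> ?q) = \<zero>" if "x \<in> offdiag F" for x
      using that compr_off_diagonal[OF c] unfolding offdiag_def by auto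
    fix d' D \<eta>
    assume e: "\<eta> \<in> block F \<nu>" and n: "near I (finsum A (\<lambda>p. d' p \<odot> munit F p) (pairs F) \<otimes> ?q) D"
    let ?x = "finsum A (\<lambda>p. d' p \<odot> munit F p) (pairs F)"
    let ?a = "vec \<tau> \<eta>" and ?b = "vec \<tau> \<nu>"
    have bn: "\<nu> \<in> block F \<nu>" using \<nu> by (simp add: block_def)
    have x: "?x \<in> carrier A" using mb by (auto intro!: M.finsum_closed)
    have ab: "?a \<in> carrier A" "?b \<in> carrier A" "nrm (adj ?a) \<le> 1" "nrm ?b \<le> 1"
      using vec_carrier[OF c e] vec_carrier[OF c bn] nrm_adj[of ?a] nrm_t vec_path[OF c e] vec_path[OF c bn]
        vec_def[OF c] by auto
    \<comment> \<open>The vectors are contractions, so multiplying by them on both sides does not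
      increase the distance from I.\<close>
    have "near I (adj ?a \<otimes> (?x \<otimes> ?q) \<otimes> ?b) D"
      using near_compress[OF I _ _ _ ab(2) ab(4) n] x compr_carrier[OF c] ab by simp
    moreover have "adj ?a \<otimes> (?x \<otimes> ?q) \<otimes> ?b = adj ?a \<otimes> (?x \<otimes> (?q \<otimes> ?b))"
      using x compr_carrier[OF c] ab by (simp add: mult_assoc)
    moreover have "\<dots> = d' (\<eta>, \<nu>) \<odot> t ?v"
      using compr_vec[OF c bn] coefficient[OF c refl e bn] by simp
    ultimately have "cmod (d' (\<eta>, \<nu>)) * \<delta> \<le> D" using d(2) by simp
    then show "cmod (d' (\<eta>, \<nu>)) \<le> 1 / \<delta> * D" using d(1) by (simp add: field_simps)
  qed
qed

text \<open>Reading off coefficients bounds the norm by \<open>K * D'\<close>, where K depends on F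
  and the chosen compressions but not on the element. For self-adjoint h this bound is applied to
  the powers \<open>isq j h\<close>, which removes K; a general x is reduced to
  \<open>adj x \<otimes> x\<close>.\<close>

lemma core_estimate:
  assumes F: "finite F" "core_closed F" and x: "x \<in> core F" and r: "r \<in> lspan (offdiag F)"
    and n: "near I (x \<oplus> r) D"
  shows "nrm x \<le> D"
proof -
  let ?N = "{\<nu> \<in> F. tails F \<nu> \<notin> FE (src \<nu>)}"
  have FP: "\<eta> \<in> paths" if "\<eta> \<in> F" for \<eta> using that F by (auto simp: core_closed_def)
  have cc: "y \<in> carrier A" if "y \<in> core F" for y using core_carrier[OF F that] .
  have oc: "offdiag F \<subseteq> carrier A" using FP by (auto simp: offdiag_def)
  have rc: "r \<in> carrier A" using lspan_carrier[OF oc r] .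
  have xc: "x \<in> carrier A" using cc[OF x] .
  have D: "D \<ge> 0" using near_nonneg[OF I _ n] xc rc by simp
  have "\<forall>\<nu>\<in>?N. \<exists>qC. fst qC \<in> carrier A \<and> nrm (fst qC) \<le> 1 \<and> snd qC \<ge> 0 \<and>
      (\<forall>x\<in>core F. fst qC \<otimes> (x \<otimes> fst qC) = x \<otimes> fst qC) \<and> (\<forall>x\<in>offdiag F. fst qC \<otimes> (x \<otimes> fst qC) = \<zero>) \<and>
      (\<forall>d D \<eta>. \<eta> \<in> block F \<nu> \<longrightarrow> near I (finsum A (\<lambda>p. d p \<odot> munit F p) (pairs F) \<otimes> fst qC) D \<longrightarrow>
         cmod (d (\<eta>, \<nu>)) \<le> snd qC * D)"
    using block_compression[OF F] by simp
  then obtain qC where qC: "\<forall>\<nu>\<in>?N. fst (qC \<nu>) \<in> carrier A \<and> nrm (fst (qC \<nu>)) \<le> 1 \<and> snd (qC \<nu>) \<ge> 0 \<and>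
      (\<forall>x\<in>core F. fst (qC \<nu>) \<otimes> (x \<otimes> fst (qC \<nu>)) = x \<otimes> fst (qC \<nu>)) \<and>
      (\<forall>x\<in>offdiag F. fst (qC \<nu>) \<otimes> (x \<otimes> fst (qC \<nu>)) = \<zero>) \<and>
      (\<forall>d D \<eta>. \<eta> \<in> block F \<nu> \<longrightarrow> near I (finsum A (\<lambda>p. d p \<odot> munit F p) (pairs F) \<otimes> fst (qC \<nu>)) D \<longrightarrow>
         cmod (d (\<eta>, \<nu>)) \<le> snd (qC \<nu>) * D)"
    by (rule bchoice[THEN exE])
  define q C where "q = (\<lambda>\<nu>. fst (qC \<nu>))" and "C = (\<lambda>\<nu>. snd (qC \<nu>))"
  have q: "q \<nu> \<in> carrier A" "nrm (q \<nu>) \<le> 1" "C \<nu> \<ge> 0" "\<And>x. x \<in> core F \<Longrightarrow> q \<nu> \<otimes> (x \<otimes> q \<nu>) = x \<otimes> q \<nu>"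
    "\<And>x. x \<in> offdiag F \<Longrightarrow> q \<nu> \<otimes> (x \<otimes> q \<nu>) = \<zero>"
    "\<And>d D \<eta>. \<lbrakk>\<eta> \<in> block F \<nu>; near I (finsum A (\<lambda>p. d p \<odot> munit F p) (pairs F) \<otimes> q \<nu>) D\<rbrakk> \<Longrightarrow> cmod (d (\<eta>, \<nu>)) \<le> C \<nu> * D"
    if "\<nu> \<in> ?N" for \<nu>
    using bspec[OF qC that] unfolding q_def C_def by simp_all
  \<comment> \<open>Columns at an exhaustive set of tails get weight zero; their matrix units vanish
    by \<open>CK4\<close>.\<close>
  define K where "K = (\<Sum>p\<in>pairs F. (if snd p \<in> ?N then C (snd p) else 0) * nrm (munit F p))"
  have "pairs F \<subseteq> F \<times> F" by (auto simp: pairs_def)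
  then have finp: "finite (pairs F)" using F finite_subset by blast
  have munit_0: "munit F p = \<zero>" if "p \<in> pairs F" "snd p \<notin> ?N" for p
  proof -
    obtain \<mu> \<nu> where p: "p = (\<mu>, \<nu>)" by (cases p)
    then have m: "\<mu> \<in> F" "\<nu> \<in> F" "tails F \<nu> \<in> FE (src \<nu>)" using that by (auto simp: pairs_def)
    have "gap (src \<nu>) (tails_list F \<nu>) = \<zero>"
      using gap_FE[OF src_vertex] FP[OF m(2)] m(3) tails_list[OF F m(2)] by simp
    then show ?thesis using p m FP by (simp add: munit_def)
  qed
  have bound: "nrm y \<le> K * D'"
    if y: "y \<in> core F" and D': "D' \<ge> 0" and ny: "\<And>\<nu>. \<nu> \<in> ?N \<Longrightarrow> near I (y \<otimes> q \<nu>) D'" for y D'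
  proof -
    obtain d where d: "y = finsum A (\<lambda>p. d p \<odot> munit F p) (pairs F)" using core_munit[OF F y] by blast
    have "nrm y \<le> (\<Sum>p\<in>pairs F. nrm (d p \<odot> munit F p))"
      unfolding d using munit_carrier[OF F] by (intro nrm_finsum[OF finp]) auto
    also have "\<dots> \<le> (\<Sum>p\<in>pairs F. (if snd p \<in> ?N then C (snd p) else 0) * nrm (munit F p) * D')"
    proof (rule sum_mono)
      fix p assume p: "p \<in> pairs F"
      have mc: "munit F p \<in> carrier A" using munit_carrier[OF F p] .
      show "nrm (d p \<odot> munit F p) \<le> (if snd p \<in> ?N then C (snd p) else 0) * nrm (munit F p) * D'"
      proof (cases "snd p \<in> ?N")
        case True
        have pe: "p = (fst p, snd p)" by simp
        have "fst p \<in> block F (snd p)" using p by (auto simp: pairs_def block_def)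
        then have "cmod (d p) \<le> C (snd p) * D'"
          using q(6)[OF True, of "fst p" d D'] ny[OF True] d pe by simp
        then have "cmod (d p) * nrm (munit F p) \<le> C (snd p) * D' * nrm (munit F p)"
          using nrm_nonneg[OF mc] by (intro mult_right_mono)
        then show ?thesis using True mc by (simp add: nrm_smult mult.commute mult.left_commute)
      next
        case False
        then show ?thesis using munit_0[OF p False] by simp
      qed
    qed
    also have "\<dots> = K * D'" by (simp add: K_def sum_distrib_right)
    finally show ?thesis .
  qed
  have selfadj: "nrm h \<le> D'"
    if h: "h \<in> core F" "adj h = h" and D': "D' \<ge> 0" and nh: "\<And>\<nu>. \<nu> \<in> ?N \<Longrightarrow> near I (h \<otimes> q \<nu>) D'" for h D'
  proof (rule nrm_le_by_isq[OF cc[OF h(1)] h(2) D', of K 0])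
    fix j
    have hj: "isq j h \<in> core F" by (induction j) (use h core_mult[OF F] in auto)
    \<comment> \<open>By invariance the powers of \<open>h \<otimes> q \<nu>\<close> are the powers
      of h times \<open>q \<nu>\<close>, so distances multiply without loss.\<close>
    have "near I (isq j h \<otimes> q \<nu>) (D' ^ 2 ^ j)" if \<nu>: "\<nu> \<in> ?N" for \<nu>
    proof -
      have "isq i h \<otimes> q \<nu> = isq i (h \<otimes> q \<nu>) \<and> isq i h \<in> core F" for i
      proof (induction i)
        case (Suc i)
        then have y: "isq i h \<in> core F" "isq i h \<in> carrier A" using cc by auto
        have "isq (Suc i) (h \<otimes> q \<nu>) = (isq i h \<otimes> q \<nu>) \<otimes> (isq i h \<otimes> q \<nu>)" using Suc by simp
        also have "\<dots> = isq i h \<otimes> (q \<nu> \<otimes> (isq i h \<otimes> q \<nu>))" using y q(1)[OF \<nu>] by (simp add: mult_assoc)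
        also have "\<dots> = isq (Suc i) h \<otimes> q \<nu>" using y q(1)[OF \<nu>] q(4)[OF \<nu> y(1)] by (simp add: mult_assoc)
        finally show ?case using core_mult[OF F y(1) y(1)] by simp
      qed (use h in simp)
      then show ?thesis using near_isq[OF I _ nh[OF \<nu>]] cc[OF h(1)] q(1)[OF \<nu>] by simp
    qed
    then have "nrm (isq j h) \<le> K * D' ^ 2 ^ j" using bound[OF hj, of "D' ^ 2 ^ j"] D' by simp
    then show "nrm (isq j h) \<le> K * (2 ^ j) ^ 0 * D' ^ 2 ^ j" by simp
  qed
  \<comment> \<open>Compression on both sides removes r and, by invariance, turns x into
    \<open>x \<otimes> q \<nu>\<close>.\<close>
  have nx: "near I (x \<otimes> q \<nu>) D" if \<nu>: "\<nu> \<in> ?N" for \<nu>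
  proof -
    have "q \<nu> \<otimes> (r \<otimes> q \<nu>) = \<zero>"
      using r
    proof induction
      case (add y g c)
      have yc: "y \<in> carrier A" "g \<in> carrier A" using lspan_carrier[OF oc add(1)] oc add(2) by auto
      have "q \<nu> \<otimes> ((c \<odot> g \<oplus> y) \<otimes> q \<nu>) = c \<odot> (q \<nu> \<otimes> (g \<otimes> q \<nu>)) \<oplus> q \<nu> \<otimes> (y \<otimes> q \<nu>)"
        using yc q(1)[OF \<nu>] by (simp add: mult_l_distr mult_r_distr smult_mult_left smult_mult_right)
      then show ?case using add.IH q(5)[OF \<nu> add(2)] by simp
    qed (use q(1)[OF \<nu>] in simp)
    then have "q \<nu> \<otimes> (x \<oplus> r) \<otimes> q \<nu> = x \<otimes> q \<nu>"
      using q(1)[OF \<nu>] q(4)[OF \<nu> x] xc rc by (simp add: mult_assoc mult_l_distr mult_r_distr)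
    moreover have "near I (q \<nu> \<otimes> (x \<oplus> r) \<otimes> q \<nu>) D"
      using near_compress[OF I _ q(1,2)[OF \<nu>] q(1,2)[OF \<nu>] n] xc rc by simp
    ultimately show ?thesis by simp
  qed
  have "nrm (adj x \<otimes> x) \<le> nrm x * D"
  proof (rule selfadj)
    show "adj x \<otimes> x \<in> core F" using core_mult[OF F core_adj[OF F x] x] .
    show "adj (adj x \<otimes> x) = adj x \<otimes> x" using xc by (simp add: adj_mult adj_adj)
    show "0 \<le> nrm x * D" using D nrm_nonneg[OF xc] by simp
    fix \<nu> assume \<nu>: "\<nu> \<in> ?N"
    show "near I (adj x \<otimes> x \<otimes> q \<nu>) (nrm x * D)"
      using near_mult_left[OF I _ _ nx[OF \<nu>], of "adj x"] xc q(1)[OF \<nu>] nrm_adj[OF xc] by (simp add: mult_assoc)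
  qed
  then have "nrm x * nrm x \<le> nrm x * D" using cstar_identity[OF xc] by (simp add: power2_eq_square)
  then show ?thesis using nrm_nonneg[OF xc] D by (cases "nrm x = 0") auto
qed

text \<open>Only finitely many paths occur in x and r; a finite \<open>core_closed\<close> set
  containing them makes \<open>core_estimate\<close> applicable.\<close>

lemma graded_estimate:
  assumes x: "x \<in> graded {0}" and r: "r \<in> graded (- {0})" and n: "near I (x \<oplus> r) D"
  shows "nrm x \<le> D"
proof -
  have d0: "ddeg \<mu> \<nu> = 0 \<longleftrightarrow> deg \<mu> = deg \<nu>" for \<mu> \<nu> by (auto simp: ddeg_def fun_eq_iff)
  obtain Y1 where Y1: "finite Y1" "Y1 \<subseteq> gens {0}" "x \<in> lspan Y1" using lspan_finite x unfolding graded_def by blast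
  obtain Y2 where Y2: "finite Y2" "Y2 \<subseteq> gens (- {0})" "r \<in> lspan Y2" using lspan_finite r unfolding graded_def by blast
  obtain E1 where E1: "finite E1" "E1 \<subseteq> paths" "\<forall>x\<in>Y1. \<exists>\<mu>\<in>E1. \<exists>\<nu>\<in>E1. src \<mu> = src \<nu> \<and> ddeg \<mu> \<nu> \<in> {0} \<and> x = sp \<mu> \<nu>"
    using finite_paths_of_gens[OF Y1(1,2)] by (elim exE conjE)
  obtain E2 where E2: "finite E2" "E2 \<subseteq> paths" "\<forall>x\<in>Y2. \<exists>\<mu>\<in>E2. \<exists>\<nu>\<in>E2. src \<mu> = src \<nu> \<and> ddeg \<mu> \<nu> \<in> - {0} \<and> x = sp \<mu> \<nu>"
    using finite_paths_of_gens[OF Y2(1,2)] by (elim exE conjE)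
  obtain F where F: "finite F" "E1 \<union> E2 \<subseteq> F" "core_closed F"
    using core_closed_exists[OF fa, of "E1 \<union> E2"] E1(1,2) E2(1,2) by auto
  have "Y1 \<subseteq> (\<lambda>(\<mu>, \<nu>). sp \<mu> \<nu>) ` pairs F"
  proof
    fix y assume "y \<in> Y1"
    then obtain \<mu> \<nu> where "\<mu> \<in> E1" "\<nu> \<in> E1" "src \<mu> = src \<nu>" "ddeg \<mu> \<nu> = 0" "y = sp \<mu> \<nu>" using E1(3) by blast
    then have "(\<mu>, \<nu>) \<in> pairs F" "y = (\<lambda>(\<mu>, \<nu>). sp \<mu> \<nu>) (\<mu>, \<nu>)" using F(2) d0 by (auto simp: pairs_def)
    then show "y \<in> (\<lambda>(\<mu>, \<nu>). sp \<mu> \<nu>) ` pairs F" by blast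
  qed
  then have xF: "x \<in> core F" using lspan_mono Y1(3) unfolding core_def by blast
  have "Y2 \<subseteq> offdiag F"
  proof
    fix y assume "y \<in> Y2"
    then obtain \<mu> \<nu> where "\<mu> \<in> E2" "\<nu> \<in> E2" "src \<mu> = src \<nu>" "ddeg \<mu> \<nu> \<noteq> 0" "y = sp \<mu> \<nu>" using E2(3) by blast
    then show "y \<in> offdiag F" using F(2) d0 unfolding offdiag_def by blast
  qed
  then have rF: "r \<in> lspan (offdiag F)" using lspan_mono Y2(3) by blast
  show ?thesis using core_estimate[OF F(1,3) xF rF n] .
qed

text \<open>Left multiplication by \<open>adj x\<close> moves degree m to degree zero and keeps the
  other degrees away from zero; the C*-identity returns from \<open>adj x \<otimes> x\<close> to
  x.\<close>

lemma component_estimate: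
  assumes x: "x \<in> graded {m}" and r: "r \<in> graded (- {m})" and n: "near I (x \<oplus> r) D"
  shows "nrm x \<le> D"
proof -
  have c: "x \<in> carrier A" "r \<in> carrier A" using graded_carrier x r by auto
  have a: "adj x \<in> graded {- m}" using graded_adj[OF x] by simp
  have "adj x \<otimes> x \<in> graded {0}" using graded_mult[OF _ a x, of "{0}"] by simp
  moreover have "adj x \<otimes> r \<in> graded (- {0})" using graded_mult[OF _ a r, of "- {0}"] by simp
  moreover have "near I (adj x \<otimes> x \<oplus> adj x \<otimes> r) (nrm x * D)"
    using near_mult_left[OF I _ _ n, of "adj x"] c nrm_adj[OF c(1)] by (simp add: mult_r_distr)
  ultimately have "nrm (adj x \<otimes> x) \<le> nrm x * D" by (rule graded_estimate)
  then have "nrm x * nrm x \<le> nrm x * D" using cstar_identity[OF c(1)] by (simp add: power2_eq_square)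
  moreover have "D \<ge> 0" using near_nonneg[OF I _ n] c by simp
  ultimately show ?thesis using nrm_nonneg[OF c(1)] by (cases "nrm x = 0") auto
qed

text \<open>Each homogeneous component is estimated on its own, with all other components counted as
  remainder; the triangle inequality adds up the bounds.\<close>

lemma graded_card_estimate:
  assumes "finite S" "S \<inter> T = {}" "x \<in> graded S" "y \<in> graded T" "near I (x \<oplus> y) D"
  shows "nrm x \<le> real (card S) * D"
  using assms
proof (induction S arbitrary: T x y rule: finite_induct)
  case empty
  have "x = \<zero>" using empty(2) unfolding graded_def by (cases rule: lspan.cases) (auto simp: gens_def)
  then show ?case by simp
next
  case (insert m S)
  obtain a b where ab: "a \<in> graded {m}" "b \<in> graded S" "x = a \<oplus> b" using graded_insert insert.prems by blast
  have c: "a \<in> carrier A" "b \<in> carrier A" "y \<in> carrier A" using ab insert.prems graded_carrier by auto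
  have "b \<oplus> y \<in> graded (- {m})"
    using ab insert by (intro graded_add) (auto elim!: graded_mono)
  moreover have "near I (a \<oplus> (b \<oplus> y)) D" using insert.prems(4) ab c by (simp add: M.a_assoc)
  ultimately have 1: "nrm a \<le> D" using component_estimate[OF ab(1)] by blast
  have "a \<oplus> y \<in> graded (insert m T)"
    using graded_add[OF graded_mono[OF ab(1)] graded_mono[OF insert.prems(3)], of "insert m T"] by blast
  moreover have "near I (b \<oplus> (a \<oplus> y)) D" using insert.prems(4) ab c by (simp add: M.a_ac)
  moreover have "S \<inter> insert m T = {}" using insert by auto
  ultimately have 2: "nrm b \<le> real (card S) * D" using insert.IH[OF _ ab(2)] by blast
  have "nrm x \<le> nrm a + nrm b" using ab c nrm_add by simp
  then show ?case using 1 2 insert.hyps by (simp add: algebra_simps)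
qed

text \<open>The group \<open>\<int>\<^sup>k\<close> has polynomial growth, which replaces an averaging over the gauge action.\<close>

lemma span_estimate:
  assumes x: "x \<in> graded UNIV" and n: "near I x D"
  shows "nrm x \<le> D"
proof -
  have xc: "x \<in> carrier A" using graded_carrier x .
  have D: "D \<ge> 0" using near_nonneg[OF I xc n] .
  let ?h = "adj x \<otimes> x"
  have hc: "?h \<in> carrier A" using xc by simp
  have h: "?h \<in> graded UNIV" using graded_mult[OF _ graded_adj[OF x, of UNIV] x, of UNIV] by simp
  then obtain R where R: "?h \<in> graded (box R)" using graded_box by blast
  have nh: "near I ?h (nrm x * D)" using near_mult_left[OF I xc _ n, of "adj x"] xc nrm_adj[OF xc] by simp
  \<comment> \<open>With k = \<open>CARD('k)\<close>, a box of radius 2 ^ j * R has (2 * 2 ^ j * R +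
    1) ^ k points, which is at most (2 * R + 1) ^ k * (2 ^ j) ^ k; this is where C comes
    from.\<close>
  have "nrm ?h \<le> nrm x * D"
  proof (rule nrm_le_by_isq[OF hc, where k = "CARD('k)" and C = "real (2 * R + 1) ^ CARD('k)"])
    show "adj ?h = ?h" using xc by (simp add: adj_mult adj_adj)
    show nD: "0 \<le> nrm x * D" using D nrm_nonneg[OF xc] by simp
    fix j
    \<comment> \<open>Degrees add up in products, so squaring doubles the radius of the box.\<close>
    have "isq j ?h \<in> graded (box (2 ^ j * R))"
    proof (induction j)
      case (Suc j)
      have "m + n \<in> box (2 ^ Suc j * R)" if "m \<in> box (2 ^ j * R)" "n \<in> box (2 ^ j * R)" for m n
        unfolding box_def
      proof (intro CollectI allI)
        fix i
        have "\<bar>m i\<bar> \<le> int (2 ^ j * R)" "\<bar>n i\<bar> \<le> int (2 ^ j * R)" using that by (auto simp: box_def)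
        then show "\<bar>(m + n) i\<bar> \<le> int (2 ^ Suc j * R)" by (simp add: mult.assoc)
      qed
      then show ?case using graded_mult[OF _ Suc Suc] by simp
    qed (use R in simp)
    moreover have "\<zero> \<in> graded {}" unfolding graded_def by (rule lspan.zero)
    moreover have "near I (isq j ?h \<oplus> \<zero>) ((nrm x * D) ^ 2 ^ j)" using near_isq[OF I hc nh] hc by simp
    ultimately have "nrm (isq j ?h) \<le> real (card (box (2 ^ j * R))) * (nrm x * D) ^ 2 ^ j"
      using graded_card_estimate[OF finite_box] by blast
    also have "\<dots> \<le> (real (2 * R + 1) ^ CARD('k) * (2 ^ j) ^ CARD('k)) * (nrm x * D) ^ 2 ^ j"
    proof (rule mult_right_mono)
      have "2 * (2 ^ j * R) + 1 \<le> (2 * R + 1) * (2 ^ j :: nat)" by (simp add: algebra_simps)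
      then have "(2 * (2 ^ j * R) + 1) ^ CARD('k) \<le> ((2 * R + 1) * 2 ^ j) ^ CARD('k)" by (rule power_mono) simp
      then have "card (box (2 ^ j * R)) \<le> (2 * R + 1) ^ CARD('k) * (2 ^ j) ^ CARD('k)"
        by (simp only: card_box power_mult_distrib)
      then have "real (card (box (2 ^ j * R))) \<le> real ((2 * R + 1) ^ CARD('k) * (2 ^ j) ^ CARD('k))"
        by (rule of_nat_mono)
      then show "real (card (box (2 ^ j * R))) \<le> real (2 * R + 1) ^ CARD('k) * (2 ^ j) ^ CARD('k)"
        by (simp only: of_nat_mult of_nat_power of_nat_numeral)
      show "0 \<le> (nrm x * D) ^ 2 ^ j" using nD by simp
    qed
    finally show "nrm (isq j ?h) \<le> real (2 * R + 1) ^ CARD('k) * (2 ^ j) ^ CARD('k) * (nrm x * D) ^ 2 ^ j" .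
  qed
  then have "nrm x * nrm x \<le> nrm x * D" using cstar_identity[OF xc] by (simp add: power2_eq_square)
  then show ?thesis using nrm_nonneg[OF xc] D by (cases "nrm x = 0") auto
qed

end

end

subsection \<open>Simplicity of aperiodic and cofinal graphs\<close>

context kgraph_ck_family
begin

lemma t_graded: "\<eta> \<in> paths \<Longrightarrow> t \<eta> \<in> graded UNIV"
proof -
  assume e: "\<eta> \<in> paths"
  let ?u = "src \<eta>"
  have u: "?u \<in> paths" "src ?u = ?u" using e by (auto simp: src_closed src_src)
  have "t \<eta> = sp \<eta> ?u" using t_mult_src[OF e] t_vertex[OF src_vertex[OF e]] by (simp add: sp_def)
  then have "t \<eta> \<in> gens UNIV" unfolding gens_def using e u by (intro CollectI bexI[of _ \<eta>] bexI[of _ ?u]) simp_all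
  then show ?thesis unfolding graded_def by (rule lspan_base[OF gens_carrier])
qed

lemma graded_UNIV_subset: "graded UNIV \<subseteq> carrier A"
  using graded_carrier by blast

lemma cstar_subalgebra_closure: "cstar_subalgebra A (nclosure (graded UNIV))"
  unfolding cstar_subalgebra_def
proof (intro conjI ballI)
  show "submodule (nclosure (graded UNIV)) complex_ring A"
    by (rule nclosure_submodule[OF graded_UNIV_subset])
      (auto simp: graded_def lspan.zero intro: lspan_add[OF gens_carrier] lspan_smult[OF gens_carrier])
  show "norm_closed A (nclosure (graded UNIV))" by (rule norm_closed_nclosure[OF graded_UNIV_subset])
  show "x \<otimes> y \<in> nclosure (graded UNIV)" if "x \<in> nclosure (graded UNIV)" "y \<in> nclosure (graded UNIV)" for x y
    by (rule nclosure_mult[OF graded_UNIV_subset _ that]) (rule graded_mult[of UNIV UNIV UNIV], simp_all)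
  show "adj x \<in> nclosure (graded UNIV)" if "x \<in> nclosure (graded UNIV)" for x
    by (rule nclosure_adj[OF graded_UNIV_subset _ that]) (rule graded_adj[of _ UNIV UNIV], simp_all)
qed

text \<open>If y in the span is within e / 2 of an element x of I, then I comes within e / 2 of y,
  so \<open>span_estimate\<close> bounds the norm of y by e / 2 and that of x by e.\<close>

lemma ideal_without_vertices:
  assumes gen: "\<And>S. \<lbrakk>cstar_subalgebra A S; t ` paths \<subseteq> S\<rbrakk> \<Longrightarrow> S = carrier A"
    and I: "cstar_ideal A I" and tI: "\<And>v. v \<in> vertices \<Longrightarrow> t v \<notin> I" and ap: "kgraph_aperiodic \<Lambda>"
  shows "I = {\<zero>}"
proof -
  have "t ` paths \<subseteq> nclosure (graded UNIV)"
    using t_graded nclosure_subset[OF graded_UNIV_subset] by blast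
  then have dense: "nclosure (graded UNIV) = carrier A" by (rule gen[OF cstar_subalgebra_closure])
  have "x = \<zero>" if x: "x \<in> I" for x
  proof -
    have xc: "x \<in> carrier A" using x cstar_idealD(1)[OF I] by auto
    have "nrm x \<le> e" if e: "e > 0" for e
    proof -
      have "x \<in> nclosure (graded UNIV)" using dense xc by simp
      then obtain y where y: "y \<in> graded UNIV" "nrm (x \<ominus> y) < e / 2"
        using nclosureE[of x "graded UNIV" "e / 2"] e by auto
      have yc: "y \<in> carrier A" using graded_carrier y by blast
      have "near I y (e / 2)"
        unfolding near_def using x y(2) nrm_minus_commute[OF xc yc] by (intro bexI[of _ x]) auto
      then have "nrm y \<le> e / 2" using span_estimate[OF I tI ap y(1)] by blast
      then show ?thesis using nrm_le_add_minus[OF xc yc] y(2) by simp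
    qed
    then have "nrm x \<le> 0" by (rule field_le_epsilon[of "nrm x" 0, simplified])
    then show ?thesis using nrm_nonneg[OF xc] nrm_eq_0_iff[OF xc] by simp
  qed
  then show ?thesis using cstar_idealD(2)[OF I] by blast
qed

text \<open>Modulo I every factor of the product is \<open>t w\<close>.\<close>

lemma gap_mod_ideal:
  assumes I: "cstar_ideal A I" and w: "w \<in> vertices" and \<eta>s: "\<And>\<eta>. \<eta> \<in> set \<eta>s \<Longrightarrow> \<eta> \<in> paths \<and> sp \<eta> \<eta> \<in> I"
  shows "\<exists>i\<in>I. gap w \<eta>s = t w \<oplus> i"
  using \<eta>s
proof (induction \<eta>s)
  case Nil
  then show ?case using w vertex_path cstar_idealD(2)[OF I] by (intro bexI[of _ \<zero>]) auto
next
  case (Cons \<eta> \<eta>s)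
  then obtain i where i: "i \<in> I" "gap w \<eta>s = t w \<oplus> i" by auto
  have c: "t w \<in> carrier A" "i \<in> carrier A" "sp \<eta> \<eta> \<in> carrier A" "sp \<eta> \<eta> \<in> I"
    using w vertex_path i cstar_idealD(1)[OF I] Cons.prems by auto
  have "gap w (\<eta> # \<eta>s) = (t w \<oplus> t w \<otimes> i) \<ominus> sp \<eta> \<eta> \<otimes> (t w \<oplus> i)"
    using i mult_minus_left[of "t w \<oplus> i" "t w" "sp \<eta> \<eta>"] mult_r_distr[of "t w" "t w" i] c t_vertex[OF w] by simp
  also have "\<dots> = t w \<oplus> (t w \<otimes> i \<ominus> sp \<eta> \<eta> \<otimes> (t w \<oplus> i))"
    using c by (simp add: a_minus_def M.a_assoc)
  finally show ?case
    using c i cstar_idealD[OF I] by (intro bexI[of _ "t w \<otimes> i \<ominus> sp \<eta> \<eta> \<otimes> (t w \<oplus> i)"]) auto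
qed

text \<open>Along a path with range v, membership in I passes from \<open>t v\<close> to the
  projection at its source, hence to \<open>t \<alpha>\<close> for every \<alpha> in an exhaustive
  set at w. Then \<open>CK4\<close> exhibits \<open>t w\<close> as the negative of an element of
  I.\<close>

lemma ideal_with_vertex:
  assumes gen: "\<And>S. \<lbrakk>cstar_subalgebra A S; t ` paths \<subseteq> S\<rbrakk> \<Longrightarrow> S = carrier A"
    and I: "cstar_ideal A I" and v: "v \<in> vertices" "t v \<in> I" and cof: "kgraph_cofinal \<Lambda>"
  shows "I = carrier A"
proof -
  note ID = cstar_idealD[OF I]
  have tw: "t w \<in> I" if w: "w \<in> vertices" for w
  proof -
    obtain E where E: "E \<in> FE w" "\<forall>\<alpha>\<in>E. {\<eta> \<in> paths_to v. src \<eta> = src \<alpha>} \<noteq> {}"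
      using cof v(1) w unfolding kgraph_cofinal_def by blast
    have EI: "\<alpha> \<in> paths \<and> sp \<alpha> \<alpha> \<in> I" if a: "\<alpha> \<in> E" for \<alpha>
    proof -
      have ap: "\<alpha> \<in> paths" using E(1) a by (auto simp: FE_iff paths_to_iff)
      obtain \<eta> where e: "\<eta> \<in> paths" "ran \<eta> = v" "src \<eta> = src \<alpha>"
        using E(2) a unfolding paths_to_iff by blast
      have "t \<eta> \<in> I" using ID(7)[of "t \<eta>" "t v"] v e ran_mult_t[of \<eta>] by simp
      then have "t (src \<eta>) \<in> I" using ID(6)[of "adj (t \<eta>)" "t \<eta>"] adj_t_mult_t_self[OF e(1)] e by simp
      then have "t \<alpha> \<in> I" using ID(6)[of "t \<alpha>" "t (src \<alpha>)"] t_mult_src[OF ap] ap e(3) by simp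
      then show ?thesis using ID(7)[of "adj (t \<alpha>)" "t \<alpha>"] ap by (simp add: sp_def)
    qed
    obtain \<eta>s where l: "set \<eta>s = E" "distinct \<eta>s" using E(1) finite_distinct_list unfolding FE_iff by blast
    have "gap w \<eta>s = \<zero>" using gap_FE[OF w] l E(1) by simp
    then obtain i where i: "i \<in> I" "t w \<oplus> i = \<zero>" using gap_mod_ideal[OF I w, of \<eta>s] EI l by auto
    have c: "t w \<in> carrier A" "i \<in> carrier A" using w vertex_path i ID(1) by auto
    have "t w = \<zero> \<ominus> i" using add_minus_cancel[OF c] i by simp
    then show ?thesis using ID(4)[OF ID(2) i(1)] by simp
  qed
  have tI: "t \<eta> \<in> I" "adj (t \<eta>) \<in> I" if e: "\<eta> \<in> paths" for \<eta>
  proof -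
    let ?w = "ran \<eta>"
    have w: "?w \<in> vertices" "t ?w \<in> carrier A" using ran_vertex[OF e] vertex_path by auto
    show "t \<eta> \<in> I" using ID(7)[of "t \<eta>" "t ?w"] tw[OF w(1)] e ran_mult_t[OF e] by simp
    have "adj (t \<eta>) = adj (t \<eta>) \<otimes> t ?w"
      using arg_cong[OF ran_mult_t[OF e], of "\<lambda>x. adj x"] t_vertex[OF w(1)] e w by (simp add: adj_mult)
    then show "adj (t \<eta>) \<in> I" using ID(6)[of "adj (t \<eta>)" "t ?w"] tw[OF w(1)] e by simp
  qed
  \<comment> \<open>The definition of an ideal does not mention adjoints, so the generation property
    is applied to those elements of I whose adjoints also lie in I.\<close>
  let ?S = "{x \<in> I. adj x \<in> I}"
  have "cstar_subalgebra A ?S"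
    unfolding cstar_subalgebra_def
  proof (intro conjI ballI)
    have IC: "x \<in> carrier A" if "x \<in> I" for x using that ID(1) by auto
    show "submodule ?S complex_ring A"
    proof (rule submoduleI)
      show "?S \<subseteq> carrier A" using IC by auto
      show "\<zero> \<in> ?S" using ID(2) by simp
      show "x \<oplus> y \<in> ?S" if "x \<in> ?S" "y \<in> ?S" for x y using that IC ID(3) by (auto simp: adj_add)
      show "c \<odot> x \<in> ?S" if "x \<in> ?S" for c x using that IC ID(5) by (auto simp: adj_smult)
      then show "\<ominus> x \<in> ?S" if "x \<in> ?S" for x using that IC minus_conv_smult by fastforce
    qed
    show "x \<otimes> y \<in> ?S" if "x \<in> ?S" "y \<in> ?S" for x y using that IC ID(6) by (auto simp: adj_mult)
    show "adj x \<in> ?S" if "x \<in> ?S" for x using that IC by (auto simp: adj_adj)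
    show "norm_closed A ?S"
      unfolding norm_closed_iff
    proof (intro conjI ballI impI)
      show "?S \<subseteq> carrier A" using IC by auto
      fix x assume x: "x \<in> carrier A" and lim: "\<forall>e>0. \<exists>y\<in>?S. nrm (x \<ominus> y) < e"
      have "\<forall>e>0. \<exists>y\<in>I. nrm (adj x \<ominus> y) < e"
      proof (intro allI impI)
        fix e :: real assume "e > 0"
        then obtain y where y: "y \<in> I" "adj y \<in> I" "nrm (x \<ominus> y) < e" using lim by blast
        have "nrm (adj x \<ominus> adj y) = nrm (x \<ominus> y)"
          using nrm_adj[of "x \<ominus> y"] x IC[OF y(1)] by (simp add: adj_minus)
        then show "\<exists>y\<in>I. nrm (adj x \<ominus> y) < e" using y by (intro bexI[of _ "adj y"]) simp_all
      qed
      moreover have "\<forall>e>0. \<exists>y\<in>I. nrm (x \<ominus> y) < e" using lim by blast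
      ultimately show "x \<in> ?S" using ID(8) x unfolding norm_closed_iff by simp
    qed
  qed
  moreover have "t ` paths \<subseteq> ?S" using tI by auto
  ultimately have "?S = carrier A" by (rule gen)
  then show ?thesis using ID(1) by blast
qed

lemma cstar_simple_if:
  assumes gen: "\<And>S. \<lbrakk>cstar_subalgebra A S; t ` paths \<subseteq> S\<rbrakk> \<Longrightarrow> S = carrier A"
    and "kgraph_aperiodic \<Lambda>" "kgraph_cofinal \<Lambda>"
  shows "cstar_simple A"
  unfolding cstar_simple_def
  using ideal_without_vertices[OF gen] ideal_with_vertex[OF gen] assms(2,3) by blast

end

section \<open>Operators on \<open>\<ell>\<^sup>2\<close>\<close>

text \<open>The index set \<open>nat\<close> accommodates every orbit, since orbits are countable
  and can be coded by numbers.\<close>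

typedef ell2 = "{f :: nat \<Rightarrow> complex. (\<lambda>i. (cmod (f i))\<^sup>2) summable_on UNIV}"
  by (rule exI[of _ "\<lambda>_. 0"]) simp

setup_lifting type_definition_ell2

lemma cmod_add_square_le: "(cmod (a + b))\<^sup>2 \<le> 2 * (cmod a)\<^sup>2 + 2 * (cmod b)\<^sup>2"
proof -
  have "(cmod (a + b))\<^sup>2 \<le> (cmod a + cmod b)\<^sup>2" by (intro power_mono norm_triangle_ineq) simp
  also have "\<dots> \<le> 2 * (cmod a)\<^sup>2 + 2 * (cmod b)\<^sup>2"
    using zero_le_power2[of "cmod a - cmod b"] by (simp add: power2_eq_square algebra_simps)
  finally show ?thesis .
qed

lemma cmod_minus_square_le: "(cmod (a - b))\<^sup>2 \<le> 2 * (cmod a)\<^sup>2 + 2 * (cmod b)\<^sup>2"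
  using cmod_add_square_le[of a "- b"] by simp

lemma summable_on_square_bound:
  fixes f g h :: "nat \<Rightarrow> complex"
  assumes "(\<lambda>i. (cmod (f i))\<^sup>2) summable_on UNIV" "(\<lambda>i. (cmod (g i))\<^sup>2) summable_on UNIV"
    and "\<And>i. k i \<le> 2 * (cmod (f i))\<^sup>2 + 2 * (cmod (g i))\<^sup>2" "\<And>i. 0 \<le> k i"
  shows "k summable_on UNIV"
proof (rule summable_on_comparison_test)
  show "(\<lambda>i. 2 * (cmod (f i))\<^sup>2 + 2 * (cmod (g i))\<^sup>2) summable_on UNIV"
    using assms(1,2) by (intro summable_on_add summable_on_cmult_right)
qed (use assms in auto)

lemma inner_complex_le: "\<bar>inner a b\<bar> \<le> 2 * (cmod a)\<^sup>2 + 2 * (cmod b)\<^sup>2" for a b :: complex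
proof -
  have "\<bar>inner a b\<bar> \<le> norm a * norm b" by (rule Cauchy_Schwarz_ineq2)
  also have "\<dots> \<le> 2 * (cmod a)\<^sup>2 + 2 * (cmod b)\<^sup>2"
  proof -
    have "0 \<le> (cmod a - cmod b)\<^sup>2 + 3 * (cmod a)\<^sup>2 + 3 * (cmod b)\<^sup>2" by simp
    then show ?thesis by (simp add: power2_eq_square algebra_simps)
  qed
  finally show ?thesis .
qed

lemma summable_on_inner:
  fixes f g :: "nat \<Rightarrow> complex"
  assumes "(\<lambda>i. (cmod (f i))\<^sup>2) summable_on UNIV" "(\<lambda>i. (cmod (g i))\<^sup>2) summable_on UNIV"
  shows "(\<lambda>i. inner (f i) (g i)) summable_on UNIV"
  by (rule abs_summable_summable, rule summable_on_square_bound[OF assms])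
    (use inner_complex_le in auto)

instantiation ell2 :: real_inner
begin

lift_definition zero_ell2 :: ell2 is "\<lambda>_. 0" by simp

lift_definition plus_ell2 :: "ell2 \<Rightarrow> ell2 \<Rightarrow> ell2" is "\<lambda>f g i. f i + g i"
  subgoal for f g by (rule summable_on_square_bound[of f g]) (auto intro: cmod_add_square_le)
  done

lift_definition minus_ell2 :: "ell2 \<Rightarrow> ell2 \<Rightarrow> ell2" is "\<lambda>f g i. f i - g i"
  subgoal for f g by (rule summable_on_square_bound[of f g]) (auto intro: cmod_minus_square_le)
  done

lift_definition uminus_ell2 :: "ell2 \<Rightarrow> ell2" is "\<lambda>f i. - f i"
  by simp

lift_definition scaleR_ell2 :: "real \<Rightarrow> ell2 \<Rightarrow> ell2" is "\<lambda>c f i. c *\<^sub>R f i"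
  by (simp add: power_mult_distrib summable_on_cmult_right)

text \<open>On complex numbers \<open>inner\<close> is the real part of the Hermitian product, so
  this is the real part of the usual inner product.\<close>

lift_definition inner_ell2 :: "ell2 \<Rightarrow> ell2 \<Rightarrow> real" is "\<lambda>f g. infsum (\<lambda>i. inner (f i) (g i)) UNIV" .

definition norm_ell2 :: "ell2 \<Rightarrow> real" where "norm_ell2 x = sqrt (inner x x)"
definition dist_ell2 :: "ell2 \<Rightarrow> ell2 \<Rightarrow> real" where "dist_ell2 x y = norm (x - y)"
definition sgn_ell2 :: "ell2 \<Rightarrow> ell2" where "sgn_ell2 x = inverse (norm x) *\<^sub>R x"
definition uniformity_ell2 :: "(ell2 \<times> ell2) filter" where
  "uniformity_ell2 = (INF e\<in>{0<..}. principal {(x, y). dist x y < e})"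
definition open_ell2 :: "ell2 set \<Rightarrow> bool" where
  "open_ell2 U = (\<forall>x\<in>U. \<forall>\<^sub>F (x', y) in uniformity. x' = x \<longrightarrow> y \<in> U)"

lemma ell2_eqI: "(\<And>i. Rep_ell2 x i = Rep_ell2 y i) \<Longrightarrow> x = y"
  by (rule Rep_ell2_inject[THEN iffD1], rule ext)

lemmas ell2_rep_eq = zero_ell2.rep_eq plus_ell2.rep_eq minus_ell2.rep_eq uminus_ell2.rep_eq scaleR_ell2.rep_eq inner_ell2.rep_eq

instance
proof
  have S: "(\<lambda>i. (cmod (Rep_ell2 x i))\<^sup>2) summable_on UNIV" for x
    using Rep_ell2[of x] by simp
  fix x y z :: ell2 and a b :: real
  show "x + y + z = x + (y + z)" by (rule ell2_eqI) (simp add: ell2_rep_eq add.assoc)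
  show "x + y = y + x" by (rule ell2_eqI) (simp add: ell2_rep_eq add.commute)
  show "0 + x = x" by (rule ell2_eqI) (simp add: ell2_rep_eq)
  show "- x + x = 0" by (rule ell2_eqI) (simp add: ell2_rep_eq)
  show "x - y = x + - y" by (rule ell2_eqI) (simp add: ell2_rep_eq)
  show "a *\<^sub>R (x + y) = a *\<^sub>R x + a *\<^sub>R y" by (rule ell2_eqI) (simp add: ell2_rep_eq scaleR_add_right)
  show "(a + b) *\<^sub>R x = a *\<^sub>R x + b *\<^sub>R x" by (rule ell2_eqI) (simp add: ell2_rep_eq scaleR_add_left)
  show "a *\<^sub>R b *\<^sub>R x = (a * b) *\<^sub>R x" by (rule ell2_eqI) (simp add: ell2_rep_eq)
  show "1 *\<^sub>R x = x" by (rule ell2_eqI) (simp add: ell2_rep_eq)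
  show "dist x y = norm (x - y)" by (rule dist_ell2_def)
  show "sgn x = inverse (norm x) *\<^sub>R x" by (rule sgn_ell2_def)
  show "(uniformity :: (ell2 \<times> ell2) filter) = (INF e\<in>{0<..}. principal {(x, y). dist x y < e})"
    by (rule uniformity_ell2_def)
  show "open U = (\<forall>x\<in>U. \<forall>\<^sub>F (x', y) in uniformity. x' = x \<longrightarrow> y \<in> U)" for U :: "ell2 set"
    by (rule open_ell2_def)
  show "inner x y = inner y x" by (simp add: ell2_rep_eq inner_commute)
  show "inner (x + y) z = inner x z + inner y z"
    by (simp add: ell2_rep_eq inner_add_left infsum_add summable_on_inner S)
  show "inner (a *\<^sub>R x) y = a * inner x y"
    by (simp add: ell2_rep_eq infsum_cmult_right')
  show "0 \<le> inner x x" by (simp add: ell2_rep_eq infsum_nonneg)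
  show "inner x x = 0 \<longleftrightarrow> x = 0"
  proof
    assume a: "inner x x = 0"
    have "Rep_ell2 x i = 0" for i
      using nonneg_infsum_le_0D[of "\<lambda>i. inner (Rep_ell2 x i) (Rep_ell2 x i)" UNIV i] a summable_on_inner[OF S S]
      by (simp add: ell2_rep_eq)
    then show "x = 0" by (intro ell2_eqI) (simp add: ell2_rep_eq)
  qed (simp add: ell2_rep_eq)
  show "norm x = sqrt (inner x x)" by (rule norm_ell2_def)
qed

end

abbreviation el :: "ell2 \<Rightarrow> nat \<Rightarrow> complex" where "el \<equiv> Rep_ell2"

lemma el_summable: "(\<lambda>i. (cmod (el x i))\<^sup>2) summable_on UNIV"
  using Rep_ell2[of x] by simp

lemma norm_ell2_square: "(norm x)\<^sup>2 = infsum (\<lambda>i. (cmod (el x i))\<^sup>2) UNIV" for x :: ell2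
  unfolding power2_norm_eq_inner inner_ell2.rep_eq ..

lemma norm_ell2_le:
  fixes x :: ell2
  assumes "C \<ge> 0" "\<And>F. finite F \<Longrightarrow> (\<Sum>i\<in>F. (cmod (el x i))\<^sup>2) \<le> C\<^sup>2"
  shows "norm x \<le> C"
proof (rule power2_le_imp_le)
  show "(norm x)\<^sup>2 \<le> C\<^sup>2"
    unfolding norm_ell2_square using assms(2) by (intro infsum_le_finite_sums el_summable) auto
qed (rule assms(1))

lemma sum_el_le: "finite F \<Longrightarrow> (\<Sum>i\<in>F. (cmod (el x i))\<^sup>2) \<le> (norm x)\<^sup>2"
  unfolding norm_ell2_square by (intro finite_sum_le_infsum el_summable) auto

lemma cmod_el_le: "cmod (el x i) \<le> norm x"
  using sum_el_le[of "{i}" x] by (simp add: power2_le_iff_abs_le)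

text \<open>The limit is formed coordinatewise. On finitely many coordinates the Cauchy estimate
  survives passage to the limit, and these finite estimates give both square summability and
  convergence in norm.\<close>

instance ell2 :: banach
proof
  fix X :: "nat \<Rightarrow> ell2" assume X: "Cauchy X"
  have "\<exists>l. (\<lambda>n. el (X n) i) \<longlonglongrightarrow> l" for i
  proof -
    have "Cauchy (\<lambda>n. el (X n) i)"
    proof (rule CauchyI)
      fix e :: real assume "0 < e"
      then obtain M where M: "\<And>m n. m \<ge> M \<Longrightarrow> n \<ge> M \<Longrightarrow> norm (X m - X n) < e" using CauchyD[OF X] by blast
      have "norm (el (X m) i - el (X n) i) < e" if "m \<ge> M" "n \<ge> M" for m n
        using M[OF that] cmod_el_le[of "X m - X n" i] by (simp add: minus_ell2.rep_eq)
      then show "\<exists>M. \<forall>m\<ge>M. \<forall>n\<ge>M. norm (el (X m) i - el (X n) i) < e" by blast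
    qed
    then show ?thesis using convergent_eq_Cauchy by blast
  qed
  then obtain f where f: "\<And>i. (\<lambda>n. el (X n) i) \<longlonglongrightarrow> f i" by metis
  have lim: "(\<Sum>i\<in>F. (cmod (el (X m) i - f i))\<^sup>2) \<le> e\<^sup>2"
    if "finite F" "e > 0" "\<And>n. n \<ge> M \<Longrightarrow> norm (X m - X n) \<le> e" for F m M e
  proof (rule tendsto_upperbound)
    show "(\<lambda>n. \<Sum>i\<in>F. (cmod (el (X m) i - el (X n) i))\<^sup>2) \<longlonglongrightarrow> (\<Sum>i\<in>F. (cmod (el (X m) i - f i))\<^sup>2)"
      by (intro tendsto_intros f)
    have "(\<Sum>i\<in>F. (cmod (el (X m) i - el (X n) i))\<^sup>2) \<le> e\<^sup>2" if "n \<ge> M" for n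
    proof -
      have "(\<Sum>i\<in>F. (cmod (el (X m) i - el (X n) i))\<^sup>2) \<le> (norm (X m - X n))\<^sup>2"
        using sum_el_le[OF \<open>finite F\<close>, of "X m - X n"] by (simp add: minus_ell2.rep_eq)
      also have "\<dots> \<le> e\<^sup>2" using \<open>\<And>n. n \<ge> M \<Longrightarrow> norm (X m - X n) \<le> e\<close>[OF that] by (intro power_mono) auto
      finally show ?thesis .
    qed
    then show "\<forall>\<^sub>F n in sequentially. (\<Sum>i\<in>F. (cmod (el (X m) i - el (X n) i))\<^sup>2) \<le> e\<^sup>2"
      using eventually_sequentially by blast
  qed simp
  obtain M where M: "\<And>m n. m \<ge> M \<Longrightarrow> n \<ge> M \<Longrightarrow> norm (X m - X n) < 1" using CauchyD[OF X, of 1] by auto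
  have "(\<lambda>i. (cmod (el (X M) i - f i))\<^sup>2) summable_on UNIV"
  proof (rule nonneg_bdd_above_summable_on)
    show "bdd_above (sum (\<lambda>i. (cmod (el (X M) i - f i))\<^sup>2) ` {F. F \<subseteq> UNIV \<and> finite F})"
      using lim[of _ 1 M M] M by (intro bdd_aboveI[of _ 1]) (force simp: less_imp_le)
  qed simp
  then have "(\<lambda>i. (cmod (f i))\<^sup>2) summable_on UNIV"
  proof (rule summable_on_square_bound[OF el_summable[of "X M"]])
    show "(cmod (f i))\<^sup>2 \<le> 2 * (cmod (el (X M) i))\<^sup>2 + 2 * (cmod (el (X M) i - f i))\<^sup>2" for i
      using cmod_add_square_le[of "el (X M) i" "f i - el (X M) i"] by (simp add: norm_minus_commute)
  qed simp
  then obtain x where x: "el x = f" by (metis (mono_tags) Abs_ell2_inverse mem_Collect_eq)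
  have "X \<longlonglongrightarrow> x"
  proof (rule LIMSEQ_I)
    fix r :: real assume r: "0 < r"
    then obtain M where M: "\<And>m n. m \<ge> M \<Longrightarrow> n \<ge> M \<Longrightarrow> norm (X m - X n) < r / 2" using CauchyD[OF X, of "r / 2"] by auto
    have "norm (X m - x) < r" if "m \<ge> M" for m
    proof -
      have "norm (X m - x) \<le> r / 2"
      proof (rule norm_ell2_le)
        show "(\<Sum>i\<in>F. (cmod (el (X m - x) i))\<^sup>2) \<le> (r / 2)\<^sup>2" if "finite F" for F
          using lim[OF that, of "r / 2" M m] M[OF \<open>m \<ge> M\<close>] r x by (simp add: minus_ell2.rep_eq less_imp_le)
      qed (use r in simp)
      then show ?thesis using r by simp
    qed
    then show "\<exists>no. \<forall>n\<ge>no. norm (X n - x) < r" by blast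
  qed
  then show "convergent X" by (rule convergentI)
qed

section \<open>Operators given by weighted partial injections\<close>

definition pinj :: "(nat \<Rightarrow> nat option) \<Rightarrow> bool" where
  "pinj h \<longleftrightarrow> (\<forall>m n x. h m = Some x \<longrightarrow> h n = Some x \<longrightarrow> m = n)"

definition pinv :: "(nat \<Rightarrow> nat option) \<Rightarrow> nat \<Rightarrow> nat option" where
  "pinv h m = (if \<exists>n. h n = Some m then Some (THE n. h n = Some m) else None)"

lemma pinv_Some_iff: "pinj h \<Longrightarrow> pinv h m = Some n \<longleftrightarrow> h n = Some m"
  unfolding pinv_def pinj_def by (auto simp: the_equality)

lemma pinj_pinv: "pinj h \<Longrightarrow> pinj (pinv h)"
  unfolding pinj_def[of "pinv h"] by (auto simp: pinv_Some_iff)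

text \<open>The map h points backwards: output coordinate n reads input coordinate
  \<open>h n\<close>, and outputs outside the domain of h are zero.\<close>

definition pcomp :: "complex \<Rightarrow> (nat \<Rightarrow> nat option) \<Rightarrow> (nat \<Rightarrow> complex) \<Rightarrow> nat \<Rightarrow> complex" where
  "pcomp c h f n = (case h n of None \<Rightarrow> 0 | Some m \<Rightarrow> c * f m)"

lemma sum_pcomp_le:
  assumes h: "pinj h" and F: "finite F"
  shows "(\<Sum>n\<in>F. (cmod (pcomp c h (el x) n))\<^sup>2) \<le> (cmod c * norm x)\<^sup>2"
proof -
  let ?G = "F \<inter> dom h"
  have inj: "inj_on (\<lambda>n. the (h n)) ?G"
    using h by (auto simp: inj_on_def pinj_def)
  have "(\<Sum>n\<in>F. (cmod (pcomp c h (el x) n))\<^sup>2) = (\<Sum>n\<in>?G. (cmod (pcomp c h (el x) n))\<^sup>2)"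
    using F by (intro sum.mono_neutral_right) (auto simp: pcomp_def domIff split: option.splits)
  also have "\<dots> = (\<Sum>n\<in>?G. (cmod c)\<^sup>2 * (cmod (el x (the (h n))))\<^sup>2)"
    by (intro sum.cong refl) (auto simp: pcomp_def norm_mult power_mult_distrib)
  also have "\<dots> = (cmod c)\<^sup>2 * (\<Sum>m\<in>(\<lambda>n. the (h n)) ` ?G. (cmod (el x m))\<^sup>2)"
    by (simp add: sum_distrib_left sum.reindex[OF inj])
  also have "\<dots> \<le> (cmod c)\<^sup>2 * (norm x)\<^sup>2"
    using F by (intro mult_left_mono sum_el_le) auto
  finally show ?thesis by (simp add: power_mult_distrib)
qed

definition pvec :: "complex \<Rightarrow> (nat \<Rightarrow> nat option) \<Rightarrow> ell2 \<Rightarrow> ell2" where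
  "pvec c h x = Abs_ell2 (pcomp c h (el x))"

lemma el_pvec:
  assumes h: "pinj h" shows "el (pvec c h x) n = (case h n of None \<Rightarrow> 0 | Some m \<Rightarrow> c * el x m)"
proof -
  have "(\<lambda>i. (cmod (pcomp c h (el x) i))\<^sup>2) summable_on UNIV"
    by (rule nonneg_bdd_above_summable_on) (auto intro!: bdd_aboveI2 sum_pcomp_le[OF h])
  then have "el (pvec c h x) = pcomp c h (el x)"
    unfolding pvec_def by (intro Abs_ell2_inverse) simp
  then show ?thesis by (simp add: pcomp_def)
qed

lemma norm_pvec: assumes h: "pinj h" shows "norm (pvec c h x) \<le> cmod c * norm x"
proof (rule norm_ell2_le)
  fix F :: "nat set" assume "finite F"
  moreover have "el (pvec c h x) = pcomp c h (el x)" using el_pvec[OF h] by (auto simp: pcomp_def)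
  ultimately show "(\<Sum>i\<in>F. (cmod (el (pvec c h x) i))\<^sup>2) \<le> (cmod c * norm x)\<^sup>2" using sum_pcomp_le[OF h] by simp
qed simp

definition popr :: "complex \<Rightarrow> (nat \<Rightarrow> nat option) \<Rightarrow> ell2 \<Rightarrow>\<^sub>L ell2" where
  "popr c h = Blinfun (pvec c h)"

lemma bounded_linear_pvec: assumes h: "pinj h" shows "bounded_linear (pvec c h)"
proof (rule bounded_linear_intro)
  show "pvec c h (x + y) = pvec c h x + pvec c h y" for x y
    by (rule ell2_eqI) (simp add: el_pvec[OF h] ell2_rep_eq distrib_left split: option.split)
  show "pvec c h (a *\<^sub>R x) = a *\<^sub>R pvec c h x" for a x
    by (rule ell2_eqI) (simp add: el_pvec[OF h] ell2_rep_eq split: option.split)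
  show "norm (pvec c h x) \<le> norm x * cmod c" for x
    using norm_pvec[OF h, of c x] by (simp add: mult.commute)
qed

lemma el_popr: "pinj h \<Longrightarrow> el (blinfun_apply (popr c h) x) n = (case h n of None \<Rightarrow> 0 | Some m \<Rightarrow> c * el x m)"
  by (simp add: popr_def bounded_linear_Blinfun_apply[OF bounded_linear_pvec] el_pvec)

lemma norm_popr: "pinj h \<Longrightarrow> norm (popr c h) \<le> cmod c"
  using norm_pvec by (intro norm_blinfun_bound)
    (simp_all add: popr_def bounded_linear_Blinfun_apply[OF bounded_linear_pvec])

lemma op_eqI: "(\<And>x n. el (blinfun_apply S x) n = el (blinfun_apply T x) n) \<Longrightarrow> S = T"
  by (intro blinfun_eqI ell2_eqI)

text \<open>Both sides are the same sum over the graph of h, indexed once by its domain and once by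
  its range; c is conjugated when it changes sides.\<close>

lemma inner_popr:
  assumes h: "pinj h"
  shows "inner (blinfun_apply (popr c h) x) y = inner x (blinfun_apply (popr (cnj c) (pinv h)) y)"
proof -
  let ?k = "pinv h"
  have k: "pinj ?k" using pinj_pinv[OF h] .
  define g where "g m = the (?k m)" for m
  have g: "h (g m) = Some m \<and> ?k m = Some (g m)" if m: "m \<in> Map.ran h" for m
  proof -
    obtain n where "h n = Some m" using m by (auto simp: Map.ran_def)
    then have "?k m = Some n" using pinv_Some_iff[OF h] by simp
    then show ?thesis using \<open>h n = Some m\<close> by (simp add: g_def)
  qed
  have bij: "bij_betw g (Map.ran h) (dom h)"
  proof (rule bij_betwI[where g = "\<lambda>n. the (h n)"])
    show "g \<in> Map.ran h \<rightarrow> dom h" using g by auto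
    show "(\<lambda>n. the (h n)) \<in> dom h \<rightarrow> Map.ran h" by (auto simp: Map.ran_def)
    show "the (h (g m)) = m" if "m \<in> Map.ran h" for m using g[OF that] by simp
    show "g (the (h n)) = n" if n: "n \<in> dom h" for n
    proof -
      obtain m where m: "h n = Some m" using n by auto
      then have "m \<in> Map.ran h" by (auto simp: Map.ran_def)
      then show ?thesis using g[of m] m h by (auto simp: pinj_def)
    qed
  qed
  have "inner (blinfun_apply (popr c h) x) y = infsum (\<lambda>n. inner (el (blinfun_apply (popr c h) x) n) (el y n)) (dom h)"
    unfolding inner_ell2.rep_eq by (rule infsum_cong_neutral) (auto simp: el_popr[OF h] domIff)
  also have "\<dots> = infsum (\<lambda>m. inner (el (blinfun_apply (popr c h) x) (g m)) (el y (g m))) (Map.ran h)"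
    by (rule infsum_reindex_bij_betw[OF bij, symmetric])
  also have "\<dots> = infsum (\<lambda>m. inner (el x m) (el (blinfun_apply (popr (cnj c) ?k) y) m)) (Map.ran h)"
    by (rule infsum_cong) (use g in \<open>auto simp: el_popr[OF h] el_popr[OF k] inner_complex_def algebra_simps\<close>)
  also have "\<dots> = inner x (blinfun_apply (popr (cnj c) ?k) y)"
    unfolding inner_ell2.rep_eq
  proof (rule infsum_cong_neutral)
    fix m assume "m \<in> UNIV - Map.ran h"
    then have "?k m = None" unfolding pinv_def by (auto simp: Map.ran_def)
    then show "inner (el x m) (el (blinfun_apply (popr (cnj c) ?k) y) m) = 0" by (simp add: el_popr[OF k])
  qed auto
  finally show ?thesis .
qed

text \<open>\<open>ell2\<close> and its operators form real vector spaces here, so complex scalars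
  enter as operators.\<close>

definition scalar_op :: "complex \<Rightarrow> ell2 \<Rightarrow>\<^sub>L ell2" where "scalar_op c = popr c Some"

lemma pinj_Some: "pinj Some" by (simp add: pinj_def)

lemma el_scalar_op: "el (blinfun_apply (scalar_op c) x) n = c * el x n"
  by (simp add: scalar_op_def el_popr[OF pinj_Some])

lemma inner_scalar_op: "inner (blinfun_apply (scalar_op c) x) y = inner x (blinfun_apply (scalar_op (cnj c)) y)"
proof -
  have "pinv Some = Some"
  proof
    fix n show "pinv Some n = Some n" using pinv_Some_iff[OF pinj_Some, of n n] by simp
  qed
  then show ?thesis using inner_popr[OF pinj_Some] by (simp add: scalar_op_def)
qed

lemma scalar_op_simps: "scalar_op (a + b) = scalar_op a + scalar_op b" "scalar_op (a * b) = scalar_op a o\<^sub>L scalar_op b" "scalar_op 1 = id_blinfun"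
  by (rule op_eqI; simp add: el_scalar_op plus_blinfun.rep_eq ell2_rep_eq distrib_right)+

lemma norm_scalar_op: "norm (scalar_op c) \<le> cmod c"
  unfolding scalar_op_def by (rule norm_popr[OF pinj_Some])

text \<open>
  The real inner product suffices: a complex linear operator with an adjoint for the real inner
  product has the same adjoint for the complex one.
\<close>

definition ops :: "(ell2 \<Rightarrow>\<^sub>L ell2) set" where
  "ops = {T. (\<exists>S. \<forall>x y. inner (blinfun_apply T x) y = inner x (blinfun_apply S y)) \<and> (\<forall>c. T o\<^sub>L scalar_op c = scalar_op c o\<^sub>L T)}"

definition adjop :: "(ell2 \<Rightarrow>\<^sub>L ell2) \<Rightarrow> ell2 \<Rightarrow>\<^sub>L ell2" where
  "adjop T = (SOME S. \<forall>x y. inner (blinfun_apply T x) y = inner x (blinfun_apply S y))"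

lemma adjop_unique:
  assumes "\<And>x y. inner (blinfun_apply T x) y = inner x (blinfun_apply S y)" shows "adjop T = S"
proof -
  have "\<exists>S. \<forall>x y. inner (blinfun_apply T x) y = inner x (blinfun_apply S y)" using assms by blast
  then have a: "\<forall>x y. inner (blinfun_apply T x) y = inner x (blinfun_apply (adjop T) y)"
    unfolding adjop_def by (rule someI_ex)
  show ?thesis
  proof (rule blinfun_eqI)
    fix y
    have "\<forall>x. inner x (blinfun_apply (adjop T) y) = inner x (blinfun_apply S y)" using a assms by metis
    then show "blinfun_apply (adjop T) y = blinfun_apply S y" by (simp add: vector_eq_ldot)
  qed
qed

lemma ops_inner: "T \<in> ops \<Longrightarrow> inner (blinfun_apply T x) y = inner x (blinfun_apply (adjop T) y)"
  using adjop_unique unfolding ops_def by blast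

lemma ops_scalar_op: "T \<in> ops \<Longrightarrow> T o\<^sub>L scalar_op c = scalar_op c o\<^sub>L T"
  by (simp add: ops_def)

lemma ops_scalar_op_apply: "T \<in> ops \<Longrightarrow> blinfun_apply T (blinfun_apply (scalar_op c) x) = blinfun_apply (scalar_op c) (blinfun_apply T x)"
  using arg_cong[OF ops_scalar_op, of T "\<lambda>S. blinfun_apply S x" c] by simp

lemma opsI:
  assumes "\<And>x y. inner (blinfun_apply T x) y = inner x (blinfun_apply S y)"
    and "\<And>c x. blinfun_apply T (blinfun_apply (scalar_op c) x) = blinfun_apply (scalar_op c) (blinfun_apply T x)"
  shows "T \<in> ops" "adjop T = S"
  unfolding ops_def using assms by (auto intro: blinfun_eqI adjop_unique)

lemma adjop_ops: assumes T: "T \<in> ops" shows "adjop T \<in> ops" "adjop (adjop T) = T"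
proof -
  have 1: "inner (blinfun_apply (adjop T) x) y = inner x (blinfun_apply T y)" for x y
    using ops_inner[OF T, of y x] by (simp add: inner_commute)
  have 2: "blinfun_apply (adjop T) (blinfun_apply (scalar_op c) y) = blinfun_apply (scalar_op c) (blinfun_apply (adjop T) y)" for c y
  proof -
    have "inner x (blinfun_apply (adjop T) (blinfun_apply (scalar_op c) y)) = inner x (blinfun_apply (scalar_op c) (blinfun_apply (adjop T) y))" for x
    proof -
      have "inner x (blinfun_apply (adjop T) (blinfun_apply (scalar_op c) y)) = inner (blinfun_apply T x) (blinfun_apply (scalar_op c) y)"
        using ops_inner[OF T] by simp
      also have "\<dots> = inner (blinfun_apply (scalar_op (cnj c)) (blinfun_apply T x)) y" using inner_scalar_op[of "cnj c"] by simp
      also have "\<dots> = inner (blinfun_apply T (blinfun_apply (scalar_op (cnj c)) x)) y" using ops_scalar_op_apply[OF T] by simp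
      also have "\<dots> = inner (blinfun_apply (scalar_op (cnj c)) x) (blinfun_apply (adjop T) y)" using ops_inner[OF T] .
      also have "\<dots> = inner x (blinfun_apply (scalar_op c) (blinfun_apply (adjop T) y))" using inner_scalar_op[of "cnj c"] by simp
      finally show ?thesis .
    qed
    then show ?thesis using vector_eq_ldot by blast
  qed
  show "adjop T \<in> ops" "adjop (adjop T) = T" using opsI[of "adjop T" T] 1 2 by blast+
qed

lemma ops_0: "0 \<in> ops" and ops_id: "id_blinfun \<in> ops"
  by (rule opsI(1)[of _ 0], simp_all, rule opsI(1)[of _ id_blinfun], simp_all)

lemma ops_add: assumes "S \<in> ops" "T \<in> ops" shows "S + T \<in> ops" "adjop (S + T) = adjop S + adjop T"
  using opsI[of "S + T" "adjop S + adjop T"] assms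
  by (simp_all add: plus_blinfun.rep_eq inner_add_left inner_add_right ops_inner ops_scalar_op_apply blinfun.add_right)

lemma ops_mult: assumes "S \<in> ops" "T \<in> ops" shows "S o\<^sub>L T \<in> ops" "adjop (S o\<^sub>L T) = adjop T o\<^sub>L adjop S"
  using opsI[of "S o\<^sub>L T" "adjop T o\<^sub>L adjop S"] assms by (simp_all add: ops_inner ops_scalar_op_apply)

lemma ops_popr: assumes h: "pinj h" shows "popr c h \<in> ops" "adjop (popr c h) = popr (cnj c) (pinv h)"
proof -
  have "blinfun_apply (popr c h) (blinfun_apply (scalar_op d) x) = blinfun_apply (scalar_op d) (blinfun_apply (popr c h) x)" for d x
    by (rule ell2_eqI) (simp add: el_popr[OF h] el_scalar_op split: option.split)
  then show "popr c h \<in> ops" "adjop (popr c h) = popr (cnj c) (pinv h)"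
    using opsI[of "popr c h" "popr (cnj c) (pinv h)"] inner_popr[OF h] by blast+
qed

lemma ops_scalar_op_mem: "scalar_op c \<in> ops" "adjop (scalar_op c) = scalar_op (cnj c)"
proof -
  have "blinfun_apply (scalar_op c) (blinfun_apply (scalar_op d) x) = blinfun_apply (scalar_op d) (blinfun_apply (scalar_op c) x)" for d x
    by (rule ell2_eqI) (simp add: el_scalar_op)
  then show "scalar_op c \<in> ops" "adjop (scalar_op c) = scalar_op (cnj c)"
    using opsI[of "scalar_op c" "scalar_op (cnj c)"] inner_scalar_op by blast+
qed

lemma ops_uminus: assumes "T \<in> ops" shows "- T \<in> ops"
  by (rule opsI(1)[of _ "- adjop T"]) (simp_all add: uminus_blinfun.rep_eq ops_inner[OF assms] ops_scalar_op_apply[OF assms] blinfun.minus_right)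

lemma ops_minus: assumes "S \<in> ops" "T \<in> ops" shows "S - T \<in> ops" "adjop (S - T) = adjop S - adjop T"
  using opsI[of "S - T" "adjop S - adjop T"] assms
  by (simp_all add: minus_blinfun.rep_eq inner_diff_left inner_diff_right ops_inner ops_scalar_op_apply blinfun.diff_right)

lemma norm_adjop_mult: assumes T: "T \<in> ops" shows "norm (adjop T o\<^sub>L T) = (norm T)\<^sup>2" "norm (adjop T) = norm T"
proof -
  have ge: "(norm S)\<^sup>2 \<le> norm (adjop S o\<^sub>L S)" if S: "S \<in> ops" for S
  proof -
    have "norm S \<le> sqrt (norm (adjop S o\<^sub>L S))"
    proof (rule norm_blinfun_bound)
      fix x
      have "(norm (blinfun_apply S x))\<^sup>2 = inner (blinfun_apply (adjop S o\<^sub>L S) x) x"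
        using ops_inner[OF S, of x "blinfun_apply S x"] by (simp add: power2_norm_eq_inner inner_commute)
      also have "\<dots> \<le> norm (blinfun_apply (adjop S o\<^sub>L S) x) * norm x" by (rule norm_cauchy_schwarz)
      also have "\<dots> \<le> norm (adjop S o\<^sub>L S) * norm x * norm x" by (intro mult_right_mono norm_blinfun) simp
      also have "\<dots> = (sqrt (norm (adjop S o\<^sub>L S)) * norm x)\<^sup>2"
        by (simp add: power_mult_distrib power2_eq_square)
      finally show "norm (blinfun_apply S x) \<le> sqrt (norm (adjop S o\<^sub>L S)) * norm x"
        by (rule power2_le_imp_le) simp
    qed simp
    then have "(norm S)\<^sup>2 \<le> (sqrt (norm (adjop S o\<^sub>L S)))\<^sup>2" by (intro power_mono) auto
    then show ?thesis by simp
  qed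
  have le: "norm S \<le> norm (adjop S)" if S: "S \<in> ops" for S
  proof (cases "norm S = 0")
    case False
    have "norm S * norm S \<le> norm (adjop S) * norm S"
      using ge[OF S] norm_blinfun_compose[of "adjop S" S] by (simp add: power2_eq_square)
    then show ?thesis using False by simp
  qed simp
  show n: "norm (adjop T) = norm T" using le[OF T] le[OF adjop_ops(1)[OF T]] adjop_ops(2)[OF T] by simp
  show "norm (adjop T o\<^sub>L T) = (norm T)\<^sup>2"
    using ge[OF T] norm_blinfun_compose[of "adjop T" T] n by (simp add: power2_eq_square)
qed

lemma norm_scalar_op_mult: "norm (scalar_op c o\<^sub>L T) = cmod c * norm T"
proof (rule antisym)
  have le: "norm (scalar_op d o\<^sub>L S) \<le> cmod d * norm S" for d S
    using norm_blinfun_compose[of "scalar_op d" S] mult_right_mono[OF norm_scalar_op[of d], of "norm S"] by simp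
  show "norm (scalar_op c o\<^sub>L T) \<le> cmod c * norm T" by (rule le)
  show "cmod c * norm T \<le> norm (scalar_op c o\<^sub>L T)"
  proof (cases "c = 0")
    case False
    have "T = scalar_op (1 / c) o\<^sub>L (scalar_op c o\<^sub>L T)"
      using False by (intro op_eqI) (simp add: el_scalar_op)
    then have "norm T \<le> cmod (1 / c) * norm (scalar_op c o\<^sub>L T)" using le[of "1 / c" "scalar_op c o\<^sub>L T"] by simp
    then show ?thesis using False by (simp add: norm_divide field_simps)
  qed simp
qed

subsection \<open>Coding operators by their matrices\<close>

definition std_basis :: "nat \<Rightarrow> ell2" where "std_basis j = Abs_ell2 (\<lambda>n. if n = j then 1 else 0)"

lemma el_std_basis: "el (std_basis j) n = (if n = j then 1 else 0)"
proof -
  have "(\<lambda>n. (cmod (if n = j then 1 else 0))\<^sup>2) summable_on UNIV"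
  proof -
    let ?g = "\<lambda>n. (cmod (if n = j then 1 else 0))\<^sup>2"
    have "?g summable_on {j} \<longleftrightarrow> ?g summable_on UNIV" by (rule summable_on_cong_neutral) auto
    then show ?thesis by simp
  qed
  then show ?thesis unfolding std_basis_def by (subst Abs_ell2_inverse) auto
qed

lemma inner_std_basis: "inner (std_basis j) y = Re (el y j)" "inner (blinfun_apply (scalar_op \<i>) (std_basis j)) y = Im (el y j)"
proof -
  have s: "infsum f UNIV = f j" if "\<And>n. n \<noteq> j \<Longrightarrow> f n = 0" for f :: "nat \<Rightarrow> real"
    using infsum_cong_neutral[of "{j}" UNIV f f] that by auto
  show "inner (std_basis j) y = Re (el y j)"
    unfolding inner_ell2.rep_eq by (subst s) (auto simp: el_std_basis inner_complex_def)
  show "inner (blinfun_apply (scalar_op \<i>) (std_basis j)) y = Im (el y j)"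
    unfolding inner_ell2.rep_eq by (subst s) (auto simp: el_scalar_op el_std_basis inner_complex_def)
qed

lemma el_inner: "el y j = Complex (inner y (std_basis j)) (inner y (blinfun_apply (scalar_op \<i>) (std_basis j)))"
  using inner_std_basis[of j y] by (simp add: inner_commute complex_eq_iff)

text \<open>Row and column are paired into one natural number, because the universal property admits
  only target algebras with carrier in \<open>nat \<Rightarrow> complex\<close>.\<close>

definition mat :: "(ell2 \<Rightarrow>\<^sub>L ell2) \<Rightarrow> nat \<Rightarrow> complex" where
  "mat T n = el (blinfun_apply T (std_basis (snd (prod_decode n)))) (fst (prod_decode n))"

text \<open>Equal matrices give equal columns and hence, by taking inner products, equal values of
  both adjoints on basis vectors; every coordinate of \<open>S x\<close> is in turn an inner product
  of x with such values. Thus x is never approximated by finitely supported vectors.\<close>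

lemma inj_on_mat: "inj_on mat ops"
proof (rule inj_onI)
  fix S T assume S: "S \<in> ops" and T: "T \<in> ops" and eq: "mat S = mat T"
  have b: "blinfun_apply S (std_basis j) = blinfun_apply T (std_basis j)" for j
    by (rule ell2_eqI) (use fun_cong[OF eq, of "prod_encode (_, j)"] in \<open>simp add: mat_def\<close>)
  have a: "blinfun_apply (adjop S) (std_basis i) = blinfun_apply (adjop T) (std_basis i)" for i
  proof (rule ell2_eqI)
    fix j
    have "inner (blinfun_apply (adjop S) (std_basis i)) y = inner (blinfun_apply (adjop T) (std_basis i)) y"
      if "blinfun_apply S y = blinfun_apply T y" for y
      using ops_inner[OF S, of y "std_basis i"] ops_inner[OF T, of y "std_basis i"] that by (simp add: inner_commute)
    \<comment> \<open>The real inner product sees only real parts, so the imaginary part of a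
      coordinate is tested against the basis vector multiplied by the imaginary unit.\<close>
    from this[of "std_basis j"] this[of "blinfun_apply (scalar_op \<i>) (std_basis j)"]
    show "el (blinfun_apply (adjop S) (std_basis i)) j = el (blinfun_apply (adjop T) (std_basis i)) j"
      unfolding el_inner[of _ j] using b S T by (simp add: ops_scalar_op_apply)
  qed
  show "S = T"
  proof (rule op_eqI)
    fix x i
    show "el (blinfun_apply S x) i = el (blinfun_apply T x) i"
      unfolding el_inner[of _ i] using a S T by (simp add: ops_inner ops_scalar_op_apply adjop_ops)
  qed
qed

definition opr :: "(nat \<Rightarrow> complex) \<Rightarrow> ell2 \<Rightarrow>\<^sub>L ell2" where "opr = the_inv_into ops mat"

lemma opr_mat [simp]: "T \<in> ops \<Longrightarrow> opr (mat T) = T"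
  unfolding opr_def by (rule the_inv_into_f_f[OF inj_on_mat])

text \<open>The operations are transported along \<open>mat\<close>, with \<open>opr\<close> as its
  inverse on \<open>ops\<close>; their values outside the carrier carry no meaning.\<close>

definition BL :: "(nat \<Rightarrow> complex) cstar" where
  "BL = \<lparr>carrier = mat ` ops, monoid.mult = \<lambda>f g. mat (opr f o\<^sub>L opr g), one = mat id_blinfun, zero = mat 0,
     add = \<lambda>f g. mat (opr f + opr g), smult = \<lambda>c f. mat (scalar_op c o\<^sub>L opr f),
     invol = \<lambda>f. mat (adjop (opr f)), cnorm = \<lambda>f. norm (opr f)\<rparr>"

lemma BL_simps:
  "carrier BL = mat ` ops" "\<zero>\<^bsub>BL\<^esub> = mat 0"
  "S \<in> ops \<Longrightarrow> T \<in> ops \<Longrightarrow> mat S \<otimes>\<^bsub>BL\<^esub> mat T = mat (S o\<^sub>L T)"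
  "S \<in> ops \<Longrightarrow> T \<in> ops \<Longrightarrow> mat S \<oplus>\<^bsub>BL\<^esub> mat T = mat (S + T)"
  "T \<in> ops \<Longrightarrow> c \<odot>\<^bsub>BL\<^esub> mat T = mat (scalar_op c o\<^sub>L T)"
  "T \<in> ops \<Longrightarrow> adj\<^bsub>BL\<^esub> (mat T) = mat (adjop T)"
  "T \<in> ops \<Longrightarrow> nrm\<^bsub>BL\<^esub> (mat T) = norm T"
  by (simp_all add: BL_def)

lemmas ops_closed = ops_0 ops_id ops_add(1) ops_mult(1) ops_scalar_op_mem(1) adjop_ops(1) ops_uminus ops_minus(1)

lemma blinfun_compose_assoc: "(R o\<^sub>L S) o\<^sub>L T = R o\<^sub>L (S o\<^sub>L T)"
  by (rule blinfun_eqI) simp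

lemma id_blinfun_compose: "id_blinfun o\<^sub>L T = T"
  by (rule blinfun_eqI) simp

lemma abelian_group_BL: "abelian_group BL"
proof (rule abelian_groupI)
  show "\<exists>y\<in>carrier BL. y \<oplus>\<^bsub>BL\<^esub> x = \<zero>\<^bsub>BL\<^esub>" if x: "x \<in> carrier BL" for x
  proof -
    obtain T where T: "T \<in> ops" "x = mat T" using x by (auto simp: BL_simps)
    then show ?thesis by (intro bexI[of _ "mat (- T)"]) (auto simp: BL_simps ops_closed)
  qed
qed (auto simp: BL_simps ops_closed add.assoc add.commute add.left_commute)

lemma module_BL: "module complex_ring BL"
proof (rule moduleI[OF cring_complex_ring abelian_group_BL])
  fix a b x y assume a: "x \<in> carrier BL" "y \<in> carrier BL"
  then obtain S T where ST: "S \<in> ops" "T \<in> ops" "x = mat S" "y = mat T" by (auto simp: BL_simps)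
  show "(a \<oplus>\<^bsub>complex_ring\<^esub> b) \<odot>\<^bsub>BL\<^esub> x = a \<odot>\<^bsub>BL\<^esub> x \<oplus>\<^bsub>BL\<^esub> b \<odot>\<^bsub>BL\<^esub> x"
    using ST by (simp add: BL_simps ops_closed complex_ring_def scalar_op_simps bounded_bilinear.add_left[OF bounded_bilinear_blinfun_compose])
  show "a \<odot>\<^bsub>BL\<^esub> (x \<oplus>\<^bsub>BL\<^esub> y) = a \<odot>\<^bsub>BL\<^esub> x \<oplus>\<^bsub>BL\<^esub> a \<odot>\<^bsub>BL\<^esub> y"
    using ST by (simp add: BL_simps ops_closed bounded_bilinear.add_right[OF bounded_bilinear_blinfun_compose])
qed (auto simp: BL_simps ops_closed complex_ring_def scalar_op_simps blinfun_compose_assoc id_blinfun_compose)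

lemma normed_star_algebra_BL: "normed_star_algebra BL"
proof (intro normed_star_algebra.intro module_BL normed_star_algebra_axioms.intro)
  fix x y z c
  { assume "x \<in> carrier BL"
    then obtain S where S: "S \<in> ops" "x = mat S" by (auto simp: BL_simps)
    show "adj\<^bsub>BL\<^esub> x \<in> carrier BL" "adj\<^bsub>BL\<^esub> (adj\<^bsub>BL\<^esub> x) = x" "nrm\<^bsub>BL\<^esub> x \<ge> 0"
      "adj\<^bsub>BL\<^esub> (c \<odot>\<^bsub>BL\<^esub> x) = cnj c \<odot>\<^bsub>BL\<^esub> adj\<^bsub>BL\<^esub> x"
      "nrm\<^bsub>BL\<^esub> x = 0 \<longleftrightarrow> x = \<zero>\<^bsub>BL\<^esub>" "nrm\<^bsub>BL\<^esub> (c \<odot>\<^bsub>BL\<^esub> x) = cmod c * nrm\<^bsub>BL\<^esub> x"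
      using S inj_onD[OF inj_on_mat _ S(1) ops_0]
      by (auto simp: BL_simps ops_closed adjop_ops(2) ops_mult(2) ops_scalar_op_mem(2) ops_scalar_op norm_scalar_op_mult)
    assume "y \<in> carrier BL"
    then obtain T where T: "T \<in> ops" "y = mat T" by (auto simp: BL_simps)
    show "x \<otimes>\<^bsub>BL\<^esub> y \<in> carrier BL"
      "(c \<odot>\<^bsub>BL\<^esub> x) \<otimes>\<^bsub>BL\<^esub> y = c \<odot>\<^bsub>BL\<^esub> (x \<otimes>\<^bsub>BL\<^esub> y)" "x \<otimes>\<^bsub>BL\<^esub> (c \<odot>\<^bsub>BL\<^esub> y) = c \<odot>\<^bsub>BL\<^esub> (x \<otimes>\<^bsub>BL\<^esub> y)"
      "adj\<^bsub>BL\<^esub> (x \<oplus>\<^bsub>BL\<^esub> y) = adj\<^bsub>BL\<^esub> x \<oplus>\<^bsub>BL\<^esub> adj\<^bsub>BL\<^esub> y" "adj\<^bsub>BL\<^esub> (x \<otimes>\<^bsub>BL\<^esub> y) = adj\<^bsub>BL\<^esub> y \<otimes>\<^bsub>BL\<^esub> adj\<^bsub>BL\<^esub> x"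
      "nrm\<^bsub>BL\<^esub> (x \<oplus>\<^bsub>BL\<^esub> y) \<le> nrm\<^bsub>BL\<^esub> x + nrm\<^bsub>BL\<^esub> y" "nrm\<^bsub>BL\<^esub> (x \<otimes>\<^bsub>BL\<^esub> y) \<le> nrm\<^bsub>BL\<^esub> x * nrm\<^bsub>BL\<^esub> y"
      using S T
      by (auto simp: BL_simps ops_closed ops_add(2) ops_mult(2) norm_triangle_ineq norm_blinfun_compose
          blinfun_compose_assoc[symmetric] ops_scalar_op)
    assume "z \<in> carrier BL"
    then obtain U where U: "U \<in> ops" "z = mat U" by (auto simp: BL_simps)
    show "(x \<otimes>\<^bsub>BL\<^esub> y) \<otimes>\<^bsub>BL\<^esub> z = x \<otimes>\<^bsub>BL\<^esub> (y \<otimes>\<^bsub>BL\<^esub> z)"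
      "(x \<oplus>\<^bsub>BL\<^esub> y) \<otimes>\<^bsub>BL\<^esub> z = (x \<otimes>\<^bsub>BL\<^esub> z) \<oplus>\<^bsub>BL\<^esub> (y \<otimes>\<^bsub>BL\<^esub> z)"
      "x \<otimes>\<^bsub>BL\<^esub> (y \<oplus>\<^bsub>BL\<^esub> z) = (x \<otimes>\<^bsub>BL\<^esub> y) \<oplus>\<^bsub>BL\<^esub> (x \<otimes>\<^bsub>BL\<^esub> z)"
      using S T U by (simp_all add: BL_simps ops_closed blinfun_compose_assoc
          bounded_bilinear.add_left[OF bounded_bilinear_blinfun_compose] bounded_bilinear.add_right[OF bounded_bilinear_blinfun_compose]) }
qed

interpretation BL: normed_star_algebra BL by (rule normed_star_algebra_BL)

lemma BL_minus: assumes "S \<in> ops" "T \<in> ops" shows "mat S \<ominus>\<^bsub>BL\<^esub> mat T = mat (S - T)"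
  using BL.add_minus_cancel[of "mat (S - T)" "mat T"] assms by (simp add: BL_simps ops_closed)

text \<open>Passing to adjoints is isometric, so the adjoints of a convergent sequence converge too,
  and both defining identities pass to the limit.\<close>

lemma ops_limit:
  assumes X: "\<And>n. X n \<in> ops" and lim: "X \<longlonglongrightarrow> T" shows "T \<in> ops"
proof -
  have "Cauchy (\<lambda>n. adjop (X n))"
  proof (rule CauchyI)
    fix e :: real assume "0 < e"
    then obtain M where "\<forall>m\<ge>M. \<forall>n\<ge>M. norm (X m - X n) < e" using CauchyD[OF LIMSEQ_imp_Cauchy[OF lim]] by blast
    moreover have "norm (adjop (X m) - adjop (X n)) = norm (X m - X n)" for m n
      using norm_adjop_mult(2)[OF ops_minus(1)[OF X X]] ops_minus(2)[OF X X] by metis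
    ultimately show "\<exists>M. \<forall>m\<ge>M. \<forall>n\<ge>M. norm (adjop (X m) - adjop (X n)) < e" by auto
  qed
  then obtain S where S: "(\<lambda>n. adjop (X n)) \<longlonglongrightarrow> S" using convergent_eq_Cauchy by blast
  show ?thesis
  proof (rule opsI(1)[of T S])
    fix x y
    have "(\<lambda>n. inner (blinfun_apply (X n) x) y) \<longlonglongrightarrow> inner (blinfun_apply T x) y"
      by (intro tendsto_intros lim)
    moreover have "(\<lambda>n. inner x (blinfun_apply (adjop (X n)) y)) \<longlonglongrightarrow> inner x (blinfun_apply S y)"
      by (intro tendsto_intros S)
    ultimately show "inner (blinfun_apply T x) y = inner x (blinfun_apply S y)"
      using ops_inner[OF X] LIMSEQ_unique by simp
  next
    fix c x
    have "(\<lambda>n. blinfun_apply (X n) (blinfun_apply (scalar_op c) x)) \<longlonglongrightarrow> blinfun_apply T (blinfun_apply (scalar_op c) x)"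
      by (intro tendsto_intros lim)
    moreover have "(\<lambda>n. blinfun_apply (scalar_op c) (blinfun_apply (X n) x)) \<longlonglongrightarrow> blinfun_apply (scalar_op c) (blinfun_apply T x)"
      by (intro tendsto_intros lim)
    ultimately show "blinfun_apply T (blinfun_apply (scalar_op c) x) = blinfun_apply (scalar_op c) (blinfun_apply T x)"
      using ops_scalar_op_apply[OF X] LIMSEQ_unique by simp
  qed
qed

lemma cstar_algebra_BL: "cstar_algebra BL"
proof (intro cstar_algebra.intro normed_star_algebra_BL cstar_algebra_axioms.intro)
  show "nrm\<^bsub>BL\<^esub> (adj\<^bsub>BL\<^esub> x \<otimes>\<^bsub>BL\<^esub> x) = (nrm\<^bsub>BL\<^esub> x)\<^sup>2" if "x \<in> carrier BL" for x
    using that by (auto simp: BL_simps ops_closed norm_adjop_mult)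
  interpret Metric_space "carrier BL" "cdist BL" by (rule BL.Metric_space_cdist)
  have dist: "cdist BL (mat S) (mat T) = norm (S - T)" if "S \<in> ops" "T \<in> ops" for S T
    using that by (simp add: cdist_def BL_minus) (simp add: BL_simps ops_closed)
  show "mcomplete"
    unfolding mcomplete_def
  proof (intro allI impI)
    fix \<sigma> assume \<sigma>: "MCauchy \<sigma>"
    define X where "X n = opr (\<sigma> n)" for n
    have X: "X n \<in> ops" "\<sigma> n = mat (X n)" for n
    proof -
      have "\<sigma> n \<in> mat ` ops" using \<sigma> unfolding MCauchy_def by (auto simp: BL_simps)
      then show "X n \<in> ops" "\<sigma> n = mat (X n)" by (auto simp: X_def)
    qed
    have "Cauchy X"
    proof (rule CauchyI)
      fix e :: real assume "0 < e"
      then obtain N where "\<forall>n n'. N \<le> n \<longrightarrow> N \<le> n' \<longrightarrow> cdist BL (\<sigma> n) (\<sigma> n') < e" using \<sigma> unfolding MCauchy_def by blast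
      then show "\<exists>M. \<forall>m\<ge>M. \<forall>n\<ge>M. norm (X m - X n) < e" using X dist by auto
    qed
    then obtain T where T: "X \<longlonglongrightarrow> T" using convergent_eq_Cauchy by blast
    then have TO: "T \<in> ops" using ops_limit X by blast
    have "limitin mtopology \<sigma> (mat T) sequentially"
      unfolding limit_metric_sequentially
    proof (intro conjI allI impI)
      show "mat T \<in> carrier BL" using TO by (simp add: BL_simps)
      fix e :: real assume "0 < e"
      then obtain N where "\<forall>n\<ge>N. norm (X n - T) < e" using LIMSEQ_D[OF T] by blast
      then show "\<exists>N. \<forall>n\<ge>N. \<sigma> n \<in> carrier BL \<and> cdist BL (\<sigma> n) (mat T) < e"
        using X TO dist by (auto simp: BL_simps)
    qed
    then show "\<exists>x. limitin mtopology \<sigma> x sequentially" by blast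
  qed
qed

section \<open>Representations by partial bijections\<close>

lemma mat_ops_sum:
  assumes "finite S" "\<And>i. i \<in> S \<Longrightarrow> F i \<in> ops"
  shows "(\<Sum>i\<in>S. F i) \<in> ops" "finsum BL (\<lambda>i. mat (F i)) S = mat (\<Sum>i\<in>S. F i)"
proof -
  have "(\<Sum>i\<in>S. F i) \<in> ops \<and> finsum BL (\<lambda>i. mat (F i)) S = mat (\<Sum>i\<in>S. F i)"
    using assms
  proof (induction S rule: finite_induct)
    case empty
    then show ?case by (simp add: ops_0 BL_simps BL.M.finsum_empty)
  next
    case (insert i S)
    then have IH: "(\<Sum>i\<in>S. F i) \<in> ops" "finsum BL (\<lambda>i. mat (F i)) S = mat (\<Sum>i\<in>S. F i)" by auto
    have "finsum BL (\<lambda>i. mat (F i)) (insert i S) = mat (F i) \<oplus>\<^bsub>BL\<^esub> finsum BL (\<lambda>i. mat (F i)) S"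
      using insert by (intro BL.M.finsum_insert) (auto simp: BL_simps)
    then show ?case using insert IH by (simp add: BL_simps ops_closed)
  qed
  then show "(\<Sum>i\<in>S. F i) \<in> ops" "finsum BL (\<lambda>i. mat (F i)) S = mat (\<Sum>i\<in>S. F i)" by auto
qed

lemma el_sum_apply: "el (blinfun_apply (\<Sum>i\<in>S. F i) x) n = (\<Sum>i\<in>S. el (blinfun_apply (F i) x) n)"
  by (induction S rule: infinite_finite_induct) (simp_all add: ell2_rep_eq plus_blinfun.rep_eq zero_blinfun.rep_eq)

text \<open>The model is a set of boundary paths: \<open>R \<eta>\<close> consists of those starting
  with \<eta>, \<open>f \<eta>\<close> puts \<eta> in front, and c is a unimodular functor that
  twists the action. \<open>R_meet\<close> is the source of \<open>CK3\<close> and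
  \<open>R_FE\<close> that of \<open>CK4\<close>.\<close>

locale path_action = k_graph \<Lambda>
  for \<Lambda> :: "('p, 'k::finite) kgraph" +
  fixes R :: "'p \<Rightarrow> 'x set" and f :: "'p \<Rightarrow> 'x \<Rightarrow> 'x" and c :: "'p \<Rightarrow> complex"
  assumes fa: "finitely_aligned \<Lambda>"
    and bij: "\<eta> \<in> paths \<Longrightarrow> bij_betw (f \<eta>) (R (src \<eta>)) (R \<eta>)"
    and f_cmp: "\<lbrakk>\<mu> \<in> paths; \<nu> \<in> paths; src \<mu> = ran \<nu>; x \<in> R (src \<nu>)\<rbrakk> \<Longrightarrow> f (cmp \<mu> \<nu>) x = f \<mu> (f \<nu> x)"
    and R_mono: "\<mu> \<preceq> \<kappa> \<Longrightarrow> R \<kappa> \<subseteq> R \<mu>"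
    and R_meet: "\<lbrakk>\<mu> \<in> paths; \<nu> \<in> paths; x \<in> R \<mu>; x \<in> R \<nu>\<rbrakk> \<Longrightarrow> \<exists>\<kappa>\<in>MCE \<mu> \<nu>. x \<in> R \<kappa>"
    and R_FE: "\<lbrakk>v \<in> vertices; E \<in> FE v; x \<in> R v\<rbrakk> \<Longrightarrow> \<exists>\<eta>\<in>E. x \<in> R \<eta>"
    and c_norm: "\<eta> \<in> paths \<Longrightarrow> cmod (c \<eta>) = 1"
    and c_cmp: "\<lbrakk>\<mu> \<in> paths; \<nu> \<in> paths; src \<mu> = ran \<nu>\<rbrakk> \<Longrightarrow> c (cmp \<mu> \<nu>) = c \<mu> * c \<nu>"
begin

lemma f_in: "\<lbrakk>\<eta> \<in> paths; x \<in> R (src \<eta>)\<rbrakk> \<Longrightarrow> f \<eta> x \<in> R \<eta>"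
  using bij bij_betwE by blast

lemma f_inj: "\<lbrakk>\<eta> \<in> paths; x \<in> R (src \<eta>); y \<in> R (src \<eta>); f \<eta> x = f \<eta> y\<rbrakk> \<Longrightarrow> x = y"
  using bij by (meson bij_betw_def inj_onD)

definition finv :: "'p \<Rightarrow> 'x \<Rightarrow> 'x" where
  "finv \<eta> = inv_into (R (src \<eta>)) (f \<eta>)"

lemma finv_in: "\<lbrakk>\<eta> \<in> paths; x \<in> R \<eta>\<rbrakk> \<Longrightarrow> finv \<eta> x \<in> R (src \<eta>)"
  unfolding finv_def using bij[of \<eta>] by (auto simp: bij_betw_def intro: inv_into_into)

lemma f_finv: "\<lbrakk>\<eta> \<in> paths; x \<in> R \<eta>\<rbrakk> \<Longrightarrow> f \<eta> (finv \<eta> x) = x"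
  unfolding finv_def using bij[of \<eta>] by (auto simp: bij_betw_def intro: f_inv_into_f)

lemma finv_f: "\<lbrakk>\<eta> \<in> paths; x \<in> R (src \<eta>)\<rbrakk> \<Longrightarrow> finv \<eta> (f \<eta> x) = x"
  unfolding finv_def using bij[of \<eta>] by (auto simp: bij_betw_def)

lemma R_ran: "\<eta> \<in> paths \<Longrightarrow> R \<eta> \<subseteq> R (ran \<eta>)"
  using R_mono ran_pre by blast

lemma R_meets: "\<lbrakk>\<mu> \<in> paths; \<nu> \<in> paths; x \<in> R \<mu>; x \<in> R \<nu>\<rbrakk> \<Longrightarrow> meets \<mu> \<nu>"
  using R_meet MCE_empty_iff by blast

text \<open>The map of a vertex is injective and idempotent, hence the identity on its
  domain.\<close>

lemma f_vertex:
  assumes v: "v \<in> vertices" and x: "x \<in> R v" shows "f v x = x" and "finv v x = x"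
proof -
  have p: "v \<in> paths" "src v = v" "ran v = v" "cmp v v = v"
    using v vertex_path vertex_ran cmp_src_right[of v] by auto
  have "f v (f v x) = f v x" using f_cmp[of v v x] p x by simp
  then show "f v x = x" using f_inj[of v "f v x" x] f_in[of v x] p x by simp
  then show "finv v x = x" using finv_f[of v x] p x by simp
qed

lemma c_vertex: assumes v: "v \<in> vertices" shows "c v = 1"
proof -
  have p: "v \<in> paths" "src v = v" "ran v = v" "cmp v v = v"
    using v vertex_path vertex_ran cmp_src_right[of v] by auto
  then have "c v * c v = c v" using c_cmp[of v v] by simp
  moreover have "c v \<noteq> 0" using c_norm[OF p(1)] by auto
  ultimately show ?thesis by simp
qed

lemma c_cnj: "\<eta> \<in> paths \<Longrightarrow> c \<eta> * cnj (c \<eta>) = 1"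
  using c_norm[of \<eta>] complex_norm_square[of "c \<eta>"] by simp

lemma R_cmp:
  assumes p: "\<mu> \<in> paths" "\<nu> \<in> paths" "src \<mu> = ran \<nu>"
  shows "x \<in> R (cmp \<mu> \<nu>) \<longleftrightarrow> x \<in> R \<mu> \<and> finv \<mu> x \<in> R \<nu>" and "x \<in> R (cmp \<mu> \<nu>) \<Longrightarrow> finv (cmp \<mu> \<nu>) x = finv \<nu> (finv \<mu> x)"
proof -
  let ?k = "cmp \<mu> \<nu>"
  have k: "?k \<in> paths" "src ?k = src \<nu>" using p cmp_closed src_cmp by auto
  have 1: "finv \<mu> x = f \<nu> (finv ?k x) \<and> x \<in> R \<mu> \<and> finv \<mu> x \<in> R \<nu>" if x: "x \<in> R ?k"
  proof -
    have y: "finv ?k x \<in> R (src \<nu>)" using finv_in[OF k(1) x] k by simp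
    have z: "f \<nu> (finv ?k x) \<in> R \<nu>" using f_in[OF p(2) y] .
    then have z': "f \<nu> (finv ?k x) \<in> R (src \<mu>)" using R_ran[OF p(2)] p by auto
    have "x = f \<mu> (f \<nu> (finv ?k x))" using f_finv[OF k(1) x] f_cmp[OF p y] by simp
    then show ?thesis using finv_f[OF p(1) z'] f_in[OF p(1) z'] z by metis
  qed
  show "x \<in> R ?k \<longleftrightarrow> x \<in> R \<mu> \<and> finv \<mu> x \<in> R \<nu>"
  proof
    assume a: "x \<in> R \<mu> \<and> finv \<mu> x \<in> R \<nu>"
    have y: "finv \<nu> (finv \<mu> x) \<in> R (src \<nu>)" using finv_in[OF p(2)] a by simp
    have "f ?k (finv \<nu> (finv \<mu> x)) = x" using f_cmp[OF p y] f_finv p a by simp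
    then show "x \<in> R ?k" using f_in[OF k(1), of "finv \<nu> (finv \<mu> x)"] y k by simp
  qed (use 1 in blast)
  assume x: "x \<in> R ?k"
  have y: "finv ?k x \<in> R (src \<nu>)" using finv_in[OF k(1) x] k by simp
  show "finv ?k x = finv \<nu> (finv \<mu> x)" using 1[OF x] finv_f[OF p(2) y] by simp
qed

text \<open>Transports an action to the natural numbers, the index set of \<open>ell2\<close>, along
  a coding e that is injective on the union of all \<open>R \<eta>\<close>.\<close>

lemma path_action_image:
  assumes e: "inj_on e (\<Union>\<eta>\<in>paths. R \<eta>)"
  shows "path_action \<Lambda> (\<lambda>\<eta>. e ` R \<eta>) (\<lambda>\<eta>. e \<circ> f \<eta> \<circ> inv_into (\<Union>\<eta>\<in>paths. R \<eta>) e) c"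
proof -
  let ?Y = "\<Union>\<eta>\<in>paths. R \<eta>" and ?d = "inv_into (\<Union>\<eta>\<in>paths. R \<eta>) e"
  have d: "?d (e x) = x" if "x \<in> R \<eta>" "\<eta> \<in> paths" for x \<eta>
    using that by (intro inv_into_f_f[OF e]) auto
  have e': "e x \<in> e ` R \<eta> \<longleftrightarrow> x \<in> R \<eta>" if "x \<in> R \<mu>" "\<mu> \<in> paths" "\<eta> \<in> paths" for x \<eta> \<mu>
    by (rule inj_on_image_mem_iff[OF e]) (use that in auto)
  show ?thesis
  proof (intro path_action.intro path_action_axioms.intro k_graph_axioms fa)
    fix \<eta> assume h: "\<eta> \<in> paths"
    have 1: "bij_betw ?d (e ` R (src \<eta>)) (R (src \<eta>))"
      using d[OF _ src_closed[OF h]] by (intro bij_betwI[where g = e]) auto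
    have 2: "bij_betw e (R \<eta>) (e ` R \<eta>)"
      using h e by (intro inj_on_imp_bij_betw) (auto intro: inj_on_subset)
    show "bij_betw (e \<circ> f \<eta> \<circ> ?d) (e ` R (src \<eta>)) (e ` R \<eta>)"
      using bij_betw_trans[OF bij_betw_trans[OF 1 bij[OF h]] 2] by (simp add: comp_assoc)
    show "cmod (c \<eta>) = 1" using c_norm[OF h] .
  next
    fix \<mu> \<nu> x assume a: "\<mu> \<in> paths" "\<nu> \<in> paths" "src \<mu> = ran \<nu>" "x \<in> e ` R (src \<nu>)"
    then obtain y where y: "y \<in> R (src \<nu>)" "x = e y" by auto
    show "(e \<circ> f (cmp \<mu> \<nu>) \<circ> ?d) x = (e \<circ> f \<mu> \<circ> ?d) ((e \<circ> f \<nu> \<circ> ?d) x)"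
      using y a d[OF y(1) src_closed[OF a(2)]] d[OF f_in[OF a(2) y(1)] a(2)] f_cmp[OF a(1-3) y(1)] by simp
  next
    fix \<mu> \<kappa> assume "\<mu> \<preceq> \<kappa>" then show "e ` R \<kappa> \<subseteq> e ` R \<mu>" using R_mono by blast
  next
    fix \<mu> \<nu> x assume a: "\<mu> \<in> paths" "\<nu> \<in> paths" "x \<in> e ` R \<mu>" "x \<in> e ` R \<nu>"
    then obtain y where y: "y \<in> R \<mu>" "x = e y" by auto
    then have "y \<in> R \<nu>" using a e' by blast
    then show "\<exists>\<kappa>\<in>MCE \<mu> \<nu>. x \<in> e ` R \<kappa>" using R_meet[OF a(1,2) y(1)] y by blast
  next
    fix v E x assume a: "v \<in> vertices" "E \<in> FE v" "x \<in> e ` R v"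
    then show "\<exists>\<eta>\<in>E. x \<in> e ` R \<eta>" using R_FE by blast
  next
    fix \<mu> \<nu> assume "\<mu> \<in> paths" "\<nu> \<in> paths" "src \<mu> = ran \<nu>"
    then show "c (cmp \<mu> \<nu>) = c \<mu> * c \<nu>" by (rule c_cmp)
  qed
qed

end

locale nat_path_action = path_action \<Lambda> R f c
  for \<Lambda> :: "('p, 'k::finite) kgraph" and R :: "'p \<Rightarrow> nat set" and f c
begin

text \<open>\<open>popr\<close> reads backwards from output coordinates, so removing \<eta> is the
  partial map that belongs to the operator putting \<eta> in front.\<close>

definition hm :: "'p \<Rightarrow> nat \<Rightarrow> nat option" where
  "hm \<eta> n = (if n \<in> R \<eta> then Some (finv \<eta> n) else None)"

definition gen_op :: "'p \<Rightarrow> ell2 \<Rightarrow>\<^sub>L ell2" where "gen_op \<eta> = popr (c \<eta>) (hm \<eta>)"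

definition rep :: "'p \<Rightarrow> nat \<Rightarrow> complex" where "rep \<eta> = mat (gen_op \<eta>)"

lemma pinj_hm: "\<eta> \<in> paths \<Longrightarrow> pinj (hm \<eta>)"
  unfolding pinj_def hm_def using f_finv by (metis option.distinct(1) option.inject)

lemma pinv_hm:
  assumes h: "\<eta> \<in> paths" shows "pinv (hm \<eta>) m = (if m \<in> R (src \<eta>) then Some (f \<eta> m) else None)"
proof (cases "m \<in> R (src \<eta>)")
  case True
  have "hm \<eta> (f \<eta> m) = Some m" using f_in[OF h True] finv_f[OF h True] by (simp add: hm_def)
  then show ?thesis using True pinv_Some_iff[OF pinj_hm[OF h]] by simp
next
  case False
  have "hm \<eta> n \<noteq> Some m" for n using finv_in[OF h, of n] False by (auto simp: hm_def)
  then show ?thesis using False by (simp add: pinv_def)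
qed

lemma gen_op_ops: "\<eta> \<in> paths \<Longrightarrow> gen_op \<eta> \<in> ops"
  unfolding gen_op_def by (rule ops_popr[OF pinj_hm])

lemma el_gen_op: "\<eta> \<in> paths \<Longrightarrow> el (blinfun_apply (gen_op \<eta>) x) n = (if n \<in> R \<eta> then c \<eta> * el x (finv \<eta> n) else 0)"
  unfolding gen_op_def by (subst el_popr[OF pinj_hm]) (auto simp: hm_def)

lemma el_adj_gen_op:
  "\<eta> \<in> paths \<Longrightarrow> el (blinfun_apply (adjop (gen_op \<eta>)) x) n = (if n \<in> R (src \<eta>) then cnj (c \<eta>) * el x (f \<eta> n) else 0)"
  unfolding gen_op_def by (subst ops_popr(2)[OF pinj_hm], assumption, subst el_popr) (auto simp: pinj_hm pinj_pinv pinv_hm)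

lemma el_gen_op_adj_gen_op:
  assumes p: "\<alpha> \<in> paths" "\<beta> \<in> paths" "src \<alpha> = src \<beta>"
  shows "el (blinfun_apply (gen_op \<alpha> o\<^sub>L adjop (gen_op \<beta>)) x) n = (if n \<in> R \<alpha> then c \<alpha> * cnj (c \<beta>) * el x (f \<beta> (finv \<alpha> n)) else 0)"
  using p finv_in[OF p(1)] by (simp add: el_gen_op el_adj_gen_op)

lemma el_gen_op_vertex:
  assumes v: "v \<in> vertices" shows "el (blinfun_apply (gen_op v) x) n = (if n \<in> R v then el x n else 0)"
  using v vertex_path[OF v] by (simp add: el_gen_op f_vertex c_vertex)

lemma gen_op_proj:
  assumes p: "\<eta> \<in> paths"
  shows "el (blinfun_apply (gen_op \<eta> o\<^sub>L adjop (gen_op \<eta>)) x) n = (if n \<in> R \<eta> then el x n else 0)"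
  using el_gen_op_adj_gen_op[OF p p refl, of x n] c_cnj[OF p] f_finv[OF p, of n] by simp

text \<open>At a single coordinate n the sum has at most one nonzero term: \<open>f \<mu> n\<close>
  lies in \<open>R \<kappa>\<close> for at most one \<kappa> in \<open>MCE \<mu> \<nu>\<close>,
  since these paths all have the same degree.\<close>

lemma gen_op_CK3:
  assumes p: "\<mu> \<in> paths" "\<nu> \<in> paths"
    and S: "S = {(\<alpha>, \<beta>). \<alpha> \<in> paths_to (src \<mu>) \<and> \<beta> \<in> paths_to (src \<nu>) \<and>
               cmp \<mu> \<alpha> = cmp \<nu> \<beta> \<and> cmp \<mu> \<alpha> \<in> MCE \<mu> \<nu>}" and fin: "finite S"
  shows "adjop (gen_op \<mu>) o\<^sub>L gen_op \<nu> = (\<Sum>q\<in>S. gen_op (fst q) o\<^sub>L adjop (gen_op (snd q)))"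
proof (rule op_eqI)
  fix x n
  have SD: "\<alpha> \<in> paths" "src \<mu> = ran \<alpha>" "\<beta> \<in> paths" "src \<nu> = ran \<beta>" "cmp \<mu> \<alpha> = cmp \<nu> \<beta>"
    "cmp \<mu> \<alpha> \<in> MCE \<mu> \<nu>" if "(\<alpha>, \<beta>) \<in> S" for \<alpha> \<beta>
    using that unfolding S mem_Collect_eq prod.case paths_to_iff by - (elim conjE, simp only:)+
  have SS: "src \<alpha> = src \<beta>" if "(\<alpha>, \<beta>) \<in> S" for \<alpha> \<beta>
    using arg_cong[OF SD(5)[OF that], of "src"] SD(1-4)[OF that] p by (simp add: src_cmp)
  define F where "F = (\<lambda>q. el (blinfun_apply (gen_op (fst q) o\<^sub>L adjop (gen_op (snd q))) x) n)"
  have F: "F (\<alpha>, \<beta>) = (if n \<in> R \<alpha> then c \<alpha> * cnj (c \<beta>) * el x (f \<beta> (finv \<alpha> n)) else 0)" if "(\<alpha>, \<beta>) \<in> S" for \<alpha> \<beta>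
    unfolding F_def fst_conv snd_conv by (rule el_gen_op_adj_gen_op[OF SD(1)[OF that] SD(3)[OF that] SS[OF that]])
  have Rk: "n \<in> R (src \<mu>) \<and> f \<mu> n \<in> R (cmp \<mu> \<alpha>)" if q: "(\<alpha>, \<beta>) \<in> S" and n: "n \<in> R \<alpha>" for \<alpha> \<beta>
  proof -
    have a: "\<alpha> \<in> paths" "src \<mu> = ran \<alpha>" using SD[OF q] by auto
    have nm: "n \<in> R (src \<mu>)" using R_ran[OF a(1)] n a(2) by auto
    then show ?thesis using R_cmp(1)[OF p(1) a] f_in[OF p(1) nm] finv_f[OF p(1) nm] n by simp
  qed
  have L: "el (blinfun_apply (adjop (gen_op \<mu>) o\<^sub>L gen_op \<nu>) x) n =
      (if n \<in> R (src \<mu>) \<and> f \<mu> n \<in> R \<nu> then cnj (c \<mu>) * c \<nu> * el x (finv \<nu> (f \<mu> n)) else 0)"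
    using p by (simp add: el_gen_op el_adj_gen_op)
  have "el (blinfun_apply (adjop (gen_op \<mu>) o\<^sub>L gen_op \<nu>) x) n = sum F S"
  proof (cases "n \<in> R (src \<mu>) \<and> f \<mu> n \<in> R \<nu>")
    case False
    have "F q = 0" if "q \<in> S" for q
    proof -
      obtain \<alpha> \<beta> where q: "q = (\<alpha>, \<beta>)" by (cases q)
      then have qS: "(\<alpha>, \<beta>) \<in> S" using that by simp
      have "\<nu> \<preceq> cmp \<mu> \<alpha>" using SD(6)[OF qS] MCE_iff[OF p] by blast
      then have "n \<notin> R \<alpha>" using Rk[OF qS] R_mono False by blast
      then show ?thesis using F[OF qS] q by simp
    qed
    then show ?thesis using L False by (simp add: sum.neutral)
  next
    case True
    then have nm: "n \<in> R (src \<mu>)" and fn: "f \<mu> n \<in> R \<mu>" "f \<mu> n \<in> R \<nu>" using f_in[OF p(1)] by auto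
    obtain \<kappa> where k: "\<kappa> \<in> MCE \<mu> \<nu>" "f \<mu> n \<in> R \<kappa>" using R_meet[OF p fn] by blast
    have k': "\<mu> \<preceq> \<kappa>" "\<nu> \<preceq> \<kappa>" using k(1) MCE_iff[OF p] by blast+
    obtain \<alpha> where a: "\<alpha> \<in> paths" "src \<mu> = ran \<alpha>" "\<kappa> = cmp \<mu> \<alpha>" using k'(1) by (blast elim: preE)
    obtain \<beta> where b: "\<beta> \<in> paths" "src \<nu> = ran \<beta>" "\<kappa> = cmp \<nu> \<beta>" using k'(2) by (blast elim: preE)
    have qS: "(\<alpha>, \<beta>) \<in> S"
      unfolding S mem_Collect_eq prod.case paths_to_iff using a b k(1) by metis
    have na: "n \<in> R \<alpha>" using R_cmp(1)[OF p(1) a(1,2)] k(2) a(3) finv_f[OF p(1) nm] by simp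
    have "F q = 0" if q: "q \<in> S" "q \<noteq> (\<alpha>, \<beta>)" for q
    proof -
      obtain \<alpha>' \<beta>' where q': "q = (\<alpha>', \<beta>')" by (cases q)
      then have q'S: "(\<alpha>', \<beta>') \<in> S" using q by simp
      note D = SD[OF q'S]
      have "n \<notin> R \<alpha>'"
      proof
        assume "n \<in> R \<alpha>'"
        then have fk: "f \<mu> n \<in> R (cmp \<mu> \<alpha>')" using Rk[OF q'S] by blast
        have kp: "\<kappa> \<in> paths" "cmp \<mu> \<alpha>' \<in> paths" using k(1) D(6) MCE_paths by blast+
        have "meets \<kappa> (cmp \<mu> \<alpha>')" using R_meets[OF kp k(2) fk] .
        moreover have "deg \<kappa> = deg (cmp \<mu> \<alpha>')" using k(1) D(6) MCE_iff[OF p] by simp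
        ultimately have eq: "cmp \<mu> \<alpha>' = \<kappa>" using meets_same_deg by metis
        have "\<alpha>' = \<alpha>" using cmp_left_cancel[OF p(1) D(1) a(1) D(2) a(2)] eq a(3) by simp
        moreover have "\<beta>' = \<beta>" using cmp_left_cancel[OF p(2) D(3) b(1) D(4) b(2)] eq D(5) b(3) by simp
        ultimately show False using q q' by simp
      qed
      then show ?thesis using F[OF q'S] q' by simp
    qed
    then have "sum F S = F (\<alpha>, \<beta>)"
      using fin qS by (subst sum.remove[of S "(\<alpha>, \<beta>)"]) (auto intro: sum.neutral)
    also have "\<dots> = c \<alpha> * cnj (c \<beta>) * el x (f \<beta> (finv \<alpha> n))" using F[OF qS] na by simp
    \<comment> \<open>Both sides are what follows \<nu> in \<open>f \<mu> n\<close>, computed along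
      the two factorisations of \<kappa>.\<close>
    also have "f \<beta> (finv \<alpha> n) = finv \<nu> (f \<mu> n)"
    proof -
      let ?y = "finv \<alpha> n"
      have y: "?y \<in> R (src \<alpha>)" "?y \<in> R (src \<beta>)" using finv_in[OF a(1) na] SS[OF qS] by auto
      have "f \<mu> n = f \<kappa> ?y" using f_cmp[OF p(1) a(1,2) y(1)] f_finv[OF a(1) na] a(3) by simp
      also have "\<dots> = f \<nu> (f \<beta> ?y)" using f_cmp[OF p(2) b(1,2) y(2)] b(3) by simp
      finally have "f \<mu> n = f \<nu> (f \<beta> ?y)" .
      moreover have "f \<beta> ?y \<in> R (src \<nu>)" using f_in[OF b(1) y(2)] R_ran[OF b(1)] b(2) by auto
      ultimately show ?thesis using finv_f[OF p(2)] by simp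
    qed
    \<comment> \<open>Multiplicativity on the two factorisations of \<kappa> gives
      \<open>c \<mu> * c \<alpha> = c \<nu> * c \<beta>\<close>, and unimodularity turns factors
      into conjugates on the other side.\<close>
    also have "c \<alpha> * cnj (c \<beta>) = cnj (c \<mu>) * c \<nu>"
    proof -
      have "c \<mu> * c \<alpha> = c \<nu> * c \<beta>" using c_cmp[OF p(1) a(1,2)] c_cmp[OF p(2) b(1,2)] a(3) b(3) by simp
      then have "cnj (c \<mu>) * (c \<mu> * c \<alpha>) * cnj (c \<beta>) = cnj (c \<mu>) * (c \<nu> * c \<beta>) * cnj (c \<beta>)" by simp
      then have "(c \<mu> * cnj (c \<mu>)) * (c \<alpha> * cnj (c \<beta>)) = (cnj (c \<mu>) * c \<nu>) * (c \<beta> * cnj (c \<beta>))"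
        by (simp only: mult.assoc mult.commute mult.left_commute)
      then show ?thesis using c_cnj[OF p(1)] c_cnj[OF b(1)] by simp
    qed
    finally show ?thesis using L True by simp
  qed
  then show "el (blinfun_apply (adjop (gen_op \<mu>) o\<^sub>L gen_op \<nu>) x) n = el (blinfun_apply (\<Sum>q\<in>S. gen_op (fst q) o\<^sub>L adjop (gen_op (snd q))) x) n"
    unfolding el_sum_apply F_def .
qed

text \<open>The product is the projection onto the coordinates in \<open>R v\<close> that avoid
  every \<open>R \<eta>\<close>; for an exhaustive set none are left, by
  \<open>R_FE\<close>.\<close>

lemma rep_gap:
  assumes v: "v \<in> vertices" and \<eta>s: "set \<eta>s \<subseteq> paths_to v"
  shows "\<exists>W\<in>ops. foldr (\<lambda>\<eta> x. (rep v \<ominus>\<^bsub>BL\<^esub> rep \<eta> \<otimes>\<^bsub>BL\<^esub> adj\<^bsub>BL\<^esub> (rep \<eta>)) \<otimes>\<^bsub>BL\<^esub> x) \<eta>s (rep v) = mat W \<and>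
     (\<forall>x n. el (blinfun_apply W x) n = (if n \<in> R v \<and> (\<forall>\<eta>\<in>set \<eta>s. n \<notin> R \<eta>) then el x n else 0))"
  using \<eta>s
proof (induction \<eta>s)
  case Nil
  then show ?case using gen_op_ops[OF vertex_path[OF v]] el_gen_op_vertex[OF v] by (intro bexI[of _ "gen_op v"]) (auto simp: rep_def)
next
  case (Cons \<eta> \<eta>s)
  let ?foldr = "\<lambda>\<eta>s. foldr (\<lambda>\<eta> x. (rep v \<ominus>\<^bsub>BL\<^esub> rep \<eta> \<otimes>\<^bsub>BL\<^esub> adj\<^bsub>BL\<^esub> (rep \<eta>)) \<otimes>\<^bsub>BL\<^esub> x) \<eta>s (rep v)"
  have "set \<eta>s \<subseteq> paths_to v" using Cons.prems by simp
  then obtain W where W: "W \<in> ops" "?foldr \<eta>s = mat W"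
    "\<And>x n. el (blinfun_apply W x) n = (if n \<in> R v \<and> (\<forall>\<eta>\<in>set \<eta>s. n \<notin> R \<eta>) then el x n else 0)"
    using Cons.IH by blast
  have h: "\<eta> \<in> paths" "ran \<eta> = v" using Cons.prems by (auto simp: paths_to_iff)
  have o: "gen_op v \<in> ops" "gen_op \<eta> \<in> ops" "gen_op \<eta> o\<^sub>L adjop (gen_op \<eta>) \<in> ops"
    using gen_op_ops h vertex_path[OF v] by (auto simp: ops_closed)
  let ?W = "(gen_op v - (gen_op \<eta> o\<^sub>L adjop (gen_op \<eta>))) o\<^sub>L W"
  have "?foldr (\<eta> # \<eta>s) = (mat (gen_op v) \<ominus>\<^bsub>BL\<^esub> mat (gen_op \<eta> o\<^sub>L adjop (gen_op \<eta>))) \<otimes>\<^bsub>BL\<^esub> mat W"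
    using W(2) o by (simp add: rep_def BL_simps ops_closed)
  also have "\<dots> = mat ?W" using o W(1) by (simp add: BL_minus BL_simps ops_closed)
  finally have 1: "?foldr (\<eta> # \<eta>s) = mat ?W" .
  have "el (blinfun_apply ?W x) n = (if n \<in> R v \<and> (\<forall>\<eta>\<in>set (\<eta> # \<eta>s). n \<notin> R \<eta>) then el x n else 0)" for x n
  proof -
    have "el (blinfun_apply ?W x) n = (if n \<in> R v then el (blinfun_apply W x) n else 0) - (if n \<in> R \<eta> then el (blinfun_apply W x) n else 0)"
      using el_gen_op_vertex[OF v] gen_op_proj[OF h(1)] by (simp add: minus_blinfun.rep_eq ell2_rep_eq)
    then show ?thesis using R_ran[OF h(1)] h(2) W(3) by auto
  qed
  moreover have "?W \<in> ops" using o W(1) by (simp add: ops_closed)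
  ultimately show ?case using 1 by blast
qed

lemma ck_family_rep: "ck_family \<Lambda> BL rep"
proof (intro ck_family.intro cstar_algebra_BL ck_family_axioms.intro)
  show "rep \<eta> \<in> carrier BL" if "\<eta> \<in> paths" for \<eta> using gen_op_ops that by (simp add: rep_def BL_simps)
  show "rep \<eta> \<otimes>\<^bsub>BL\<^esub> adj\<^bsub>BL\<^esub> (rep \<eta>) \<otimes>\<^bsub>BL\<^esub> rep \<eta> = rep \<eta>" if h: "\<eta> \<in> paths" for \<eta>
  proof -
    have "(gen_op \<eta> o\<^sub>L adjop (gen_op \<eta>)) o\<^sub>L gen_op \<eta> = gen_op \<eta>"
      using gen_op_proj[OF h] h by (intro op_eqI) (simp add: el_gen_op)
    then show ?thesis using gen_op_ops[OF h] by (simp add: rep_def BL_simps ops_closed)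
  qed
  show "adj\<^bsub>BL\<^esub> (rep v) = rep v \<and> rep v \<otimes>\<^bsub>BL\<^esub> rep v = rep v" if v: "v \<in> vertices" for v
  proof -
    have p: "v \<in> paths" "src v = v" using v vertex_path vertex_ran by auto
    have "adjop (gen_op v) = gen_op v" "gen_op v o\<^sub>L gen_op v = gen_op v"
      using p v by (auto intro!: op_eqI simp: el_adj_gen_op el_gen_op_vertex f_vertex c_vertex)
    then show ?thesis using gen_op_ops[OF p(1)] by (simp add: rep_def BL_simps)
  qed
  show "rep v \<otimes>\<^bsub>BL\<^esub> rep w = \<zero>\<^bsub>BL\<^esub>" if v: "v \<in> vertices" "w \<in> vertices" "v \<noteq> w" for v w
  proof -
    have p: "v \<in> paths" "w \<in> paths" using v vertex_path by auto
    have "R v \<inter> R w = {}"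
      using R_meets[OF p] meets_same_deg[of v w] vertex_deg v by fastforce
    then have "gen_op v o\<^sub>L gen_op w = 0"
      using v by (auto intro!: op_eqI simp: el_gen_op_vertex zero_blinfun.rep_eq ell2_rep_eq)
    then show ?thesis using gen_op_ops p by (simp add: rep_def BL_simps)
  qed
  show "rep \<mu> \<otimes>\<^bsub>BL\<^esub> rep \<nu> = rep (cmp \<mu> \<nu>)" if p: "\<mu> \<in> paths" "\<nu> \<in> paths" "src \<mu> = ran \<nu>" for \<mu> \<nu>
  proof -
    have "gen_op \<mu> o\<^sub>L gen_op \<nu> = gen_op (cmp \<mu> \<nu>)"
    proof (rule op_eqI)
      fix x n
      show "el (blinfun_apply (gen_op \<mu> o\<^sub>L gen_op \<nu>) x) n = el (blinfun_apply (gen_op (cmp \<mu> \<nu>)) x) n"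
        using R_cmp[OF p, of n] c_cmp[OF p] p by (simp add: el_gen_op cmp_closed)
    qed
    then show ?thesis using gen_op_ops p by (simp add: rep_def BL_simps)
  qed
  show "adj\<^bsub>BL\<^esub> (rep \<mu>) \<otimes>\<^bsub>BL\<^esub> rep \<nu> = finsum BL (\<lambda>(\<alpha>, \<beta>). rep \<alpha> \<otimes>\<^bsub>BL\<^esub> adj\<^bsub>BL\<^esub> (rep \<beta>))
       {(\<alpha>, \<beta>). \<alpha> \<in> paths_to (src \<mu>) \<and> \<beta> \<in> paths_to (src \<nu>) \<and>
               cmp \<mu> \<alpha> = cmp \<nu> \<beta> \<and> cmp \<mu> \<alpha> \<in> MCE \<mu> \<nu>}" (is "_ = finsum BL ?t ?S")
    if p: "\<mu> \<in> paths" "\<nu> \<in> paths" for \<mu> \<nu>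
  proof -
    have S: "fst q \<in> paths \<and> snd q \<in> paths" if "q \<in> ?S" for q
    proof -
      have "fst q \<in> paths_to (src \<mu>) \<and> snd q \<in> paths_to (src \<nu>)"
        using that unfolding mem_Collect_eq case_prod_beta by (elim conjE) (rule conjI)
      then show ?thesis by (simp add: paths_to_iff)
    qed
    have o: "gen_op (fst q) o\<^sub>L adjop (gen_op (snd q)) \<in> ops" if "q \<in> ?S" for q
      using S[OF that] gen_op_ops by (simp add: ops_closed)
    have "finsum BL ?t ?S = finsum BL (\<lambda>q. mat (gen_op (fst q) o\<^sub>L adjop (gen_op (snd q)))) ?S"
    proof (rule BL.M.finsum_cong'[OF refl])
      show "(\<lambda>q. mat (gen_op (fst q) o\<^sub>L adjop (gen_op (snd q)))) \<in> ?S \<rightarrow> carrier BL" using o unfolding BL_simps(1) by blast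
      fix q assume "q \<in> ?S"
      then have "gen_op (fst q) \<in> ops" "gen_op (snd q) \<in> ops" using S gen_op_ops by blast+
      then show "?t q = mat (gen_op (fst q) o\<^sub>L adjop (gen_op (snd q)))"
        by (simp add: case_prod_beta rep_def BL_simps ops_closed)
    qed
    also have "\<dots> = mat (\<Sum>q\<in>?S. gen_op (fst q) o\<^sub>L adjop (gen_op (snd q)))"
      using mat_ops_sum(2)[OF finite_CK3_index[OF fa p] o] .
    also have "\<dots> = mat (adjop (gen_op \<mu>) o\<^sub>L gen_op \<nu>)"
      using gen_op_CK3[OF p refl finite_CK3_index[OF fa p]] by simp
    finally show ?thesis using gen_op_ops p by (simp add: rep_def BL_simps ops_closed)
  qed
  show "foldr (\<lambda>\<eta> x. (rep v \<ominus>\<^bsub>BL\<^esub> rep \<eta> \<otimes>\<^bsub>BL\<^esub> adj\<^bsub>BL\<^esub> (rep \<eta>)) \<otimes>\<^bsub>BL\<^esub> x) \<eta>s (rep v) = \<zero>\<^bsub>BL\<^esub>"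
    if v: "v \<in> vertices" "set \<eta>s \<in> FE v" for v \<eta>s
  proof -
    obtain W where W: "W \<in> ops"
      "foldr (\<lambda>\<eta> x. (rep v \<ominus>\<^bsub>BL\<^esub> rep \<eta> \<otimes>\<^bsub>BL\<^esub> adj\<^bsub>BL\<^esub> (rep \<eta>)) \<otimes>\<^bsub>BL\<^esub> x) \<eta>s (rep v) = mat W"
      "\<And>x n. el (blinfun_apply W x) n = (if n \<in> R v \<and> (\<forall>\<eta>\<in>set \<eta>s. n \<notin> R \<eta>) then el x n else 0)"
      using rep_gap[OF v(1)] v(2) unfolding FE_iff by blast
    have "W = 0"
      by (rule op_eqI) (use W(3) R_FE[OF v] in \<open>auto simp: zero_blinfun.rep_eq ell2_rep_eq\<close>)
    then show ?thesis using W(2) by (simp add: BL_simps)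
  qed
qed

lemma rep_eq_0_iff:
  assumes h: "\<eta> \<in> paths" shows "rep \<eta> = \<zero>\<^bsub>BL\<^esub> \<longleftrightarrow> R (src \<eta>) = {}"
proof
  assume "rep \<eta> = \<zero>\<^bsub>BL\<^esub>"
  then have T0: "gen_op \<eta> = 0" using inj_onD[OF inj_on_mat _ gen_op_ops[OF h] ops_0] by (simp add: rep_def BL_simps)
  show "R (src \<eta>) = {}"
  proof (rule ccontr)
    assume "R (src \<eta>) \<noteq> {}"
    then obtain x where x: "x \<in> R (src \<eta>)" by blast
    have "el (blinfun_apply (gen_op \<eta>) (std_basis x)) (f \<eta> x) = c \<eta>"
      using f_in[OF h x] finv_f[OF h x] h by (simp add: el_gen_op el_std_basis)
    moreover have "c \<eta> \<noteq> 0" using c_norm[OF h] by auto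
    ultimately show False using T0 by (simp add: zero_blinfun.rep_eq ell2_rep_eq)
  qed
next
  assume "R (src \<eta>) = {}"
  then have "R \<eta> = {}" using bij[OF h] by (auto simp: bij_betw_def)
  then have "gen_op \<eta> = 0" using h by (intro op_eqI) (simp add: el_gen_op zero_blinfun.rep_eq ell2_rep_eq)
  then show "rep \<eta> = \<zero>\<^bsub>BL\<^esub>" by (simp add: rep_def BL_simps)
qed

text \<open>The two partial bijections coincide, so the operators can differ only by their phases,
  and a basis vector in the domain detects these.\<close>

lemma rep_eq_iff:
  assumes p: "\<alpha> \<in> paths" "\<beta> \<in> paths" "src \<alpha> = src \<beta>"
    and eq: "\<And>x. x \<in> R (src \<alpha>) \<Longrightarrow> f \<alpha> x = f \<beta> x" and ne: "R (src \<alpha>) \<noteq> {}"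
  shows "rep \<alpha> = rep \<beta> \<longleftrightarrow> c \<alpha> = c \<beta>"
proof
  have R: "R \<alpha> = R \<beta>" using bij[OF p(1)] bij[OF p(2)] eq p(3) unfolding bij_betw_def by (metis image_cong)
  have gg: "finv \<alpha> n = finv \<beta> n" if n: "n \<in> R \<alpha>" for n
  proof -
    have y: "finv \<alpha> n \<in> R (src \<alpha>)" using finv_in[OF p(1) n] .
    then have "finv \<beta> (f \<beta> (finv \<alpha> n)) = finv \<alpha> n" using finv_f[OF p(2)] p(3) by simp
    then show ?thesis using eq[OF y] f_finv[OF p(1) n] by simp
  qed
  { assume "c \<alpha> = c \<beta>"
    then have "gen_op \<alpha> = gen_op \<beta>" using R gg p by (intro op_eqI) (simp add: el_gen_op)
    then show "rep \<alpha> = rep \<beta>" by (simp add: rep_def) }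
  assume "rep \<alpha> = rep \<beta>"
  then have TT: "gen_op \<alpha> = gen_op \<beta>" using inj_onD[OF inj_on_mat _ gen_op_ops[OF p(1)] gen_op_ops[OF p(2)]] by (simp add: rep_def)
  obtain x where x: "x \<in> R (src \<alpha>)" using ne by blast
  have "el (blinfun_apply (gen_op \<alpha>) (std_basis x)) (f \<alpha> x) = c \<alpha>"
    using f_in[OF p(1) x] finv_f[OF p(1) x] p by (simp add: el_gen_op el_std_basis)
  moreover have "el (blinfun_apply (gen_op \<beta>) (std_basis x)) (f \<alpha> x) = c \<beta>"
    using f_in[OF p(1) x] finv_f[OF p(1) x] p gg[OF f_in[OF p(1) x]] R by (simp add: el_gen_op el_std_basis)
  ultimately show "c \<alpha> = c \<beta>" using TT by simp
qed

end

section \<open>Tight filters\<close>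

context k_graph
begin

text \<open>A boundary path of the graph is represented by the set of its initial segments.\<close>

definition tight :: "'p set \<Rightarrow> bool" where
  "tight x \<longleftrightarrow> x \<noteq> {} \<and> x \<subseteq> paths \<and> (\<forall>\<eta>\<in>x. \<forall>\<mu>. \<mu> \<preceq> \<eta> \<longrightarrow> \<mu> \<in> x) \<and>
     (\<forall>\<eta>\<in>x. \<forall>\<mu>\<in>x. \<exists>\<kappa>\<in>x. \<eta> \<preceq> \<kappa> \<and> \<mu> \<preceq> \<kappa>) \<and>
     (\<forall>\<eta>\<in>x. \<forall>E\<in>FE (src \<eta>). \<exists>\<mu>\<in>E. cmp \<eta> \<mu> \<in> x)"

text \<open>The paths \<open>cmp \<eta> \<nu>\<close> alone omit initial segments that do not extend
  \<eta>, hence the downward closure.\<close>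

definition act :: "'p \<Rightarrow> 'p set \<Rightarrow> 'p set" where
  "act \<eta> x = {\<mu>. \<exists>\<nu>\<in>x. \<mu> \<preceq> cmp \<eta> \<nu>}"

definition shift :: "'p \<Rightarrow> 'p set \<Rightarrow> 'p set" where
  "shift \<eta> x = {\<nu> \<in> paths. src \<eta> = ran \<nu> \<and> cmp \<eta> \<nu> \<in> x}"

lemma tightD:
  assumes "tight x"
  shows "\<eta> \<in> x \<Longrightarrow> \<eta> \<in> paths" "\<lbrakk>\<eta> \<in> x; \<mu> \<preceq> \<eta>\<rbrakk> \<Longrightarrow> \<mu> \<in> x"
    "\<lbrakk>\<eta> \<in> x; \<mu> \<in> x\<rbrakk> \<Longrightarrow> \<exists>\<kappa>\<in>x. \<eta> \<preceq> \<kappa> \<and> \<mu> \<preceq> \<kappa>"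
    "\<lbrakk>\<eta> \<in> x; E \<in> FE (src \<eta>)\<rbrakk> \<Longrightarrow> \<exists>\<mu>\<in>E. cmp \<eta> \<mu> \<in> x" "x \<noteq> {}"
  using assms unfolding tight_def by blast+

lemma tight_ran:
  assumes x: "tight x" "\<eta> \<in> x" "\<mu> \<in> x" shows "ran \<eta> = ran \<mu>"
proof -
  obtain \<kappa> where "\<eta> \<preceq> \<kappa>" "\<mu> \<preceq> \<kappa>" using tightD(3)[OF x(1)] x by blast
  then show ?thesis using pre_ran by metis
qed

lemma tight_ran_vertex:
  assumes x: "tight x" "v \<in> x" "v \<in> vertices" "\<eta> \<in> x" shows "ran \<eta> = v"
  using tight_ran[OF x(1,4,2)] vertex_ran(1)[OF x(3)] by simp

lemma ran_in_tight: "\<lbrakk>tight x; \<eta> \<in> x\<rbrakk> \<Longrightarrow> ran \<eta> \<in> x"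
  using tightD(1,2) ran_pre by blast

lemma tight_MCE:
  assumes x: "tight x" "\<mu> \<in> x" "\<nu> \<in> x" shows "\<exists>\<kappa>\<in>MCE \<mu> \<nu>. \<kappa> \<in> x"
proof -
  obtain \<eta> where e: "\<eta> \<in> x" "\<mu> \<preceq> \<eta>" "\<nu> \<preceq> \<eta>" using tightD(3)[OF x] by blast
  then obtain \<kappa> where "\<kappa> \<in> MCE \<mu> \<nu>" "\<kappa> \<preceq> \<eta>" using MCE_below by blast
  then show ?thesis using tightD(2)[OF x(1) e(1)] by blast
qed

lemma act_in:
  assumes x: "tight x" and h: "\<eta> \<in> paths" "src \<eta> \<in> x"
  shows "\<nu> \<in> x \<Longrightarrow> \<nu> \<in> paths \<and> src \<eta> = ran \<nu>" "\<nu> \<in> x \<Longrightarrow> cmp \<eta> \<nu> \<in> act \<eta> x" "\<eta> \<in> act \<eta> x"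
proof -
  show 1: "\<nu> \<in> paths \<and> src \<eta> = ran \<nu>" if "\<nu> \<in> x" for \<nu>
    using tight_ran_vertex[OF x h(2) src_vertex[OF h(1)] that] tightD(1)[OF x that] by simp
  show 2: "cmp \<eta> \<nu> \<in> act \<eta> x" if "\<nu> \<in> x" for \<nu>
    using 1[OF that] that h pre_refl[of "cmp \<eta> \<nu>"] cmp_closed unfolding act_def by blast
  show "\<eta> \<in> act \<eta> x" using 2[OF h(2)] cmp_src_right[OF h(1)] by simp
qed

text \<open>For tightness at an initial segment \<mu> of \<open>cmp \<eta> \<rho>\<close>, the
  exhaustive set at \<open>src \<mu>\<close> is moved along the remaining path \<kappa> to
  \<open>Ext \<kappa> E\<close> at \<open>src \<rho>\<close>, where tightness of x applies.\<close>

lemma act_tight: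
  assumes fa: "finitely_aligned \<Lambda>" and x: "tight x" and h: "\<eta> \<in> paths" "src \<eta> \<in> x"
  shows "tight (act \<eta> x)"
  unfolding tight_def
proof (intro conjI ballI allI impI)
  note X = act_in(1)[OF x h]
  show "act \<eta> x \<noteq> {}" using act_in(3)[OF x h] by blast
  show "act \<eta> x \<subseteq> paths" unfolding act_def using pre_paths by blast
  show "\<mu> \<in> act \<eta> x" if "\<nu> \<in> act \<eta> x" "\<mu> \<preceq> \<nu>" for \<mu> \<nu>
    using that pre_trans unfolding act_def by blast
  fix \<mu> assume m: "\<mu> \<in> act \<eta> x"
  then obtain \<rho> where r: "\<rho> \<in> x" "\<mu> \<preceq> cmp \<eta> \<rho>" unfolding act_def by blast
  note rp = X[OF r(1)]
  { fix \<mu>' assume "\<mu>' \<in> act \<eta> x"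
    then obtain \<rho>' where r': "\<rho>' \<in> x" "\<mu>' \<preceq> cmp \<eta> \<rho>'" unfolding act_def by blast
    obtain \<kappa> where k: "\<kappa> \<in> x" "\<rho> \<preceq> \<kappa>" "\<rho>' \<preceq> \<kappa>" using tightD(3)[OF x r(1) r'(1)] by blast
    have "cmp \<eta> \<rho> \<preceq> cmp \<eta> \<kappa>" "cmp \<eta> \<rho>' \<preceq> cmp \<eta> \<kappa>"
      using pre_cmp_left[OF h(1)] k rp X[OF r'(1)] by auto
    then show "\<exists>\<kappa>\<in>act \<eta> x. \<mu> \<preceq> \<kappa> \<and> \<mu>' \<preceq> \<kappa>"
      using r(2) r'(2) pre_trans act_in(2)[OF x h k(1)] by blast }
  fix E assume E: "E \<in> FE (src \<mu>)"
  obtain \<kappa> where k: "\<mu> \<in> paths" "\<kappa> \<in> paths" "src \<mu> = ran \<kappa>" "cmp \<eta> \<rho> = cmp \<mu> \<kappa>"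
    using r(2) by (rule preE)
  have sk: "src \<kappa> = src \<rho>"
    using arg_cong[OF k(4), of "src"] src_cmp[OF k(1-3)] src_cmp[OF h(1) rp[THEN conjunct1] rp[THEN conjunct2]] by simp
  have "Ext \<kappa> E \<in> FE (src \<rho>)" using Ext_FE[OF fa, of E \<kappa>] E k sk by simp
  then obtain \<beta> where b: "\<beta> \<in> Ext \<kappa> E" "cmp \<rho> \<beta> \<in> x" using tightD(4)[OF x r(1)] by blast
  obtain \<epsilon> where e: "\<epsilon> \<in> E" "cmp \<kappa> \<beta> \<in> MCE \<kappa> \<epsilon>" and b': "\<beta> \<in> paths" "src \<kappa> = ran \<beta>"
    using b(1) unfolding Ext_def by blast
  have ep: "\<epsilon> \<in> paths" "src \<mu> = ran \<epsilon>" using E e(1) by (auto simp: FE_iff paths_to_iff)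
  have "\<epsilon> \<preceq> cmp \<kappa> \<beta>" using e(2) MCE_iff[OF k(2) ep(1)] by blast
  then have "cmp \<mu> \<epsilon> \<preceq> cmp \<mu> (cmp \<kappa> \<beta>)" using pre_cmp_left[OF k(1) ep(2)] by blast
  also have "cmp \<mu> (cmp \<kappa> \<beta>) = cmp (cmp \<eta> \<rho>) \<beta>" using cmp_assoc[OF k(1,2) b'(1) k(3) b'(2)] k(4) by simp
  also have "\<dots> = cmp \<eta> (cmp \<rho> \<beta>)" using cmp_assoc[of \<eta> \<rho> \<beta>] h rp b' sk by simp
  finally show "\<exists>\<epsilon>\<in>E. cmp \<mu> \<epsilon> \<in> act \<eta> x" using e(1) b(2) unfolding act_def by blast
qed

lemma shift_tight:
  assumes x: "tight x" and h: "\<eta> \<in> x"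
  shows "tight (shift \<eta> x)" "src \<eta> \<in> shift \<eta> x"
proof -
  have hp: "\<eta> \<in> paths" using tightD(1)[OF x h] .
  show s: "src \<eta> \<in> shift \<eta> x"
    using hp h by (simp add: shift_def src_closed ran_src cmp_src_right)
  show "tight (shift \<eta> x)"
    unfolding tight_def
  proof (intro conjI ballI allI impI)
    show "shift \<eta> x \<noteq> {}" using s by blast
    show "shift \<eta> x \<subseteq> paths" unfolding shift_def by blast
    fix \<mu> assume m: "\<mu> \<in> shift \<eta> x"
    then have m': "\<mu> \<in> paths" "src \<eta> = ran \<mu>" "cmp \<eta> \<mu> \<in> x" by (simp_all add: shift_def)
    { fix \<nu> assume n: "\<nu> \<preceq> \<mu>"
      have r: "src \<eta> = ran \<nu>" using pre_ran[OF n] m' by simp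
      have "cmp \<eta> \<nu> \<in> x" using tightD(2)[OF x m'(3) pre_cmp_left[OF hp r n]] .
      then show "\<nu> \<in> shift \<eta> x" using r pre_paths(1)[OF n] by (simp add: shift_def) }
    { fix \<nu> assume n: "\<nu> \<in> shift \<eta> x"
      then have n': "\<nu> \<in> paths" "src \<eta> = ran \<nu>" "cmp \<eta> \<nu> \<in> x" by (simp_all add: shift_def)
      obtain \<kappa> where k: "\<kappa> \<in> x" "cmp \<eta> \<mu> \<preceq> \<kappa>" "cmp \<eta> \<nu> \<preceq> \<kappa>" using tightD(3)[OF x m'(3) n'(3)] by blast
      have "\<eta> \<preceq> \<kappa>" using pre_trans[OF preI[OF hp m'(1,2)] k(2)] .
      then obtain \<rho> where r: "\<rho> \<in> paths" "src \<eta> = ran \<rho>" "\<kappa> = cmp \<eta> \<rho>" by (blast elim: preE)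
      have "\<mu> \<preceq> \<rho>" "\<nu> \<preceq> \<rho>"
        using pre_cmp_cancel[OF hp m'(1) r(1) m'(2) r(2)] pre_cmp_cancel[OF hp n'(1) r(1) n'(2) r(2)] k r by simp_all
      moreover have "\<rho> \<in> shift \<eta> x" using r k by (simp add: shift_def)
      ultimately show "\<exists>\<rho>\<in>shift \<eta> x. \<mu> \<preceq> \<rho> \<and> \<nu> \<preceq> \<rho>" by blast }
    fix E assume E: "E \<in> FE (src \<mu>)"
    have "src (cmp \<eta> \<mu>) = src \<mu>" using src_cmp[OF hp m'(1,2)] .
    then obtain \<epsilon> where e: "\<epsilon> \<in> E" "cmp (cmp \<eta> \<mu>) \<epsilon> \<in> x" using tightD(4)[OF x m'(3)] E by metis
    have ep: "\<epsilon> \<in> paths" "src \<mu> = ran \<epsilon>" using E e(1) by (auto simp: FE_iff paths_to_iff)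
    have "cmp \<mu> \<epsilon> \<in> shift \<eta> x"
      using e(2) cmp_assoc[OF hp m'(1) ep(1) m'(2) ep(2)] cmp_closed[OF m'(1) ep] ran_cmp[OF m'(1) ep] m'(2) by (simp add: shift_def)
    then show "\<exists>\<epsilon>\<in>E. cmp \<mu> \<epsilon> \<in> shift \<eta> x" using e(1) by blast
  qed
qed

lemma act_shift:
  assumes x: "tight x" and h: "\<eta> \<in> x" shows "act \<eta> (shift \<eta> x) = x"
proof (intro equalityI subsetI)
  have hp: "\<eta> \<in> paths" using tightD(1)[OF x h] .
  fix \<mu>
  { assume "\<mu> \<in> act \<eta> (shift \<eta> x)"
    then obtain \<nu> where "cmp \<eta> \<nu> \<in> x" "\<mu> \<preceq> cmp \<eta> \<nu>" unfolding act_def shift_def by blast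
    then show "\<mu> \<in> x" using tightD(2)[OF x] by blast }
  assume m: "\<mu> \<in> x"
  obtain \<kappa> where k: "\<kappa> \<in> x" "\<eta> \<preceq> \<kappa>" "\<mu> \<preceq> \<kappa>" using tightD(3)[OF x h m] by blast
  obtain \<rho> where r: "\<rho> \<in> paths" "src \<eta> = ran \<rho>" "\<kappa> = cmp \<eta> \<rho>" using k(2) by (blast elim: preE)
  then have "\<rho> \<in> shift \<eta> x" using k by (simp add: shift_def)
  then show "\<mu> \<in> act \<eta> (shift \<eta> x)" using k(3) r(3) unfolding act_def by blast
qed

lemma shift_act:
  assumes x: "tight x" and h: "\<eta> \<in> paths" "src \<eta> \<in> x" shows "shift \<eta> (act \<eta> x) = x"
proof (intro equalityI subsetI)
  fix \<mu>
  { assume "\<mu> \<in> shift \<eta> (act \<eta> x)"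
    then have m: "\<mu> \<in> paths" "src \<eta> = ran \<mu>" "cmp \<eta> \<mu> \<in> act \<eta> x" by (simp_all add: shift_def)
    obtain \<nu> where n: "\<nu> \<in> x" "cmp \<eta> \<mu> \<preceq> cmp \<eta> \<nu>" using m(3) unfolding act_def by blast
    have "\<mu> \<preceq> \<nu>" using pre_cmp_cancel[OF h(1) m(1) _ m(2) _ n(2)] act_in(1)[OF x h n(1)] by blast
    then show "\<mu> \<in> x" using tightD(2)[OF x n(1)] by blast }
  assume "\<mu> \<in> x"
  then show "\<mu> \<in> shift \<eta> (act \<eta> x)" using act_in(1,2)[OF x h] by (simp add: shift_def)
qed

lemma act_cmp:
  assumes x: "tight x" and p: "\<mu> \<in> paths" "\<nu> \<in> paths" "src \<mu> = ran \<nu>" "src \<nu> \<in> x"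
  shows "act (cmp \<mu> \<nu>) x = act \<mu> (act \<nu> x)"
proof (intro equalityI subsetI)
  fix \<omega>
  { assume "\<omega> \<in> act (cmp \<mu> \<nu>) x"
    then obtain \<rho> where r: "\<rho> \<in> x" "\<omega> \<preceq> cmp (cmp \<mu> \<nu>) \<rho>" unfolding act_def by blast
    then have "\<omega> \<preceq> cmp \<mu> (cmp \<nu> \<rho>)" using cmp_assoc[of \<mu> \<nu> \<rho>] act_in(1)[OF x p(2,4) r(1)] p by simp
    then show "\<omega> \<in> act \<mu> (act \<nu> x)" using act_in(2)[OF x p(2,4) r(1)] unfolding act_def[of \<mu>] by blast }
  assume "\<omega> \<in> act \<mu> (act \<nu> x)"
  then obtain \<zeta> where z: "\<zeta> \<in> act \<nu> x" "\<omega> \<preceq> cmp \<mu> \<zeta>" unfolding act_def[of \<mu>] by blast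
  then obtain \<rho> where r: "\<rho> \<in> x" "\<zeta> \<preceq> cmp \<nu> \<rho>" unfolding act_def by blast
  note rp = act_in(1)[OF x p(2,4) r(1)]
  have "src \<mu> = ran \<zeta>" using pre_ran[OF r(2)] ran_cmp[of \<nu> \<rho>] rp p by simp
  then have "cmp \<mu> \<zeta> \<preceq> cmp \<mu> (cmp \<nu> \<rho>)" using pre_cmp_left[OF p(1) _ r(2)] by blast
  then have "\<omega> \<preceq> cmp (cmp \<mu> \<nu>) \<rho>" using pre_trans[OF z(2)] cmp_assoc[of \<mu> \<nu> \<rho>] rp p by simp
  then show "\<omega> \<in> act (cmp \<mu> \<nu>) x" using r(1) unfolding act_def by blast
qed

subsection \<open>Orbits\<close>

text \<open>This is shift-tail equivalence: an initial segment is removed and replaced by any path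
  with the same source.\<close>

definition orbit :: "'p set \<Rightarrow> 'p set set" where
  "orbit x = {y. \<exists>\<eta>\<in>paths. \<exists>\<mu>\<in>x. src \<eta> = src \<mu> \<and> y = act \<eta> (shift \<mu> x)}"

lemma orbitE:
  assumes x: "tight x" and y: "y \<in> orbit x"
  obtains \<eta> \<mu> where "\<eta> \<in> paths" "\<mu> \<in> x" "src \<eta> = src \<mu>" "y = act \<eta> (shift \<mu> x)" "tight (shift \<mu> x)" "src \<eta> \<in> shift \<mu> x"
proof -
  obtain \<eta> \<mu> where m: "\<eta> \<in> paths" "\<mu> \<in> x" "src \<eta> = src \<mu>" "y = act \<eta> (shift \<mu> x)"
    using y unfolding orbit_def by blast
  then show ?thesis using that[OF m] shift_tight[OF x m(2)] by simp
qed

lemma countable_orbit: assumes x: "tight x" shows "countable (orbit x)"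
proof -
  have "orbit x \<subseteq> (\<lambda>(\<eta>, \<mu>). act \<eta> (shift \<mu> x)) ` (paths \<times> paths)"
    using tightD(1)[OF x] unfolding orbit_def by blast
  then show ?thesis using countable_paths by (meson countable_SIGMA countable_image countable_subset)
qed

lemma self_in_orbit: assumes x: "tight x" shows "x \<in> orbit x"
proof -
  obtain \<mu> where m: "\<mu> \<in> x" using tightD(5)[OF x] by blast
  then have "x = act \<mu> (shift \<mu> x)" using act_shift[OF x m] by simp
  then show ?thesis using m tightD(1)[OF x m] unfolding orbit_def by blast
qed

lemma orbit_tight: assumes fa: "finitely_aligned \<Lambda>" and x: "tight x" and y: "y \<in> orbit x" shows "tight y"
  using orbitE[OF x y] act_tight[OF fa] by metis

lemma act_orbit:
  assumes x: "tight x" and y: "y \<in> orbit x" and h: "\<nu> \<in> paths" "src \<nu> \<in> y" and fa: "finitely_aligned \<Lambda>"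
  shows "act \<nu> y \<in> orbit x"
proof -
  obtain \<eta> \<mu> where m: "\<eta> \<in> paths" "\<mu> \<in> x" "src \<eta> = src \<mu>" "y = act \<eta> (shift \<mu> x)"
    "tight (shift \<mu> x)" "src \<eta> \<in> shift \<mu> x" using orbitE[OF x y] .
  have "\<eta> \<in> y" using act_in(3)[OF m(5,1,6)] m(4) by simp
  then have s: "src \<nu> = ran \<eta>"
    using tight_ran_vertex[OF orbit_tight[OF fa x y] h(2) src_vertex[OF h(1)]] by simp
  have "act \<nu> y = act (cmp \<nu> \<eta>) (shift \<mu> x)" using act_cmp[OF m(5) h(1) m(1) s m(6)] m(4) by simp
  moreover have "cmp \<nu> \<eta> \<in> paths" "src (cmp \<nu> \<eta>) = src \<mu>"
    using cmp_closed[OF h(1) m(1) s] src_cmp[OF h(1) m(1) s] m(3) by auto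
  ultimately show ?thesis using m(2) unfolding orbit_def by blast
qed

text \<open>The path \<nu> need not be an initial segment of \<eta>, so \<eta> is prolonged by a
  part \<rho> of the tail until it extends \<nu>. Removing \<nu> then leaves the rest \<kappa> in
  front of x shifted by \<open>cmp \<mu> \<rho>\<close>.\<close>

lemma shift_orbit:
  assumes x: "tight x" and y: "y \<in> orbit x" and h: "\<nu> \<in> y" and fa: "finitely_aligned \<Lambda>"
  shows "shift \<nu> y \<in> orbit x"
proof -
  obtain \<eta> \<mu> where m: "\<eta> \<in> paths" "\<mu> \<in> x" "src \<eta> = src \<mu>" "y = act \<eta> (shift \<mu> x)"
    "tight (shift \<mu> x)" "src \<eta> \<in> shift \<mu> x" using orbitE[OF x y] .
  let ?z = "shift \<mu> x"
  have mp: "\<mu> \<in> paths" using tightD(1)[OF x m(2)] .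
  obtain \<rho> where r: "\<rho> \<in> ?z" "\<nu> \<preceq> cmp \<eta> \<rho>" using h m(4) unfolding act_def by blast
  have rp: "\<rho> \<in> paths" "src \<eta> = ran \<rho>" using act_in(1)[OF m(5,1,6) r(1)] by auto
  obtain \<kappa> where k: "\<nu> \<in> paths" "\<kappa> \<in> paths" "src \<nu> = ran \<kappa>" "cmp \<eta> \<rho> = cmp \<nu> \<kappa>"
    using r(2) by (rule preE)
  let ?w = "shift \<rho> ?z"
  have w: "tight ?w" "src \<rho> \<in> ?w" using shift_tight[OF m(5) r(1)] by auto
  have sk: "src \<kappa> = src \<rho>"
    using arg_cong[OF k(4), of "src"] src_cmp[OF k(1-3)] src_cmp[OF m(1) rp] by simp
  have "y = act \<eta> (act \<rho> ?w)" using m(4) act_shift[OF m(5) r(1)] by simp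
  also have "\<dots> = act (cmp \<nu> \<kappa>) ?w" using act_cmp[OF w(1) m(1) rp w(2)] k(4) by simp
  also have "\<dots> = act \<nu> (act \<kappa> ?w)" using act_cmp[OF w(1) k(1-3)] w(2) sk by simp
  finally have yk: "y = act \<nu> (act \<kappa> ?w)" .
  have t: "tight (act \<kappa> ?w)" "\<kappa> \<in> act \<kappa> ?w" using act_tight[OF fa w(1) k(2)] act_in(3)[OF w(1) k(2)] w(2) sk by auto
  then have "src \<nu> \<in> act \<kappa> ?w" using ran_in_tight[OF t] k(3) by simp
  then have "shift \<nu> y = act \<kappa> ?w" using shift_act[OF t(1) k(1)] yk by simp
  moreover have "?w = shift (cmp \<mu> \<rho>) x"
  proof -
    have s: "src \<mu> = ran \<rho>" using rp m(3) by simp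
    have "\<zeta> \<in> ?w \<longleftrightarrow> \<zeta> \<in> shift (cmp \<mu> \<rho>) x" for \<zeta>
      using src_cmp[OF mp rp(1) s] cmp_assoc[OF mp rp(1) _ s, of \<zeta>] cmp_closed[OF rp(1), of \<zeta>] ran_cmp[OF rp(1), of \<zeta>] s
      unfolding shift_def by auto
    then show ?thesis by blast
  qed
  moreover have "cmp \<mu> \<rho> \<in> x" using r(1) by (simp add: shift_def)
  moreover have "src \<kappa> = src (cmp \<mu> \<rho>)" using src_cmp[OF mp rp(1)] rp m(3) sk by simp
  ultimately show ?thesis
    using k(2) unfolding orbit_def mem_Collect_eq by (intro bexI[of _ \<kappa>] bexI[of _ "cmp \<mu> \<rho>"] conjI) simp_all
qed

lemma orbit_path_action:
  assumes fa: "finitely_aligned \<Lambda>" and x: "tight x"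
    and c: "\<And>\<eta>. \<eta> \<in> paths \<Longrightarrow> cmod (c \<eta>) = 1"
      "\<And>\<mu> \<nu>. \<lbrakk>\<mu> \<in> paths; \<nu> \<in> paths; src \<mu> = ran \<nu>\<rbrakk> \<Longrightarrow> c (cmp \<mu> \<nu>) = c \<mu> * c \<nu>"
  shows "path_action \<Lambda> (\<lambda>\<eta>. {y \<in> orbit x. \<eta> \<in> y}) act c"
proof (intro path_action.intro path_action_axioms.intro k_graph_axioms fa c)
  note T = orbit_tight[OF fa x]
  fix \<eta> assume h: "\<eta> \<in> paths"
  show "bij_betw (act \<eta>) {y \<in> orbit x. src \<eta> \<in> y} {y \<in> orbit x. \<eta> \<in> y}"
  proof (rule bij_betwI[where g = "shift \<eta>"])
    show "act \<eta> \<in> {y \<in> orbit x. src \<eta> \<in> y} \<rightarrow> {y \<in> orbit x. \<eta> \<in> y}"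
      using act_orbit[OF x _ h _ fa] act_in(3)[OF T h] by simp
    show "shift \<eta> \<in> {y \<in> orbit x. \<eta> \<in> y} \<rightarrow> {y \<in> orbit x. src \<eta> \<in> y}"
      using shift_orbit[OF x _ _ fa] shift_tight(2)[OF T] by simp
  qed (use shift_act[OF T h] act_shift[OF T] in auto)
next
  fix \<mu> \<nu> y assume "\<mu> \<in> paths" "\<nu> \<in> paths" "src \<mu> = ran \<nu>" "y \<in> {y \<in> orbit x. src \<nu> \<in> y}"
  then show "act (cmp \<mu> \<nu>) y = act \<mu> (act \<nu> y)" using act_cmp orbit_tight[OF fa x] by simp
next
  fix \<mu> \<kappa> assume "\<mu> \<preceq> \<kappa>"
  then show "{y \<in> orbit x. \<kappa> \<in> y} \<subseteq> {y \<in> orbit x. \<mu> \<in> y}" using tightD(2) orbit_tight[OF fa x] by blast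
next
  fix \<mu> \<nu> y assume "\<mu> \<in> paths" "\<nu> \<in> paths" "y \<in> {y \<in> orbit x. \<mu> \<in> y}" "y \<in> {y \<in> orbit x. \<nu> \<in> y}"
  then show "\<exists>\<kappa>\<in>MCE \<mu> \<nu>. y \<in> {y \<in> orbit x. \<kappa> \<in> y}" using tight_MCE orbit_tight[OF fa x] by simp
next
  fix v E y assume v: "v \<in> vertices" and E: "E \<in> FE v" and y: "y \<in> {y \<in> orbit x. v \<in> y}"
  have sv: "src v = v" using vertex_ran[OF v] by simp
  obtain \<eta> where e: "\<eta> \<in> E" "cmp v \<eta> \<in> y" using tightD(4)[OF orbit_tight[OF fa x], of y v E] y E sv by auto
  have "\<eta> \<in> paths" "ran \<eta> = v" using E e(1) by (auto simp: FE_iff paths_to_iff)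
  then have "cmp v \<eta> = \<eta>" using cmp_ran_left[of \<eta>] by simp
  then show "\<exists>\<eta>\<in>E. y \<in> {y \<in> orbit x. \<eta> \<in> y}" using e y by auto
qed

subsection \<open>Existence of tight filters\<close>

text \<open>An exhaustive set at the end of an initial segment \<mu> is transported by
  \<open>Ext\<close> to the end of \<eta>, where the hypothesis on \<open>Bad\<close> chooses the
  continuation.\<close>

lemma tight_step:
  assumes fa: "finitely_aligned \<Lambda>" and Bad: "\<And>u E. \<lbrakk>u \<in> Bad; E \<in> FE u\<rbrakk> \<Longrightarrow> \<exists>\<tau>\<in>E. src \<tau> \<in> Bad"
    and l: "\<eta> \<in> paths" "src \<eta> \<in> Bad" and m: "\<mu> \<preceq> \<eta>" and E: "E \<in> FE (src \<mu>)"
  shows "\<exists>\<eta>'. \<eta> \<preceq> \<eta>' \<and> src \<eta>' \<in> Bad \<and> (\<exists>\<epsilon>\<in>E. cmp \<mu> \<epsilon> \<preceq> \<eta>')"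
proof -
  obtain \<kappa> where k: "\<mu> \<in> paths" "\<kappa> \<in> paths" "src \<mu> = ran \<kappa>" "\<eta> = cmp \<mu> \<kappa>" using m by (rule preE)
  have sk: "src \<eta> = src \<kappa>" using src_cmp[OF k(1-3)] k(4) by simp
  have "Ext \<kappa> E \<in> FE (src \<eta>)" using Ext_FE[OF fa, of E \<kappa>] E k(2,3) sk by simp
  then obtain \<tau> where t: "\<tau> \<in> Ext \<kappa> E" "src \<tau> \<in> Bad" using Bad l(2) by blast
  obtain \<epsilon> where e: "\<epsilon> \<in> E" "cmp \<kappa> \<tau> \<in> MCE \<kappa> \<epsilon>" and t': "\<tau> \<in> paths" "src \<kappa> = ran \<tau>"
    using t(1) unfolding Ext_def by blast
  have ep: "\<epsilon> \<in> paths" "src \<mu> = ran \<epsilon>" using E e(1) by (auto simp: FE_iff paths_to_iff)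
  have "\<epsilon> \<preceq> cmp \<kappa> \<tau>" using e(2) MCE_iff[OF k(2) ep(1)] by blast
  then have "cmp \<mu> \<epsilon> \<preceq> cmp \<eta> \<tau>"
    using pre_cmp_left[OF k(1) ep(2)] cmp_assoc[OF k(1,2) t'(1) k(3) t'(2)] k(4) by simp
  moreover have "\<eta> \<preceq> cmp \<eta> \<tau>" "src (cmp \<eta> \<tau>) = src \<tau>"
    using preI[OF l(1) t'(1)] src_cmp[OF l(1) t'(1)] sk t'(2) by simp_all
  ultimately show ?thesis using t(2) e(1) by auto
qed

text \<open>A chain of paths with sources in \<open>Bad\<close> works through the countably many
  pairs of a path and a finite set of paths; the initial segments of its members form the filter.
  \<open>Bad\<close> is the set of all vertices when mere existence is wanted, and the set of
  vertices violating cofinality otherwise.\<close>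

lemma tight_exists:
  assumes fa: "finitely_aligned \<Lambda>" and BV: "Bad \<subseteq> vertices"
    and Bad: "\<And>u E. \<lbrakk>u \<in> Bad; E \<in> FE u\<rbrakk> \<Longrightarrow> \<exists>\<tau>\<in>E. src \<tau> \<in> Bad" and u: "u \<in> Bad"
  shows "\<exists>x. tight x \<and> u \<in> x \<and> (\<forall>\<eta>\<in>x. \<exists>\<kappa>\<in>x. \<eta> \<preceq> \<kappa> \<and> src \<kappa> \<in> Bad)"
proof -
  define W where "W = paths \<times> {E. finite E \<and> E \<subseteq> paths}"
  have cW: "countable W" unfolding W_def by (intro countable_SIGMA countable_Collect_finite_subset countable_paths)
  define task where "task n = from_nat_into W (fst (prod_decode n))" for n
  have up: "u \<in> paths" "src u = u" using u BV vertex_path vertex_ran by auto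
  \<comment> \<open>The clause for n = 0 fixes the start of the chain at u.\<close>
  define P where "P n \<eta> \<longleftrightarrow> \<eta> \<in> paths \<and> src \<eta> \<in> Bad \<and> (n = 0 \<longrightarrow> \<eta> = u)" for n :: nat and \<eta>
  define Q where "Q n \<eta> \<eta>' \<longleftrightarrow> \<eta> \<preceq> \<eta>' \<and> (fst (task n) \<preceq> \<eta> \<longrightarrow> snd (task n) \<in> FE (src (fst (task n))) \<longrightarrow>
      (\<exists>\<epsilon>\<in>snd (task n). cmp (fst (task n)) \<epsilon> \<preceq> \<eta>'))" for n \<eta> \<eta>'
  have "\<exists>l. \<forall>n. P n (l n) \<and> Q n (l n) (l (Suc n))"
  proof (rule dependent_nat_choice)
    show "\<exists>\<eta>. P 0 \<eta>" using up u by (auto simp: P_def)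
    fix \<eta> n assume "P n \<eta>"
    then have h: "\<eta> \<in> paths" "src \<eta> \<in> Bad" by (simp_all add: P_def)
    show "\<exists>\<eta>'. P (Suc n) \<eta>' \<and> Q n \<eta> \<eta>'"
    proof (cases "fst (task n) \<preceq> \<eta> \<and> snd (task n) \<in> FE (src (fst (task n)))")
      case True
      have "\<exists>\<eta>'. \<eta> \<preceq> \<eta>' \<and> src \<eta>' \<in> Bad \<and> (\<exists>\<epsilon>\<in>snd (task n). cmp (fst (task n)) \<epsilon> \<preceq> \<eta>')"
      proof (rule tight_step[OF fa _ h])
        show "\<exists>\<tau>\<in>E. src \<tau> \<in> Bad" if "v \<in> Bad" "E \<in> FE v" for v E using Bad that by blast
      qed (use True in simp_all)
      then obtain \<eta>' where "\<eta> \<preceq> \<eta>'" "src \<eta>' \<in> Bad" "\<exists>\<epsilon>\<in>snd (task n). cmp (fst (task n)) \<epsilon> \<preceq> \<eta>'"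
        by blast
      then show ?thesis using pre_paths(2) unfolding P_def Q_def by blast
    next
      case False
      then show ?thesis using h pre_refl unfolding P_def Q_def by blast
    qed
  qed
  then obtain l where l: "\<And>n. P n (l n)" "\<And>n. Q n (l n) (l (Suc n))" by blast
  have step: "l n \<preceq> l (Suc n)" and lp: "l n \<in> paths" "src (l n) \<in> Bad" for n
    using l(2)[of n] l(1)[of n] unfolding P_def Q_def by blast+
  have mono: "l m \<preceq> l n" if "m \<le> n" for m n
    using that by (induction n rule: dec_induct) (use step lp pre_refl pre_trans in blast)+
  define x where "x = {\<mu>. \<exists>n. \<mu> \<preceq> l n}"
  have lx: "l n \<in> x" for n using pre_refl lp unfolding x_def by blast
  have "tight x"
    unfolding tight_def
  proof (intro conjI ballI allI impI)
    show "x \<noteq> {}" using lx by blast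
    show "x \<subseteq> paths" using pre_paths unfolding x_def by blast
    show "\<mu> \<in> x" if "\<eta> \<in> x" "\<mu> \<preceq> \<eta>" for \<mu> \<eta> using that pre_trans unfolding x_def by blast
    show "\<exists>\<kappa>\<in>x. \<eta> \<preceq> \<kappa> \<and> \<mu> \<preceq> \<kappa>" if xx: "\<eta> \<in> x" "\<mu> \<in> x" for \<eta> \<mu>
    proof -
      obtain m n where mn: "\<eta> \<preceq> l m" "\<mu> \<preceq> l n" using xx unfolding x_def by blast
      have "\<eta> \<preceq> l (max m n)" "\<mu> \<preceq> l (max m n)"
        using pre_trans[OF mn(1) mono] pre_trans[OF mn(2) mono] by simp_all
      then show ?thesis using lx by blast
    qed
    fix \<eta> E assume h: "\<eta> \<in> x" and E: "E \<in> FE (src \<eta>)"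
    obtain m where m: "\<eta> \<preceq> l m" using h unfolding x_def by blast
    have "(\<eta>, E) \<in> W"
      unfolding W_def using pre_paths(1)[OF m] E by (auto simp: FE_iff paths_to_iff)
    then obtain i where i: "from_nat_into W i = (\<eta>, E)" using from_nat_into_surj[OF cW] by blast
    \<comment> \<open>Every pair is processed at infinitely many stages; this stage does not precede
      m, so \<eta> is already an initial segment of the chain.\<close>
    define n where "n = prod_encode (i, m)"
    have tn: "task n = (\<eta>, E)" using i by (simp add: task_def n_def)
    have "m \<le> n" unfolding n_def by (rule le_prod_encode_2)
    then have "\<eta> \<preceq> l n" using pre_trans[OF m mono] by simp
    then obtain \<epsilon> where "\<epsilon> \<in> E" "cmp \<eta> \<epsilon> \<preceq> l (Suc n)" using l(2)[of n] tn E unfolding Q_def by auto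
    then show "\<exists>\<epsilon>\<in>E. cmp \<eta> \<epsilon> \<in> x" unfolding x_def by blast
  qed
  moreover have "u \<in> x" using lx[of 0] l(1)[of 0] by (simp add: P_def)
  moreover have "\<forall>\<eta>\<in>x. \<exists>\<kappa>\<in>x. \<eta> \<preceq> \<kappa> \<and> src \<kappa> \<in> Bad" using lx lp(2) unfolding x_def by blast
  ultimately show ?thesis by blast
qed

text \<open>An exhaustive set is nonempty, since the vertex itself meets a member, so the set of all
  vertices qualifies as \<open>Bad\<close>.\<close>

lemma tight_at_vertex:
  assumes fa: "finitely_aligned \<Lambda>" and v: "v \<in> vertices" shows "\<exists>x. tight x \<and> v \<in> x"
proof -
  have "\<exists>\<tau>\<in>E. src \<tau> \<in> vertices" if u: "u \<in> vertices" and E: "E \<in> FE u" for u E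
  proof -
    have "u \<in> paths_to u" using u vertex_path vertex_ran by (simp add: paths_to_iff)
    then obtain \<tau> where "\<tau> \<in> E" "meets u \<tau>" using E unfolding FE_iff by blast
    then show ?thesis using src_vertex meets_paths(2) by blast
  qed
  then show ?thesis using tight_exists[OF fa subset_refl _ v] by blast
qed

text \<open>Periodicity makes \<open>Ext (cmp \<alpha> \<tau>) {cmp \<beta> \<tau>}\<close>
  exhaustive at \<open>src \<tau>\<close>. Tightness then selects \<rho> with
  \<open>cmp \<tau> \<rho>\<close> in x and \<open>cmp \<beta> \<tau>\<close> an initial segment of
  \<open>cmp (cmp \<alpha> \<tau>) \<rho>\<close>.\<close>

lemma act_periodic:
  assumes fa: "finitely_aligned \<Lambda>" and p: "\<alpha> \<in> paths" "\<beta> \<in> paths" "src \<alpha> = src \<beta>"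
    and per: "\<And>\<tau>. \<tau> \<in> paths_to (src \<alpha>) \<Longrightarrow> meets (cmp \<alpha> \<tau>) (cmp \<beta> \<tau>)"
    and x: "tight x" "src \<alpha> \<in> x"
  shows "act \<beta> x \<subseteq> act \<alpha> x"
proof
  fix \<mu> assume "\<mu> \<in> act \<beta> x"
  then obtain \<tau> where t: "\<tau> \<in> x" "\<mu> \<preceq> cmp \<beta> \<tau>" unfolding act_def by blast
  have tp: "\<tau> \<in> paths" "src \<alpha> = ran \<tau>" "src \<beta> = ran \<tau>" using act_in(1)[OF x(1) p(1) x(2) t(1)] p(3) by auto
  let ?a = "cmp \<alpha> \<tau>" and ?b = "cmp \<beta> \<tau>"
  have ab: "?a \<in> paths" "?b \<in> paths" "src ?a = src \<tau>" "src ?b = src \<tau>"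
    using cmp_closed src_cmp p tp by auto
  have "Ext ?a {?b} \<in> FE (src \<tau>)"
    unfolding FE_iff
  proof (intro conjI ballI)
    show "finite (Ext ?a {?b})" using finite_Ext[OF fa] ab by simp
    show "Ext ?a {?b} \<subseteq> paths_to (src \<tau>)" using ab(3) by (auto simp: Ext_def paths_to_iff)
    fix \<gamma> assume g: "\<gamma> \<in> paths_to (src \<tau>)"
    then have gp: "\<gamma> \<in> paths" "src \<tau> = ran \<gamma>" by (simp_all add: paths_to_iff)
    have "cmp \<tau> \<gamma> \<in> paths_to (src \<alpha>)" using cmp_closed ran_cmp gp tp by (simp add: paths_to_iff)
    then have "meets (cmp ?a \<gamma>) (cmp ?b \<gamma>)" using per cmp_assoc p tp gp by simp
    moreover have "?b \<preceq> cmp ?b \<gamma>" using preI[OF ab(2) gp(1)] ab(4) gp(2) by simp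
    ultimately have "meets (cmp ?a \<gamma>) ?b" using meets_mono pre_refl meets_paths(1) by blast
    then show "\<exists>\<rho>\<in>Ext ?a {?b}. meets \<gamma> \<rho>" using Ext_meets[OF ab(1), of \<gamma> ?b "{?b}"] g ab(3) by simp
  qed
  then obtain \<rho> where r: "\<rho> \<in> Ext ?a {?b}" "cmp \<tau> \<rho> \<in> x" using tightD(4)[OF x(1) t(1)] by blast
  then have r': "\<rho> \<in> paths" "src \<tau> = ran \<rho>" "cmp ?a \<rho> \<in> MCE ?a ?b" using ab(3) by (auto simp: Ext_def)
  have "?b \<preceq> cmp ?a \<rho>" using r'(3) MCE_iff[OF ab(1,2)] by blast
  then have "\<mu> \<preceq> cmp \<alpha> (cmp \<tau> \<rho>)" using pre_trans[OF t(2)] cmp_assoc[OF p(1) tp(1) r'(1) tp(2) r'(2)] by simp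
  then show "\<mu> \<in> act \<alpha> x" using r(2) unfolding act_def by blast
qed

end

section \<open>Simple graph algebras\<close>

lemma star_homD:
  assumes "star_hom A B \<phi>"
  shows "x \<in> carrier A \<Longrightarrow> \<phi> x \<in> carrier B"
    "\<lbrakk>x \<in> carrier A; y \<in> carrier A\<rbrakk> \<Longrightarrow> \<phi> (x \<oplus>\<^bsub>A\<^esub> y) = \<phi> x \<oplus>\<^bsub>B\<^esub> \<phi> y"
    "x \<in> carrier A \<Longrightarrow> \<phi> (c \<odot>\<^bsub>A\<^esub> x) = c \<odot>\<^bsub>B\<^esub> \<phi> x"
    "\<lbrakk>x \<in> carrier A; y \<in> carrier A\<rbrakk> \<Longrightarrow> \<phi> (x \<otimes>\<^bsub>A\<^esub> y) = \<phi> x \<otimes>\<^bsub>B\<^esub> \<phi> y"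
  using assms unfolding star_hom_def by auto

context cstar_algebra
begin

text \<open>The solution is the Neumann series of y without its constant term, obtained without a
  unit as the fixed point of a contraction with factor \<open>nrm y\<close>.\<close>

lemma quasi_inverse:
  assumes y: "y \<in> carrier A" "nrm y < 1"
  obtains z where "z \<in> carrier A" "z = y \<oplus> y \<otimes> z"
proof -
  interpret Metric_space "carrier A" "cdist A" by (rule Metric_space_cdist)
  obtain z where z: "z \<in> carrier A" "y \<oplus> y \<otimes> z = z"
  proof (rule Banach_fixedpoint_thm[OF complete, of "\<lambda>z. y \<oplus> y \<otimes> z" "nrm y"])
    fix a b assume ab: "a \<in> carrier A" "b \<in> carrier A"
    have "(y \<oplus> y \<otimes> a) \<ominus> (y \<oplus> y \<otimes> b) = y \<otimes> a \<ominus> y \<otimes> b"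
      using y ab by (simp add: a_minus_def M.minus_add M.a_ac M.r_neg1 M.r_neg2)
    then have "(y \<oplus> y \<otimes> a) \<ominus> (y \<oplus> y \<otimes> b) = y \<otimes> (a \<ominus> b)"
      using y ab by (simp add: mult_minus_right)
    then show "cdist A (y \<oplus> y \<otimes> a) (y \<oplus> y \<otimes> b) \<le> nrm y * cdist A a b"
      using nrm_mult[of y "a \<ominus> b"] y ab by (simp add: cdist_def)
  qed (use y in auto)
  then show ?thesis using that by simp
qed

text \<open>
  Star homomorphisms are not assumed to be continuous here, so the kernel is replaced by its closure;
  a projection at distance less than 1 from the kernel still belongs to the kernel.
\<close>

lemma not_simple:
  assumes B: "normed_star_algebra B" and \<phi>: "star_hom A B \<phi>"
    and a: "a \<in> carrier A" "a \<noteq> \<zero>" "\<phi> a = \<zero>\<^bsub>B\<^esub>"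
    and p: "p \<in> carrier A" "adj p = p" "p \<otimes> p = p" "\<phi> p \<noteq> \<zero>\<^bsub>B\<^esub>"
  shows "\<not> cstar_simple A"
proof
  assume simple: "cstar_simple A"
  interpret B: normed_star_algebra B by (rule B)
  note H = star_homD[OF \<phi>]
  have \<phi>0: "\<phi> \<zero> = \<zero>\<^bsub>B\<^esub>" using H(3)[of \<zero> 0] H(1)[of \<zero>] by simp
  let ?K = "{x \<in> carrier A. \<phi> x = \<zero>\<^bsub>B\<^esub>}"
  have KC: "?K \<subseteq> carrier A" by blast
  have NC: "nclosure ?K \<subseteq> carrier A" by (auto simp: nclosure_def)
  have "cstar_ideal A (nclosure ?K)"
    unfolding cstar_ideal_def
  proof (intro conjI ballI)
    show "submodule (nclosure ?K) complex_ring A"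
      by (rule nclosure_submodule[OF KC]) (auto simp: H \<phi>0)
    show "norm_closed A (nclosure ?K)" by (rule norm_closed_nclosure[OF KC])
    fix b x assume b: "b \<in> carrier A" and x: "x \<in> nclosure ?K"
    have xc: "x \<in> carrier A" using x NC by blast
    show "b \<otimes> x \<in> nclosure ?K"
    proof (rule nclosure_map[OF x KC, where f = "\<lambda>x. b \<otimes> x" and K = "nrm b"])
      fix y assume y: "y \<in> ?K"
      show "b \<otimes> y \<in> ?K" using y b H(1)[of b] by (simp add: H(4))
      show "nrm (b \<otimes> x \<ominus> b \<otimes> y) \<le> nrm b * nrm (x \<ominus> y)"
        using nrm_mult[of b "x \<ominus> y"] b xc y by (simp add: mult_minus_right)
    qed (use b xc in simp)
    show "x \<otimes> b \<in> nclosure ?K"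
    proof (rule nclosure_map[OF x KC, where f = "\<lambda>x. x \<otimes> b" and K = "nrm b"])
      fix y assume y: "y \<in> ?K"
      show "y \<otimes> b \<in> ?K" using y b H(1)[of b] by (simp add: H(4))
      show "nrm (x \<otimes> b \<ominus> y \<otimes> b) \<le> nrm b * nrm (x \<ominus> y)"
        using nrm_mult[of "x \<ominus> y" b] b xc y by (simp add: mult_minus_left mult.commute)
    qed (use b xc in simp)
  qed
  moreover have "a \<in> nclosure ?K" using a nclosure_subset[OF KC] by blast
  ultimately have "nclosure ?K = carrier A" using simple a(2) unfolding cstar_simple_def by blast
  then have "p \<in> nclosure ?K" using p(1) by simp
  then obtain k where k: "k \<in> ?K" "nrm (p \<ominus> k) < 1" by (rule nclosureE[OF _ zero_less_one])
  then have kc: "k \<in> carrier A" "\<phi> k = \<zero>\<^bsub>B\<^esub>" by auto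
  \<comment> \<open>Compression by p turns the small element \<open>p \<ominus> k\<close> into p
    minus an element of the kernel, so its image is exactly that of p.\<close>
  let ?y = "p \<otimes> (p \<ominus> k) \<otimes> p"
  have np: "nrm p \<le> 1" using nrm_projection[OF p(1-3)] .
  have yc: "?y \<in> carrier A" using p kc by simp
  have "nrm ?y \<le> nrm (p \<otimes> (p \<ominus> k)) * nrm p" using p kc by (intro nrm_mult) auto
  also have "\<dots> \<le> (nrm p * nrm (p \<ominus> k)) * nrm p" using p kc nrm_nonneg[OF p(1)] by (intro mult_right_mono nrm_mult) auto
  also have "\<dots> \<le> (1 * nrm (p \<ominus> k)) * 1"
    using np nrm_nonneg[OF p(1)] nrm_nonneg[of "p \<ominus> k"] p kc by (intro mult_mono) auto
  finally have "nrm ?y < 1" using k(2) by simp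
  then obtain z where z: "z \<in> carrier A" "z = ?y \<oplus> ?y \<otimes> z" using quasi_inverse[OF yc] by blast
  have py: "p \<otimes> ?y = ?y"
    using p(3) p kc mult_assoc[of p p "(p \<ominus> k) \<otimes> p"] by (simp add: mult_assoc)
  have "p \<otimes> z = p \<otimes> (?y \<oplus> ?y \<otimes> z)" using z(2) by (rule arg_cong)
  also have "\<dots> = p \<otimes> ?y \<oplus> (p \<otimes> ?y) \<otimes> z" using p(1) yc z(1) by (simp only: mult_r_distr mult_closed mult_assoc)
  also have "\<dots> = z" using py z(2) by simp
  finally have pz: "p \<otimes> z = z" .
  have "?y = p \<ominus> p \<otimes> k \<otimes> p"
    using p kc by (simp add: mult_minus_right mult_minus_left)
  then have yk: "?y \<oplus> p \<otimes> k \<otimes> p = p" using minus_add_cancel[of p "p \<otimes> k \<otimes> p"] p kc by simp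
  have "\<phi> (p \<otimes> k \<otimes> p) = \<zero>\<^bsub>B\<^esub>" using p kc H(1)[of p] by (simp add: H(4))
  then have "\<phi> ?y = \<phi> p" using H(2)[of ?y "p \<otimes> k \<otimes> p"] yk yc p kc H(1)[of ?y] by simp
  \<comment> \<open>Because \<open>p \<otimes> z = z\<close>, the equation for z says that \<phi> z
    equals \<phi> p plus \<phi> z, so \<phi> p vanishes.\<close>
  then have "\<phi> z = \<phi> p \<oplus>\<^bsub>B\<^esub> \<phi> p \<otimes>\<^bsub>B\<^esub> \<phi> z"
    using arg_cong[OF z(2), of \<phi>] H(2)[of ?y "?y \<otimes> z"] H(4)[of ?y z] yc z(1) by simp
  also have "\<phi> p \<otimes>\<^bsub>B\<^esub> \<phi> z = \<phi> z" using H(4)[OF p(1) z(1)] pz by simp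
  finally have e: "\<phi> z = \<phi> p \<oplus>\<^bsub>B\<^esub> \<phi> z" .
  have "\<phi> p = (\<phi> p \<oplus>\<^bsub>B\<^esub> \<phi> z) \<ominus>\<^bsub>B\<^esub> \<phi> z" using B.add_minus_cancel H(1) p(1) z(1) by simp
  also have "\<dots> = \<zero>\<^bsub>B\<^esub>" using e H(1)[OF z(1)] by simp
  finally show False using p(4) by simp
qed

end

text \<open>The phases \<open>c\<close> play the role of the gauge action.\<close>

lemma (in k_graph) tight_representation:
  assumes fa: "finitely_aligned \<Lambda>" and x: "tight x"
    and c: "\<And>\<eta>. \<eta> \<in> paths \<Longrightarrow> cmod (c \<eta>) = 1"
      "\<And>\<mu> \<nu>. \<lbrakk>\<mu> \<in> paths; \<nu> \<in> paths; src \<mu> = ran \<nu>\<rbrakk> \<Longrightarrow> c (cmp \<mu> \<nu>) = c \<mu> * c \<nu>"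
  obtains t where "ck_family \<Lambda> BL t"
    "\<And>\<eta>. \<eta> \<in> paths \<Longrightarrow> t \<eta> = \<zero>\<^bsub>BL\<^esub> \<longleftrightarrow> (\<forall>y\<in>orbit x. src \<eta> \<notin> y)"
    "\<And>\<alpha> \<beta>. \<lbrakk>\<alpha> \<in> paths; \<beta> \<in> paths; src \<alpha> = src \<beta>; src \<alpha> \<in> x;
        \<And>y. \<lbrakk>y \<in> orbit x; src \<alpha> \<in> y\<rbrakk> \<Longrightarrow> act \<alpha> y = act \<beta> y\<rbrakk> \<Longrightarrow> t \<alpha> = t \<beta> \<longleftrightarrow> c \<alpha> = c \<beta>"
proof -
  let ?R = "\<lambda>\<eta>. {y \<in> orbit x. \<eta> \<in> y}"
  interpret O: path_action \<Lambda> ?R act c by (rule orbit_path_action[OF fa x c])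
  define Y where "Y = (\<Union>\<eta>\<in>paths. ?R \<eta>)"
  have "countable Y" by (rule countable_subset[OF _ countable_orbit[OF x]]) (auto simp: Y_def)
  then obtain e :: "'p set \<Rightarrow> nat" where e: "inj_on e Y" unfolding countable_def by blast
  let ?R' = "\<lambda>\<eta>. e ` ?R \<eta>" and ?f' = "\<lambda>\<eta>. e \<circ> act \<eta> \<circ> inv_into Y e"
  have "path_action \<Lambda> ?R' ?f' c" using O.path_action_image e unfolding Y_def by blast
  then interpret N: nat_path_action \<Lambda> ?R' ?f' c by (rule nat_path_action.intro)
  show ?thesis
  proof (rule that[of N.rep])
    show "ck_family \<Lambda> BL N.rep" by (rule N.ck_family_rep)
    show "N.rep \<eta> = \<zero>\<^bsub>BL\<^esub> \<longleftrightarrow> (\<forall>y\<in>orbit x. src \<eta> \<notin> y)" if "\<eta> \<in> paths" for \<eta>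
      using N.rep_eq_0_iff[OF that] by auto
    fix \<alpha> \<beta> assume p: "\<alpha> \<in> paths" "\<beta> \<in> paths" "src \<alpha> = src \<beta>" "src \<alpha> \<in> x"
      and eq: "\<And>y. \<lbrakk>y \<in> orbit x; src \<alpha> \<in> y\<rbrakk> \<Longrightarrow> act \<alpha> y = act \<beta> y"
    show "N.rep \<alpha> = N.rep \<beta> \<longleftrightarrow> c \<alpha> = c \<beta>"
    proof (rule N.rep_eq_iff[OF p(1-3)])
      show "e ` ?R (src \<alpha>) \<noteq> {}" using p(4) self_in_orbit[OF x] by blast
      fix n assume "n \<in> e ` ?R (src \<alpha>)"
      then obtain y where y: "y \<in> orbit x" "src \<alpha> \<in> y" "n = e y" by blast
      have "y \<in> Y" using y(1,2) src_closed[OF p(1)] unfolding Y_def by blast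
      then have "inv_into Y e n = y" using y(3) inv_into_f_f[OF e] by simp
      then show "?f' \<alpha> n = ?f' \<beta> n" using eq[OF y(1,2)] by simp
    qed
  qed
qed

lemma (in k_graph) tight_representation_one:
  assumes fa: "finitely_aligned \<Lambda>" and x: "tight x"
  obtains t where "ck_family \<Lambda> BL t"
    "\<And>\<eta>. \<eta> \<in> paths \<Longrightarrow> t \<eta> = \<zero>\<^bsub>BL\<^esub> \<longleftrightarrow> (\<forall>y\<in>orbit x. src \<eta> \<notin> y)"
    "\<And>\<alpha> \<beta>. \<lbrakk>\<alpha> \<in> paths; \<beta> \<in> paths; src \<alpha> = src \<beta>; src \<alpha> \<in> x;
        \<And>y. \<lbrakk>y \<in> orbit x; src \<alpha> \<in> y\<rbrakk> \<Longrightarrow> act \<alpha> y = act \<beta> y\<rbrakk> \<Longrightarrow> t \<alpha> = t \<beta>"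
proof (rule tight_representation[OF assms, of "\<lambda>_. 1"])
  fix t assume t: "ck_family \<Lambda> BL t"
    "\<And>\<eta>. \<eta> \<in> paths \<Longrightarrow> t \<eta> = \<zero>\<^bsub>BL\<^esub> \<longleftrightarrow> (\<forall>y\<in>orbit x. src \<eta> \<notin> y)"
    "\<And>\<alpha> \<beta>. \<lbrakk>\<alpha> \<in> paths; \<beta> \<in> paths; src \<alpha> = src \<beta>; src \<alpha> \<in> x;
        \<And>y. \<lbrakk>y \<in> orbit x; src \<alpha> \<in> y\<rbrakk> \<Longrightarrow> act \<alpha> y = act \<beta> y\<rbrakk> \<Longrightarrow> t \<alpha> = t \<beta> \<longleftrightarrow> (1 :: complex) = 1"
  show ?thesis by (rule that[OF t(1,2)]) (assumption | rule t(3)[THEN iffD2, OF _ _ _ _ _ refl])+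
qed simp_all

section \<open>Simplicity and the two conditions on the graph\<close>

context
  fixes \<Lambda> :: "('p, 'k::finite) kgraph" and A :: "'a cstar" (structure) and s :: "'p \<Rightarrow> 'a"
  assumes kg: "k_graph \<Lambda>" and fa: "finitely_aligned \<Lambda>" and gc: "graph_cstar \<Lambda> A s"
begin

interpretation k_graph \<Lambda> by (rule kg)
interpretation graph_cstar \<Lambda> A s by (rule gc)

text \<open>A tight filter containing v lies in its own orbit, so its representation does not kill
  v.\<close>

lemma vertex_not_zero: assumes v: "v \<in> vertices" shows "s v \<noteq> \<zero>"
proof
  assume sv: "s v = \<zero>"
  obtain x where x: "tight x" "v \<in> x" using tight_at_vertex[OF fa v] by blast
  obtain t where t: "ck_family \<Lambda> BL t" "\<And>\<eta>. \<eta> \<in> paths \<Longrightarrow> t \<eta> = \<zero>\<^bsub>BL\<^esub> \<longleftrightarrow> (\<forall>y\<in>orbit x. src \<eta> \<notin> y)"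
    by (rule tight_representation_one[OF fa x(1)]) (rule that)
  obtain \<phi> where \<phi>: "star_hom A BL \<phi>" "\<forall>\<eta>\<in>paths. \<phi> (s \<eta>) = t \<eta>" using universal[OF t(1)] by blast
  have "\<phi> \<zero> = \<zero>\<^bsub>BL\<^esub>" using star_homD(3)[OF \<phi>(1), of \<zero> 0] star_homD(1)[OF \<phi>(1), of \<zero>] by simp
  then have "t v = \<zero>\<^bsub>BL\<^esub>" using \<phi>(2) sv vertex_path[OF v] by metis
  then show False
    using t(2)[OF vertex_path[OF v]] self_in_orbit[OF x(1)] x(2) vertex_ran(2)[OF v] by auto
qed

text \<open>\<open>Bad\<close> collects the vertices at which every finite exhaustive set has a
  member whose source is not the source of a path with range v. It satisfies the hypothesis of
  \<open>tight_exists\<close>, because good exhaustive sets at all sources would combine by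
  \<open>FE_cmp\<close>.\<close>

lemma simple_imp_cofinal: assumes simple: "cstar_simple A" shows "kgraph_cofinal \<Lambda>"
proof (rule ccontr)
  define reach where "reach v u \<longleftrightarrow> {\<eta> \<in> paths_to v. src \<eta> = u} \<noteq> {}" for v u
  have cof: "kgraph_cofinal \<Lambda> \<longleftrightarrow> (\<forall>v\<in>vertices. \<forall>w\<in>vertices. \<exists>E\<in>FE w. \<forall>\<alpha>\<in>E. reach v (src \<alpha>))"
    by (simp only: kgraph_cofinal_def reach_def)
  assume "\<not> kgraph_cofinal \<Lambda>"
  then obtain v w where v: "v \<in> vertices" and w: "w \<in> vertices"
    and nc: "\<not> (\<exists>E\<in>FE w. \<forall>\<alpha>\<in>E. reach v (src \<alpha>))"
    unfolding cof by (simp only: ball_simps(10)) (elim bexE)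
  define Bad where "Bad = {u \<in> vertices. \<not> (\<exists>E\<in>FE u. \<forall>\<alpha>\<in>E. reach v (src \<alpha>))}"
  have Bad: "\<exists>\<tau>\<in>E. src \<tau> \<in> Bad" if u: "u \<in> Bad" and E: "E \<in> FE u" for u E
  proof (rule ccontr)
    assume n: "\<not> (\<exists>\<tau>\<in>E. src \<tau> \<in> Bad)"
    have "\<forall>\<tau>\<in>E. \<exists>F. F \<in> FE (src \<tau>) \<and> (\<forall>\<rho>\<in>F. reach v (src \<rho>))"
    proof
      fix \<tau> assume t: "\<tau> \<in> E"
      then have "src \<tau> \<in> vertices" using E src_vertex by (auto simp: FE_iff paths_to_iff)
      then show "\<exists>F. F \<in> FE (src \<tau>) \<and> (\<forall>\<rho>\<in>F. reach v (src \<rho>))" using n t unfolding Bad_def by blast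
    qed
    then obtain F where F: "\<forall>\<tau>\<in>E. F \<tau> \<in> FE (src \<tau>) \<and> (\<forall>\<rho>\<in>F \<tau>. reach v (src \<rho>))"
      by (rule bchoice[THEN exE])
    have "(\<Union>\<tau>\<in>E. cmp \<tau> ` F \<tau>) \<in> FE u" using FE_cmp[OF E] F by blast
    then obtain \<alpha> where a: "\<alpha> \<in> (\<Union>\<tau>\<in>E. cmp \<tau> ` F \<tau>)" "\<not> reach v (src \<alpha>)" using u unfolding Bad_def by blast
    then obtain \<tau> \<rho> where r: "\<tau> \<in> E" "\<rho> \<in> F \<tau>" "\<alpha> = cmp \<tau> \<rho>" by blast
    have tp: "\<tau> \<in> paths" using E r(1) by (auto simp: FE_iff paths_to_iff)
    have "F \<tau> \<in> FE (src \<tau>)" "reach v (src \<rho>)" using F r by blast+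
    moreover from this have "\<rho> \<in> paths" "ran \<rho> = src \<tau>" using r(2) by (auto simp: FE_iff paths_to_iff)
    ultimately show False using a(2) r(3) src_cmp[OF tp] by simp
  qed
  have wB: "w \<in> Bad" using w nc unfolding Bad_def by blast
  \<comment> \<open>The set {u} is exhaustive at u, so the source of a path with range v is never
    bad.\<close>
  have nB: "\<not> reach v u" if u: "u \<in> Bad" for u
  proof -
    have uv: "u \<in> vertices" using u by (simp add: Bad_def)
    have "meets \<mu> u" if "\<mu> \<in> paths_to u" for \<mu>
      using that ran_pre[of \<mu>] pre_meets meets_sym by (auto simp: paths_to_iff)
    then have "{u} \<in> FE u" unfolding FE_iff using vertex_path[OF uv] vertex_ran[OF uv] by (simp add: paths_to_iff)
    then show ?thesis using u vertex_ran[OF uv] unfolding Bad_def by auto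
  qed
  have "\<exists>x. tight x \<and> w \<in> x \<and> (\<forall>\<eta>\<in>x. \<exists>\<kappa>\<in>x. \<eta> \<preceq> \<kappa> \<and> src \<kappa> \<in> Bad)"
  proof (rule tight_exists[OF fa _ _ wB])
    show "Bad \<subseteq> vertices" by (auto simp: Bad_def)
    show "\<exists>\<tau>\<in>E. src \<tau> \<in> Bad" if "u \<in> Bad" "E \<in> FE u" for u E using Bad that by blast
  qed
  then obtain x where x: "tight x" "w \<in> x" "\<And>\<eta>. \<eta> \<in> x \<Longrightarrow> \<exists>\<kappa>\<in>x. \<eta> \<preceq> \<kappa> \<and> src \<kappa> \<in> Bad" by blast
  have nv: "v \<notin> y" if y: "y \<in> orbit x" for y
  proof
    assume vy: "v \<in> y"
    obtain \<eta> \<mu> where m: "\<eta> \<in> paths" "\<mu> \<in> x" "src \<eta> = src \<mu>" "y = act \<eta> (shift \<mu> x)"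
      "tight (shift \<mu> x)" "src \<eta> \<in> shift \<mu> x" using orbitE[OF x(1) y] .
    have "\<eta> \<in> y" using act_in(3)[OF m(5,1,6)] m(4) by simp
    then have re: "ran \<eta> = v" using tight_ran_vertex[OF orbit_tight[OF fa x(1) y] vy v] by simp
    \<comment> \<open>Prolonging \<mu> inside x up to a bad source and then replacing \<mu> by
      \<eta> gives a path with range v whose source is bad.\<close>
    obtain \<kappa> where k: "\<kappa> \<in> x" "\<mu> \<preceq> \<kappa>" "src \<kappa> \<in> Bad" using x(3)[OF m(2)] by blast
    obtain \<rho> where r: "\<mu> \<in> paths" "\<rho> \<in> paths" "src \<mu> = ran \<rho>" "\<kappa> = cmp \<mu> \<rho>" using k(2) by (rule preE)
    have "cmp \<eta> \<rho> \<in> paths_to v" "src (cmp \<eta> \<rho>) = src \<kappa>"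
      using r m(1,3) re by (simp_all add: paths_to_iff cmp_closed ran_cmp src_cmp)
    then have "reach v (src \<kappa>)" unfolding reach_def by blast
    then show False using nB[OF k(3)] by simp
  qed
  obtain t where t: "ck_family \<Lambda> BL t" "\<And>\<eta>. \<eta> \<in> paths \<Longrightarrow> t \<eta> = \<zero>\<^bsub>BL\<^esub> \<longleftrightarrow> (\<forall>y\<in>orbit x. src \<eta> \<notin> y)"
    by (rule tight_representation_one[OF fa x(1)]) (rule that)
  obtain \<phi> where \<phi>: "star_hom A BL \<phi>" "\<forall>\<eta>\<in>paths. \<phi> (s \<eta>) = t \<eta>" using universal[OF t(1)] by blast
  have "\<phi> (s v) = \<zero>\<^bsub>BL\<^esub>" using \<phi>(2) t(2) nv vertex_path[OF v] vertex_ran(2)[OF v] by simp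
  moreover have "\<phi> (s w) \<noteq> \<zero>\<^bsub>BL\<^esub>"
    using \<phi>(2) t(2) vertex_path[OF w] vertex_ran(2)[OF w] self_in_orbit[OF x(1)] x(2) by auto
  ultimately show False
    using not_simple[OF normed_star_algebra_BL \<phi>(1) in_carrier[OF vertex_path[OF v]] vertex_not_zero[OF v] _
        in_carrier[OF vertex_path[OF w]]] CK1_projection[OF w] simple by simp
qed

lemma simple_imp_aperiodic: assumes simple: "cstar_simple A" shows "kgraph_aperiodic \<Lambda>"
proof (rule ccontr)
  assume "\<not> kgraph_aperiodic \<Lambda>"
  then obtain \<alpha> \<beta> where ab: "\<alpha> \<in> paths" "\<beta> \<in> paths" "\<alpha> \<noteq> \<beta>" "src \<alpha> = src \<beta>"
    and ne: "\<forall>\<tau>\<in>paths_to (src \<alpha>). MCE (cmp \<alpha> \<tau>) (cmp \<beta> \<tau>) \<noteq> {}"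
    unfolding kgraph_aperiodic_def by blast
  let ?u = "src \<alpha>"
  have u: "?u \<in> vertices" "?u \<in> paths" "src ?u = ?u" using ab src_vertex src_closed src_src by auto
  have per: "meets (cmp \<alpha> \<tau>) (cmp \<beta> \<tau>)" if t: "\<tau> \<in> paths_to ?u" for \<tau>
  proof -
    have "cmp \<alpha> \<tau> \<in> paths" "cmp \<beta> \<tau> \<in> paths" using t ab cmp_closed by (auto simp: paths_to_iff)
    then show ?thesis using MCE_empty_iff ne t by blast
  qed
  have "?u \<in> paths_to ?u" using ab ran_src src_closed by (simp add: paths_to_iff)
  then have "meets \<alpha> \<beta>" using per[of ?u] cmp_src_right[OF ab(1)] cmp_src_right[OF ab(2)] ab(4) by simp
  \<comment> \<open>Paths of equal degree with a common extension coincide, so \<alpha> and \<beta>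
    differ in degree and some coordinate can tell them apart.\<close>
  then have "deg \<alpha> \<noteq> deg \<beta>" using meets_same_deg ab(3) by blast
  then obtain i where i: "deg \<alpha> i \<noteq> deg \<beta> i" by (auto simp: fun_eq_iff)
  obtain x where x: "tight x" "?u \<in> x" using tight_at_vertex[OF fa u(1)] by blast
  have act: "act \<alpha> y = act \<beta> y" if y: "y \<in> orbit x" "?u \<in> y" for y
  proof
    have ty: "tight y" using orbit_tight[OF fa x(1) y(1)] .
    show "act \<alpha> y \<subseteq> act \<beta> y"
      using act_periodic[OF fa ab(2,1) ab(4)[symmetric] _ ty] per meets_sym ab(4) y(2) by simp
    show "act \<beta> y \<subseteq> act \<alpha> y" using act_periodic[OF fa ab(1,2,4) per ty y(2)] .
  qed
  \<comment> \<open>With d the absolute difference of the i-th degrees, z is chosen such that z ^ d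
    = -1; hence the phases of \<alpha> and \<beta> differ.\<close>
  define z where "z = cis (pi / \<bar>real (deg \<alpha> i) - real (deg \<beta> i)\<bar>)"
  have zd: "z ^ d = -1" if "real d = \<bar>real (deg \<alpha> i) - real (deg \<beta> i)\<bar>" "d > 0" for d
    unfolding z_def that(1)[symmetric] using that(2) by (simp add: DeMoivre)
  have z0: "z \<noteq> 0" by (simp add: z_def)
  have zne: "z ^ m \<noteq> z ^ n" if mn: "m < n" "real (n - m) = \<bar>real (deg \<alpha> i) - real (deg \<beta> i)\<bar>" for m n
  proof
    assume "z ^ m = z ^ n"
    moreover have "z ^ n = z ^ m * z ^ (n - m)" using mn(1) by (simp flip: power_add)
    ultimately have "z ^ (n - m) = 1" using z0 by simp
    then show False using zd[of "n - m"] mn by simp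
  qed
  have zab: "z ^ deg \<alpha> i \<noteq> z ^ deg \<beta> i"
  proof (cases "deg \<alpha> i < deg \<beta> i")
    case True
    then show ?thesis using zne by (simp add: of_nat_diff)
  next
    case False
    then have "deg \<beta> i < deg \<alpha> i" using i by simp
    then show ?thesis using zne[of "deg \<beta> i" "deg \<alpha> i"] by (simp add: of_nat_diff)
  qed
  obtain t1 where t1: "ck_family \<Lambda> BL t1" "\<And>\<eta>. \<eta> \<in> paths \<Longrightarrow> t1 \<eta> = \<zero>\<^bsub>BL\<^esub> \<longleftrightarrow> (\<forall>y\<in>orbit x. src \<eta> \<notin> y)" "t1 \<alpha> = t1 \<beta>"
  proof (rule tight_representation_one[OF fa x(1)])
    fix t assume t: "ck_family \<Lambda> BL t" "\<And>\<eta>. \<eta> \<in> paths \<Longrightarrow> t \<eta> = \<zero>\<^bsub>BL\<^esub> \<longleftrightarrow> (\<forall>y\<in>orbit x. src \<eta> \<notin> y)"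
      and r: "\<And>\<alpha> \<beta>. \<lbrakk>\<alpha> \<in> paths; \<beta> \<in> paths; src \<alpha> = src \<beta>; src \<alpha> \<in> x;
        \<And>y. \<lbrakk>y \<in> orbit x; src \<alpha> \<in> y\<rbrakk> \<Longrightarrow> act \<alpha> y = act \<beta> y\<rbrakk> \<Longrightarrow> t \<alpha> = t \<beta>"
    show ?thesis by (rule that[OF t r[OF ab(1,2,4) x(2) act]])
  qed
  obtain t2 where t2: "ck_family \<Lambda> BL t2" "t2 \<alpha> \<noteq> t2 \<beta>"
  proof (rule tight_representation[OF fa x(1), of "\<lambda>\<eta>. z ^ deg \<eta> i"])
    show "cmod (z ^ deg \<eta> i) = 1" for \<eta> by (simp add: z_def norm_power)
    show "z ^ deg (cmp \<mu> \<nu>) i = z ^ deg \<mu> i * z ^ deg \<nu> i"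
      if "\<mu> \<in> paths" "\<nu> \<in> paths" "src \<mu> = ran \<nu>" for \<mu> \<nu>
      using that by (simp add: deg_cmp power_add)
    fix t assume "ck_family \<Lambda> BL t"
      and r: "\<And>\<alpha> \<beta>. \<lbrakk>\<alpha> \<in> paths; \<beta> \<in> paths; src \<alpha> = src \<beta>; src \<alpha> \<in> x;
        \<And>y. \<lbrakk>y \<in> orbit x; src \<alpha> \<in> y\<rbrakk> \<Longrightarrow> act \<alpha> y = act \<beta> y\<rbrakk> \<Longrightarrow> t \<alpha> = t \<beta> \<longleftrightarrow> z ^ deg \<alpha> i = z ^ deg \<beta> i"
    moreover have "t \<alpha> \<noteq> t \<beta>" using r[OF ab(1,2,4) x(2) act] zab by simp
    ultimately show ?thesis using that by blast
  qed
  obtain \<phi> where \<phi>: "star_hom A BL \<phi>" "\<forall>\<eta>\<in>paths. \<phi> (s \<eta>) = t1 \<eta>" using universal[OF t1(1)] by blast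
  obtain \<psi> where \<psi>: "star_hom A BL \<psi>" "\<forall>\<eta>\<in>paths. \<psi> (s \<eta>) = t2 \<eta>" using universal[OF t2(1)] by blast
  have sc: "s \<alpha> \<in> carrier A" "s \<beta> \<in> carrier A" using in_carrier ab by auto
  \<comment> \<open>This difference is killed by \<phi>, which identifies the two generators, and is
    nonzero because \<psi> separates them.\<close>
  let ?a = "s \<alpha> \<ominus> s \<beta>"
  have "s \<alpha> \<noteq> s \<beta>" using \<psi>(2) t2(2) ab by metis
  then have a0: "?a \<noteq> \<zero>" using minus_eq_zero_iff[OF sc] by simp
  have ac: "?a \<in> carrier A" using sc by simp
  interpret BL: normed_star_algebra BL by (rule normed_star_algebra_BL)
  have "\<phi> (s \<alpha>) = \<phi> ?a \<oplus>\<^bsub>BL\<^esub> \<phi> (s \<beta>)" using star_homD(2)[OF \<phi>(1) ac sc(2)] minus_add_cancel[OF sc] by simp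
  moreover have "\<phi> (s \<alpha>) = \<phi> (s \<beta>)" using \<phi>(2) ab t1(3) by simp
  ultimately have "\<phi> ?a = \<zero>\<^bsub>BL\<^esub>"
    using BL.add_minus_cancel[of "\<phi> ?a" "\<phi> (s \<beta>)"] star_homD(1)[OF \<phi>(1)] ac sc by simp
  moreover have "\<phi> (s ?u) \<noteq> \<zero>\<^bsub>BL\<^esub>" using \<phi>(2) t1(2) u self_in_orbit[OF x(1)] x(2) by auto
  ultimately show False
    using not_simple[OF normed_star_algebra_BL \<phi>(1) ac a0 _ in_carrier[OF u(2)]] CK1_projection[OF u(1)] simple by simp
qed

lemma simple_iff: "cstar_simple A \<longleftrightarrow> kgraph_aperiodic \<Lambda> \<and> kgraph_cofinal \<Lambda>"
proof
  interpret kgraph_ck_family \<Lambda> A s by unfold_locales (rule fa)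
  assume "kgraph_aperiodic \<Lambda> \<and> kgraph_cofinal \<Lambda>"
  then show "cstar_simple A" using cstar_simple_if generated by blast
qed (use simple_imp_aperiodic simple_imp_cofinal in blast)

end

theorem theorem3p4:
  fixes \<Lambda> :: "('p, 'k::finite) kgraph"
    and A :: "'a cstar"
    and s :: "'p \<Rightarrow> 'a"
  assumes "k_graph \<Lambda>"
    and "finitely_aligned \<Lambda>"
    and "graph_cstar \<Lambda> A s"
  shows "cstar_simple A \<longleftrightarrow> kgraph_aperiodic \<Lambda> \<and> kgraph_cofinal \<Lambda>"
  by (rule simple_iff[OF assms])

end
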